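(* There is a constant $C>0$ such that for all $t>0$, $M\ge1$, $0<\varepsilon\le\sqrt t$, $x\in\mathbb{R}$ and finite measures $X_0$, \[P_{X_0}\bigl(0<X_t([x,x+\varepsilon])\le\varepsilon^2M\bigr)\le C\,X_0(\mathbb{R})\,t^{-(1/2)-\lambda_0}M^{19}\varepsilon^{2\lambda_0-1}.\]
   Context: For a finite measure $X_0$ on $\mathbb{R}$, $X_t$ is one-dimensional super-Brownian motion started at $X_0$ with law $P_{X_0}$; $X_t(dx)=X(t,x)dx$ for $t>0$, where $X(t,x)$ is the jointly continuous density solving $\partial_tX=\frac12\partial_x^2X+\sqrt X\dot W$. $\lambda_0$: with $F(x)=-\log P_{\delta_x}(X(1,0)=0)$ and $m$ the standard normal law, the operator $L^Fh=\frac12h''-\frac x2h'-Fh$ (generator on $L^2(m)$ of the Ornstein–Uhlenbeck semigroup killed at rate $F$) has a complete orthonormal system of $C^2$ eigenfunctions with eigenvalues $-\lambda_n$, $0\le\lambda_0<\lambda_1\le\dots$; $\lambda_0$ is the lowest value (and $1/2<\lambda_0<1$). *)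

theory Defs
  imports "HOL-Probability.Probability"
begin

definition std_gauss :: "real measure" where
  "std_gauss = density lborel (\<lambda>x. ennreal (std_normal_density x))"

definition finite_borel_measure :: "real measure \<Rightarrow> bool" where
  "finite_borel_measure \<mu> \<longleftrightarrow> sets \<mu> = sets borel \<and> finite_measure \<mu>"

definition test_fun :: "(real \<Rightarrow> real) \<Rightarrow> bool" where
  "test_fun \<phi> \<longleftrightarrow> continuous_on UNIV \<phi> \<and> (\<forall>x. 0 \<le> \<phi> x) \<and> (\<exists>B. \<forall>x. \<phi> x \<le> B)"

definition log_laplace_sol :: "(real \<Rightarrow> real) \<Rightarrow> (real \<Rightarrow> real \<Rightarrow> real) \<Rightarrow> bool" where
  "log_laplace_sol \<phi> u \<longleftrightarrow>
     continuous_on ({0..} \<times> UNIV) (\<lambda>(t, x). u t x) \<and>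
     (\<exists>B. \<forall>t\<ge>0. \<forall>x. \<bar>u t x\<bar> \<le> B) \<and>
     (\<forall>x. u 0 x = \<phi> x) \<and>
     (\<forall>t>0. \<forall>x. \<exists>ut ux uxx.
        ((\<lambda>s. u s x) has_real_derivative ut) (at t) \<and>
        (\<forall>y. ((\<lambda>z. u t z) has_real_derivative ux y) (at y)) \<and>
        (ux has_real_derivative uxx) (at x) \<and>
        ut = uxx / 2 - (u t x)\<^sup>2 / 2)"

definition mass_fun :: "('w \<Rightarrow> real \<Rightarrow> real \<Rightarrow> real) \<Rightarrow> 'w \<Rightarrow> real \<Rightarrow> (real \<Rightarrow> real) \<Rightarrow> real" where
  "mass_fun X \<omega> t \<phi> = (\<integral>y. \<phi> y * X \<omega> t y \<partial>lborel)"

(* P : X_0 \<mapsto> P_{X_0}, X \<omega> t x : density X(t,x) of X_t.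
   P, X describe one-dimensional super-Brownian motion: jointly continuous nonnegative
   densities of finite mass, and for each finite initial measure X_0 the law of X_t
   is given by the Laplace functional
     E_{X_0} exp(-X_t(phi)) = exp(-X_0(u_t)),   u solving the log-Laplace equation. *)
definition is_SBM :: "(real measure \<Rightarrow> 'w measure) \<Rightarrow> ('w \<Rightarrow> real \<Rightarrow> real \<Rightarrow> real) \<Rightarrow> bool" where
  "is_SBM P X \<longleftrightarrow>
     (\<forall>\<omega>. continuous_on ({0<..} \<times> UNIV) (\<lambda>(t, x). X \<omega> t x) \<and>
          (\<forall>t>0. \<forall>x. 0 \<le> X \<omega> t x) \<and>
          (\<forall>t>0. integrable lborel (X \<omega> t))) \<and>
     (\<forall>\<mu>. finite_borel_measure \<mu> \<longrightarrow>
        prob_space (P \<mu>) \<and>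
        (\<forall>t>0. \<forall>x. (\<lambda>\<omega>. X \<omega> t x) \<in> borel_measurable (P \<mu>)) \<and>
        (\<forall>\<phi> u t. test_fun \<phi> \<and> log_laplace_sol \<phi> u \<and> t > 0 \<longrightarrow>
           (\<integral>\<omega>. exp (- mass_fun X \<omega> t \<phi>) \<partial>(P \<mu>)) = exp (- (\<integral>y. u t y \<partial>\<mu>))))"

definition sbm_F :: "(real measure \<Rightarrow> 'w measure) \<Rightarrow> ('w \<Rightarrow> real \<Rightarrow> real \<Rightarrow> real) \<Rightarrow> real \<Rightarrow> real" where
  "sbm_F P X x = - ln (measure (P (return borel x)) {\<omega> \<in> space (P (return borel x)). X \<omega> 1 0 = 0})"

definition LF_eigen :: "(real measure \<Rightarrow> 'w measure) \<Rightarrow> ('w \<Rightarrow> real \<Rightarrow> real \<Rightarrow> real) \<Rightarrow> (real \<Rightarrow> real) \<Rightarrow> real \<Rightarrow> bool" where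
  "LF_eigen P X h lam \<longleftrightarrow>
     (\<exists>h1 h2. (\<forall>x. (h has_real_derivative h1 x) (at x) \<and> (h1 has_real_derivative h2 x) (at x)) \<and>
        continuous_on UNIV h2 \<and>
        (\<forall>x. h2 x / 2 - x / 2 * h1 x - sbm_F P X x * h x = - lam * h x)) \<and>
     integrable std_gauss (\<lambda>x. (h x)\<^sup>2) \<and> (\<exists>x. h x \<noteq> 0)"

definition sbm_lambda0 :: "(real measure \<Rightarrow> 'w measure) \<Rightarrow> ('w \<Rightarrow> real \<Rightarrow> real \<Rightarrow> real) \<Rightarrow> real" where
  "sbm_lambda0 P X = Inf {lam. \<exists>h. LF_eigen P X h lam}"

end

theory Submission
  imports Defs
begin

text \<open>
  Write \<open>u\<^sub>N\<close> for the solution of the log-Laplace equation with initial datum \<open>N \<phi> / a\<close>, where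
  \<open>\<phi>\<close> is a bump below the indicator of the interval, positive on its interior, and \<open>a = \<epsilon>\<^sup>2 M\<close>. Since
  \<open>X\<^sub>t(\<phi>) \<in> (0, a]\<close> costs only a factor \<open>e\<close> against \<open>E[exp (- X\<^sub>t(\<phi>) / a) - exp (- N X\<^sub>t(\<phi>) / a)]\<close> as
  \<open>N \<rightarrow> \<infinity>\<close>, the probability is at most \<open>e X\<^sub>0(\<real>) sup (u\<^sub>N - u\<^sub>1)(t, \<cdot>)\<close>. Brownian scaling reduces
  the supremum to solutions that start from bumps of height at least one, and the point is
  that their difference \<open>V\<close> decays like \<open>t\<close> to the power \<open>- 1/2 - \<lambda>\<^sub>0\<close>.

  As \<open>V\<close> is a subsolution of \<open>\<partial>\<^sub>t V = V'' / 2 - u\<^sub>1 V\<close>, it suffices to find a supersolution. The potential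
  \<open>u\<^sub>1\<close> stays above the self-similar solution \<open>F (x / sqrt t) / t\<close> up to an error that is smaller by a
  negative power of \<open>t\<close>, hence integrable in time, so \<open>u\<^sub>1\<close> may be replaced by
  \<open>F (x / sqrt t) / t\<close>. A positive eigenfunction \<open>\<psi>\<close> of \<open>L\<^sup>F\<close> with eigenvalue \<open>- l\<close> then yields
  the self-similar supersolution built on \<open>\<psi>(y) exp (- y\<^sup>2 / 2)\<close>, \<open>y = x / sqrt t\<close>. Such a \<open>\<psi>\<close> is
  found by shooting: \<open>l\<close> is the largest value for which the even solution of the eigenvalue
  equation stays positive. Only \<open>\<lambda>\<^sub>0 \<le> l\<close> is needed, because \<open>t \<ge> 1\<close> after scaling.
\<close>

section \<open>The parabolic maximum principle\<close>

text \<open>\<open>is_SBM\<close> speaks only of continuous test functions and classical solutions.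
  So the indicator has to be replaced by a smooth bump, and the solutions have to be constructed, up
  to two space derivatives and one time derivative, before any comparison can start. A bump of
  half-width \<epsilon>/2 and height \<open>1 / (\<epsilon>\<^sup>2 M)\<close>, rescaled by
  \<open>r = 2 \<epsilon> M\<close>, has height 4M and half-width 1/(4M). Its mass is then a fixed
  constant, which is why the Gaussian lower bounds on u_1, and with them all later constants, do not
  depend on \<epsilon>, M or t. In the scaled time \<open>t / r\<^sup>2\<close> the decay of V
  becomes a power of t times \<open>r\<close> to the power 2 \<lambda>_0 - 1. This produces the
  power of \<epsilon>, together with a power of 2M that is at most the third. The constant is
  quantified before the process. It therefore may depend on F only through the equation, and F has
  to be recovered as a limit of solutions. Shooting replaces spectral theory: one positive square
  integrable eigenfunction is enough, and no completeness enters.\<close>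

definition C12_at :: "(real \<Rightarrow> real \<Rightarrow> real) \<Rightarrow> real \<Rightarrow> real \<Rightarrow> real \<Rightarrow> real \<Rightarrow> bool" where
  "C12_at w t x a b \<longleftrightarrow> ((\<lambda>s. w s x) has_real_derivative a) (at t) \<and>
     (\<exists>wx. (\<forall>y. (w t has_real_derivative wx y) (at y)) \<and> (wx has_real_derivative b) (at x))"

lemma second_derivative_nonpos_at_local_max:
  fixes f f' :: "real \<Rightarrow> real"
  assumes f: "\<And>y. (f has_real_derivative f' y) (at y)"
    and f': "(f' has_real_derivative b) (at x)"
    and d: "d > 0" and mx: "\<And>y. \<bar>y - x\<bar> < d \<Longrightarrow> f y \<le> f x"
  shows "b \<le> 0"
proof (rule ccontr)
  assume "\<not> b \<le> 0"
  then have b: "b > 0" by simp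
  have 0: "f' x = 0"
    by (rule DERIV_local_max[OF f[of x] d]) (use mx in \<open>auto simp: abs_minus_commute\<close>)
  from DERIV_pos_inc_right[OF f' b] obtain e where e: "e > 0" "\<And>h. 0 < h \<Longrightarrow> h < e \<Longrightarrow> f' x < f' (x + h)"
    by blast
  define h where "h = min d e / 2"
  have h: "0 < h" "h < d" "h < e" using d e(1) by (auto simp: h_def)
  from MVT2[of x "x + h" f f'] h(1) f obtain z where z: "x < z" "z < x + h" "f (x + h) - f x = h * f' z"
    by (auto simp: algebra_simps)
  have "f' z > 0" using e(2)[of "z - x"] z h 0 by simp
  then have "f (x + h) > f x" using z h by (smt (verit) mult_pos_pos)
  moreover have "f (x + h) \<le> f x" using mx[of "x + h"] h by simp
  ultimately show False by simp
qed

text \<open>The differential inequality is asked for only where \<open>w\<close> is positive. This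
  lets nonlinear equations be compared, since their quadratic terms have the right sign exactly
  there. The demand that such points be interior encodes the boundary condition
  \<open>w \<le> 0\<close> on the lateral boundary. The penalty
  \<open>y\<^sup>2 + 2 (s - t0)\<close> has heat operator 2 - 1 > 0, so it both forces a maximum to
  be attained on the unbounded domain and makes the inequality strict.\<close>

lemma max_principle:
  fixes w :: "real \<Rightarrow> real \<Rightarrow> real"
  assumes D: "closed D"
    and cont: "continuous_on ({t0..T} \<times> D) (\<lambda>(t, x). w t x)"
    and bdd: "\<And>t x. t \<in> {t0..T} \<Longrightarrow> x \<in> D \<Longrightarrow> w t x \<le> B"
    and init: "\<And>x. x \<in> D \<Longrightarrow> w t0 x \<le> 0"
    and pde: "\<And>t x. t0 < t \<Longrightarrow> t \<le> T \<Longrightarrow> x \<in> D \<Longrightarrow> w t x > 0 \<Longrightarrow>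
        x \<in> interior D \<and> (\<exists>a b. C12_at w t x a b \<and> a \<le> b / 2)"
    and tx: "t \<in> {t0..T}" "x \<in> D"
  shows "w t x \<le> 0"
proof (rule ccontr)
  assume "\<not> w t x \<le> 0"
  then have pos: "w t x > 0" by simp
  \<comment> \<open>Chosen so that the penalty at the given point is at most half of
    \<open>w t x\<close>, which leaves \<open>z t x\<close> positive.\<close>
  define \<epsilon> where "\<epsilon> = w t x / (2 * (x\<^sup>2 + 2 * (t - t0) + 1))"
  have den: "x\<^sup>2 + 2 * (t - t0) + 1 > 0" using tx by (auto intro!: add_nonneg_pos)
  have eps: "\<epsilon> > 0" unfolding \<epsilon>_def using pos den by simp
  define z where "z = (\<lambda>s y. w s y - \<epsilon> * (y\<^sup>2 + 2 * (s - t0)))"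
  have "\<epsilon> * (x\<^sup>2 + 2 * (t - t0)) \<le> \<epsilon> * (x\<^sup>2 + 2 * (t - t0) + 1)" using eps by simp
  also have "\<dots> = w t x / 2" unfolding \<epsilon>_def using den by (simp add: field_simps)
  finally have zpos: "z t x > 0" using pos by (simp add: z_def)
  \<comment> \<open>Beyond \<open>R\<close> the penalty exceeds the bound \<open>B\<close>, so
    \<open>z \<le> 0\<close> there and the maximum over the compact set \<open>K\<close> is
    global.\<close>
  define R where "R = \<bar>x\<bar> + sqrt (\<bar>B\<bar> / \<epsilon>) + 1"
  have Rx: "\<bar>x\<bar> \<le> R" unfolding R_def using eps by simp
  have Rb: "\<epsilon> * y\<^sup>2 \<ge> B" if "\<bar>y\<bar> > R" for y
  proof -
    have "\<bar>y\<bar> \<ge> sqrt (\<bar>B\<bar> / \<epsilon>)" using that unfolding R_def by linarith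
    then have "\<bar>y\<bar>\<^sup>2 \<ge> (sqrt (\<bar>B\<bar> / \<epsilon>))\<^sup>2" by (intro power_mono) (use eps in auto)
    then have "y\<^sup>2 \<ge> \<bar>B\<bar> / \<epsilon>" using eps by simp
    then show ?thesis using eps by (simp add: field_simps)
  qed
  define K where "K = {t0..T} \<times> (D \<inter> cball 0 R)"
  have K: "compact K" unfolding K_def by (intro compact_Times closed_Int_compact D) auto
  have txK: "(t, x) \<in> K" using tx Rx by (auto simp: K_def)
  have "continuous_on K (\<lambda>(s, y). z s y)"
    unfolding z_def case_prod_beta
    by (intro continuous_intros continuous_on_subset[OF cont[unfolded case_prod_beta]]) (auto simp: K_def)
  from continuous_attains_sup[OF K _ this] txK
  obtain m where m: "m \<in> K" "\<And>p. p \<in> K \<Longrightarrow> (case p of (s, y) \<Rightarrow> z s y) \<le> (case m of (s, y) \<Rightarrow> z s y)"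
    by blast
  obtain ts xs where ms: "m = (ts, xs)" by force
  have tsD: "ts \<in> {t0..T}" "xs \<in> D" using m(1) ms by (auto simp: K_def)
  have zm: "z ts xs \<ge> z t x" using m(2)[OF txK] ms by simp
  have zmax: "z s y \<le> z ts xs" if "s \<in> {t0..T}" "y \<in> D" for s y
  proof (cases "\<bar>y\<bar> \<le> R")
    case True then show ?thesis using m(2)[of "(s, y)"] that ms by (auto simp: K_def)
  next
    case False
    then have "z s y \<le> 0" unfolding z_def using Rb[of y] bdd[OF that] that eps
      by (smt (verit) atLeastAtMost_iff distrib_left mult_nonneg_nonneg)
    then show ?thesis using zm zpos by linarith
  qed
  have wpos: "w ts xs > 0"
  proof -
    have "\<epsilon> * (xs\<^sup>2 + 2 * (ts - t0)) \<ge> 0" using eps tsD by simp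
    then show ?thesis using zm zpos by (simp add: z_def)
  qed
  have "ts \<noteq> t0" using wpos init[OF tsD(2)] by auto
  then have ts: "t0 < ts" "ts \<le> T" using tsD by auto
  from pde[OF ts tsD(2) wpos] obtain a b where int: "xs \<in> interior D" and c: "C12_at w ts xs a b" and ab: "a \<le> b / 2"
    by blast
  from c obtain wx where wt: "((\<lambda>s. w s xs) has_real_derivative a) (at ts)"
    and wx: "\<And>y. (w ts has_real_derivative wx y) (at y)" and wxx: "(wx has_real_derivative b) (at xs)"
    unfolding C12_at_def by blast
  have zt: "((\<lambda>s. z s xs) has_real_derivative (a - 2 * \<epsilon>)) (at ts)"
    unfolding z_def by (rule derivative_eq_intros wt refl | simp)+
  \<comment> \<open>The maximum may sit at the final time, so only earlier times are compared and
    only this one sign is obtained.\<close>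
  have a: "a - 2 * \<epsilon> \<ge> 0"
  proof (rule ccontr)
    assume "\<not> a - 2 * \<epsilon> \<ge> 0"
    then have "a - 2 * \<epsilon> < 0" by simp
    from DERIV_neg_dec_left[OF zt this] obtain e where e: "e > 0" "\<And>h. 0 < h \<Longrightarrow> h < e \<Longrightarrow> z ts xs < z (ts - h) xs"
      by blast
    define h where "h = min e (ts - t0) / 2"
    have "0 < h" "h < e" "h < ts - t0" using e(1) ts by (auto simp: h_def)
    then show False using e(2)[of h] zmax[of "ts - h" xs] tsD ts by auto
  qed
  from int obtain d where d: "d > 0" "ball xs d \<subseteq> D" using mem_interior by blast
  have "b - 2 * \<epsilon> \<le> 0"
  proof (rule second_derivative_nonpos_at_local_max[of "z ts" "\<lambda>y. wx y - 2 * \<epsilon> * y" _ xs d])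
    show "(z ts has_real_derivative wx y - 2 * \<epsilon> * y) (at y)" for y
      unfolding z_def by (rule derivative_eq_intros wx refl | simp)+
    show "((\<lambda>y. wx y - 2 * \<epsilon> * y) has_real_derivative b - 2 * \<epsilon>) (at xs)"
      by (rule derivative_eq_intros wxx refl | simp)+
    show "z ts y \<le> z ts xs" if "\<bar>y - xs\<bar> < d" for y
      using that d(2) zmax[OF tsD(1)] by (auto simp: ball_def dist_real_def abs_minus_commute subset_iff)
  qed (use d in auto)
  then show False using a ab eps by simp
qed

section \<open>Calculus of pointwise time and space derivatives\<close>

lemma C12_atI:
  assumes "((\<lambda>s. w s x) has_real_derivative a) (at t)"
    "\<And>y. (w t has_real_derivative wx y) (at y)" "(wx has_real_derivative b) (at x)"
  shows "C12_at w t x a b"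
  using assms unfolding C12_at_def by blast

lemma C12_atE:
  assumes "C12_at w t x a b"
  obtains wx where "((\<lambda>s. w s x) has_real_derivative a) (at t)"
    "\<And>y. (w t has_real_derivative wx y) (at y)" "(wx has_real_derivative b) (at x)"
  using assms unfolding C12_at_def by blast

lemma C12_at_add:
  assumes "C12_at v t x a b" "C12_at w t x c d"
  shows "C12_at (\<lambda>t x. v t x + w t x) t x (a + c) (b + d)"
  using assms by (elim C12_atE) (rule C12_atI; rule DERIV_add; assumption)

lemma C12_at_diff:
  assumes "C12_at v t x a b" "C12_at w t x c d"
  shows "C12_at (\<lambda>t x. v t x - w t x) t x (a - c) (b - d)"
  using assms by (elim C12_atE) (rule C12_atI; rule DERIV_diff; assumption)

lemma C12_at_time_mult:
  assumes "C12_at w t x a b" "(g has_real_derivative g') (at t)"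
  shows "C12_at (\<lambda>t x. g t * w t x) t x (g' * w t x + g t * a) (g t * b)"
proof -
  from assms(1) obtain wx where w: "((\<lambda>s. w s x) has_real_derivative a) (at t)"
    "\<And>y. (w t has_real_derivative wx y) (at y)" "(wx has_real_derivative b) (at x)"
    by (rule C12_atE) blast
  show ?thesis
  proof (rule C12_atI)
    show "((\<lambda>s. g s * w s x) has_real_derivative (g' * w t x + g t * a)) (at t)"
      using DERIV_mult[OF assms(2) w(1)] by (simp add: algebra_simps)
    show "((\<lambda>x. g t * w t x) has_real_derivative g t * wx y) (at y)" for y
      by (rule DERIV_cmult[OF w(2)])
    show "((\<lambda>y. g t * wx y) has_real_derivative g t * b) (at x)"
      by (rule DERIV_cmult[OF w(3)])
  qed
qed

lemma C12_at_cmult: "C12_at w t x a b \<Longrightarrow> C12_at (\<lambda>t x. c * w t x) t x (c * a) (c * b)"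
  using C12_at_time_mult[of w t x a b "\<lambda>_. c" 0] by simp

lemma C12_at_affine:
  assumes "C12_at w (p * t + q) (r * x + s) a b"
  shows "C12_at (\<lambda>t x. w (p * t + q) (r * x + s)) t x (p * a) (r\<^sup>2 * b)"
proof -
  from assms obtain wx where w: "((\<lambda>u. w u (r * x + s)) has_real_derivative a) (at (p * t + q))"
    "\<And>y. (w (p * t + q) has_real_derivative wx y) (at y)" "(wx has_real_derivative b) (at (r * x + s))"
    by (rule C12_atE) blast
  have p: "((\<lambda>u. p * u + q) has_real_derivative p) (at t)"
    by (auto intro!: derivative_eq_intros)
  have r: "((\<lambda>u. r * u + s) has_real_derivative r) (at y)" for y
    by (auto intro!: derivative_eq_intros)
  show ?thesis
  proof (rule C12_atI)
    show "((\<lambda>u. w (p * u + q) (r * x + s)) has_real_derivative (p * a)) (at t)"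
      using DERIV_chain2[OF w(1) p] by (simp add: mult.commute)
    show "((\<lambda>z. w (p * t + q) (r * z + s)) has_real_derivative wx (r * y + s) * r) (at y)" for y
      by (rule DERIV_chain2[OF w(2) r])
    show "((\<lambda>y. wx (r * y + s) * r) has_real_derivative r\<^sup>2 * b) (at x)"
      using DERIV_cmult_right[OF DERIV_chain2[OF w(3) r], of r] by (simp add: power2_eq_square mult_ac)
  qed
qed

text \<open>Self-similar functions: in the variable \<open>y = x / sqrt t\<close> the heat operator becomes
  an Ornstein--Uhlenbeck type operator.\<close>

lemma C12_at_self_similar:
  assumes t: "t > 0"
    and G: "\<And>y. (G has_real_derivative G1 y) (at y)" and G1: "\<And>y. (G1 has_real_derivative G2 y) (at y)"
  shows "C12_at (\<lambda>t x. t powr \<alpha> * G (x / sqrt t)) t x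
     (t powr (\<alpha> - 1) * (\<alpha> * G (x / sqrt t) - (x / sqrt t) / 2 * G1 (x / sqrt t)))
     (t powr (\<alpha> - 1) * G2 (x / sqrt t))"
proof -
  have s: "sqrt t > 0" "sqrt t * sqrt t = t" using t by auto
  have p: "t powr (\<alpha> - 1) * t = t powr \<alpha>" "t powr \<alpha> / t = t powr (\<alpha> - 1)"
    using t by (simp_all add: powr_diff)
  have "((\<lambda>s. x / sqrt s) has_real_derivative (- (x / sqrt t) / (2 * t))) (at t)"
    using t s by (auto intro!: derivative_eq_intros simp: field_simps)
  from DERIV_chain2[OF G this]
  have "((\<lambda>s. G (x / sqrt s)) has_real_derivative G1 (x / sqrt t) * (- (x / sqrt t) / (2 * t))) (at t)" .
  moreover have "((\<lambda>s. s powr \<alpha>) has_real_derivative \<alpha> * t powr (\<alpha> - 1)) (at t)"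
    by (rule has_real_derivative_powr[OF t])
  ultimately have "((\<lambda>s. s powr \<alpha> * G (x / sqrt s)) has_real_derivative
      (\<alpha> * t powr (\<alpha> - 1)) * G (x / sqrt t) + (G1 (x / sqrt t) * (- (x / sqrt t) / (2 * t))) * t powr \<alpha>) (at t)"
    by (rule DERIV_mult[rotated])
  also have "(\<alpha> * t powr (\<alpha> - 1)) * G (x / sqrt t) + (G1 (x / sqrt t) * (- (x / sqrt t) / (2 * t))) * t powr \<alpha>
     = t powr (\<alpha> - 1) * (\<alpha> * G (x / sqrt t) - (x / sqrt t) / 2 * G1 (x / sqrt t))"
    using t unfolding p(1)[symmetric] by (simp add: field_simps)
  finally have 1: "((\<lambda>s. s powr \<alpha> * G (x / sqrt s)) has_real_derivative \<dots>) (at t)" .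
  have 2: "((\<lambda>z. t powr \<alpha> * G (z / sqrt t)) has_real_derivative t powr \<alpha> * (G1 (y / sqrt t) * (1 / sqrt t))) (at y)" for y
    by (rule DERIV_cmult, rule DERIV_chain2[OF G DERIV_cdivide[OF DERIV_ident]])
  have 3: "((\<lambda>y. t powr \<alpha> * (G1 (y / sqrt t) * (1 / sqrt t))) has_real_derivative
      t powr \<alpha> * (G2 (x / sqrt t) * (1 / sqrt t) * (1 / sqrt t))) (at x)"
    by (rule DERIV_cmult, rule DERIV_cmult_right, rule DERIV_chain2[OF G1 DERIV_cdivide[OF DERIV_ident]])
  have "G2 (x / sqrt t) * (1 / sqrt t) * (1 / sqrt t) = G2 (x / sqrt t) / t"
    by (metis (no_types) mult.right_neutral times_divide_eq_right divide_divide_eq_left s(2))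
  then have "t powr \<alpha> * (G2 (x / sqrt t) * (1 / sqrt t) * (1 / sqrt t)) = t powr (\<alpha> - 1) * G2 (x / sqrt t)"
    unfolding p(2)[symmetric] by simp
  with 3 have 4: "((\<lambda>y. t powr \<alpha> * (G1 (y / sqrt t) * (1 / sqrt t))) has_real_derivative t powr (\<alpha> - 1) * G2 (x / sqrt t)) (at x)"
    by simp
  show ?thesis by (rule C12_atI[OF 1 2 4])
qed

section \<open>Gaussian averages\<close>

lemma DERIV_under_integral:
  fixes g :: "real \<Rightarrow> 'a \<Rightarrow> real"
  assumes r: "r > 0"
    and d: "\<And>x z. \<bar>x - x0\<bar> < r \<Longrightarrow> ((\<lambda>x. g x z) has_real_derivative g' x z) (at x)"
    and i: "\<And>x. \<bar>x - x0\<bar> < r \<Longrightarrow> integrable M (g x)"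
    and m: "g' x0 \<in> borel_measurable M"
    and b: "\<And>x z. \<bar>x - x0\<bar> < r \<Longrightarrow> \<bar>g' x z\<bar> \<le> G z" and G: "integrable M G"
  shows "((\<lambda>x. \<integral>z. g x z \<partial>M) has_real_derivative (\<integral>z. g' x0 z \<partial>M)) (at x0)"
proof -
  have "((\<lambda>h. ((\<integral>z. g (x0 + h) z \<partial>M) - (\<integral>z. g x0 z \<partial>M)) / h) \<longlongrightarrow> (\<integral>z. g' x0 z \<partial>M)) (at 0)"
  proof (subst tendsto_at_iff_sequentially, intro allI impI)
    fix X :: "nat \<Rightarrow> real" assume X0: "\<forall>i. X i \<in> UNIV - {0}" and X: "X \<longlonglongrightarrow> 0"
    then obtain N where N: "\<And>n. n \<ge> N \<Longrightarrow> \<bar>X n\<bar> < r"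
      using LIMSEQ_D[OF X r] by (metis diff_zero real_norm_def)
    define Y where "Y = (\<lambda>n. X (n + N))"
    have Y: "Y \<longlonglongrightarrow> 0" "\<And>n. Y n \<noteq> 0" "\<And>n. \<bar>Y n\<bar> < r"
      using X X0 N LIMSEQ_ignore_initial_segment[OF X, of N] by (auto simp: Y_def)
    have i': "integrable M (g (x0 + Y n))" "integrable M (g x0)" for n
      using i[of "x0 + Y n"] i[of x0] Y(3) r by auto
    have "(\<lambda>n. \<integral>z. (g (x0 + Y n) z - g x0 z) / Y n \<partial>M) \<longlonglongrightarrow> (\<integral>z. g' x0 z \<partial>M)"
    proof (rule integral_dominated_convergence[where w = G])
      show "(\<lambda>z. (g (x0 + Y n) z - g x0 z) / Y n) \<in> borel_measurable M" for n
        using i' by (intro borel_measurable_divide borel_measurable_diff) auto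
      show "AE z in M. (\<lambda>n. (g (x0 + Y n) z - g x0 z) / Y n) \<longlonglongrightarrow> g' x0 z"
      proof (rule AE_I2)
        fix z
        have "((\<lambda>h. (g (x0 + h) z - g x0 z) / h) \<longlongrightarrow> g' x0 z) (at 0)"
          using d[of x0 z] r by (simp add: DERIV_def)
        then show "(\<lambda>n. (g (x0 + Y n) z - g x0 z) / Y n) \<longlonglongrightarrow> g' x0 z"
          using Y unfolding tendsto_at_iff_sequentially by (auto simp: o_def)
      qed
      show "AE z in M. norm ((g (x0 + Y n) z - g x0 z) / Y n) \<le> G z" for n
      proof (rule AE_I2)
        fix z
        have "\<bar>g (x0 + Y n) z - g x0 z\<bar> \<le> G z * \<bar>(x0 + Y n) - x0\<bar>"
        proof (rule field_differentiable_bound[of "{x. \<bar>x - x0\<bar> < r}" "\<lambda>x. g x z" "\<lambda>x. g' x z", simplified real_norm_def])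
          have "{x. \<bar>x - x0\<bar> < r} = ball x0 r" by (auto simp: dist_real_def)
          then show "convex {x. \<bar>x - x0\<bar> < r}" by simp
        qed (use d b r Y in \<open>auto intro: has_field_derivative_at_within\<close>)
        then show "norm ((g (x0 + Y n) z - g x0 z) / Y n) \<le> G z"
          using Y(2)[of n] by (simp add: field_simps)
      qed
    qed (use m G in auto)
    moreover have "(\<integral>z. (g (x0 + Y n) z - g x0 z) / Y n \<partial>M) = ((\<integral>z. g (x0 + Y n) z \<partial>M) - (\<integral>z. g x0 z \<partial>M)) / Y n" for n
      using i' by (simp add: Bochner_Integration.integral_diff)
    ultimately have "(\<lambda>n. ((\<integral>z. g (x0 + Y n) z \<partial>M) - (\<integral>z. g x0 z \<partial>M)) / Y n) \<longlonglongrightarrow> (\<integral>z. g' x0 z \<partial>M)"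
      by (simp only:)
    then show "((\<lambda>h. ((\<integral>z. g (x0 + h) z \<partial>M) - (\<integral>z. g x0 z \<partial>M)) / h) \<circ> X) \<longlonglongrightarrow> (\<integral>z. g' x0 z \<partial>M)"
      unfolding Y_def o_def by (rule LIMSEQ_offset)
  qed
  then show ?thesis by (simp add: DERIV_def)
qed

section \<open>Expectations under the standard Gaussian law\<close>

lemma sets_std_gauss [simp, measurable_cong]: "sets std_gauss = sets borel"
  by (simp add: std_gauss_def)

lemma space_std_gauss [simp]: "space std_gauss = UNIV"
  by (simp add: std_gauss_def)

lemma prob_space_std_gauss: "prob_space std_gauss"
  unfolding std_gauss_def by (rule prob_space_normal_density) simp

lemma borel_measurable_std_gauss_iff: "f \<in> borel_measurable std_gauss \<longleftrightarrow> f \<in> borel_measurable borel"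
  unfolding measurable_def by (simp add: space_borel)

lemma integrable_std_gauss_iff:
  fixes f :: "real \<Rightarrow> real"
  assumes "f \<in> borel_measurable borel"
  shows "integrable std_gauss f \<longleftrightarrow> integrable lborel (\<lambda>x. std_normal_density x * f x)"
  unfolding std_gauss_def using assms by (subst integrable_density) auto

lemma integral_std_gauss:
  fixes f :: "real \<Rightarrow> real"
  assumes "f \<in> borel_measurable borel"
  shows "(\<integral>z. f z \<partial>std_gauss) = (\<integral>x. std_normal_density x * f x \<partial>lborel)"
  unfolding std_gauss_def using assms by (subst integral_density) auto

lemma integrable_std_gauss_abs: "integrable std_gauss (\<lambda>z. \<bar>z\<bar>)"
  using integrable_std_normal_moment_abs[of 1] by (subst integrable_std_gauss_iff) auto

lemma integral_std_gauss_abs: "(\<integral>z. \<bar>z\<bar> \<partial>std_gauss) \<le> 1"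
proof -
  have "(\<integral>z. \<bar>z\<bar> \<partial>std_gauss) = sqrt (2 / pi)"
    using integral_std_normal_moment_abs_odd[of 0] by (subst integral_std_gauss) auto
  also have "\<dots> \<le> 1" using pi_gt3 by simp
  finally show ?thesis .
qed

lemma integral_std_gauss_id: "(\<integral>z. z \<partial>std_gauss) = 0"
  using integral_std_normal_moment_odd[of 0] by (subst integral_std_gauss) auto

lemma integrable_std_gauss_linear_growth:
  fixes g :: "real \<Rightarrow> real"
  assumes "continuous_on UNIV g" "\<And>z. \<bar>g z\<bar> \<le> B * (1 + \<bar>z\<bar>)"
  shows "integrable std_gauss g"
proof (rule Bochner_Integration.integrable_bound)
  interpret prob_space std_gauss by (rule prob_space_std_gauss)
  show "integrable std_gauss (\<lambda>z. B * (1 + \<bar>z\<bar>))"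
    using integrable_std_gauss_abs by simp
  show "g \<in> borel_measurable std_gauss"
    using borel_measurable_continuous_onI[OF assms(1)] by (simp add: borel_measurable_std_gauss_iff)
  show "AE z in std_gauss. norm (g z) \<le> norm (B * (1 + \<bar>z\<bar>))"
    using assms(2) by (intro AE_I2) (smt (verit) real_norm_def)
qed

lemma integrable_std_gauss_bounded:
  fixes g :: "real \<Rightarrow> real"
  assumes "continuous_on UNIV g" "\<And>z. \<bar>g z\<bar> \<le> B"
  shows "integrable std_gauss g"
proof (rule integrable_std_gauss_linear_growth[OF assms(1)])
  have B: "B \<ge> 0" using assms(2)[of 0] by linarith
  show "\<bar>g z\<bar> \<le> B * (1 + \<bar>z\<bar>)" for z
    using assms(2)[of z] mult_nonneg_nonneg[OF B, of "\<bar>z\<bar>"] unfolding distrib_left by linarith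
qed

lemma abs_integral_std_gauss_le:
  fixes g :: "real \<Rightarrow> real"
  assumes "continuous_on UNIV g" "\<And>z. \<bar>g z\<bar> \<le> B"
  shows "\<bar>\<integral>z. g z \<partial>std_gauss\<bar> \<le> B"
proof -
  interpret prob_space std_gauss by (rule prob_space_std_gauss)
  have i: "integrable std_gauss g" by (rule integrable_std_gauss_bounded[OF assms])
  have b: "g z \<le> B" "- B \<le> g z" for z using assms(2)[of z] by linarith+
  have "(\<integral>z. g z \<partial>std_gauss) \<le> B" by (rule integral_le_const[OF i]) (rule AE_I2, rule b)
  moreover have "(\<integral>z. g z \<partial>std_gauss) \<ge> - B" by (rule integral_ge_const[OF i]) (rule AE_I2, rule b)
  ultimately show ?thesis by linarith
qed

lemma abs_integral_std_gauss_mult_le: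
  fixes g :: "real \<Rightarrow> real"
  assumes "continuous_on UNIV g" "\<And>z. \<bar>g z\<bar> \<le> B"
  shows "\<bar>\<integral>z. z * g z \<partial>std_gauss\<bar> \<le> B"
proof -
  have B: "B \<ge> 0" using assms(2)[of 0] by linarith
  have b: "\<bar>z * g z\<bar> \<le> B * \<bar>z\<bar>" for z
    using mult_left_mono[OF assms(2)[of z], of "\<bar>z\<bar>"] by (simp add: abs_mult mult.commute)
  have "\<bar>\<integral>z. z * g z \<partial>std_gauss\<bar> \<le> (\<integral>z. \<bar>z * g z\<bar> \<partial>std_gauss)"
    by simp
  also have "\<dots> \<le> (\<integral>z. B * \<bar>z\<bar> \<partial>std_gauss)"
  proof (rule integral_mono)
    show "integrable std_gauss (\<lambda>z. \<bar>z * g z\<bar>)"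
      by (rule integrable_std_gauss_linear_growth[where B = B])
        (use assms(1) b B in \<open>auto intro!: continuous_intros simp: distrib_left intro: add_increasing\<close>)
  qed (use integrable_std_gauss_abs b in auto)
  also have "\<dots> \<le> B * 1" using integral_std_gauss_abs B by (simp add: mult_left_le)
  finally show ?thesis by simp
qed

lemma continuous_on_integral_std_gauss:
  fixes g :: "'a::euclidean_space \<Rightarrow> real \<Rightarrow> real"
  assumes c: "continuous_on UNIV (\<lambda>(p, z). g p z)"
    and b: "\<And>R. \<exists>B. \<forall>p z. norm p \<le> R \<longrightarrow> \<bar>g p z\<bar> \<le> B * (1 + \<bar>z\<bar>)"
  shows "continuous_on UNIV (\<lambda>p. \<integral>z. g p z \<partial>std_gauss)"
proof (rule continuous_at_imp_continuous_on, intro ballI, subst continuous_at_sequentially, intro allI impI)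
  interpret prob_space std_gauss by (rule prob_space_std_gauss)
  fix p :: 'a and X :: "nat \<Rightarrow> 'a" assume X: "X \<longlonglongrightarrow> p"
  then have "Bseq X" by (meson convergent_def Bseq_def convergent_imp_Bseq)
  then obtain R where R: "\<And>n. norm (X n) \<le> R" by (auto simp: Bseq_def)
  from b obtain B where B: "\<And>p z. norm p \<le> R \<Longrightarrow> \<bar>g p z\<bar> \<le> B * (1 + \<bar>z\<bar>)" by blast
  have cz: "continuous_on UNIV (g p)" for p
    using continuous_on_compose2[OF c continuous_on_Pair[OF continuous_on_const continuous_on_id]] by simp
  have cp: "continuous_on UNIV (\<lambda>p. g p z)" for z
    using continuous_on_compose2[OF c continuous_on_Pair[OF continuous_on_id continuous_on_const]] by simp
  show "((\<lambda>p. \<integral>z. g p z \<partial>std_gauss) \<circ> X) \<longlonglongrightarrow> (\<integral>z. g p z \<partial>std_gauss)"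
    unfolding o_def
  proof (rule integral_dominated_convergence[where w = "\<lambda>z. B * (1 + \<bar>z\<bar>)"])
    show "integrable std_gauss (\<lambda>z. B * (1 + \<bar>z\<bar>))" using integrable_std_gauss_abs by simp
    show "AE z in std_gauss. (\<lambda>n. g (X n) z) \<longlonglongrightarrow> g p z"
    proof (rule AE_I2)
      fix z show "(\<lambda>n. g (X n) z) \<longlonglongrightarrow> g p z"
        by (rule continuous_on_tendsto_compose[OF cp X]) auto
    qed
    show "g p \<in> borel_measurable std_gauss" for p
      unfolding borel_measurable_std_gauss_iff by (rule borel_measurable_continuous_onI[OF cz])
    then show "g (X n) \<in> borel_measurable std_gauss" for n .
    show "AE z in std_gauss. norm (g (X n) z) \<le> B * (1 + \<bar>z\<bar>)" for n
      by (rule AE_I2) (simp add: B R)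
  qed
qed

lemma DERIV_std_normal_density:
  "(std_normal_density has_real_derivative (- v * std_normal_density v)) (at v)"
proof -
  have "((\<lambda>x. - x\<^sup>2 / 2) has_real_derivative (- (2 * v) / 2)) (at v)"
    by (rule derivative_eq_intros refl | simp)+
  from DERIV_cmult[OF DERIV_chain2[OF DERIV_exp this], of "1 / sqrt (2 * pi)"]
  show ?thesis unfolding std_normal_density_def[abs_def] by (rule DERIV_cong) simp
qed

text \<open>Moving the parameter from the integrand to the density turns a bounded function
  into a smooth one.\<close>

lemma DERIV_std_gauss_smoothing:
  fixes h :: "real \<Rightarrow> real"
  assumes h: "continuous_on UNIV h" and B: "\<And>y. \<bar>h y\<bar> \<le> B" and \<sigma>: "\<sigma> > 0"
  shows "((\<lambda>x. \<integral>z. h (x + \<sigma> * z) \<partial>std_gauss) has_real_derivative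
      (\<integral>z. z * h (x0 + \<sigma> * z) \<partial>std_gauss) / \<sigma>) (at x0)"
proof -
  have [measurable]: "h \<in> borel_measurable borel" by (rule borel_measurable_continuous_onI[OF h])
  have shift: "(\<integral>z. std_normal_density z * k z (x + \<sigma> * z) \<partial>lborel)
      = (\<integral>w. std_normal_density (w - x / \<sigma>) * k (w - x / \<sigma>) (\<sigma> * w) \<partial>lborel)" for x and k :: "real \<Rightarrow> real \<Rightarrow> real"
  proof -
    have e: "- x / \<sigma> + 1 * w = w - x / \<sigma>" "x + \<sigma> * (w - x / \<sigma>) = \<sigma> * w" for w
      using \<sigma> by (simp_all add: right_diff_distrib)
    have "(\<integral>z. std_normal_density z * k z (x + \<sigma> * z) \<partial>lborel)
      = \<bar>1\<bar> *\<^sub>R (\<integral>w. std_normal_density (- x / \<sigma> + 1 * w) * k (- x / \<sigma> + 1 * w) (x + \<sigma> * (- x / \<sigma> + 1 * w)) \<partial>lborel)"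
      by (rule lborel_integral_real_affine) simp
    then show ?thesis unfolding e abs_one scaleR_one .
  qed
  \<comment> \<open>After the substitution the parameter occurs only in the density, so no
    derivative of \<open>h\<close> is needed.\<close>
  have eq1: "(\<integral>z. h (x + \<sigma> * z) \<partial>std_gauss) = (\<integral>w. std_normal_density (w - x / \<sigma>) * h (\<sigma> * w) \<partial>lborel)" for x
    unfolding shift[of "\<lambda>_ y. h y", symmetric] by (rule integral_std_gauss) measurable
  have "(\<integral>z. z * h (x0 + \<sigma> * z) \<partial>std_gauss) = (\<integral>w. std_normal_density (w - x0 / \<sigma>) * ((w - x0 / \<sigma>) * h (\<sigma> * w)) \<partial>lborel)"
    unfolding shift[of "\<lambda>z y. z * h y", symmetric] by (rule integral_std_gauss) measurable
  then have "(\<integral>z. z * h (x0 + \<sigma> * z) \<partial>std_gauss) / \<sigma> = (\<integral>w. std_normal_density (w - x0 / \<sigma>) * ((w - x0 / \<sigma>) * h (\<sigma> * w)) / \<sigma> \<partial>lborel)"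
    by (simp only: integral_divide_zero)
  also have "\<dots> = (\<integral>w. (w - x0 / \<sigma>) / \<sigma> * std_normal_density (w - x0 / \<sigma>) * h (\<sigma> * w) \<partial>lborel)"
    by (rule Bochner_Integration.integral_cong) (simp_all only: times_divide_eq_left times_divide_eq_right mult_ac)
  finally have eq2: "(\<integral>z. z * h (x0 + \<sigma> * z) \<partial>std_gauss) / \<sigma> = \<dots>" .
  define \<mu> where "\<mu> = x0 / \<sigma>"
  \<comment> \<open>For \<bar>e\<bar> \<le> 1 one has
    \<open>(v - e)\<^sup>2 \<ge> v\<^sup>2 / 2 - 1\<close>. So all shifted densities with
    \<open>\<bar>x - x0\<bar> < \<sigma>\<close> lie below one Gaussian of variance 2, at the cost
    of the factor exp(1/2) sqrt 2.\<close>
  define C where "C = exp (1/2) * sqrt 2 * \<bar>B\<bar> / \<sigma>"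
  show ?thesis unfolding eq1 eq2
  proof (rule DERIV_under_integral[where r = \<sigma> and G = "\<lambda>w. C * (normal_density \<mu> (sqrt 2) w * \<bar>w - \<mu>\<bar> ^ 1 + normal_density \<mu> (sqrt 2) w * \<bar>w - \<mu>\<bar> ^ 0)"
      and g' = "\<lambda>x w. (w - x / \<sigma>) / \<sigma> * std_normal_density (w - x / \<sigma>) * h (\<sigma> * w)"])
    show "((\<lambda>x. std_normal_density (w - x / \<sigma>) * h (\<sigma> * w)) has_real_derivative
        (w - x / \<sigma>) / \<sigma> * std_normal_density (w - x / \<sigma>) * h (\<sigma> * w)) (at x)" for x w
    proof -
      have "((\<lambda>x. w - x / \<sigma>) has_real_derivative (0 - 1 / \<sigma>)) (at x)"
        by (rule DERIV_diff[OF DERIV_const DERIV_cdivide[OF DERIV_ident]])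
      from DERIV_cmult_right[OF DERIV_chain2[OF DERIV_std_normal_density this], of "h (\<sigma> * w)"]
      show ?thesis by (rule DERIV_cong) (simp add: divide_inverse algebra_simps)
    qed
    show "integrable lborel (\<lambda>w. std_normal_density (w - x / \<sigma>) * h (\<sigma> * w))" for x
    proof (rule Bochner_Integration.integrable_bound[where f = "\<lambda>w. B * normal_density (x / \<sigma>) 1 w"])
      show "AE w in lborel. norm (std_normal_density (w - x / \<sigma>) * h (\<sigma> * w)) \<le> norm (B * normal_density (x / \<sigma>) 1 w)"
      proof (rule AE_I2)
        fix w
        have "\<bar>std_normal_density (w - x / \<sigma>) * h (\<sigma> * w)\<bar> = std_normal_density (w - x / \<sigma>) * \<bar>h (\<sigma> * w)\<bar>"
          by (simp only: abs_mult abs_of_nonneg normal_density_nonneg)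
        also have "\<dots> \<le> std_normal_density (w - x / \<sigma>) * B"
          by (rule mult_left_mono[OF B normal_density_nonneg])
        also have "\<dots> = B * normal_density (x / \<sigma>) 1 w" by (simp add: normal_density_def)
        also have "\<dots> \<le> \<bar>B * normal_density (x / \<sigma>) 1 w\<bar>" by (rule abs_ge_self)
        finally show "norm (std_normal_density (w - x / \<sigma>) * h (\<sigma> * w)) \<le> norm (B * normal_density (x / \<sigma>) 1 w)"
          by (simp only: real_norm_def)
      qed
    qed auto
    show "integrable lborel (\<lambda>w. C * (normal_density \<mu> (sqrt 2) w * \<bar>w - \<mu>\<bar> ^ 1 + normal_density \<mu> (sqrt 2) w * \<bar>w - \<mu>\<bar> ^ 0))"
      by (intro integrable_mult_right Bochner_Integration.integrable_add integrable_normal_moment_abs) auto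
    fix x w assume x: "\<bar>x - x0\<bar> < \<sigma>"
    define v where "v = w - \<mu>"
    define e where "e = (x - x0) / \<sigma>"
    have e: "\<bar>e\<bar> < 1" using x \<sigma> by (simp add: e_def)
    have ve: "w - x / \<sigma> = v - e" by (simp add: v_def e_def \<mu>_def diff_divide_distrib)
    have sq: "(v - e)\<^sup>2 \<ge> v\<^sup>2 / 2 - 1"
    proof -
      have "(v - e)\<^sup>2 - (v\<^sup>2 / 2 - e\<^sup>2) = (v - 2 * e)\<^sup>2 / 2"
        by (simp add: power2_eq_square algebra_simps)
      moreover have "e\<^sup>2 \<le> 1" using e by (simp add: abs_square_le_1)
      ultimately show ?thesis using zero_le_power2[of "v - 2 * e"] by linarith
    qed
    have nd: "normal_density \<mu> (sqrt 2) w = exp (- v\<^sup>2 / 4) / (sqrt (2 * pi) * sqrt 2)"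
      by (simp add: normal_density_def v_def real_sqrt_mult)
    have "std_normal_density (v - e) \<le> exp (1/2 - v\<^sup>2 / 4) / sqrt (2 * pi)"
      unfolding std_normal_density_def using sq by (simp add: divide_right_mono)
    also have "\<dots> = exp (1/2) * sqrt 2 * normal_density \<mu> (sqrt 2) w"
    proof -
      have "exp (1/2 - v\<^sup>2 / 4) = exp (1/2) * exp (- v\<^sup>2 / 4)" by (simp add: exp_add[symmetric])
      then show ?thesis unfolding nd by simp
    qed
    finally have 1: "std_normal_density (v - e) \<le> exp (1/2) * sqrt 2 * normal_density \<mu> (sqrt 2) w" .
    have "\<bar>(v - e) / \<sigma> * std_normal_density (v - e) * h (\<sigma> * w)\<bar> = \<bar>v - e\<bar> / \<sigma> * std_normal_density (v - e) * \<bar>h (\<sigma> * w)\<bar>"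
      using \<sigma> by (simp add: abs_mult)
    also have "\<dots> \<le> (\<bar>v\<bar> + 1) / \<sigma> * (exp (1/2) * sqrt 2 * normal_density \<mu> (sqrt 2) w) * \<bar>B\<bar>"
    proof (intro mult_mono 1 divide_right_mono)
      show "\<bar>v - e\<bar> \<le> \<bar>v\<bar> + 1" using e by linarith
      show "\<bar>h (\<sigma> * w)\<bar> \<le> \<bar>B\<bar>" using B[of "\<sigma> * w"] by linarith
    qed (use \<sigma> in auto)
    also have "\<dots> = C * (normal_density \<mu> (sqrt 2) w * \<bar>w - \<mu>\<bar> ^ 1 + normal_density \<mu> (sqrt 2) w * \<bar>w - \<mu>\<bar> ^ 0)"
      unfolding C_def v_def by (simp add: algebra_simps add_divide_distrib)
    finally show "\<bar>(w - x / \<sigma>) / \<sigma> * std_normal_density (w - x / \<sigma>) * h (\<sigma> * w)\<bar> \<le> \<dots>" unfolding ve .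
  qed (use \<sigma> in auto)
qed

lemma DERIV_std_gauss_shift:
  fixes h :: "real \<Rightarrow> real"
  assumes h: "\<And>y. (h has_real_derivative h' y) (at y)" and h': "continuous_on UNIV h'"
    and B: "\<And>y. \<bar>h y\<bar> \<le> B" and B': "\<And>y. \<bar>h' y\<bar> \<le> B'"
  shows "((\<lambda>x. \<integral>z. h (x + \<sigma> * z) \<partial>std_gauss) has_real_derivative (\<integral>z. h' (x + \<sigma> * z) \<partial>std_gauss)) (at x)"
proof -
  interpret prob_space std_gauss by (rule prob_space_std_gauss)
  have hc: "continuous_on UNIV h"
    using h by (meson DERIV_isCont continuous_at_imp_continuous_on)
  show ?thesis
  proof (rule DERIV_under_integral[where r = 1 and G = "\<lambda>_. B'" and g' = "\<lambda>x z. h' (x + \<sigma> * z)"])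
    show "((\<lambda>x. h (x + \<sigma> * z)) has_real_derivative h' (x + \<sigma> * z)) (at x)" for x z
    proof -
      have "((\<lambda>x. x + \<sigma> * z) has_real_derivative 1 + 0) (at x)"
        by (rule DERIV_add[OF DERIV_ident DERIV_const])
      from DERIV_chain2[OF h this] show ?thesis by simp
    qed
    show "integrable std_gauss (\<lambda>z. h (x + \<sigma> * z))" for x
      by (rule integrable_std_gauss_bounded[where B = B])
        (auto intro!: continuous_on_compose2[OF hc] continuous_intros B)
    show "(\<lambda>z. h' (x + \<sigma> * z)) \<in> borel_measurable std_gauss"
      unfolding borel_measurable_std_gauss_iff
      by (rule borel_measurable_continuous_onI) (auto intro!: continuous_on_compose2[OF h'] continuous_intros)
  qed (use B' in auto)
qed

text \<open>The same average is differentiated twice, once through the density and once through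
  \<open>h\<close>; uniqueness of derivatives equates the two results.\<close>

lemma std_gauss_integration_by_parts:
  fixes h :: "real \<Rightarrow> real"
  assumes h: "\<And>y. (h has_real_derivative h' y) (at y)" and h': "continuous_on UNIV h'"
    and B: "\<And>y. \<bar>h y\<bar> \<le> B" and B': "\<And>y. \<bar>h' y\<bar> \<le> B'" and \<sigma>: "\<sigma> > 0"
  shows "(\<integral>z. z * h (x + \<sigma> * z) \<partial>std_gauss) = \<sigma> * (\<integral>z. h' (x + \<sigma> * z) \<partial>std_gauss)"
proof -
  have hc: "continuous_on UNIV h"
    using h by (meson DERIV_isCont continuous_at_imp_continuous_on)
  have "(\<integral>z. z * h (x + \<sigma> * z) \<partial>std_gauss) / \<sigma> = (\<integral>z. h' (x + \<sigma> * z) \<partial>std_gauss)"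
    by (rule DERIV_unique[OF DERIV_std_gauss_smoothing[OF hc B \<sigma>] DERIV_std_gauss_shift[OF h h' B B']])
  then show ?thesis using \<sigma> by (simp add: field_simps)
qed

section \<open>The log-Laplace equation\<close>

text \<open>Averaging over a scaled variable, instead of integrating against the heat kernel, leaves
  no singularity at \<open>t = 0\<close>. Since \<open>sqrt\<close> is odd and continuous, the
  expression is continuous on the whole time axis.\<close>

definition heat :: "(real \<Rightarrow> real) \<Rightarrow> real \<Rightarrow> real \<Rightarrow> real" where
  "heat f t x = (\<integral>z. f (x + sqrt t * z) \<partial>std_gauss)"

definition C2b :: "(real \<Rightarrow> real) \<Rightarrow> (real \<Rightarrow> real) \<Rightarrow> (real \<Rightarrow> real) \<Rightarrow> bool" where
  "C2b f f1 f2 \<longleftrightarrow> (\<forall>x. (f has_real_derivative f1 x) (at x)) \<and> (\<forall>x. (f1 has_real_derivative f2 x) (at x)) \<and>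
     continuous_on UNIV f2 \<and> (\<exists>B. \<forall>x. \<bar>f x\<bar> \<le> B \<and> \<bar>f1 x\<bar> \<le> B \<and> \<bar>f2 x\<bar> \<le> B)"

lemma C2bD:
  assumes "C2b f f1 f2"
  obtains B where "\<And>x. (f has_real_derivative f1 x) (at x)" "\<And>x. (f1 has_real_derivative f2 x) (at x)"
    "continuous_on UNIV f" "continuous_on UNIV f1" "continuous_on UNIV f2"
    "\<And>x. \<bar>f x\<bar> \<le> B" "\<And>x. \<bar>f1 x\<bar> \<le> B" "\<And>x. \<bar>f2 x\<bar> \<le> B"
proof -
  from assms have d: "\<And>x. (f has_real_derivative f1 x) (at x)" "\<And>x. (f1 has_real_derivative f2 x) (at x)"
    and c2: "continuous_on UNIV f2" and "\<exists>B. \<forall>x. \<bar>f x\<bar> \<le> B \<and> \<bar>f1 x\<bar> \<le> B \<and> \<bar>f2 x\<bar> \<le> B"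
    unfolding C2b_def by auto
  moreover from d have "continuous_on UNIV f" "continuous_on UNIV f1"
    by (meson DERIV_isCont continuous_at_imp_continuous_on)+
  ultimately show thesis using that by blast
qed

lemma continuous_on_std_gauss_shift:
  fixes h :: "real \<Rightarrow> real"
  assumes "continuous_on UNIV h" "\<And>y. \<bar>h y\<bar> \<le> B"
  shows "continuous_on UNIV (\<lambda>p::real \<times> real. \<integral>z. h (fst p + snd p * z) \<partial>std_gauss)"
proof (rule continuous_on_integral_std_gauss)
  show "continuous_on UNIV (\<lambda>(p::real \<times> real, z). h (fst p + snd p * z))"
    unfolding case_prod_beta by (auto intro!: continuous_on_compose2[OF assms(1)] continuous_intros)
  have "B \<ge> 0" using assms(2)[of 0] by linarith
  have "\<bar>h y\<bar> \<le> B * (1 + \<bar>z\<bar>)" for y z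
    using assms(2)[of y] mult_nonneg_nonneg[OF \<open>B \<ge> 0\<close>, of "\<bar>z\<bar>"] unfolding distrib_left by linarith
  then show "\<exists>B. \<forall>(p::real \<times> real) z. norm p \<le> R \<longrightarrow> \<bar>h (fst p + snd p * z)\<bar> \<le> B * (1 + \<bar>z\<bar>)" for R
    by blast
qed

lemma continuous_on_heat:
  assumes "continuous_on UNIV h" "\<And>y. \<bar>h y\<bar> \<le> B"
  shows "continuous_on UNIV (\<lambda>(t, x). heat h t x)"
  unfolding heat_def case_prod_beta
  using continuous_on_compose2[OF continuous_on_std_gauss_shift[OF assms], of UNIV "\<lambda>p. (snd p, sqrt (fst p))"]
  by (simp add: continuous_intros)

text \<open>Differentiation in \<sigma> = sqrt t gives the average of \<open>z f1\<close>, which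
  integration by parts turns into \<sigma> times the average of \<open>f2\<close>. This \<sigma>
  cancels the singular factor 1/(2 \<sigma>) of the chain rule.\<close>

lemma DERIV_heat_time:
  assumes f: "C2b f f1 f2" and t: "t > 0"
  shows "((\<lambda>s. heat f s x) has_real_derivative heat f2 t x / 2) (at t)"
proof -
  interpret prob_space std_gauss by (rule prob_space_std_gauss)
  from f obtain B where d: "\<And>x. (f has_real_derivative f1 x) (at x)" "\<And>x. (f1 has_real_derivative f2 x) (at x)"
    and c: "continuous_on UNIV f" "continuous_on UNIV f1" "continuous_on UNIV f2"
    and B: "\<And>x. \<bar>f x\<bar> \<le> B" "\<And>x. \<bar>f1 x\<bar> \<le> B" "\<And>x. \<bar>f2 x\<bar> \<le> B"
    by (rule C2bD) blast
  have "((\<lambda>\<sigma>. \<integral>z. f (x + \<sigma> * z) \<partial>std_gauss) has_real_derivative (\<integral>z. z * f1 (x + sqrt t * z) \<partial>std_gauss)) (at (sqrt t))"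
  proof (rule DERIV_under_integral[where r = 1 and G = "\<lambda>z. B * \<bar>z\<bar>" and g' = "\<lambda>\<sigma> z. z * f1 (x + \<sigma> * z)"])
    show "((\<lambda>\<sigma>. f (x + \<sigma> * z)) has_real_derivative z * f1 (x + \<sigma> * z)) (at \<sigma>)" for \<sigma> z
    proof -
      have "((\<lambda>\<sigma>. x + \<sigma> * z) has_real_derivative 0 + 1 * z) (at \<sigma>)"
        by (rule DERIV_add[OF DERIV_const DERIV_cmult_right[OF DERIV_ident]])
      from DERIV_chain2[OF d(1) this] show ?thesis by (simp add: mult.commute)
    qed
    show "integrable std_gauss (\<lambda>z. f (x + \<sigma> * z))" for \<sigma>
      by (rule integrable_std_gauss_bounded[where B = B])
        (auto intro!: continuous_on_compose2[OF c(1)] continuous_intros B)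
    show "(\<lambda>z. z * f1 (x + sqrt t * z)) \<in> borel_measurable std_gauss"
      unfolding borel_measurable_std_gauss_iff
      by (rule borel_measurable_continuous_onI) (auto intro!: continuous_on_compose2[OF c(2)] continuous_intros)
    show "\<bar>z * f1 (x + \<sigma> * z)\<bar> \<le> B * \<bar>z\<bar>" for \<sigma> z
      using mult_left_mono[OF B(2)[of "x + \<sigma> * z"], of "\<bar>z\<bar>"] by (simp add: abs_mult mult.commute)
  qed (use integrable_std_gauss_abs in auto)
  also have "(\<integral>z. z * f1 (x + sqrt t * z) \<partial>std_gauss) = sqrt t * heat f2 t x"
    unfolding heat_def by (rule std_gauss_integration_by_parts[OF d(2) c(3) B(2,3)]) (use t in simp)
  finally have 1: "((\<lambda>\<sigma>. \<integral>z. f (x + \<sigma> * z) \<partial>std_gauss) has_real_derivative sqrt t * heat f2 t x) (at (sqrt t))" .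
  have "((\<lambda>s. heat f s x) has_real_derivative (sqrt t * heat f2 t x) * (inverse (sqrt t) / 2)) (at t)"
    unfolding heat_def[of f, abs_def] by (rule DERIV_chain2[OF 1 DERIV_real_sqrt[OF t]])
  moreover have "(sqrt t * heat f2 t x) * (inverse (sqrt t) / 2) = heat f2 t x / 2"
  proof -
    have "sqrt t * inverse (sqrt t) = 1" using t by simp
    then show ?thesis by algebra
  qed
  ultimately show ?thesis by metis
qed

lemma DERIV_heat:
  assumes f: "C2b f f1 f2"
  shows "(heat f t has_real_derivative heat f1 t x) (at x)" "(heat f1 t has_real_derivative heat f2 t x) (at x)"
proof -
  from f obtain B where d: "\<And>x. (f has_real_derivative f1 x) (at x)" "\<And>x. (f1 has_real_derivative f2 x) (at x)"
    and c: "continuous_on UNIV f" "continuous_on UNIV f1" "continuous_on UNIV f2"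
    and B: "\<And>x. \<bar>f x\<bar> \<le> B" "\<And>x. \<bar>f1 x\<bar> \<le> B" "\<And>x. \<bar>f2 x\<bar> \<le> B"
    by (rule C2bD) blast
  show "(heat f t has_real_derivative heat f1 t x) (at x)"
    unfolding heat_def[abs_def] by (rule DERIV_std_gauss_shift[OF d(1) c(2) B(1,2)])
  show "(heat f1 t has_real_derivative heat f2 t x) (at x)"
    unfolding heat_def[abs_def] by (rule DERIV_std_gauss_shift[OF d(2) c(3) B(2,3)])
qed

lemma C12_at_heat:
  assumes "C2b f f1 f2" "t > 0"
  shows "C12_at (heat f) t x (heat f2 t x / 2) (heat f2 t x)"
  by (rule C12_atI[OF DERIV_heat_time[OF assms] DERIV_heat[OF assms(1)]])

lemma heat_0 [simp]: "heat f 0 x = f x"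
proof -
  interpret prob_space std_gauss by (rule prob_space_std_gauss)
  show ?thesis by (simp add: heat_def prob_space[simplified])
qed

lemma heat_eq_integral:
  assumes f: "C2b f f1 f2" and t: "t \<ge> 0"
  shows "heat f t x = f x + integral {0..t} (\<lambda>s. heat f2 s x / 2)"
proof -
  from f obtain B where c: "continuous_on UNIV f" and B: "\<And>x. \<bar>f x\<bar> \<le> B"
    by (rule C2bD) blast
  have "continuous_on {0..t} (\<lambda>s. heat f s x)"
    using continuous_on_compose2[OF continuous_on_heat[OF c B], of "{0..t}" "\<lambda>s. (s, x)"]
    by (simp add: continuous_intros)
  from fundamental_theorem_of_calculus_interior[OF t this, of "\<lambda>s. heat f2 s x / 2"]
  have "((\<lambda>s. heat f2 s x / 2) has_integral heat f t x - heat f 0 x) {0..t}"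
    using DERIV_heat_time[OF f] by (auto simp: has_real_derivative_iff_has_vector_derivative)
  from integral_unique[OF this] show ?thesis unfolding heat_0 by linarith
qed

text \<open>Duhamel's integral \<open>\<integral>\<^sub>0\<^sup>t P\<^sub>t\<^sub>-\<^sub>s h\<^sub>s ds\<close> for the heat semigroup \<open>P\<close> and its space derivative,
  after \<open>t - s = t \<rho>\<^sup>2\<close>, which removes the singularity at \<open>s = t\<close>. \<open>lbc\<close>: continuous and
  locally bounded in time.\<close>

definition lbc :: "(real \<Rightarrow> real \<Rightarrow> real) \<Rightarrow> bool" where
  "lbc h \<longleftrightarrow> continuous_on UNIV (\<lambda>(t, x). h t x) \<and> (\<forall>T. \<exists>B. \<forall>t x. \<bar>t\<bar> \<le> T \<longrightarrow> \<bar>h t x\<bar> \<le> B)"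

definition duh :: "(real \<Rightarrow> real \<Rightarrow> real) \<Rightarrow> real \<Rightarrow> real \<Rightarrow> real" where
  "duh h t x = t * integral {0..1} (\<lambda>\<rho>. 2 * \<rho> * (\<integral>z. h (t * (1 - \<rho>\<^sup>2)) (x + sqrt t * \<rho> * z) \<partial>std_gauss))"

definition duhx :: "(real \<Rightarrow> real \<Rightarrow> real) \<Rightarrow> real \<Rightarrow> real \<Rightarrow> real" where
  "duhx h t x = sqrt t * integral {0..1} (\<lambda>\<rho>. 2 * (\<integral>z. z * h (t * (1 - \<rho>\<^sup>2)) (x + sqrt t * \<rho> * z) \<partial>std_gauss))"

lemma lbc_cont: "lbc h \<Longrightarrow> continuous_on UNIV (\<lambda>p. h (fst p) (snd p))"
  unfolding lbc_def case_prod_beta by blast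

lemma lbc_cont_x: "lbc h \<Longrightarrow> continuous_on UNIV (h t)"
  using continuous_on_compose2[OF lbc_cont, of h UNIV "\<lambda>x. (t, x)"] by (simp add: continuous_intros)

lemma lbc_bound:
  assumes "lbc h" obtains B where "B \<ge> 0" "\<And>t x. \<bar>t\<bar> \<le> T \<Longrightarrow> \<bar>h t x\<bar> \<le> B"
proof -
  from assms obtain B where B: "\<And>t x. \<bar>t\<bar> \<le> T \<Longrightarrow> \<bar>h t x\<bar> \<le> B" unfolding lbc_def by blast
  show thesis
    by (rule that[of "max 0 B"]) (use B in \<open>auto simp: le_max_iff_disj\<close>)
qed

lemma continuous_on_lbc_gauss:
  fixes q r s :: "'a::euclidean_space \<Rightarrow> real"
  assumes h: "lbc h" and c: "continuous_on UNIV q" "continuous_on UNIV r" "continuous_on UNIV s"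
  shows "continuous_on UNIV (\<lambda>p. \<integral>z. h (q p) (r p + s p * z) \<partial>std_gauss)"
    and "continuous_on UNIV (\<lambda>p. \<integral>z. z * h (q p) (r p + s p * z) \<partial>std_gauss)"
proof -
  have c1: "continuous_on UNIV (\<lambda>x::'a \<times> real. h (q (fst x)) (r (fst x) + s (fst x) * snd x))"
    using continuous_on_compose2[OF lbc_cont[OF h], of UNIV "\<lambda>x::'a \<times> real. (q (fst x), r (fst x) + s (fst x) * snd x)"]
    by (simp add: continuous_intros continuous_on_compose2[OF c(1)] continuous_on_compose2[OF c(2)] continuous_on_compose2[OF c(3)])
  have b: "\<exists>B\<ge>0. \<forall>p z. norm p \<le> R \<longrightarrow> \<bar>h (q p) (r p + s p * z)\<bar> \<le> B" for R
  proof -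
    have "bounded (q ` cball 0 R)"
      by (intro compact_imp_bounded compact_continuous_image continuous_on_subset[OF c(1)]) auto
    then obtain T where "\<forall>x\<in>q ` cball 0 R. norm x \<le> T"
      unfolding bounded_iff by blast
    then have T: "\<bar>q p\<bar> \<le> T" if "norm p \<le> R" for p
      using that by simp
    obtain B where "B \<ge> 0" "\<And>t x. \<bar>t\<bar> \<le> T \<Longrightarrow> \<bar>h t x\<bar> \<le> B" by (rule lbc_bound[OF h, of T]) blast
    then show ?thesis using T by blast
  qed
  have b1: "a \<le> B \<Longrightarrow> B \<ge> 0 \<Longrightarrow> a \<le> B * (1 + \<bar>z\<bar>)" for a B z :: real
    using mult_nonneg_nonneg[of B "\<bar>z\<bar>"] unfolding distrib_left by linarith
  have b2: "\<bar>a\<bar> \<le> B \<Longrightarrow> B \<ge> 0 \<Longrightarrow> \<bar>z * a\<bar> \<le> B * (1 + \<bar>z\<bar>)" for a B z :: real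
    using mult_left_mono[of "\<bar>a\<bar>" B "\<bar>z\<bar>"] unfolding distrib_left abs_mult by (simp add: mult.commute)
  show "continuous_on UNIV (\<lambda>p. \<integral>z. h (q p) (r p + s p * z) \<partial>std_gauss)"
  proof (rule continuous_on_integral_std_gauss)
    show "continuous_on UNIV (\<lambda>(p, z). h (q p) (r p + s p * z))"
      using c1 by (simp add: case_prod_beta)
    show "\<exists>B. \<forall>p z. norm p \<le> R \<longrightarrow> \<bar>h (q p) (r p + s p * z)\<bar> \<le> B * (1 + \<bar>z\<bar>)" for R
      using b[of R] b1 by blast
  qed
  show "continuous_on UNIV (\<lambda>p. \<integral>z. z * h (q p) (r p + s p * z) \<partial>std_gauss)"
  proof (rule continuous_on_integral_std_gauss)
    show "continuous_on UNIV (\<lambda>(p, z). z * h (q p) (r p + s p * z))"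
      unfolding case_prod_beta by (intro continuous_on_mult c1 continuous_intros)
    show "\<exists>B. \<forall>p z. norm p \<le> R \<longrightarrow> \<bar>z * h (q p) (r p + s p * z)\<bar> \<le> B * (1 + \<bar>z\<bar>)" for R
      using b[of R] b2 by blast
  qed
qed

lemma abs_integral_01_le:
  fixes g :: "real \<Rightarrow> real"
  assumes "continuous_on {0..1} g" "\<And>t. t \<in> {0..1} \<Longrightarrow> \<bar>g t\<bar> \<le> B"
  shows "\<bar>integral {0..1} g\<bar> \<le> B"
  using integral_bound[OF _ assms(1), of B] assms(2) by simp

lemma duh_inner_continuous:
  assumes h: "lbc h"
  shows "continuous_on S (\<lambda>p::(real \<times> real) \<times> real. \<integral>z. h (fst (fst p) * (1 - (snd p)\<^sup>2)) (snd (fst p) + sqrt (fst (fst p)) * snd p * z) \<partial>std_gauss)"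
    "continuous_on S (\<lambda>p::(real \<times> real) \<times> real. \<integral>z. z * h (fst (fst p) * (1 - (snd p)\<^sup>2)) (snd (fst p) + sqrt (fst (fst p)) * snd p * z) \<partial>std_gauss)"
  by (rule continuous_on_subset[OF continuous_on_lbc_gauss(1)[OF h]] continuous_on_subset[OF continuous_on_lbc_gauss(2)[OF h]];
      intro continuous_intros subset_UNIV)+

lemma duh_inner_continuous_rho:
  assumes h: "lbc h"
  shows "continuous_on S (\<lambda>\<rho>. \<integral>z. h (t * (1 - \<rho>\<^sup>2)) (x + sqrt t * \<rho> * z) \<partial>std_gauss)"
    "continuous_on S (\<lambda>\<rho>. \<integral>z. z * h (t * (1 - \<rho>\<^sup>2)) (x + sqrt t * \<rho> * z) \<partial>std_gauss)"
  by (rule continuous_on_subset[OF continuous_on_lbc_gauss(1)[OF h]] continuous_on_subset[OF continuous_on_lbc_gauss(2)[OF h]];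
      intro continuous_intros subset_UNIV)+

lemma abs_time_le:
  assumes "\<bar>t\<bar> \<le> T" "\<rho> \<in> {0..1::real}"
  shows "\<bar>t * (1 - \<rho>\<^sup>2)\<bar> \<le> T"
proof -
  have "\<rho>\<^sup>2 \<le> 1" "0 \<le> \<rho>\<^sup>2" using assms(2) by (auto simp: abs_square_le_1)
  then have "\<bar>1 - \<rho>\<^sup>2\<bar> \<le> 1" by linarith
  then have "\<bar>t\<bar> * \<bar>1 - \<rho>\<^sup>2\<bar> \<le> \<bar>t\<bar>" by (intro mult_left_le) auto
  then show ?thesis using assms(1) by (simp add: abs_mult)
qed

lemma lbc_duh:
  assumes h: "lbc h"
  shows "lbc (duh h)"
  unfolding lbc_def
proof (intro conjI allI)
  have "continuous_on UNIV (\<lambda>p::real \<times> real. integral (cbox 0 1)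
     (\<lambda>\<rho>. 2 * \<rho> * (\<integral>z. h (fst p * (1 - \<rho>\<^sup>2)) (snd p + sqrt (fst p) * \<rho> * z) \<partial>std_gauss)))"
    by (rule integral_continuous_on_param) (unfold case_prod_beta, intro continuous_intros duh_inner_continuous[OF h])
  then show "continuous_on UNIV (\<lambda>(t, x). duh h t x)"
    unfolding duh_def case_prod_beta by (intro continuous_intros) simp
  fix T
  obtain B where B: "B \<ge> 0" "\<And>t x. \<bar>t\<bar> \<le> T \<Longrightarrow> \<bar>h t x\<bar> \<le> B" by (rule lbc_bound[OF h, of T]) blast
  have "\<bar>duh h t x\<bar> \<le> T * (2 * B)" if t: "\<bar>t\<bar> \<le> T" for t x
  proof -
    have "\<bar>integral {0..1} (\<lambda>\<rho>. 2 * \<rho> * (\<integral>z. h (t * (1 - \<rho>\<^sup>2)) (x + sqrt t * \<rho> * z) \<partial>std_gauss))\<bar> \<le> 2 * B"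
    proof (rule abs_integral_01_le)
      show "continuous_on {0..1} (\<lambda>\<rho>. 2 * \<rho> * (\<integral>z. h (t * (1 - \<rho>\<^sup>2)) (x + sqrt t * \<rho> * z) \<partial>std_gauss))"
        by (intro continuous_intros duh_inner_continuous_rho[OF h])
      fix \<rho> :: real assume \<rho>: "\<rho> \<in> {0..1}"
      have "\<bar>\<integral>z. h (t * (1 - \<rho>\<^sup>2)) (x + sqrt t * \<rho> * z) \<partial>std_gauss\<bar> \<le> B"
        by (intro abs_integral_std_gauss_le B abs_time_le[OF t \<rho>] continuous_on_compose2[OF lbc_cont_x[OF h]] continuous_intros) auto
      moreover have "\<bar>2 * \<rho>\<bar> \<le> 2" using \<rho> by auto
      ultimately show "\<bar>2 * \<rho> * (\<integral>z. h (t * (1 - \<rho>\<^sup>2)) (x + sqrt t * \<rho> * z) \<partial>std_gauss)\<bar> \<le> 2 * B"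
        unfolding abs_mult by (intro mult_mono) auto
    qed
    then show ?thesis unfolding duh_def abs_mult using t B(1) by (intro mult_mono) auto
  qed
  then show "\<exists>B. \<forall>t x. \<bar>t\<bar> \<le> T \<longrightarrow> \<bar>duh h t x\<bar> \<le> B" by blast
qed

lemma abs_duhx_le:
  assumes h: "lbc h" and t: "t \<ge> 0" and B: "\<And>s x. 0 \<le> s \<Longrightarrow> s \<le> t \<Longrightarrow> \<bar>h s x\<bar> \<le> B"
  shows "\<bar>duhx h t x\<bar> \<le> sqrt t * (2 * B)"
proof -
  have "\<bar>integral {0..1} (\<lambda>\<rho>. 2 * (\<integral>z. z * h (t * (1 - \<rho>\<^sup>2)) (x + sqrt t * \<rho> * z) \<partial>std_gauss))\<bar> \<le> 2 * B"
  proof (rule abs_integral_01_le)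
    show "continuous_on {0..1} (\<lambda>\<rho>. 2 * (\<integral>z. z * h (t * (1 - \<rho>\<^sup>2)) (x + sqrt t * \<rho> * z) \<partial>std_gauss))"
      by (intro continuous_intros duh_inner_continuous_rho[OF h])
    fix \<rho> :: real assume \<rho>: "\<rho> \<in> {0..1}"
    have "0 \<le> t * (1 - \<rho>\<^sup>2)" using t \<rho> by (auto simp: abs_square_le_1)
    moreover have "t * (1 - \<rho>\<^sup>2) \<le> t" using abs_time_le[of t t \<rho>] t \<rho> by auto
    ultimately have "\<bar>\<integral>z. z * h (t * (1 - \<rho>\<^sup>2)) (x + sqrt t * \<rho> * z) \<partial>std_gauss\<bar> \<le> B"
      by (intro abs_integral_std_gauss_mult_le B continuous_on_compose2[OF lbc_cont_x[OF h]] continuous_intros) auto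
    then show "\<bar>2 * (\<integral>z. z * h (t * (1 - \<rho>\<^sup>2)) (x + sqrt t * \<rho> * z) \<partial>std_gauss)\<bar> \<le> 2 * B"
      by simp
  qed
  then show ?thesis unfolding duhx_def abs_mult using t by (simp add: mult_left_mono)
qed

lemma continuous_on_duhx:
  assumes h: "lbc h"
  shows "continuous_on UNIV (\<lambda>(t, x). duhx h t x)"
proof -
  have "continuous_on UNIV (\<lambda>p::real \<times> real. integral (cbox 0 1)
     (\<lambda>\<rho>. 2 * (\<integral>z. z * h (fst p * (1 - \<rho>\<^sup>2)) (snd p + sqrt (fst p) * \<rho> * z) \<partial>std_gauss)))"
    by (rule integral_continuous_on_param) (unfold case_prod_beta, intro continuous_intros duh_inner_continuous[OF h])
  then show ?thesis
    unfolding duhx_def case_prod_beta by (intro continuous_intros) simp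
qed

text \<open>The gain of one space derivative from a merely continuous source: differentiating the
  inner average costs 1/(sqrt t \<rho>), and the Jacobian 2 \<rho> t pays for it. At \<rho> = 0 the
  weight vanishes on one side and the mean of \<open>z\<close> on the other.\<close>

lemma DERIV_duh_smoothing:
  assumes h: "lbc h" and t: "t \<ge> 0"
  shows "(duh h t has_real_derivative duhx h t x) (at x)"
proof (cases "t = 0")
  case True
  then show ?thesis by (simp add: duh_def[abs_def] duhx_def)
next
  case False
  then have t: "t > 0" using t by simp
  have "((\<lambda>x. integral (cbox 0 1) (\<lambda>\<rho>. 2 * \<rho> * (\<integral>z. h (t * (1 - \<rho>\<^sup>2)) (x + sqrt t * \<rho> * z) \<partial>std_gauss)))
     has_real_derivative integral (cbox 0 1) (\<lambda>\<rho>. 2 / sqrt t * (\<integral>z. z * h (t * (1 - \<rho>\<^sup>2)) (x + sqrt t * \<rho> * z) \<partial>std_gauss))) (at x)"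
  proof (rule leibniz_rule_field_derivative)
    fix x \<rho> :: real assume "\<rho> \<in> cbox 0 1"
    then have \<rho>: "\<rho> \<in> {0..1}" by simp
    show "((\<lambda>x. 2 * \<rho> * (\<integral>z. h (t * (1 - \<rho>\<^sup>2)) (x + sqrt t * \<rho> * z) \<partial>std_gauss)) has_real_derivative
        2 / sqrt t * (\<integral>z. z * h (t * (1 - \<rho>\<^sup>2)) (x + sqrt t * \<rho> * z) \<partial>std_gauss)) (at x)"
    proof (cases "\<rho> = 0")
      case True
      then show ?thesis by (simp add: integral_std_gauss_id)
    next
      case False
      then have \<rho>0: "\<rho> > 0" using \<rho> by simp
      obtain B where "B \<ge> 0" and B: "\<And>s x. \<bar>s\<bar> \<le> t \<Longrightarrow> \<bar>h s x\<bar> \<le> B" by (rule lbc_bound[OF h, of t]) blast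
      have "((\<lambda>x. \<integral>z. h (t * (1 - \<rho>\<^sup>2)) (x + (sqrt t * \<rho>) * z) \<partial>std_gauss) has_real_derivative
          (\<integral>z. z * h (t * (1 - \<rho>\<^sup>2)) (x + (sqrt t * \<rho>) * z) \<partial>std_gauss) / (sqrt t * \<rho>)) (at x)"
        by (rule DERIV_std_gauss_smoothing[OF lbc_cont_x[OF h] B]) (use \<rho>0 t abs_time_le[of t t \<rho>] \<rho> in auto)
      from DERIV_cmult[OF this, of "2 * \<rho>"] show ?thesis
        by (rule DERIV_cong) (use \<rho>0 t in \<open>simp add: field_simps\<close>)
    qed
  next
    show "(\<lambda>\<rho>. 2 * \<rho> * (\<integral>z. h (t * (1 - \<rho>\<^sup>2)) (x + sqrt t * \<rho> * z) \<partial>std_gauss)) integrable_on cbox 0 1" for x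
      by (rule integrable_continuous) (intro continuous_intros duh_inner_continuous_rho[OF h])
    show "continuous_on (UNIV \<times> cbox 0 1) (\<lambda>(x, \<rho>). 2 / sqrt t * (\<integral>z. z * h (t * (1 - \<rho>\<^sup>2)) (x + sqrt t * \<rho> * z) \<partial>std_gauss))"
      unfolding case_prod_beta
      by (rule continuous_on_subset[OF _ subset_UNIV]) (intro continuous_intros continuous_on_lbc_gauss[OF h])
  qed auto
  from DERIV_cmult[OF this, of t] show ?thesis unfolding duh_def[abs_def] duhx_def cbox_interval
  proof (rule DERIV_cong)
    have "t = sqrt t * sqrt t" using t by simp
    then have "t * (2 / sqrt t * c) = sqrt t * (2 * c)" for c
      using t by (metis (no_types, opaque_lifting) mult.assoc mult.left_commute nonzero_mult_div_cancel_left
          real_sqrt_gt_zero less_irrefl times_divide_eq_left times_divide_eq_right)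
    then show "t * integral {0..1} (\<lambda>\<rho>. 2 / sqrt t * (\<integral>z. z * h (t * (1 - \<rho>\<^sup>2)) (x + sqrt t * \<rho> * z) \<partial>std_gauss))
      = sqrt t * integral {0..1} (\<lambda>\<rho>. 2 * (\<integral>z. z * h (t * (1 - \<rho>\<^sup>2)) (x + sqrt t * \<rho> * z) \<partial>std_gauss))"
      by simp
  qed
qed

lemma DERIV_duh_shift:
  assumes h: "lbc h" and h': "lbc h'" and d: "\<And>t x. t \<ge> 0 \<Longrightarrow> (h t has_real_derivative h' t x) (at x)" and t: "t \<ge> 0"
  shows "(duh h t has_real_derivative duh h' t x) (at x)"
proof -
  have "((\<lambda>x. integral (cbox 0 1) (\<lambda>\<rho>. 2 * \<rho> * (\<integral>z. h (t * (1 - \<rho>\<^sup>2)) (x + sqrt t * \<rho> * z) \<partial>std_gauss)))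
     has_real_derivative integral (cbox 0 1) (\<lambda>\<rho>. 2 * \<rho> * (\<integral>z. h' (t * (1 - \<rho>\<^sup>2)) (x + sqrt t * \<rho> * z) \<partial>std_gauss))) (at x)"
  proof (rule leibniz_rule_field_derivative)
    fix x \<rho> :: real assume "\<rho> \<in> cbox 0 1"
    then have \<rho>: "\<rho> \<in> {0..1}" by simp
    obtain B where "B \<ge> 0" and B: "\<And>s x. \<bar>s\<bar> \<le> t \<Longrightarrow> \<bar>h s x\<bar> \<le> B" by (rule lbc_bound[OF h, of t]) blast
    obtain B' where "B' \<ge> 0" and B': "\<And>s x. \<bar>s\<bar> \<le> t \<Longrightarrow> \<bar>h' s x\<bar> \<le> B'" by (rule lbc_bound[OF h', of t]) blast
    have s: "\<bar>t * (1 - \<rho>\<^sup>2)\<bar> \<le> t" by (rule abs_time_le[OF _ \<rho>]) (use t in simp)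
    have s0: "t * (1 - \<rho>\<^sup>2) \<ge> 0" using t \<rho> by (auto simp: abs_square_le_1)
    show "((\<lambda>x. 2 * \<rho> * (\<integral>z. h (t * (1 - \<rho>\<^sup>2)) (x + sqrt t * \<rho> * z) \<partial>std_gauss)) has_real_derivative
        2 * \<rho> * (\<integral>z. h' (t * (1 - \<rho>\<^sup>2)) (x + sqrt t * \<rho> * z) \<partial>std_gauss)) (at x)"
      by (rule DERIV_cmult, rule DERIV_std_gauss_shift[OF d[OF s0] lbc_cont_x[OF h'] B[OF s] B'[OF s]])
  next
    show "(\<lambda>\<rho>. 2 * \<rho> * (\<integral>z. h (t * (1 - \<rho>\<^sup>2)) (x + sqrt t * \<rho> * z) \<partial>std_gauss)) integrable_on cbox 0 1" for x
      by (rule integrable_continuous) (intro continuous_intros duh_inner_continuous_rho[OF h])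
    show "continuous_on (UNIV \<times> cbox 0 1) (\<lambda>(x, \<rho>). 2 * \<rho> * (\<integral>z. h' (t * (1 - \<rho>\<^sup>2)) (x + sqrt t * \<rho> * z) \<partial>std_gauss))"
      unfolding case_prod_beta
      by (rule continuous_on_subset[OF _ subset_UNIV]) (intro continuous_intros continuous_on_lbc_gauss[OF h'])
  qed auto
  from DERIV_cmult[OF this, of t] show ?thesis unfolding duh_def[abs_def] cbox_interval .
qed

lemma duh_eq_time_integral:
  assumes h: "lbc h" and t: "t \<ge> 0"
  shows "duh h t x = integral {0..t} (\<lambda>s. \<integral>z. h s (x + sqrt (t - s) * z) \<partial>std_gauss)"
proof (cases "t = 0")
  case True
  then show ?thesis by (simp add: duh_def)
next
  case False
  then have t: "t > 0" using t by simp
  define f where "f = (\<lambda>s. \<integral>z. h s (x + sqrt (t - s) * z) \<partial>std_gauss)"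
  have f: "continuous_on S f" for S
    unfolding f_def
    by (rule continuous_on_subset[OF continuous_on_lbc_gauss(1)[OF h] subset_UNIV]) (intro continuous_intros)+
  have sub: "(\<lambda>\<rho>. t * (1 - \<rho>\<^sup>2)) ` {0..1} \<subseteq> {0..t}"
  proof safe
    fix \<rho> :: real assume "\<rho> \<in> {0..1}"
    then have "0 \<le> \<rho>\<^sup>2" "\<rho>\<^sup>2 \<le> 1" by (auto simp: abs_square_le_1)
    then show "t * (1 - \<rho>\<^sup>2) \<in> {0..t}" using t by (auto simp: mult_left_le)
  qed
  \<comment> \<open>The substitution is decreasing, so the rule yields a difference of two
    integrals; the first one runs over a reversed interval and is 0.\<close>
  have "((\<lambda>\<rho>. (- 2 * t * \<rho>) *\<^sub>R f (t * (1 - \<rho>\<^sup>2))) has_integral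
     (integral {t * (1 - 0\<^sup>2)..t * (1 - 1\<^sup>2)} f - integral {t * (1 - 1\<^sup>2)..t * (1 - 0\<^sup>2)} f)) {0..1}"
    by (rule has_integral_substitution_general[of "{}" 0 1 "\<lambda>\<rho>. t * (1 - \<rho>\<^sup>2)" 0 t f "\<lambda>\<rho>. - 2 * t * \<rho>"])
      (use f sub in \<open>auto intro!: continuous_intros derivative_eq_intros\<close>)
  then have "((\<lambda>\<rho>. (- 2 * t * \<rho>) *\<^sub>R f (t * (1 - \<rho>\<^sup>2))) has_integral (- integral {0..t} f)) {0..1}"
    using t by simp
  from has_integral_neg[OF this]
  have "((\<lambda>\<rho>. t * (2 * \<rho> * f (t * (1 - \<rho>\<^sup>2)))) has_integral integral {0..t} f) {0..1}"
    by (simp add: mult_ac)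
  then have 1: "integral {0..t} f = integral {0..1} (\<lambda>\<rho>. t * (2 * \<rho> * f (t * (1 - \<rho>\<^sup>2))))"
    by (rule integral_unique[symmetric])
  also have "\<dots> = integral {0..1} (\<lambda>\<rho>. t * (2 * \<rho> * (\<integral>z. h (t * (1 - \<rho>\<^sup>2)) (x + sqrt t * \<rho> * z) \<partial>std_gauss)))"
  proof (rule integral_cong)
    fix \<rho> :: real assume \<rho>: "\<rho> \<in> {0..1}"
    have "t - t * (1 - \<rho>\<^sup>2) = t * \<rho>\<^sup>2" by (simp add: algebra_simps)
    then have "sqrt (t - t * (1 - \<rho>\<^sup>2)) = sqrt t * \<rho>" using \<rho> by (simp add: real_sqrt_mult)
    then show "t * (2 * \<rho> * f (t * (1 - \<rho>\<^sup>2))) = t * (2 * \<rho> * (\<integral>z. h (t * (1 - \<rho>\<^sup>2)) (x + sqrt t * \<rho> * z) \<partial>std_gauss))"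
      unfolding f_def by (simp only:)
  qed
  also have "\<dots> = duh h t x" unfolding duh_def by (rule integral_mult_right)
  finally show ?thesis unfolding f_def by (rule sym)
qed

text \<open>Fubini for the Lebesgue integral on the closed triangle, where continuity on a compact
  set gives integrability; the gauge integrals are translated there and back.\<close>

lemma integral_triangle_swap:
  fixes k :: "real \<Rightarrow> real \<Rightarrow> real"
  assumes k: "continuous_on UNIV (\<lambda>p. k (fst p) (snd p))" and t: "t \<ge> 0"
  shows "integral {0..t} (\<lambda>s. integral {s..t} (k s)) = integral {0..t} (\<lambda>r. integral {0..r} (\<lambda>s. k s r))"
proof -
  define S where "S = {p. 0 \<le> fst p \<and> fst p \<le> snd p \<and> snd p \<le> (t::real)}"
  have "S = ({0..t} \<times> {0..t}) \<inter> {p. fst p \<le> snd p}" by (auto simp: S_def)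
  then have S: "compact S"
    by (simp add: compact_Times compact_Int_closed closed_Collect_le continuous_on_fst continuous_on_snd continuous_on_id)
  define F where "F = (\<lambda>p. indicator S p * k (fst p) (snd p))"
  have "integrable lborel (\<lambda>p. indicator S p *\<^sub>R k (fst p) (snd p))"
    by (rule borel_integrable_compact[OF S continuous_on_subset[OF k subset_UNIV]])
  then have F: "integrable (lborel \<Otimes>\<^sub>M lborel) (\<lambda>(x, y). F (x, y))"
    unfolding F_def by (simp add: lborel_prod case_prod_beta')
  have Iint: "(\<integral>r. indicator {a..b} r * g r \<partial>lborel) = integral {a..b} g" if "continuous_on UNIV g" for a b and g :: "real \<Rightarrow> real"
  proof -
    have "set_integrable lborel {a..b} g"
      unfolding set_integrable_def by (rule borel_integrable_compact[OF _ continuous_on_subset[OF that subset_UNIV]]) auto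
    from set_borel_integral_eq_integral(2)[OF this] show ?thesis by (simp add: set_lebesgue_integral_def)
  qed
  have kc: "continuous_on UNIV (k s)" "continuous_on UNIV (\<lambda>s. k s r)" for s r
    using continuous_on_compose2[OF k, of UNIV "\<lambda>r. (s, r)"] continuous_on_compose2[OF k, of UNIV "\<lambda>s. (s, r)"]
    by (simp_all add: continuous_intros)
  have F1: "(\<integral>r. F (s, r) \<partial>lborel) = indicator {0..t} s * integral {s..t} (k s)" for s
  proof -
    have "(\<integral>r. F (s, r) \<partial>lborel) = (\<integral>r. indicator {0..t} s * (indicator {s..t} r * k s r) \<partial>lborel)"
      by (rule Bochner_Integration.integral_cong) (auto simp: F_def S_def indicator_def)
    then show ?thesis using Iint[OF kc(1)] by simp
  qed
  have F2: "(\<integral>s. F (s, r) \<partial>lborel) = indicator {0..t} r * integral {0..r} (\<lambda>s. k s r)" for r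
  proof -
    have "(\<integral>s. F (s, r) \<partial>lborel) = (\<integral>s. indicator {0..t} r * (indicator {0..r} s * k s r) \<partial>lborel)"
      by (rule Bochner_Integration.integral_cong) (auto simp: F_def S_def indicator_def)
    then show ?thesis using Iint[OF kc(2)] by simp
  qed
  have i1: "set_integrable lborel {0..t} (\<lambda>s. integral {s..t} (k s))"
    using lborel_pair.integrable_fst[OF F] unfolding F1 set_integrable_def by simp
  have i2: "set_integrable lborel {0..t} (\<lambda>r. integral {0..r} (\<lambda>s. k s r))"
    using lborel_pair.integrable_snd[OF F] unfolding F2 set_integrable_def by simp
  have "(\<integral>r. (\<integral>s. F (s, r) \<partial>lborel) \<partial>lborel) = (\<integral>s. (\<integral>r. F (s, r) \<partial>lborel) \<partial>lborel)"
    using lborel_pair.Fubini_integral[OF F] by simp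
  then show ?thesis
    using set_borel_integral_eq_integral(2)[OF i1] set_borel_integral_eq_integral(2)[OF i2]
    unfolding F1 F2 set_lebesgue_integral_def by simp
qed

text \<open>The kernel is never differentiated in time. Writing the semigroup as identity plus half
  the time integral of its action on the second derivative, and exchanging the two time integrals
  over the triangle, gives \<open>duh h T x\<close> as the integral of
  \<open>h r x + duh h2 r x / 2\<close> over 0 \<le> r \<le> T. The fundamental theorem of calculus
  does the rest.\<close>

lemma DERIV_duh_time:
  assumes h: "lbc h" and h2: "lbc h2" and C2: "\<And>s. s \<ge> 0 \<Longrightarrow> \<exists>h1. C2b (h s) h1 (h2 s)" and t: "t > 0"
  shows "((\<lambda>t. duh h t x) has_real_derivative h t x + duh h2 t x / 2) (at t)"
proof -
  define k2 where "k2 = (\<lambda>s r. \<integral>z. h2 s (x + sqrt (r - s) * z) \<partial>std_gauss)"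
  have k2: "continuous_on UNIV (\<lambda>p. k2 (fst p) (snd p))"
    unfolding k2_def by (rule continuous_on_lbc_gauss(1)[OF h2]) (intro continuous_intros)+
  have k2c: "continuous_on S (k2 s)" for s S
    using continuous_on_compose2[OF k2, of S "\<lambda>r. (s, r)"] by (simp add: continuous_intros)
  have hc: "continuous_on S (\<lambda>s. h s x)" for S
    using continuous_on_compose2[OF lbc_cont[OF h], of S "\<lambda>s. (s, x)"] by (simp add: continuous_intros)
  have dc: "continuous_on S (\<lambda>s. duh h2 s x)" for S
    using continuous_on_compose2[OF lbc_cont[OF lbc_duh[OF h2]], of S "\<lambda>s. (s, x)"] by (simp add: continuous_intros)
  have in1: "(\<integral>z. h s (x + sqrt (T - s) * z) \<partial>std_gauss) = h s x + integral {s..T} (k2 s) / 2" if s: "s \<in> {0..T}" for s T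
  proof -
    from C2 s obtain h1 where c: "C2b (h s) h1 (h2 s)" by auto
    have "(\<integral>z. h s (x + sqrt (T - s) * z) \<partial>std_gauss) = h s x + integral {0..T - s} (\<lambda>r. heat (h2 s) r x / 2)"
      using heat_eq_integral[OF c, of "T - s" x] s unfolding heat_def by simp
    also have "integral {0..T - s} (\<lambda>r. heat (h2 s) r x / 2) = integral {0..T - s} ((\<lambda>r. k2 s r / 2) \<circ> (\<lambda>r. r + s))"
      by (rule integral_cong) (simp add: k2_def heat_def)
    also have "\<dots> = integral {0 + s..T - s + s} (\<lambda>r. k2 s r / 2)"
      by (rule integral_shift) (intro continuous_intros k2c, simp)
    finally show ?thesis by simp
  qed
  have rep: "duh h T x = integral {0..T} (\<lambda>r. h r x + duh h2 r x / 2)" if T: "T \<ge> 0" for T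
  proof -
    have duh2: "duh h2 r x = integral {0..r} (\<lambda>s. k2 s r)" if "r \<ge> 0" for r
      unfolding k2_def by (rule duh_eq_time_integral[OF h2 that])
    have mi: "(\<lambda>s. integral {s..T} (k2 s)) integrable_on {0..T}"
    proof -
      have e: "integral {s..T} (k2 s) = 2 * ((\<integral>z. h s (x + sqrt (T - s) * z) \<partial>std_gauss) - h s x)" if "s \<in> {0..T}" for s
        using in1[OF that] by simp
      have "continuous_on {0..T} (\<lambda>s. 2 * ((\<integral>z. h s (x + sqrt (T - s) * z) \<partial>std_gauss) - h s x))"
        by (intro continuous_intros hc continuous_on_subset[OF continuous_on_lbc_gauss(1)[OF h] subset_UNIV])
      then show ?thesis using integrable_continuous_interval e integrable_cong by (metis (no_types, lifting))
    qed
    have "duh h T x = integral {0..T} (\<lambda>s. h s x + integral {s..T} (k2 s) / 2)"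
      unfolding duh_eq_time_integral[OF h T] by (rule integral_cong) (rule in1)
    also have "\<dots> = integral {0..T} (\<lambda>s. h s x) + integral {0..T} (\<lambda>s. integral {s..T} (k2 s)) / 2"
      using mi by (subst Henstock_Kurzweil_Integration.integral_add) (auto intro!: integrable_continuous_interval hc)
    also have "integral {0..T} (\<lambda>s. integral {s..T} (k2 s)) = integral {0..T} (\<lambda>r. duh h2 r x)"
      unfolding integral_triangle_swap[OF k2 T] by (rule integral_cong) (simp add: duh2)
    also have "integral {0..T} (\<lambda>s. h s x) + integral {0..T} (\<lambda>r. duh h2 r x) / 2 = integral {0..T} (\<lambda>r. h r x + duh h2 r x / 2)"
      by (subst Henstock_Kurzweil_Integration.integral_add) (auto intro!: integrable_continuous_interval hc dc)
    finally show ?thesis .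
  qed
  have "((\<lambda>T. integral {0..T} (\<lambda>r. h r x + duh h2 r x / 2)) has_real_derivative h t x + duh h2 t x / 2) (at t within {0..t + 1})"
    by (rule integral_has_real_derivative) (use t in \<open>auto intro!: continuous_intros hc dc\<close>)
  then have "((\<lambda>T. integral {0..T} (\<lambda>r. h r x + duh h2 r x / 2)) has_real_derivative h t x + duh h2 t x / 2) (at t)"
    using t by (simp add: at_within_Icc_at)
  moreover have "eventually (\<lambda>T. integral {0..T} (\<lambda>r. h r x + duh h2 r x / 2) = duh h T x) (nhds t)"
    using eventually_nhds_in_open[of "{0<..}" t] t by (auto elim!: eventually_mono simp: rep)
  ultimately show ?thesis by (subst DERIV_cong_ev[OF refl _ refl, symmetric])
qed

section \<open>Closure properties of \<open>lbc\<close> and order bounds for the heat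
  semigroup\<close>

lemma lbcI:
  assumes "continuous_on UNIV (\<lambda>p. h (fst p) (snd p))" "\<And>T. \<exists>B. \<forall>t x. \<bar>t\<bar> \<le> T \<longrightarrow> \<bar>h t x\<bar> \<le> B"
  shows "lbc h"
  using assms unfolding lbc_def case_prod_beta by blast

lemma lbc_time: "continuous_on UNIV g \<Longrightarrow> lbc (\<lambda>t x. g t)"
proof (rule lbcI)
  assume g: "continuous_on UNIV g"
  show "continuous_on UNIV (\<lambda>p::real \<times> real. g (fst p))"
    by (rule continuous_on_compose2[OF g]) (auto intro: continuous_intros)
  fix T :: real
  have "compact (g ` {- T..T})" by (intro compact_continuous_image continuous_on_subset[OF g]) auto
  then obtain B where "\<forall>y\<in>g ` {- T..T}. norm y \<le> B" using compact_imp_bounded bounded_iff by metis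
  then show "\<exists>B. \<forall>t (x::real). \<bar>t\<bar> \<le> T \<longrightarrow> \<bar>g t\<bar> \<le> B" by (intro exI[of _ B]) (auto simp: abs_le_iff)
qed

lemma lbc_add: assumes "lbc g" "lbc h" shows "lbc (\<lambda>t x. g t x + h t x)"
proof (rule lbcI)
  show "continuous_on UNIV (\<lambda>p. g (fst p) (snd p) + h (fst p) (snd p))"
    by (intro continuous_on_add lbc_cont assms)
  fix T
  obtain B where "\<And>t x. \<bar>t\<bar> \<le> T \<Longrightarrow> \<bar>g t x\<bar> \<le> B" by (rule lbc_bound[OF assms(1), of T]) blast
  moreover obtain B' where "\<And>t x. \<bar>t\<bar> \<le> T \<Longrightarrow> \<bar>h t x\<bar> \<le> B'" by (rule lbc_bound[OF assms(2), of T]) blast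
  ultimately have "\<bar>g t x + h t x\<bar> \<le> B + B'" if "\<bar>t\<bar> \<le> T" for t x
    using that by (intro order.trans[OF abs_triangle_ineq] add_mono)
  then show "\<exists>B. \<forall>t x. \<bar>t\<bar> \<le> T \<longrightarrow> \<bar>g t x + h t x\<bar> \<le> B" by blast
qed

lemma lbc_mult: assumes "lbc g" "lbc h" shows "lbc (\<lambda>t x. g t x * h t x)"
proof (rule lbcI)
  show "continuous_on UNIV (\<lambda>p. g (fst p) (snd p) * h (fst p) (snd p))"
    by (intro continuous_on_mult lbc_cont assms)
  fix T
  obtain B where "B \<ge> 0" "\<And>t x. \<bar>t\<bar> \<le> T \<Longrightarrow> \<bar>g t x\<bar> \<le> B" by (rule lbc_bound[OF assms(1), of T]) blast
  moreover obtain B' where "\<And>t x. \<bar>t\<bar> \<le> T \<Longrightarrow> \<bar>h t x\<bar> \<le> B'" by (rule lbc_bound[OF assms(2), of T]) blast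
  ultimately have "\<bar>g t x * h t x\<bar> \<le> B * B'" if "\<bar>t\<bar> \<le> T" for t x
    using that unfolding abs_mult by (intro mult_mono) auto
  then show "\<exists>B. \<forall>t x. \<bar>t\<bar> \<le> T \<longrightarrow> \<bar>g t x * h t x\<bar> \<le> B" by blast
qed

lemma lbc_nonneg_times: assumes "lbc h" shows "lbc (\<lambda>t x. h (max 0 t) x)"
proof (rule lbcI)
  show "continuous_on UNIV (\<lambda>p. h (max 0 (fst p)) (snd p))"
    using continuous_on_compose2[OF lbc_cont[OF assms], of UNIV "\<lambda>p. (max 0 (fst p), snd p)"]
    by (simp add: continuous_intros)
  fix T
  obtain B where B: "\<And>t x. \<bar>t\<bar> \<le> T \<Longrightarrow> \<bar>h t x\<bar> \<le> B" by (rule lbc_bound[OF assms, of T]) blast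
  have "\<bar>h (max 0 t) x\<bar> \<le> B" if "\<bar>t\<bar> \<le> T" for t x
    by (rule B) (use that in auto)
  then show "\<exists>B. \<forall>t x. \<bar>t\<bar> \<le> T \<longrightarrow> \<bar>h (max 0 t) x\<bar> \<le> B" by blast
qed

lemma heat_bounds:
  assumes "continuous_on UNIV f" "\<And>y. l \<le> f y" "\<And>y. f y \<le> u"
  shows "l \<le> heat f t x" "heat f t x \<le> u"
proof -
  interpret prob_space std_gauss by (rule prob_space_std_gauss)
  have i: "integrable std_gauss (\<lambda>z. f (x + sqrt t * z))"
  proof (rule integrable_std_gauss_bounded)
    show "\<bar>f (x + sqrt t * z)\<bar> \<le> \<bar>l\<bar> + \<bar>u\<bar>" for z
      using assms(2,3)[of "x + sqrt t * z"] by linarith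
  qed (auto intro!: continuous_on_compose2[OF assms(1)] continuous_intros)
  show "l \<le> heat f t x" unfolding heat_def
    by (rule integral_ge_const[OF i]) (rule AE_I2, rule assms)
  show "heat f t x \<le> u" unfolding heat_def
    by (rule integral_le_const[OF i]) (rule AE_I2, rule assms)
qed

lemma lbc_heat: assumes "continuous_on UNIV f" "\<And>y. \<bar>f y\<bar> \<le> B" shows "lbc (heat f)"
proof (rule lbcI)
  show "continuous_on UNIV (\<lambda>p. heat f (fst p) (snd p))"
    using continuous_on_heat[OF assms] by (simp add: case_prod_beta)
  have "\<bar>heat f t x\<bar> \<le> B" for t x
    using heat_bounds[OF assms(1), of "- B" B t x] assms(2) by (auto simp: abs_le_iff minus_le_iff)
  then show "\<exists>B. \<forall>t x. \<bar>t\<bar> \<le> T \<longrightarrow> \<bar>heat f t x\<bar> \<le> B" for T by blast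
qed

lemma lbc_duhx: assumes h: "lbc h" shows "lbc (\<lambda>t x. duhx h (max 0 t) x)"
proof (rule lbcI)
  show "continuous_on UNIV (\<lambda>p. duhx h (max 0 (fst p)) (snd p))"
    using continuous_on_compose2[OF continuous_on_duhx[OF h, unfolded case_prod_beta], of UNIV "\<lambda>p. (max 0 (fst p), snd p)"]
    by (simp add: continuous_intros)
  fix T
  obtain B where B0: "B \<ge> 0" and B: "\<And>t x. \<bar>t\<bar> \<le> \<bar>T\<bar> \<Longrightarrow> \<bar>h t x\<bar> \<le> B" by (rule lbc_bound[OF h, of "\<bar>T\<bar>"]) blast
  have "\<bar>duhx h (max 0 t) x\<bar> \<le> sqrt \<bar>T\<bar> * (2 * B)" if "\<bar>t\<bar> \<le> T" for t x
  proof -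
    have "\<bar>duhx h (max 0 t) x\<bar> \<le> sqrt (max 0 t) * (2 * B)"
      by (rule abs_duhx_le[OF h]) (use that in \<open>auto intro!: B\<close>)
    also have "\<dots> \<le> sqrt \<bar>T\<bar> * (2 * B)"
      by (intro mult_right_mono real_sqrt_le_mono) (use that B0 in auto)
    finally show ?thesis .
  qed
  then show "\<exists>B. \<forall>t x. \<bar>t\<bar> \<le> T \<longrightarrow> \<bar>duhx h (max 0 t) x\<bar> \<le> B" by blast
qed

lemma duh_diff_le:
  assumes h: "lbc h" and h': "lbc h'" and g: "continuous_on {0..t} g" and t: "t \<ge> 0"
    and le: "\<And>s y. s \<in> {0..t} \<Longrightarrow> h s y - h' s y \<le> g s"
  shows "duh h t x - duh h' t x \<le> integral {0..t} g"
proof -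
  interpret prob_space std_gauss by (rule prob_space_std_gauss)
  have c: "(\<lambda>s. \<integral>z. h s (x + sqrt (t - s) * z) \<partial>std_gauss) integrable_on {0..t}" if "lbc h" for h
    by (intro integrable_continuous_interval continuous_on_subset[OF continuous_on_lbc_gauss(1)[OF that] subset_UNIV]
        continuous_intros)
  have i: "integrable std_gauss (\<lambda>z. h s (x + sqrt (t - s) * z))" if hl: "lbc h" for h s
  proof -
    obtain B where B: "\<And>r x. \<bar>r\<bar> \<le> \<bar>s\<bar> \<Longrightarrow> \<bar>h r x\<bar> \<le> B" by (rule lbc_bound[OF hl, of "\<bar>s\<bar>"]) blast
    show ?thesis
      by (rule integrable_std_gauss_bounded[where B = B])
        (auto intro!: continuous_on_compose2[OF lbc_cont_x[OF hl]] continuous_intros B)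
  qed
  have "duh h t x - duh h' t x = integral {0..t} (\<lambda>s. (\<integral>z. h s (x + sqrt (t - s) * z) \<partial>std_gauss) - (\<integral>z. h' s (x + sqrt (t - s) * z) \<partial>std_gauss))"
    unfolding duh_eq_time_integral[OF h t] duh_eq_time_integral[OF h' t]
    by (rule Henstock_Kurzweil_Integration.integral_diff[OF c[OF h] c[OF h'], symmetric])
  also have "\<dots> \<le> integral {0..t} g"
  proof (rule integral_le)
    show "(\<lambda>s. (\<integral>z. h s (x + sqrt (t - s) * z) \<partial>std_gauss) - (\<integral>z. h' s (x + sqrt (t - s) * z) \<partial>std_gauss)) integrable_on {0..t}"
      by (rule integrable_diff[OF c[OF h] c[OF h']])
    show "g integrable_on {0..t}" by (rule integrable_continuous_interval[OF g])
    fix s assume s: "s \<in> {0..t}"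
    have "(\<integral>z. h s (x + sqrt (t - s) * z) \<partial>std_gauss) - (\<integral>z. h' s (x + sqrt (t - s) * z) \<partial>std_gauss)
       = (\<integral>z. h s (x + sqrt (t - s) * z) - h' s (x + sqrt (t - s) * z) \<partial>std_gauss)"
      by (rule Bochner_Integration.integral_diff[OF i[OF h] i[OF h'], symmetric])
    also have "\<dots> \<le> g s"
      by (rule integral_le_const) (intro Bochner_Integration.integrable_diff i h h', rule AE_I2, rule le[OF s])
    finally show "(\<integral>z. h s (x + sqrt (t - s) * z) \<partial>std_gauss) - (\<integral>z. h' s (x + sqrt (t - s) * z) \<partial>std_gauss) \<le> g s" .
  qed
  finally show ?thesis .
qed

lemma lbc_0: "lbc (\<lambda>t x. 0)"
  by (rule lbc_time) simp

lemma duh_0 [simp]: "duh (\<lambda>t x. 0) t x = 0"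
  by (simp add: duh_def)

lemma duh_bounds:
  assumes h: "lbc h" and g: "continuous_on {0..t} g" and t: "t \<ge> 0"
    and le: "\<And>s y. s \<in> {0..t} \<Longrightarrow> 0 \<le> h s y \<and> h s y \<le> g s"
  shows "0 \<le> duh h t x" "duh h t x \<le> integral {0..t} g"
  using duh_diff_le[OF lbc_0 h, of t "\<lambda>_. 0" x] duh_diff_le[OF h lbc_0 g t, of x] le t by auto

lemma abs_duh_diff_le:
  assumes h: "lbc h" and h': "lbc h'" and g: "continuous_on {0..t} g" and t: "t \<ge> 0"
    and le: "\<And>s y. s \<in> {0..t} \<Longrightarrow> \<bar>h s y - h' s y\<bar> \<le> g s"
  shows "\<bar>duh h t x - duh h' t x\<bar> \<le> integral {0..t} g"
proof -
  have "h s y - h' s y \<le> g s" "h' s y - h s y \<le> g s" if "s \<in> {0..t}" for s y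
    using le[OF that, of y] by linarith+
  from duh_diff_le[OF h h' g t this(1)] duh_diff_le[OF h' h g t this(2)] show ?thesis
    unfolding abs_le_iff by (metis minus_diff_eq)
qed

lemma integral_exp:
  fixes t b c :: real
  assumes "t \<ge> 0" "b > 0"
  shows "integral {0..t} (\<lambda>s. c * exp (b * s)) = c / b * (exp (b * t) - 1)"
proof -
  have "((\<lambda>s. c * exp (b * s)) has_integral (c / b * exp (b * t) - c / b * exp (b * 0))) {0..t}"
  proof (rule fundamental_theorem_of_calculus[OF assms(1)])
    fix s
    have "((\<lambda>s. c / b * exp (b * s)) has_real_derivative c * exp (b * s)) (at s within {0..t})"
      using assms(2) by (auto intro!: derivative_eq_intros)
    then show "((\<lambda>s. c / b * exp (b * s)) has_vector_derivative c * exp (b * s)) (at s within {0..t})"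
      by (simp add: has_real_derivative_iff_has_vector_derivative)
  qed
  from integral_unique[OF this] show ?thesis by (simp add: algebra_simps)
qed

text \<open>\<open>U = exp (a t) u\<close> turns \<open>\<partial>\<^sub>t u = u'' / 2 - u\<^sup>2 / 2\<close> into \<open>\<partial>\<^sub>t U = U'' / 2 + nl a U\<close>, where \<open>nl a\<close>
  is monotone and Lipschitz in the relevant range, so Picard iterates stay nonnegative.\<close>

definition nl :: "real \<Rightarrow> (real \<Rightarrow> real \<Rightarrow> real) \<Rightarrow> real \<Rightarrow> real \<Rightarrow> real" where
  "nl a U s x = a * U s x - exp (- a * max 0 s) * (U s x)\<^sup>2 / 2"

primrec picard :: "real \<Rightarrow> (real \<Rightarrow> real) \<Rightarrow> nat \<Rightarrow> real \<Rightarrow> real \<Rightarrow> real" where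
  "picard a f 0 = (\<lambda>t x. heat f (max 0 t) x)"
| "picard a f (Suc k) = (\<lambda>t x. heat f (max 0 t) x + duh (nl a (picard a f k)) (max 0 t) x)"

lemma lbc_nl: assumes "lbc U" shows "lbc (nl a U)"
proof -
  have "lbc (\<lambda>t x. a * U t x + (- exp (- a * max 0 t) / 2) * (U t x * U t x))"
    by (intro lbc_add lbc_mult assms lbc_time continuous_intros) auto
  moreover have "nl a U = (\<lambda>t x. a * U t x + (- exp (- a * max 0 t) / 2) * (U t x * U t x))"
    by (auto simp: nl_def fun_eq_iff power2_eq_square)
  ultimately show ?thesis by simp
qed

text \<open>In terms of u = exp(- a s) U, which lies in [0, a], the source is exp(a s) (a u -
  u^2/2). This parabola is nonnegative on [0, a] and maximal at u = a.\<close>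

lemma nl_bounds:
  assumes "a > 0" "0 \<le> s" "0 \<le> U s x" "U s x \<le> a * exp (a * s)"
  shows "0 \<le> nl a U s x" "nl a U s x \<le> a\<^sup>2 / 2 * exp (a * s)"
proof -
  define u where "u = exp (- a * s) * U s x"
  have U: "U s x = exp (a * s) * u" by (simp add: u_def exp_minus field_simps)
  have u: "0 \<le> u" "u \<le> a" using assms(3,4) unfolding U
    by (simp_all add: zero_le_mult_iff mult.commute[of a])
  have e2: "exp (- a * max 0 s) * (U s x)\<^sup>2 = exp (a * s) * u\<^sup>2"
  proof -
    have "max 0 s = s" using assms(2) by simp
    moreover have "exp (- a * s) * exp (a * s) = 1" by (simp add: exp_minus)
    moreover have "exp (- a * s) * (exp (a * s) * u)\<^sup>2 = (exp (- a * s) * exp (a * s)) * (exp (a * s) * u\<^sup>2)"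
      by (simp only: power2_eq_square mult_ac)
    ultimately show ?thesis unfolding U by (simp only: mult_1)
  qed
  then have n: "nl a U s x = exp (a * s) * (a * u - u\<^sup>2 / 2)"
    unfolding nl_def e2 unfolding U by (simp add: algebra_simps)
  have "u * u \<le> a * u" using u by (intro mult_right_mono) auto
  then have "0 \<le> a * u - u\<^sup>2 / 2" using mult_nonneg_nonneg[OF less_imp_le[OF assms(1)] u(1)] unfolding power2_eq_square by linarith
  then show "0 \<le> nl a U s x" unfolding n by simp
  have "a * u - u\<^sup>2 / 2 \<le> a\<^sup>2 / 2"
    using zero_le_power2[of "a - u"] by (simp add: power2_eq_square algebra_simps)
  then show "nl a U s x \<le> a\<^sup>2 / 2 * exp (a * s)" unfolding n by (simp add: mult.commute)
qed

lemma nl_lipschitz: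
  assumes "a > 0" "0 \<le> s" "0 \<le> U s x" "U s x \<le> a * exp (a * s)" "0 \<le> V s x" "V s x \<le> a * exp (a * s)"
  shows "\<bar>nl a U s x - nl a V s x\<bar> \<le> a * \<bar>U s x - V s x\<bar>"
proof -
  \<comment> \<open>The mean of the two values of u = exp(- a s) U; it lies in [0, a], so the
    difference quotient \<open>a - q\<close> of the source does too.\<close>
  define q where "q = exp (- a * s) * (U s x + V s x) / 2"
  have e: "exp (- a * s) * (a * exp (a * s)) = a" by (simp add: exp_minus)
  have "exp (- a * s) * (U s x + V s x) \<le> exp (- a * s) * (2 * (a * exp (a * s)))"
    using assms by (intro mult_left_mono) auto
  also have "\<dots> = 2 * a" unfolding mult.left_commute[of _ 2] e ..
  finally have q: "0 \<le> q" "q \<le> a" using assms by (auto simp: q_def)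
  have "nl a U s x - nl a V s x = (U s x - V s x) * (a - q)"
    unfolding nl_def q_def using assms(2) by (simp add: power2_eq_square algebra_simps diff_divide_distrib add_divide_distrib)
  then have "\<bar>nl a U s x - nl a V s x\<bar> = \<bar>U s x - V s x\<bar> * (a - q)" using q by (simp add: abs_mult)
  also have "\<dots> \<le> \<bar>U s x - V s x\<bar> * a" using q by (intro mult_left_mono) auto
  finally show ?thesis by (simp add: mult.commute)
qed

text \<open>The bound \<open>a exp (a t)\<close> is reproduced by the iteration because a +
  (a/2)(exp(a t) - 1) \<le> a exp(a t). The iteration is a contraction globally in time in a
  weighted norm, so no gluing of short time intervals is needed. Times are frozen at 0 from below by
  \<open>max 0 t\<close>, which keeps everything continuous on the whole plane.\<close>

lemma exists_mild_solution:
  assumes f: "continuous_on UNIV f" and fb: "\<And>x. 0 \<le> f x" "\<And>x. f x \<le> a" and a: "a > 0"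
  obtains U where "lbc U" "\<And>t x. 0 \<le> U t x" "\<And>t x. U t x \<le> a * exp (a * max 0 t)"
    "\<And>t x. U t x = heat f (max 0 t) x + duh (nl a U) (max 0 t) x"
proof -
  define U where "U = picard a f"
  have fa: "\<bar>f y\<bar> \<le> a" for y using fb[of y] by simp
  have lbcU: "lbc (U k)" for k
    unfolding U_def
    by (induction k) (auto intro!: lbc_nonneg_times[OF lbc_heat[OF f fa]] lbc_add lbc_nonneg_times[OF lbc_duh] lbc_nl)
  have Ub: "0 \<le> U k t x \<and> U k t x \<le> a * exp (a * max 0 t)" for k t x
  proof (induction k arbitrary: t x)
    case 0
    have "a * 1 \<le> a * exp (a * max 0 t)" using a by (intro mult_left_mono) auto
    then show ?case using heat_bounds[OF f fb, of "max 0 t" x] by (auto simp: U_def)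
  next
    case (Suc k)
    define T where "T = max 0 t"
    have T: "T \<ge> 0" by (simp add: T_def)
    have n: "0 \<le> nl a (U k) s y \<and> nl a (U k) s y \<le> a\<^sup>2 / 2 * exp (a * s)" if s: "s \<in> {0..T}" for s y
    proof -
      have "0 \<le> U k s y" "U k s y \<le> a * exp (a * s)" using Suc.IH[of s y] s by auto
      from nl_bounds[where U = "U k", OF a _ this] s show ?thesis by simp
    qed
    have c: "continuous_on {0..T} (\<lambda>s. a\<^sup>2 / 2 * exp (a * s))" by (intro continuous_intros)
    note duh_bounds[OF lbc_nl[OF lbcU] c T n, of x]
    moreover have "integral {0..T} (\<lambda>s. a\<^sup>2 / 2 * exp (a * s)) = a / 2 * (exp (a * T) - 1)"
      unfolding integral_exp[OF T a] using a by (simp add: power2_eq_square)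
    moreover have "a + a / 2 * (exp (a * T) - 1) \<le> a * exp (a * T)"
    proof -
      have "0 \<le> a / 2 * (exp (a * T) - 1)" using a T by simp
      then show ?thesis by (simp add: algebra_simps)
    qed
    ultimately show ?case using heat_bounds[OF f fb, of T x] by (simp add: U_def T_def[symmetric])
  qed
  \<comment> \<open>The exponent 2a is twice the Lipschitz constant a of the source. Integrating a
    exp(2 a s) then gains exactly the factor 1/2 in each step.\<close>
  have diff: "\<bar>U (Suc k) t x - U k t x\<bar> \<le> a * (1/2) ^ k * exp (2 * a * max 0 t)" for k t x
  proof (induction k arbitrary: t x)
    case 0
    define T where "T = max 0 t"
    have T: "T \<ge> 0" by (simp add: T_def)
    have "\<bar>U (Suc 0) t x - U 0 t x\<bar> \<le> a * exp (a * T)"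
      using Ub[of "Suc 0" t x] Ub[of 0 t x] by (auto simp: T_def)
    also have "\<dots> \<le> a * exp (2 * a * T)" using a T by (intro mult_left_mono) auto
    finally show ?case by (simp add: T_def)
  next
    case (Suc k)
    define T where "T = max 0 t"
    have T: "T \<ge> 0" by (simp add: T_def)
    have "\<bar>U (Suc (Suc k)) t x - U (Suc k) t x\<bar> = \<bar>duh (nl a (U (Suc k))) T x - duh (nl a (U k)) T x\<bar>"
      by (simp add: U_def T_def)
    also have "\<dots> \<le> integral {0..T} (\<lambda>s. (a * (a * (1/2) ^ k)) * exp ((2 * a) * s))"
    proof (rule abs_duh_diff_le[OF lbc_nl[OF lbcU] lbc_nl[OF lbcU] _ T])
      show "continuous_on {0..T} (\<lambda>s. (a * (a * (1/2) ^ k)) * exp ((2 * a) * s))" by (intro continuous_intros)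
      fix s y assume s: "s \<in> {0..T}"
      have "\<bar>nl a (U (Suc k)) s y - nl a (U k) s y\<bar> \<le> a * \<bar>U (Suc k) s y - U k s y\<bar>"
        using Ub[of "Suc k" s y] Ub[of k s y] s by (intro nl_lipschitz[OF a]) auto
      also have "\<dots> \<le> a * (a * (1/2) ^ k * exp (2 * a * max 0 s))"
        using Suc.IH[of s y] a by (intro mult_left_mono) auto
      finally show "\<bar>nl a (U (Suc k)) s y - nl a (U k) s y\<bar> \<le> (a * (a * (1/2) ^ k)) * exp ((2 * a) * s)"
        using s by simp
    qed
    also have "\<dots> = a * (1/2) ^ Suc k * (exp (2 * a * T) - 1)"
      using integral_exp[OF T, of "2 * a"] a by (simp add: power2_eq_square)
    also have "\<dots> \<le> a * (1/2) ^ Suc k * exp (2 * a * T)" using a by (intro mult_left_mono) auto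
    finally show ?case by (simp add: T_def)
  qed
  \<comment> \<open>Dividing by the weight makes the geometric bound uniform on the whole plane, as
    the Weierstrass test requires.\<close>
  define d where "d = (\<lambda>k p. exp (- (2 * a * max 0 (fst p))) * (U (Suc k) (fst p) (snd p) - U k (fst p) (snd p)))"
  have db: "norm (d k p) \<le> a * (1/2) ^ k" for k p
  proof -
    have "\<bar>d k p\<bar> \<le> exp (- (2 * a * max 0 (fst p))) * (a * (1/2) ^ k * exp (2 * a * max 0 (fst p)))"
      unfolding d_def abs_mult using diff[of k "fst p" "snd p"] by (simp add: mult_left_mono)
    also have "\<dots> = a * (1/2) ^ k" by (simp add: exp_minus)
    finally show ?thesis by simp
  qed
  have ul: "uniform_limit UNIV (\<lambda>n p. \<Sum>i<n. d i p) (\<lambda>p. \<Sum>i. d i p) sequentially"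
    by (rule Weierstrass_m_test[where M = "\<lambda>k. a * (1/2) ^ k"]) (use db in \<open>auto intro!: summable_mult summable_geometric\<close>)
  have tel: "(\<Sum>i<n. d i p) = exp (- (2 * a * max 0 (fst p))) * (U n (fst p) (snd p) - U 0 (fst p) (snd p))" for n p
    unfolding d_def sum_distrib_left[symmetric] by (subst sum_lessThan_telescope) simp
  have cU: "continuous_on UNIV (\<lambda>p. U k (fst p) (snd p))" for k by (rule lbc_cont[OF lbcU])
  define L where "L = (\<lambda>t x. U 0 t x + exp (2 * a * max 0 t) * (\<Sum>i. d i (t, x)))"
  have close: "\<exists>N. \<forall>n\<ge>N. \<forall>t x. \<bar>U n t x - L t x\<bar> \<le> e * exp (2 * a * max 0 t)" if e: "e > 0" for e
  proof -
    from uniform_limitD[OF ul e] obtain N where N: "\<And>n p. n \<ge> N \<Longrightarrow> dist (\<Sum>i<n. d i p) (\<Sum>i. d i p) < e"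
      by (auto simp: eventually_sequentially)
    have "\<bar>U n t x - L t x\<bar> \<le> e * exp (2 * a * max 0 t)" if "n \<ge> N" for n t x
    proof -
      have "U n t x - L t x = exp (2 * a * max 0 t) * ((\<Sum>i<n. d i (t, x)) - (\<Sum>i. d i (t, x)))"
        unfolding L_def tel by (simp add: exp_minus algebra_simps)
      also have "\<bar>\<dots>\<bar> \<le> exp (2 * a * max 0 t) * e"
        unfolding abs_mult using N[OF that, of "(t, x)"] by (simp add: dist_real_def)
      finally show ?thesis by (simp add: mult.commute)
    qed
    then show ?thesis by blast
  qed
  have lim: "(\<lambda>n. U n t x) \<longlonglongrightarrow> L t x" for t x
  proof (rule LIMSEQ_I)
    fix r :: real assume r: "r > 0"
    define e where "e = r / (2 * exp (2 * a * max 0 t))"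
    have "e > 0" using r by (simp add: e_def)
    from close[OF this] obtain N where "\<And>n. n \<ge> N \<Longrightarrow> \<bar>U n t x - L t x\<bar> \<le> e * exp (2 * a * max 0 t)" by blast
    moreover have "e * exp (2 * a * max 0 t) = r / 2" by (simp add: e_def)
    ultimately have "\<And>n. n \<ge> N \<Longrightarrow> norm (U n t x - L t x) < r" using r by fastforce
    then show "\<exists>no. \<forall>n\<ge>no. norm (U n t x - L t x) < r" by blast
  qed
  have Lb: "0 \<le> L t x" "L t x \<le> a * exp (a * max 0 t)" for t x
    using LIMSEQ_le_const[OF lim[of t x]] LIMSEQ_le_const2[OF lim[of t x]] Ub[of _ t x] by blast+
  have "continuous_on UNIV (\<lambda>p. \<Sum>i. d i p)"
    by (rule uniform_limit_theorem[OF _ ul])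
      (auto intro!: always_eventually continuous_intros cU simp: d_def)
  then have cL: "continuous_on UNIV (\<lambda>p. L (fst p) (snd p))"
    unfolding L_def by (auto intro!: continuous_intros cU)
  have lbcL: "lbc L"
  proof (rule lbcI[OF cL])
    fix T
    have "\<bar>L t x\<bar> \<le> a * exp (a * \<bar>T\<bar>)" if "\<bar>t\<bar> \<le> T" for t x
    proof -
      have "\<bar>L t x\<bar> \<le> a * exp (a * max 0 t)" using Lb[of t x] by simp
      also have "\<dots> \<le> a * exp (a * \<bar>T\<bar>)" using that a by (intro mult_left_mono) auto
      finally show ?thesis .
    qed
    then show "\<exists>B. \<forall>t x. \<bar>t\<bar> \<le> T \<longrightarrow> \<bar>L t x\<bar> \<le> B" by blast
  qed
  have eq: "L t x = heat f (max 0 t) x + duh (nl a L) (max 0 t) x" for t x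
  proof -
    define T where "T = max 0 t"
    have T: "T \<ge> 0" by (simp add: T_def)
    have "(\<lambda>n. duh (nl a (U n)) T x) \<longlonglongrightarrow> duh (nl a L) T x"
    proof (rule LIMSEQ_I)
      fix r :: real assume r: "r > 0"
      define e where "e = r / (exp (2 * a * T))"
      have "e > 0" using r by (simp add: e_def)
      from close[OF this] obtain N where N: "\<And>n t x. n \<ge> N \<Longrightarrow> \<bar>U n t x - L t x\<bar> \<le> e * exp (2 * a * max 0 t)" by blast
      have "norm (duh (nl a (U n)) T x - duh (nl a L) T x) < r" if n: "n \<ge> N" for n
      proof -
        have "\<bar>duh (nl a (U n)) T x - duh (nl a L) T x\<bar> \<le> integral {0..T} (\<lambda>s. (a * e) * exp ((2 * a) * s))"
        proof (rule abs_duh_diff_le[OF lbc_nl[OF lbcU] lbc_nl[OF lbcL] _ T])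
          show "continuous_on {0..T} (\<lambda>s. (a * e) * exp ((2 * a) * s))" by (intro continuous_intros)
          fix s y assume s: "s \<in> {0..T}"
          have "\<bar>nl a (U n) s y - nl a L s y\<bar> \<le> a * \<bar>U n s y - L s y\<bar>"
            using Ub[of n s y] Lb[of s y] s by (intro nl_lipschitz[OF a]) auto
          also have "\<dots> \<le> a * (e * exp (2 * a * max 0 s))"
            using N[OF n, of s y] a by (intro mult_left_mono) auto
          finally show "\<bar>nl a (U n) s y - nl a L s y\<bar> \<le> (a * e) * exp ((2 * a) * s)" using s by simp
        qed
        also have "\<dots> = e / 2 * (exp (2 * a * T) - 1)"
          using integral_exp[OF T, of "2 * a"] a by simp
        also have "\<dots> < e / 2 * (2 * exp (2 * a * T))" using \<open>e > 0\<close> exp_gt_zero[of "2 * a * T"] by (intro mult_strict_left_mono) linarith+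
        also have "\<dots> = r" by (simp add: e_def)
        finally show ?thesis by simp
      qed
      then show "\<exists>no. \<forall>n\<ge>no. norm (duh (nl a (U n)) T x - duh (nl a L) T x) < r" by blast
    qed
    then have "(\<lambda>n. U (Suc n) t x) \<longlonglongrightarrow> heat f T x + duh (nl a L) T x"
      unfolding U_def by (auto simp: T_def intro!: tendsto_intros)
    moreover have "(\<lambda>n. U (Suc n) t x) \<longlonglongrightarrow> L t x" by (rule LIMSEQ_Suc[OF lim])
    ultimately show ?thesis unfolding T_def by (rule LIMSEQ_unique[rotated])
  qed
  show thesis by (rule that[OF lbcL Lb eq])
qed

text \<open>The third clause is what makes a solution restartable: each time slice is again
  admissible as a smooth bounded initial datum. It also supplies the continuity, hence
  measurability, of slices that are integrated against the initial measure.\<close>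

definition sol :: "(real \<Rightarrow> real) \<Rightarrow> (real \<Rightarrow> real \<Rightarrow> real) \<Rightarrow> bool" where
  "sol f u \<longleftrightarrow> log_laplace_sol f u \<and> (\<forall>t\<ge>0. \<forall>x. 0 \<le> u t x) \<and> (\<forall>t\<ge>0. \<exists>f1 f2. C2b (u t) f1 f2)"

lemma C2bI_lbc:
  assumes "\<And>x. (u t has_real_derivative u1 t x) (at x)" "\<And>x. (u1 t has_real_derivative u2 t x) (at x)"
    "lbc u" "lbc u1" "lbc u2"
  shows "C2b (u t) (u1 t) (u2 t)"
  unfolding C2b_def
proof (intro conjI allI assms(1,2) lbc_cont_x[OF assms(5)])
  obtain A where A: "A \<ge> 0" "\<And>s x. \<bar>s\<bar> \<le> \<bar>t\<bar> \<Longrightarrow> \<bar>u s x\<bar> \<le> A" by (rule lbc_bound[OF assms(3), of "\<bar>t\<bar>"]) blast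
  obtain B where B: "B \<ge> 0" "\<And>s x. \<bar>s\<bar> \<le> \<bar>t\<bar> \<Longrightarrow> \<bar>u1 s x\<bar> \<le> B" by (rule lbc_bound[OF assms(4), of "\<bar>t\<bar>"]) blast
  obtain C where C: "C \<ge> 0" "\<And>s x. \<bar>s\<bar> \<le> \<bar>t\<bar> \<Longrightarrow> \<bar>u2 s x\<bar> \<le> C" by (rule lbc_bound[OF assms(5), of "\<bar>t\<bar>"]) blast
  have "\<bar>u t x\<bar> \<le> A + B + C \<and> \<bar>u1 t x\<bar> \<le> A + B + C \<and> \<bar>u2 t x\<bar> \<le> A + B + C" for x
    using A(1) B(1) C(1) A(2)[of t x] B(2)[of t x] C(2)[of t x] by simp
  then show "\<exists>B. \<forall>x. \<bar>u t x\<bar> \<le> B \<and> \<bar>u1 t x\<bar> \<le> B \<and> \<bar>u2 t x\<bar> \<le> B" by blast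
qed

text \<open>A bootstrap. Smoothing gives \<open>Ux\<close>; then the source is differentiable, and
  shifting the derivative onto it gives a second formula for \<open>Ux\<close> with source
  \<open>hx\<close>, to which smoothing applies again. One more round expresses \<open>Uxx\<close>
  through \<open>hxx\<close>, which is the form needed for the time derivative. At each stage
  uniqueness of derivatives identifies the two formulas.\<close>

lemma mild_solution_regular:
  assumes f: "C2b f f1 f2" and U: "lbc U"
    and eq: "\<And>t x. U t x = heat f (max 0 t) x + duh (nl a U) (max 0 t) x"
  obtains Ux Uxx where "lbc Ux" "lbc Uxx"
    "\<And>t x. t \<ge> 0 \<Longrightarrow> (U t has_real_derivative Ux t x) (at x)"
    "\<And>t x. t \<ge> 0 \<Longrightarrow> (Ux t has_real_derivative Uxx t x) (at x)"
    "\<And>t x. t > 0 \<Longrightarrow> ((\<lambda>s. U s x) has_real_derivative Uxx t x / 2 + nl a U t x) (at t)"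
    "\<And>t x. t \<ge> 0 \<Longrightarrow> Ux t x = heat f1 t x + duhx (nl a U) t x"
proof -
  from f obtain B where d: "\<And>x. (f has_real_derivative f1 x) (at x)" "\<And>x. (f1 has_real_derivative f2 x) (at x)"
    and c: "continuous_on UNIV f" "continuous_on UNIV f1" "continuous_on UNIV f2"
    and B: "\<And>x. \<bar>f x\<bar> \<le> B" "\<And>x. \<bar>f1 x\<bar> \<le> B" "\<And>x. \<bar>f2 x\<bar> \<le> B"
    by (rule C2bD) blast
  have lh: "lbc (nl a U)" by (rule lbc_nl[OF U])
  define E where "E = (\<lambda>t::real. exp (- a * max 0 t))"
  have lE: "lbc (\<lambda>t x. E t)" unfolding E_def by (intro lbc_time continuous_intros)
  have lc: "lbc (\<lambda>t x. c)" for c by (intro lbc_time continuous_intros)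
  have Ueq: "U t = (\<lambda>x. heat f t x + duh (nl a U) t x)" if "t \<ge> 0" for t
    using eq[of t] that by (auto simp: fun_eq_iff)
  define Ux where "Ux = (\<lambda>t x. heat f1 (max 0 t) x + duhx (nl a U) (max 0 t) x)"
  have lUx: "lbc Ux" unfolding Ux_def
    by (intro lbc_add lbc_nonneg_times[OF lbc_heat[OF c(2) B(2)]] lbc_duhx[OF lh])
  have dU: "(U t has_real_derivative Ux t x) (at x)" if t: "t \<ge> 0" for t x
  proof -
    have "((\<lambda>x. heat f t x + duh (nl a U) t x) has_real_derivative heat f1 t x + duhx (nl a U) t x) (at x)"
      by (intro DERIV_add DERIV_heat[OF f] DERIV_duh_smoothing[OF lh t])
    then show ?thesis using t by (simp add: Ueq Ux_def)
  qed
  define hx where "hx = (\<lambda>t x. a * Ux t x - E t * (U t x * Ux t x))"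
  have lhx: "lbc hx"
  proof -
    have "lbc (\<lambda>t x. a * Ux t x + (- 1) * (E t * (U t x * Ux t x)))"
      by (intro lbc_add lbc_mult lc lE U lUx)
    then show ?thesis by (simp add: hx_def)
  qed
  have nl_eq: "nl a U t = (\<lambda>x. a * U t x - E t * (U t x)\<^sup>2 / 2)" for t
    by (simp add: fun_eq_iff nl_def E_def)
  have dh: "(nl a U t has_real_derivative hx t x) (at x)" if t: "t \<ge> 0" for t x
  proof -
    have "((\<lambda>x. a * U t x - E t * (U t x)\<^sup>2 / 2) has_real_derivative a * Ux t x - E t * (U t x * Ux t x)) (at x)"
      by (rule derivative_eq_intros dU[OF t] refl | simp)+
    then show ?thesis unfolding nl_eq hx_def .
  qed
  have Ux_eq: "Ux t x = heat f1 t x + duh hx t x" if t: "t \<ge> 0" for t x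
  proof (rule DERIV_unique[OF dU[OF t]])
    have "((\<lambda>x. heat f t x + duh (nl a U) t x) has_real_derivative heat f1 t x + duh hx t x) (at x)"
      by (intro DERIV_add DERIV_heat[OF f] DERIV_duh_shift[OF lh lhx dh t])
    then show "(U t has_real_derivative heat f1 t x + duh hx t x) (at x)" using t by (simp add: Ueq)
  qed
  define Uxx where "Uxx = (\<lambda>t x. heat f2 (max 0 t) x + duhx hx (max 0 t) x)"
  have lUxx: "lbc Uxx" unfolding Uxx_def
    by (intro lbc_add lbc_nonneg_times[OF lbc_heat[OF c(3) B(3)]] lbc_duhx[OF lhx])
  have dUx: "(Ux t has_real_derivative Uxx t x) (at x)" if t: "t \<ge> 0" for t x
  proof -
    have "((\<lambda>x. heat f1 t x + duh hx t x) has_real_derivative heat f2 t x + duhx hx t x) (at x)"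
      by (intro DERIV_add DERIV_heat[OF f] DERIV_duh_smoothing[OF lhx t])
    moreover have "Ux t = (\<lambda>x. heat f1 t x + duh hx t x)" using Ux_eq[OF t] by (simp add: fun_eq_iff)
    ultimately show ?thesis using t by (simp add: Uxx_def)
  qed
  define hxx where "hxx = (\<lambda>t x. a * Uxx t x - E t * (Ux t x * Ux t x + U t x * Uxx t x))"
  have lhxx: "lbc hxx"
  proof -
    have "lbc (\<lambda>t x. a * Uxx t x + (- 1) * (E t * (Ux t x * Ux t x + U t x * Uxx t x)))"
      by (intro lbc_add lbc_mult lc lE U lUx lUxx)
    then show ?thesis by (simp add: hxx_def)
  qed
  have dhx: "(hx t has_real_derivative hxx t x) (at x)" if t: "t \<ge> 0" for t x
    unfolding hx_def hxx_def
    by (rule derivative_eq_intros dU[OF t] dUx[OF t] refl | simp add: algebra_simps)+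
  have Uxx_eq: "Uxx t x = heat f2 t x + duh hxx t x" if t: "t \<ge> 0" for t x
  proof (rule DERIV_unique[OF dUx[OF t]])
    have "((\<lambda>x. heat f1 t x + duh hx t x) has_real_derivative heat f2 t x + duh hxx t x) (at x)"
      by (intro DERIV_add DERIV_heat[OF f] DERIV_duh_shift[OF lhx lhxx dhx t])
    moreover have "Ux t = (\<lambda>x. heat f1 t x + duh hx t x)" using Ux_eq[OF t] by (simp add: fun_eq_iff)
    ultimately show "(Ux t has_real_derivative heat f2 t x + duh hxx t x) (at x)" by simp
  qed
  have dt: "((\<lambda>s. U s x) has_real_derivative Uxx t x / 2 + nl a U t x) (at t)" if t: "t > 0" for t x
  proof -
    have "((\<lambda>s. heat f s x + duh (nl a U) s x) has_real_derivative heat f2 t x / 2 + (nl a U t x + duh hxx t x / 2)) (at t)"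
    proof (intro DERIV_add DERIV_heat_time[OF f t] DERIV_duh_time[OF lh lhxx _ t])
      fix s :: real assume s: "s \<ge> 0"
      have "C2b (nl a U s) (hx s) (hxx s)"
        by (rule C2bI_lbc[OF dh[OF s] dhx[OF s] lh lhx lhxx])
      then show "\<exists>h1. C2b (nl a U s) h1 (hxx s)" by blast
    qed
    also have "heat f2 t x / 2 + (nl a U t x + duh hxx t x / 2) = Uxx t x / 2 + nl a U t x"
      using Uxx_eq[of t x] t by simp
    finally have "((\<lambda>s. heat f s x + duh (nl a U) s x) has_real_derivative Uxx t x / 2 + nl a U t x) (at t)" .
    moreover have "eventually (\<lambda>s. heat f s x + duh (nl a U) s x = U s x) (nhds t)"
      using eventually_nhds_in_open[of "{0<..}" t] t by (auto elim!: eventually_mono simp: eq)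
    ultimately show ?thesis by (subst DERIV_cong_ev[OF refl _ refl, symmetric])
  qed
  show thesis
    by (rule that[OF lUx lUxx dU dUx dt]) (auto simp: Ux_def)
qed

text \<open>The Lipschitz bound at time 1/2 involves only the supremum \<open>a\<close> of the datum
  and none of its derivatives: one derivative is taken from the Gaussian density in the heat term
  (2a, as 1/sqrt(1/2) \<le> 2) and one from \<open>duhx\<close>. This is what makes slopes uniform
  over ever steeper bumps.\<close>

lemma exists_sol:
  assumes f: "C2b f f1 f2" and fb: "\<And>x. 0 \<le> f x" "\<And>x. f x \<le> a" and a: "a > 0"
  obtains u where "sol f u" "\<And>t x. t \<ge> 0 \<Longrightarrow> u t x \<le> a"
    "\<And>x y. \<bar>u (1/2) x - u (1/2) y\<bar> \<le> (2 * a + 2 * (a\<^sup>2 * exp a)) * \<bar>x - y\<bar>"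
proof -
  from f obtain B where d: "\<And>x. (f has_real_derivative f1 x) (at x)" "\<And>x. (f1 has_real_derivative f2 x) (at x)"
    and c: "continuous_on UNIV f" "continuous_on UNIV f1" "continuous_on UNIV f2"
    and B: "\<And>x. \<bar>f x\<bar> \<le> B" "\<And>x. \<bar>f1 x\<bar> \<le> B" "\<And>x. \<bar>f2 x\<bar> \<le> B"
    by (rule C2bD) blast
  obtain U where U: "lbc U" and Ub: "\<And>t x. 0 \<le> U t x" "\<And>t x. U t x \<le> a * exp (a * max 0 t)"
    and eq: "\<And>t x. U t x = heat f (max 0 t) x + duh (nl a U) (max 0 t) x"
    by (rule exists_mild_solution[OF c(1) fb a]) blast
  obtain Ux Uxx where l: "lbc Ux" "lbc Uxx"
    and dU: "\<And>t x. t \<ge> 0 \<Longrightarrow> (U t has_real_derivative Ux t x) (at x)"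
    and dUx: "\<And>t x. t \<ge> 0 \<Longrightarrow> (Ux t has_real_derivative Uxx t x) (at x)"
    and dt: "\<And>t x. t > 0 \<Longrightarrow> ((\<lambda>s. U s x) has_real_derivative Uxx t x / 2 + nl a U t x) (at t)"
    and Ux: "\<And>t x. t \<ge> 0 \<Longrightarrow> Ux t x = heat f1 t x + duhx (nl a U) t x"
    by (rule mild_solution_regular[OF f U eq]) blast
  define u where "u = (\<lambda>t x. exp (- a * t) * U t x)"
  define ux where "ux = (\<lambda>t x. exp (- a * t) * Ux t x)"
  define uxx where "uxx = (\<lambda>t x. exp (- a * t) * Uxx t x)"
  have lexp: "lbc (\<lambda>t x. exp (- a * t))" by (intro lbc_time continuous_intros)
  have lu: "lbc u" "lbc ux" "lbc uxx" unfolding u_def ux_def uxx_def by (intro lbc_mult lexp U l)+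
  have u0: "0 \<le> u t x" for t x using Ub(1)[of t x] by (simp add: u_def)
  have ua: "u t x \<le> a" if "t \<ge> 0" for t x
  proof -
    have "u t x \<le> exp (- a * t) * (a * exp (a * t))"
      unfolding u_def using Ub(2)[of t x] that by (intro mult_left_mono) auto
    also have "\<dots> = a" by (simp add: exp_minus)
    finally show ?thesis .
  qed
  have dux: "(u t has_real_derivative ux t x) (at x)" "(ux t has_real_derivative uxx t x) (at x)" if t: "t \<ge> 0" for t x
    unfolding u_def ux_def uxx_def by (intro DERIV_cmult dU dUx t)+
  have dut: "((\<lambda>s. u s x) has_real_derivative uxx t x / 2 - (u t x)\<^sup>2 / 2) (at t)" if t: "t > 0" for t x
  proof -
    have "((\<lambda>s. exp (- a * s)) has_real_derivative - a * exp (- a * t)) (at t)"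
      by (auto intro!: derivative_eq_intros)
    from DERIV_mult[OF this dt[OF t]]
    have "((\<lambda>s. u s x) has_real_derivative - a * exp (- a * t) * U t x + (Uxx t x / 2 + nl a U t x) * exp (- a * t)) (at t)"
      unfolding u_def .
    moreover have "max 0 t = t" using t by simp
    ultimately show ?thesis
      by (elim DERIV_cong) (simp only: nl_def u_def uxx_def, simp add: power2_eq_square algebra_simps)
  qed
  have heat0: "heat f 0 x = f x" for x by simp
  have "u 0 x = f x" for x using eq[of 0 x] by (simp add: u_def duh_def)
  moreover have "continuous_on ({0..} \<times> UNIV) (\<lambda>(t, x). u t x)"
    using continuous_on_subset[OF lbc_cont[OF lu(1)] subset_UNIV] by (simp add: case_prod_beta)
  moreover have "\<exists>B. \<forall>t\<ge>0. \<forall>x. \<bar>u t x\<bar> \<le> B" using u0 ua by (intro exI[of _ a]) simp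
  moreover have "\<exists>ut ux uxx. ((\<lambda>s. u s x) has_real_derivative ut) (at t) \<and>
        (\<forall>y. ((\<lambda>z. u t z) has_real_derivative ux y) (at y)) \<and>
        (ux has_real_derivative uxx) (at x) \<and> ut = uxx / 2 - (u t x)\<^sup>2 / 2" if "t > 0" for t x
    using dut[OF that, of x] dux[of t] that by (intro exI[of _ "uxx t x / 2 - (u t x)\<^sup>2 / 2"] exI[of _ "ux t"] exI[of _ "uxx t x"]) auto
  ultimately have "log_laplace_sol f u" unfolding log_laplace_sol_def by simp
  moreover have "\<exists>f1 f2. C2b (u t) f1 f2" if "t \<ge> 0" for t
    using C2bI_lbc[OF dux(1)[OF that] dux(2)[OF that] lu] by blast
  ultimately have s: "sol f u" using u0 unfolding sol_def by blast
  have fa: "\<bar>f y\<bar> \<le> a" for y using fb[of y] by simp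
  have grad: "\<bar>ux (1/2) x\<bar> \<le> 2 * a + 2 * (a\<^sup>2 * exp a)" for x
  proof -
    define \<sigma> where "\<sigma> = sqrt (1/2)"
    have sg: "\<sigma> > 0" "\<sigma> \<le> 1" by (simp_all add: \<sigma>_def)
    have sg2: "1 / \<sigma> \<le> 2"
    proof -
      have "sqrt (1/4) \<le> sqrt (1/2)" by (rule real_sqrt_le_mono) simp
      moreover have "sqrt (1/4) = 1/2" by (simp add: real_sqrt_divide)
      ultimately show ?thesis using sg by (simp add: \<sigma>_def[symmetric] field_simps)
    qed
    have "heat f1 (1/2) x = (\<integral>z. z * f (x + \<sigma> * z) \<partial>std_gauss) / \<sigma>"
    proof (rule DERIV_unique[OF DERIV_heat(1)[OF f]])
      show "(heat f (1/2) has_real_derivative (\<integral>z. z * f (x + \<sigma> * z) \<partial>std_gauss) / \<sigma>) (at x)"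
        unfolding heat_def[abs_def] \<sigma>_def by (rule DERIV_std_gauss_smoothing[OF c(1) fa]) simp
    qed
    moreover have "\<bar>\<integral>z. z * f (x + \<sigma> * z) \<partial>std_gauss\<bar> \<le> a"
      by (rule abs_integral_std_gauss_mult_le) (auto intro!: continuous_on_compose2[OF c(1)] continuous_intros fa)
    then have "\<bar>(\<integral>z. z * f (x + \<sigma> * z) \<partial>std_gauss) / \<sigma>\<bar> \<le> a * (1 / \<sigma>)" using sg by (simp add: divide_right_mono)
    also have "\<dots> \<le> a * 2" using sg2 a by (intro mult_left_mono) auto
    ultimately have 1: "\<bar>heat f1 (1/2) x\<bar> \<le> 2 * a" by simp
    have "\<bar>duhx (nl a U) (1/2) x\<bar> \<le> sqrt (1/2) * (2 * (a\<^sup>2 * exp a))"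
    proof (rule abs_duhx_le[OF lbc_nl[OF U]])
      fix s x :: real assume s0: "0 \<le> s" "s \<le> 1/2"
      have n: "0 \<le> nl a U s x" "nl a U s x \<le> a\<^sup>2 / 2 * exp (a * s)"
        using nl_bounds[where U = U, OF a s0(1)] Ub[of s x] s0 by auto
      have "a\<^sup>2 / 2 * exp (a * s) \<le> a\<^sup>2 * exp a"
        using s0 a by (intro mult_mono) (auto intro: order.trans[OF mult_left_le])
      then show "\<bar>nl a U s x\<bar> \<le> a\<^sup>2 * exp a" using n by simp
    qed simp
    also have "\<dots> \<le> 1 * (2 * (a\<^sup>2 * exp a))" using sg by (intro mult_right_mono) (auto simp: \<sigma>_def)
    finally have 2: "\<bar>duhx (nl a U) (1/2) x\<bar> \<le> 2 * (a\<^sup>2 * exp a)" by simp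
    have "\<bar>ux (1/2) x\<bar> \<le> \<bar>Ux (1/2) x\<bar>"
      unfolding ux_def abs_mult using a by (intro mult_left_le_one_le) auto
    also have "\<dots> \<le> 2 * a + 2 * (a\<^sup>2 * exp a)" using Ux[of "1/2" x] 1 2 by simp
    finally show ?thesis .
  qed
  have "\<bar>u (1/2) x - u (1/2) y\<bar> \<le> (2 * a + 2 * (a\<^sup>2 * exp a)) * \<bar>x - y\<bar>" for x y
    using field_differentiable_bound[of UNIV "u (1/2)" "ux (1/2)" "2 * a + 2 * (a\<^sup>2 * exp a)" x y] dux(1)[of "1/2"] grad
    by auto
  from that[OF s ua this] show thesis .
qed

lemma log_laplace_sol_iff_C12:
  "log_laplace_sol \<phi> u \<longleftrightarrow> continuous_on ({0..} \<times> UNIV) (\<lambda>(t, x). u t x) \<and> (\<exists>B. \<forall>t\<ge>0. \<forall>x. \<bar>u t x\<bar> \<le> B) \<and>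
     (\<forall>x. u 0 x = \<phi> x) \<and> (\<forall>t>0. \<forall>x. \<exists>a b. C12_at u t x a b \<and> a = b / 2 - (u t x)\<^sup>2 / 2)"
  unfolding log_laplace_sol_def C12_at_def by blast

lemma solD:
  assumes "sol f u"
  shows "continuous_on ({0..} \<times> UNIV) (\<lambda>(t, x). u t x)" "\<And>x. u 0 x = f x" "\<And>t x. t \<ge> 0 \<Longrightarrow> 0 \<le> u t x"
    "\<exists>B>0. \<forall>t\<ge>0. \<forall>x. u t x \<le> B"
    "\<And>t x. t > 0 \<Longrightarrow> \<exists>a b. C12_at u t x a b \<and> a = b / 2 - (u t x)\<^sup>2 / 2"
    "log_laplace_sol f u" "\<And>t. t \<ge> 0 \<Longrightarrow> \<exists>f1 f2. C2b (u t) f1 f2"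
proof -
  from assms obtain B where "\<forall>t\<ge>0. \<forall>x. \<bar>u t x\<bar> \<le> B" unfolding sol_def log_laplace_sol_iff_C12 by blast
  then have "\<forall>t\<ge>0. \<forall>x. u t x \<le> \<bar>B\<bar> + 1" by (smt (verit))
  then show "\<exists>B>0. \<forall>t\<ge>0. \<forall>x. u t x \<le> B" by (intro exI[of _ "\<bar>B\<bar> + 1"]) auto
qed (use assms in \<open>unfold sol_def log_laplace_sol_iff_C12, blast+\<close>)

lemma sol_cont_subset: "sol f u \<Longrightarrow> S \<subseteq> {0..} \<times> UNIV \<Longrightarrow> continuous_on S (\<lambda>(t, x). u t x)"
  using solD(1) continuous_on_subset by blast

section \<open>Comparison and scaling\<close>

lemma half_diff_le:
  fixes a b c d S U :: real
  shows "b / 2 - S / 2 \<le> a \<Longrightarrow> c = d / 2 - U / 2 \<Longrightarrow> S \<le> U \<Longrightarrow> c - a \<le> (d - b) / 2"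
    and "a \<le> b / 2 - S / 2 \<Longrightarrow> c = d / 2 - U / 2 \<Longrightarrow> U \<le> S \<Longrightarrow> a - c \<le> (b - d) / 2"
  by (simp_all add: field_simps)

text \<open>Where u > s \<ge> 0 also u^2 \<ge> s^2, so the quadratic terms only help and
  \<open>u - s\<close> is a subsolution of the heat equation at exactly those points where
  \<open>max_principle\<close> asks for it.\<close>

lemma sol_le_supersolution:
  assumes u: "sol f u" and t0: "0 \<le> t0" and D: "closed D"
    and s: "continuous_on ({t0..T} \<times> D) (\<lambda>(t, x). s t x)" "\<And>t x. t \<in> {t0..T} \<Longrightarrow> x \<in> D \<Longrightarrow> 0 \<le> s t x"
    and init: "\<And>x. x \<in> D \<Longrightarrow> u t0 x \<le> s t0 x"
    and bdry: "\<And>t x. t0 < t \<Longrightarrow> t \<le> T \<Longrightarrow> x \<in> D \<Longrightarrow> x \<notin> interior D \<Longrightarrow> u t x \<le> s t x"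
    and super: "\<And>t x. t0 < t \<Longrightarrow> t \<le> T \<Longrightarrow> x \<in> interior D \<Longrightarrow> \<exists>a b. C12_at s t x a b \<and> b / 2 - (s t x)\<^sup>2 / 2 \<le> a"
    and tx: "t \<in> {t0..T}" "x \<in> D"
  shows "u t x \<le> s t x"
proof -
  obtain B where B: "\<And>t x. t \<ge> 0 \<Longrightarrow> u t x \<le> B" using solD(4)[OF u] by blast
  have "u t x - s t x \<le> 0"
  proof (rule max_principle[OF D, where w = "\<lambda>t x. u t x - s t x" and B = B and T = T and ?t0.0 = t0])
    show "continuous_on ({t0..T} \<times> D) (\<lambda>(t, x). u t x - s t x)"
    proof -
      have "{t0..T} \<times> D \<subseteq> {0..} \<times> UNIV" using t0 by auto
      from continuous_on_diff[OF sol_cont_subset[OF u this] s(1)] show ?thesis by (simp add: case_prod_beta)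
    qed
    show "u t x - s t x \<le> B" if "t \<in> {t0..T}" "x \<in> D" for t x
      using B[of t x] s(2)[OF that] that t0 by auto
    show "x \<in> interior D \<and> (\<exists>a b. C12_at (\<lambda>t x. u t x - s t x) t x a b \<and> a \<le> b / 2)"
      if "t0 < t" "t \<le> T" "x \<in> D" "u t x - s t x > 0" for t x
    proof
      show int: "x \<in> interior D" using bdry[of t x] that by force
      from super[OF that(1,2) int] obtain a b where a: "C12_at s t x a b" "b / 2 - (s t x)\<^sup>2 / 2 \<le> a" by blast
      from solD(5)[OF u, of t x] that t0 obtain c d where c: "C12_at u t x c d" "c = d / 2 - (u t x)\<^sup>2 / 2" by auto
      have "(s t x)\<^sup>2 \<le> (u t x)\<^sup>2" using s(2)[of t x] that by (intro power_mono) auto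
      then show "\<exists>a b. C12_at (\<lambda>t x. u t x - s t x) t x a b \<and> a \<le> b / 2"
      proof (intro exI conjI)
        show "C12_at (\<lambda>t x. u t x - s t x) t x (c - a) (d - b)" by (rule C12_at_diff[OF c(1) a(1)])
        show "c - a \<le> (d - b) / 2" by (rule half_diff_le(1)[OF a(2) c(2) \<open>(s t x)\<^sup>2 \<le> (u t x)\<^sup>2\<close>])
      qed
    qed
  qed (use init tx in auto)
  then show ?thesis by simp
qed

lemma subsolution_le_sol:
  assumes u: "sol f u" and t0: "0 \<le> t0"
    and s: "continuous_on ({t0..T} \<times> UNIV) (\<lambda>(t, x). s t x)" "\<And>t x. t \<in> {t0..T} \<Longrightarrow> s t x \<le> B"
    and init: "\<And>x. s t0 x \<le> u t0 x"
    and sub: "\<And>t x. t0 < t \<Longrightarrow> t \<le> T \<Longrightarrow> \<exists>a b. C12_at s t x a b \<and> a \<le> b / 2 - (s t x)\<^sup>2 / 2"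
    and tx: "t \<in> {t0..T}"
  shows "s t x \<le> u t x"
proof -
  have "s t x - u t x \<le> 0"
  proof (rule max_principle[where D = UNIV and w = "\<lambda>t x. s t x - u t x" and B = B and T = T and ?t0.0 = t0])
    show "continuous_on ({t0..T} \<times> UNIV) (\<lambda>(t, x). s t x - u t x)"
    proof -
      have "{t0..T} \<times> UNIV \<subseteq> {0..} \<times> UNIV" using t0 by auto
      from continuous_on_diff[OF s(1) sol_cont_subset[OF u this]] show ?thesis by (simp add: case_prod_beta)
    qed
    show "s t x - u t x \<le> B" if "t \<in> {t0..T}" for t x
      using s(2)[OF that, of x] solD(3)[OF u, of t x] that t0 by auto
    show "x \<in> interior UNIV \<and> (\<exists>a b. C12_at (\<lambda>t x. s t x - u t x) t x a b \<and> a \<le> b / 2)"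
      if "t0 < t" "t \<le> T" "s t x - u t x > 0" for t x
    proof
      from sub[OF that(1,2)] obtain a b where a: "C12_at s t x a b" "a \<le> b / 2 - (s t x)\<^sup>2 / 2" by blast
      from solD(5)[OF u, of t x] that t0 obtain c d where c: "C12_at u t x c d" "c = d / 2 - (u t x)\<^sup>2 / 2" by auto
      have "(u t x)\<^sup>2 \<le> (s t x)\<^sup>2" using solD(3)[OF u, of t x] that t0 by (intro power_mono) auto
      then show "\<exists>a b. C12_at (\<lambda>t x. s t x - u t x) t x a b \<and> a \<le> b / 2"
      proof (intro exI conjI)
        show "C12_at (\<lambda>t x. s t x - u t x) t x (a - c) (b - d)" by (rule C12_at_diff[OF a(1) c(1)])
        show "a - c \<le> (b - d) / 2" by (rule half_diff_le(2)[OF a(2) c(2) \<open>(u t x)\<^sup>2 \<le> (s t x)\<^sup>2\<close>])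
      qed
    qed simp
  qed (use init tx in auto)
  then show ?thesis by simp
qed

lemma sol_mono:
  assumes u: "sol f u" and v: "sol g v" and fg: "\<And>x. f x \<le> g x" and t: "t \<ge> 0"
  shows "u t x \<le> v t x"
proof (rule sol_le_supersolution[OF u order.refl closed_UNIV, where T = t])
  show "continuous_on ({0..t} \<times> UNIV) (\<lambda>(t, x). v t x)" by (rule sol_cont_subset[OF v]) auto
  show "\<exists>a b. C12_at v t x a b \<and> b / 2 - (v t x)\<^sup>2 / 2 \<le> a" if "0 < t" for t x
    using solD(5)[OF v that, of x] by fastforce
qed (use solD(2,3)[OF v] solD(2)[OF u] fg t in auto)

lemma sol_unique: "sol f u \<Longrightarrow> sol f v \<Longrightarrow> t \<ge> 0 \<Longrightarrow> u t x = v t x"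
  by (meson sol_mono order.refl order.antisym)

lemma C2b_affine:
  assumes "C2b f f1 f2"
  shows "C2b (\<lambda>x. k * f (r * x + c)) (\<lambda>x. k * r * f1 (r * x + c)) (\<lambda>x. k * r\<^sup>2 * f2 (r * x + c))"
proof -
  from assms obtain B where d: "\<And>x. (f has_real_derivative f1 x) (at x)" "\<And>x. (f1 has_real_derivative f2 x) (at x)"
    and c: "continuous_on UNIV f" "continuous_on UNIV f1" "continuous_on UNIV f2"
    and B: "\<And>x. \<bar>f x\<bar> \<le> B" "\<And>x. \<bar>f1 x\<bar> \<le> B" "\<And>x. \<bar>f2 x\<bar> \<le> B"
    by (rule C2bD) blast
  have r: "((\<lambda>x. r * x + c) has_real_derivative r) (at x)" for x
    by (auto intro!: derivative_eq_intros)
  have "((\<lambda>x. k * f (r * x + c)) has_real_derivative k * r * f1 (r * x + c)) (at x)" for x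
    using DERIV_cmult[OF DERIV_chain2[OF d(1) r], of k x] by (simp add: mult_ac)
  moreover have "((\<lambda>x. k * r * f1 (r * x + c)) has_real_derivative k * r\<^sup>2 * f2 (r * x + c)) (at x)" for x
    using DERIV_cmult[OF DERIV_chain2[OF d(2) r], of "k * r" x] by (simp add: mult_ac power2_eq_square)
  moreover have "continuous_on UNIV (\<lambda>x. k * r\<^sup>2 * f2 (r * x + c))"
    by (intro continuous_intros continuous_on_compose2[OF c(3)]) auto
  moreover have "\<exists>B. \<forall>x. \<bar>k * f (r * x + c)\<bar> \<le> B \<and> \<bar>k * r * f1 (r * x + c)\<bar> \<le> B \<and> \<bar>k * r\<^sup>2 * f2 (r * x + c)\<bar> \<le> B"
  proof (intro exI allI conjI)
    fix x
    have B0: "B \<ge> 0" using B(1)[of 0] by linarith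
    define S where "S = \<bar>k\<bar> * B + \<bar>k * r\<bar> * B + \<bar>k * r\<^sup>2\<bar> * B"
    have n: "0 \<le> \<bar>k\<bar> * B" "0 \<le> \<bar>k * r\<bar> * B" "0 \<le> \<bar>k * r\<^sup>2\<bar> * B" using B0 by simp_all
    show "\<bar>k * f (r * x + c)\<bar> \<le> S" "\<bar>k * r * f1 (r * x + c)\<bar> \<le> S" "\<bar>k * r\<^sup>2 * f2 (r * x + c)\<bar> \<le> S"
      using n mult_left_mono[OF B(1)[of "r * x + c"], of "\<bar>k\<bar>"] mult_left_mono[OF B(2)[of "r * x + c"], of "\<bar>k * r\<bar>"]
        mult_left_mono[OF B(3)[of "r * x + c"], of "\<bar>k * r\<^sup>2\<bar>"]
      unfolding S_def by (simp_all only: abs_mult[symmetric]) linarith+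
  qed
  ultimately show ?thesis unfolding C2b_def by blast
qed

text \<open>Brownian scaling combined with a translation. Negative \<open>r\<close> is included, so
  that \<open>r = - 1\<close> gives the reflection behind \<open>sol_even\<close>.\<close>

lemma sol_scale:
  assumes u: "sol f u" and r: "r \<noteq> 0"
  shows "sol (\<lambda>x. r\<^sup>2 * f (r * x + c)) (\<lambda>t x. r\<^sup>2 * u (r\<^sup>2 * t) (r * x + c))"
  unfolding sol_def log_laplace_sol_iff_C12
proof (intro conjI allI impI)
  show "continuous_on ({0..} \<times> UNIV) (\<lambda>(t, x). r\<^sup>2 * u (r\<^sup>2 * t) (r * x + c))"
  proof -
    have c': "continuous_on ({0..} \<times> UNIV) (\<lambda>p. (r\<^sup>2 * fst p, r * snd p + c))" by (intro continuous_intros)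
    have i': "(\<lambda>p. (r\<^sup>2 * fst p, r * snd p + c)) ` ({0..} \<times> UNIV) \<subseteq> {0..} \<times> UNIV" by auto
    from continuous_on_compose2[OF solD(1)[OF u] c' i']
    have "continuous_on ({0..} \<times> UNIV) (\<lambda>p. u (r\<^sup>2 * fst p) (r * snd p + c))"
      by simp
    then show ?thesis unfolding case_prod_beta by (intro continuous_intros)
  qed
  obtain B where B: "\<And>t x. t \<ge> 0 \<Longrightarrow> u t x \<le> B" using solD(4)[OF u] by blast
  show "\<exists>B. \<forall>t\<ge>0. \<forall>x. \<bar>r\<^sup>2 * u (r\<^sup>2 * t) (r * x + c)\<bar> \<le> B"
  proof (intro exI[of _ "r\<^sup>2 * B"] allI impI)
    fix t x :: real assume "t \<ge> 0"
    then show "\<bar>r\<^sup>2 * u (r\<^sup>2 * t) (r * x + c)\<bar> \<le> r\<^sup>2 * B"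
      using B[of "r\<^sup>2 * t" "r * x + c"] solD(3)[OF u, of "r\<^sup>2 * t" "r * x + c"] by (simp add: abs_mult mult_left_mono)
  qed
  show "r\<^sup>2 * u (r\<^sup>2 * 0) (r * x + c) = r\<^sup>2 * f (r * x + c)" for x using solD(2)[OF u] by simp
  show "0 \<le> r\<^sup>2 * u (r\<^sup>2 * t) (r * x + c)" if "0 \<le> t" for t x using solD(3)[OF u] that by simp
  show "\<exists>f1 f2. C2b (\<lambda>x. r\<^sup>2 * u (r\<^sup>2 * t) (r * x + c)) f1 f2" if t: "0 \<le> t" for t
  proof -
    from t have "0 \<le> r\<^sup>2 * t" by simp
    from solD(7)[OF u this] obtain f1 f2 where "C2b (u (r\<^sup>2 * t)) f1 f2" by blast
    from C2b_affine[OF this, of "r\<^sup>2" r c] show ?thesis by blast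
  qed
  fix t x :: real assume t: "0 < t"
  from solD(5)[OF u, of "r\<^sup>2 * t + 0" "r * x + c"] t r
  obtain a b where ab: "C12_at u (r\<^sup>2 * t + 0) (r * x + c) a b" "a = b / 2 - (u (r\<^sup>2 * t) (r * x + c))\<^sup>2 / 2" by auto
  from C12_at_cmult[OF C12_at_affine[OF ab(1)], of "r\<^sup>2"]
  have "C12_at (\<lambda>t x. r\<^sup>2 * u (r\<^sup>2 * t) (r * x + c)) t x (r\<^sup>2 * (r\<^sup>2 * a)) (r\<^sup>2 * (r\<^sup>2 * b))" by simp
  moreover have "r\<^sup>2 * (r\<^sup>2 * a) = r\<^sup>2 * (r\<^sup>2 * b) / 2 - (r\<^sup>2 * u (r\<^sup>2 * t) (r * x + c))\<^sup>2 / 2"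
    unfolding ab(2) by (simp add: power2_eq_square algebra_simps)
  ultimately show "\<exists>a b. C12_at (\<lambda>t x. r\<^sup>2 * u (r\<^sup>2 * t) (r * x + c)) t x a b \<and>
      a = b / 2 - (r\<^sup>2 * u (r\<^sup>2 * t) (r * x + c))\<^sup>2 / 2" by blast
qed

lemma sol_even:
  assumes u: "sol f u" and f: "\<And>x. f (- x) = f x" and t: "t \<ge> 0"
  shows "u t (- x) = u t x"
  using sol_unique[OF sol_scale[OF u, of "- 1" 0] _ t, of u x] u f by simp

lemma sol_restart:
  assumes u: "sol f u" and s: "s \<ge> 0"
  shows "sol (u s) (\<lambda>t x. u (s + t) x)"
  unfolding sol_def log_laplace_sol_iff_C12
proof (intro conjI allI impI)
  show "continuous_on ({0..} \<times> UNIV) (\<lambda>(t, x). u (s + t) x)"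
  proof -
    have c': "continuous_on ({0..} \<times> UNIV) (\<lambda>p. (s + fst p, snd p))" by (intro continuous_intros)
    have i': "(\<lambda>p. (s + fst p, snd p)) ` ({0..} \<times> UNIV) \<subseteq> {0..} \<times> UNIV" using s by auto
    from continuous_on_compose2[OF solD(1)[OF u] c' i']
    have "continuous_on ({0..} \<times> UNIV) (\<lambda>p. u (s + fst p) (snd p))"
      by simp
    then show ?thesis unfolding case_prod_beta .
  qed
  obtain B where B: "\<And>t x. t \<ge> 0 \<Longrightarrow> u t x \<le> B" using solD(4)[OF u] by blast
  show "\<exists>B. \<forall>t\<ge>0. \<forall>x. \<bar>u (s + t) x\<bar> \<le> B"
  proof (intro exI[of _ B] allI impI)
    fix t x :: real assume "0 \<le> t"
    then show "\<bar>u (s + t) x\<bar> \<le> B" using B[of "s + t" x] solD(3)[OF u, of "s + t" x] s by simp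
  qed
  show "0 \<le> u (s + t) x" if "0 \<le> t" for t x using solD(3)[OF u] that s by simp
  show "\<exists>f1 f2. C2b (u (s + t)) f1 f2" if t: "0 \<le> t" for t using solD(7)[OF u, of "s + t"] that s by simp
  fix t x :: real assume t: "0 < t"
  from solD(5)[OF u, of "1 * t + s" x] t s
  obtain a b where ab: "C12_at u (1 * t + s) (1 * x + 0) a b" "a = b / 2 - (u (s + t) x)\<^sup>2 / 2"
    by (auto simp: add.commute)
  from C12_at_affine[OF ab(1)] have "C12_at (\<lambda>t x. u (s + t) x) t x a b" by (simp add: add.commute)
  with ab(2) show "\<exists>a b. C12_at (\<lambda>t x. u (s + t) x) t x a b \<and> a = b / 2 - (u (s + t) x)\<^sup>2 / 2" by blast
qed simp

text \<open>The comparison function is the spatially constant solution, that of y' = - y^2/2 with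
  y(0) = K. Letting K grow gives the universal bound 2/t.\<close>

lemma sol_le_2_div:
  assumes u: "sol f u" and K: "\<And>x. f x \<le> K" and K0: "K > 0" and t: "t \<ge> 0"
  shows "u t x \<le> 2 / (t + 2 / K)"
proof (rule sol_le_supersolution[OF u order.refl closed_UNIV, where T = t and s = "\<lambda>t x. 2 / (t + 2 / K)"])
  have pos: "t + 2 / K > 0" if "t \<ge> 0" for t using that K0 by (intro add_nonneg_pos) auto
  show "continuous_on ({0..t} \<times> UNIV) (\<lambda>(t, x::real). 2 / (t + 2 / K))"
    unfolding case_prod_beta by (intro continuous_intros) (use pos in force)
  show "0 \<le> 2 / (t + 2 / K)" if "t \<in> {0..t'}" for t t' using pos[of t] that by auto
  show "u 0 x \<le> 2 / (0 + 2 / K)" for x using solD(2)[OF u] K K0 by simp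
  show "\<exists>a b. C12_at (\<lambda>t x. 2 / (t + 2 / K)) t x a b \<and> b / 2 - (2 / (t + 2 / K))\<^sup>2 / 2 \<le> a" if "0 < t" for t x
  proof (intro exI conjI)
    have p: "t + 2 / K > 0" using pos[of t] that by simp
    have "((\<lambda>s. 2 * inverse (s + 2 / K)) has_real_derivative 2 * (- (inverse (t + 2 / K) * 1 * inverse (t + 2 / K)))) (at t)"
      by (rule derivative_eq_intros refl | use p in force)+
    then have d: "((\<lambda>s. 2 / (s + 2 / K)) has_real_derivative - 2 / (t + 2 / K)\<^sup>2) (at t)"
      by (simp add: divide_inverse power2_eq_square mult_ac)
    show "C12_at (\<lambda>t x. 2 / (t + 2 / K)) t x (- 2 / (t + 2 / K)\<^sup>2) 0"
      by (rule C12_atI[where wx = "\<lambda>_. 0"]) (use d in auto)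
    show "0 / 2 - (2 / (t + 2 / K))\<^sup>2 / 2 \<le> - 2 / (t + 2 / K)\<^sup>2" by (simp add: power_divide)
  qed
qed (use t in auto)

lemma sol_le_2_div_t:
  assumes u: "sol f u" and t: "t > 0"
  shows "u t x \<le> 2 / t"
proof -
  obtain K where K: "K > 0" "\<And>x. f x \<le> K" using solD(4)[OF u] solD(2)[OF u] by (metis order.refl)
  have "u t x \<le> 2 / (t + 2 / K)" by (rule sol_le_2_div[OF u K(2,1)]) (use t in simp)
  also have "\<dots> \<le> 2 / t" by (rule frac_le) (use t K in auto)
  finally show ?thesis .
qed

text \<open>The fourth power keeps the second derivative continuous across \<bar>x\<bar> = 1, so
  that bumps are admissible initial data.\<close>

definition bump :: "real \<Rightarrow> real" where "bump x = (max 0 (1 - x\<^sup>2)) ^ 4"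

lemma DERIV_max0_power:
  "((\<lambda>y. (max 0 y) ^ (Suc (Suc n))) has_real_derivative real (Suc (Suc n)) * (max 0 y) ^ Suc n) (at y)"
proof -
  consider "y > 0" | "y < 0" | "y = 0" by linarith
  then show ?thesis
  proof cases
    case 1
    have "eventually (\<lambda>z. z ^ Suc (Suc n) = (max 0 z) ^ Suc (Suc n)) (nhds y)"
      using eventually_nhds_in_open[of "{0<..}" y] 1 by (auto elim!: eventually_mono simp: max_def)
    moreover have "((\<lambda>y. y ^ Suc (Suc n)) has_real_derivative real (Suc (Suc n)) * (max 0 y) ^ Suc n) (at y)"
      using DERIV_pow[of "Suc (Suc n)" y] 1 by simp
    ultimately show ?thesis by (subst DERIV_cong_ev[OF refl _ refl, symmetric])
  next
    case 2
    have "eventually (\<lambda>z. 0 = (max 0 z) ^ Suc (Suc n)) (nhds y)"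
      using eventually_nhds_in_open[of "{..<0}" y] 2 by (auto elim!: eventually_mono simp: max_def)
    moreover have "((\<lambda>y. 0) has_real_derivative real (Suc (Suc n)) * (max 0 y) ^ Suc n) (at y)"
      using 2 by simp
    ultimately show ?thesis by (subst DERIV_cong_ev[OF refl _ refl, symmetric])
  next
    case 3
    have "((\<lambda>h::real. (max 0 h) ^ Suc n * (if h > 0 then 1 else 0)) \<longlongrightarrow> 0) (at 0)"
    proof (rule Lim_null_comparison[rotated])
      show "((\<lambda>h::real. (max 0 h) ^ Suc n) \<longlongrightarrow> 0) (at 0)"
        using tendsto_power[OF tendsto_max[OF tendsto_const[of "0::real"] tendsto_ident_at[of "0::real" UNIV]], of "Suc n"] by simp
    qed (auto intro!: always_eventually)
    moreover have "(max 0 h) ^ Suc n * (if h > 0 then 1 else 0) = ((max 0 (0 + h)) ^ Suc (Suc n) - (max 0 0) ^ Suc (Suc n)) / h" for h :: real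
      by (cases "h > 0") auto
    ultimately have "((\<lambda>h::real. ((max 0 (0 + h)) ^ Suc (Suc n) - (max 0 0) ^ Suc (Suc n)) / h) \<longlongrightarrow> 0) (at 0)" by simp
    then show ?thesis unfolding 3 DERIV_def by simp
  qed
qed

lemma C2b_bump: "C2b bump (\<lambda>x. - 8 * x * (max 0 (1 - x\<^sup>2)) ^ 3)
    (\<lambda>x. - 8 * (max 0 (1 - x\<^sup>2)) ^ 3 + 48 * x\<^sup>2 * (max 0 (1 - x\<^sup>2)) ^ 2)"
proof -
  have i: "((\<lambda>x. 1 - x\<^sup>2) has_real_derivative - 2 * x) (at x)" for x :: real
    by (auto intro!: derivative_eq_intros)
  have d4: "((\<lambda>x. (max 0 (1 - x\<^sup>2)) ^ 4) has_real_derivative (4 * (max 0 (1 - x\<^sup>2)) ^ 3) * (- 2 * x)) (at x)" for x :: real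
    using DERIV_chain2[OF DERIV_max0_power[of 2] i] by (simp add: eval_nat_numeral)
  have d3: "((\<lambda>x. (max 0 (1 - x\<^sup>2)) ^ 3) has_real_derivative (3 * (max 0 (1 - x\<^sup>2)) ^ 2) * (- 2 * x)) (at x)" for x :: real
    using DERIV_chain2[OF DERIV_max0_power[of 1] i] by (simp add: eval_nat_numeral)
  have 1: "(bump has_real_derivative - 8 * x * (max 0 (1 - x\<^sup>2)) ^ 3) (at x)" for x
    unfolding bump_def[abs_def] by (rule DERIV_cong[OF d4]) simp
  have i2: "((\<lambda>x. - 8 * x) has_real_derivative - 8) (at x)" for x :: real
    using DERIV_cmult[OF DERIV_ident, of "- 8" x] by simp
  have 2: "((\<lambda>x. - 8 * x * (max 0 (1 - x\<^sup>2)) ^ 3) has_real_derivative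
      - 8 * (max 0 (1 - x\<^sup>2)) ^ 3 + 48 * x\<^sup>2 * (max 0 (1 - x\<^sup>2)) ^ 2) (at x)" for x :: real
    by (rule DERIV_cong[OF DERIV_mult[OF i2 d3]]) (simp add: power2_eq_square)
  have m: "0 \<le> max 0 (1 - x\<^sup>2)" "max 0 (1 - x\<^sup>2) \<le> 1" for x :: real by auto
  have p: "0 \<le> (max 0 (1 - x\<^sup>2)) ^ k" "(max 0 (1 - x\<^sup>2)) ^ k \<le> 1" for x :: real and k
    by (rule zero_le_power[OF m(1)], rule power_le_one[OF m])
  have b: "\<bar>bump x\<bar> \<le> 56 \<and> \<bar>- 8 * x * (max 0 (1 - x\<^sup>2)) ^ 3\<bar> \<le> 56 \<and>
      \<bar>- 8 * (max 0 (1 - x\<^sup>2)) ^ 3 + 48 * x\<^sup>2 * (max 0 (1 - x\<^sup>2)) ^ 2\<bar> \<le> 56" for x :: real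
  proof (cases "\<bar>x\<bar> \<le> 1")
    case True
    then have x2: "x\<^sup>2 \<le> 1" "0 \<le> x\<^sup>2" by (auto simp: abs_square_le_1)
    have "\<bar>x\<bar> * (max 0 (1 - x\<^sup>2)) ^ 3 \<le> 1 * 1" using True p by (intro mult_mono) auto
    moreover have "x\<^sup>2 * (max 0 (1 - x\<^sup>2)) ^ 2 \<le> 1 * 1" by (rule mult_mono[OF x2(1) p(2)]) auto
    moreover have "0 \<le> x\<^sup>2 * (max 0 (1 - x\<^sup>2)) ^ 2" by simp
    moreover have "\<bar>- 8 * x * (max 0 (1 - x\<^sup>2)) ^ 3\<bar> = 8 * (\<bar>x\<bar> * (max 0 (1 - x\<^sup>2)) ^ 3)"
      using p(1)[of x 3] by (simp add: abs_mult)
    moreover have "\<bar>bump x\<bar> \<le> 1" unfolding bump_def using p[of x 4] by simp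
    ultimately show ?thesis using p[of x 3] unfolding mult.assoc[of 48] by linarith
  next
    case False
    then have "max 0 (1 - x\<^sup>2) = 0" using abs_square_le_1[of x] by (simp add: max_def)
    then show ?thesis by (simp add: bump_def)
  qed
  have "continuous_on UNIV (\<lambda>x::real. - 8 * (max 0 (1 - x\<^sup>2)) ^ 3 + 48 * x\<^sup>2 * (max 0 (1 - x\<^sup>2)) ^ 2)"
    by (intro continuous_intros)
  then show ?thesis unfolding C2b_def using 1 2 b by blast
qed

lemma bump_bounds: "0 \<le> bump x" "bump x \<le> 1"
  by (auto simp: bump_def intro!: power_le_one)

lemma bump_eq_0: "1 \<le> \<bar>x\<bar> \<Longrightarrow> bump x = 0"
proof -
  assume "1 \<le> \<bar>x\<bar>"
  then have "1 \<le> x\<^sup>2" using one_le_power[of "\<bar>x\<bar>" 2] by simp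
  then show ?thesis by (simp add: bump_def)
qed

lemma bump_pos: "\<bar>x\<bar> < 1 \<Longrightarrow> 0 < bump x"
  using abs_square_less_1[of x] by (auto simp: bump_def)

lemma bump_ge: "\<bar>x\<bar> \<le> 1/2 \<Longrightarrow> 1/4 \<le> bump x"
proof -
  assume "\<bar>x\<bar> \<le> 1/2"
  then have "\<bar>x\<bar>\<^sup>2 \<le> (1/2)\<^sup>2" by (intro power_mono) auto
  then have "3/4 \<le> 1 - x\<^sup>2" by (simp add: power2_eq_square)
  then have "(3/4) ^ 4 \<le> (max 0 (1 - x\<^sup>2)) ^ 4" by (intro power_mono) auto
  moreover have "(1/4::real) \<le> (3/4) ^ 4" by (simp add: power_divide)
  ultimately show ?thesis unfolding bump_def by linarith
qed

lemma bump_even: "bump (- x) = bump x" by (simp add: bump_def)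

lemma continuous_on_bump: "continuous_on S bump"
  unfolding bump_def[abs_def] by (intro continuous_intros)

text \<open>The solution started from a bump of height \<open>k\<close> and half-width 1/n; it is
  determined for t \<ge> 0 only. For k = l n the datum approximates l times a fixed multiple of the
  point mass at 0 as n grows.\<close>

definition bsol :: "real \<Rightarrow> real \<Rightarrow> real \<Rightarrow> real \<Rightarrow> real" where
  "bsol k n = (SOME u. sol (\<lambda>x. k * bump (n * x)) u)"

lemma sol_bsol: "k > 0 \<Longrightarrow> sol (\<lambda>x. k * bump (n * x)) (bsol k n)"
proof -
  assume k: "k > 0"
  have "C2b (\<lambda>x. k * bump (n * x + 0)) (\<lambda>x. k * n * (- 8 * (n * x + 0) * (max 0 (1 - (n * x + 0)\<^sup>2)) ^ 3))
    (\<lambda>x. k * n\<^sup>2 * (- 8 * (max 0 (1 - (n * x + 0)\<^sup>2)) ^ 3 + 48 * (n * x + 0)\<^sup>2 * (max 0 (1 - (n * x + 0)\<^sup>2)) ^ 2))"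
    by (rule C2b_affine[OF C2b_bump])
  then obtain u where "sol (\<lambda>x. k * bump (n * x + 0)) u"
    by (rule exists_sol[where a = k]) (use k bump_bounds in \<open>auto simp: mult_left_le\<close>)
  then show ?thesis unfolding bsol_def by (simp add: someI_ex[of "sol (\<lambda>x. k * bump (n * x))"] exI[of _ u])
qed

lemma bsol_scale:
  assumes "k > 0" "r > 0" "t \<ge> 0"
  shows "bsol (r\<^sup>2 * k) (n * r) t x = r\<^sup>2 * bsol k n (r\<^sup>2 * t) (r * x)"
proof -
  have "sol (\<lambda>x. r\<^sup>2 * k * bump (n * r * x)) (bsol (r\<^sup>2 * k) (n * r))"
    by (rule sol_bsol) (use assms in simp)
  moreover have "sol (\<lambda>x. r\<^sup>2 * k * bump (n * r * x)) (\<lambda>t x. r\<^sup>2 * bsol k n (r\<^sup>2 * t) (r * x))"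
    using sol_scale[OF sol_bsol[OF assms(1), of n], of r 0] assms by (simp add: mult_ac)
  ultimately show ?thesis using assms(3) by (rule sol_unique)
qed

lemma bsol_mono: "0 < k \<Longrightarrow> k \<le> k' \<Longrightarrow> t \<ge> 0 \<Longrightarrow> bsol k n t x \<le> bsol k' n t x"
  by (rule sol_mono[OF sol_bsol sol_bsol]) (auto intro: mult_right_mono bump_bounds)

lemma bsol_even: "0 < k \<Longrightarrow> t \<ge> 0 \<Longrightarrow> bsol k n t (- x) = bsol k n t x"
  by (rule sol_even[OF sol_bsol]) (auto simp: bump_even)

lemma bsol_nonneg: "0 < k \<Longrightarrow> t \<ge> 0 \<Longrightarrow> 0 \<le> bsol k n t x"
  by (rule solD(3)[OF sol_bsol])

lemma bsol_le_2_div_t: "0 < k \<Longrightarrow> t > 0 \<Longrightarrow> bsol k n t x \<le> 2 / t"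
  by (rule sol_le_2_div_t[OF sol_bsol])

text \<open>At time 1/2 every solution is at most 4, whatever its datum. Restarting there and using
  the slope bound that depends only on the supremum gives one Lipschitz constant for all
  solutions.\<close>

lemma sol_lipschitz_at_1: "\<exists>L. \<forall>f u. sol f u \<longrightarrow> (\<forall>x y. \<bar>u 1 x - u 1 y\<bar> \<le> L * \<bar>x - y\<bar>)"
proof (intro exI allI impI)
  fix f u x y assume u: "sol f u"
  from solD(7)[OF u, of "1/2"] obtain f1 f2 where "C2b (u (1/2)) f1 f2" by auto
  then obtain v where v: "sol (u (1/2)) v" "\<And>x y. \<bar>v (1/2) x - v (1/2) y\<bar> \<le> (2 * 4 + 2 * (4\<^sup>2 * exp 4)) * \<bar>x - y\<bar>"
    by (rule exists_sol[where a = 4]) (use solD(3)[OF u] sol_le_2_div_t[OF u, of "1/2"] in auto)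
  have "v (1/2) x = u 1 x" for x
    using sol_unique[OF v(1) sol_restart[OF u, of "1/2"], of "1/2" x] by simp
  then show "\<bar>u 1 x - u 1 y\<bar> \<le> (2 * 4 + 2 * (4\<^sup>2 * exp 4)) * \<bar>x - y\<bar>" using v(2)[of x y] by simp
qed

section \<open>Gaussian bounds and convergence to the self-similar solution\<close>

lemma C12_at_gaussian:
  assumes t: "t > 0"
  shows "C12_at (\<lambda>t x. t powr \<alpha> * exp (- \<beta> * (x / sqrt t)\<^sup>2)) t x
     (t powr (\<alpha> - 1) * ((\<alpha> + \<beta> * (x / sqrt t)\<^sup>2) * exp (- \<beta> * (x / sqrt t)\<^sup>2)))
     (t powr (\<alpha> - 1) * ((4 * \<beta>\<^sup>2 * (x / sqrt t)\<^sup>2 - 2 * \<beta>) * exp (- \<beta> * (x / sqrt t)\<^sup>2)))"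
proof -
  have G: "((\<lambda>y. exp (- \<beta> * y\<^sup>2)) has_real_derivative - 2 * \<beta> * y * exp (- \<beta> * y\<^sup>2)) (at y)" for y
    by (auto intro!: derivative_eq_intros)
  have G1: "((\<lambda>y. - 2 * \<beta> * y * exp (- \<beta> * y\<^sup>2)) has_real_derivative (4 * \<beta>\<^sup>2 * y\<^sup>2 - 2 * \<beta>) * exp (- \<beta> * y\<^sup>2)) (at y)" for y
    by (rule derivative_eq_intros refl | simp add: power2_eq_square algebra_simps)+
  have e: "\<alpha> * exp (- \<beta> * y\<^sup>2) - y / 2 * (- 2 * \<beta> * y * exp (- \<beta> * y\<^sup>2)) = (\<alpha> + \<beta> * y\<^sup>2) * exp (- \<beta> * y\<^sup>2)" for y
    by (simp add: power2_eq_square algebra_simps)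
  show ?thesis using C12_at_self_similar[OF t G G1, of \<alpha> x] unfolding e .
qed

lemma continuous_on_gaussian:
  assumes "\<And>p. p \<in> S \<Longrightarrow> fst p + q > 0"
  shows "continuous_on S (\<lambda>(t, x). K * ((t + q) powr \<alpha> * exp (- \<beta> * ((x + c) / sqrt (t + q))\<^sup>2)))"
  unfolding case_prod_beta
  by (intro continuous_intros) (use assms in \<open>force simp: less_imp_neq[symmetric]\<close>)+

lemma powr_minus1_sq: "t > 0 \<Longrightarrow> (t powr (- 1))\<^sup>2 = (t::real) powr (- 2)"
  unfolding power2_eq_square powr_add[symmetric] by simp

lemma powr_minus1: "t > 0 \<Longrightarrow> (t::real) powr (- 1) = 1 / t"
  by (simp add: powr_minus_divide)

lemma exp_2_le: "exp (2::real) \<le> 9"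
proof -
  have "exp (2::real) = exp 1 * exp 1" by (simp add: exp_add[symmetric])
  also have "\<dots> \<le> 3 * 3" using exp_le by (intro mult_mono) auto
  finally show ?thesis by simp
qed

text \<open>This is the factor that remains after inserting the Gaussian below into the equation.
  For q \<ge> 6 the diffusive term suffices; for q < 6 the exponential is at least exp(- 2) \<ge>
  1/9, and 16/9 > 3/4.\<close>

lemma supersolution_ineq: "q \<ge> 0 \<Longrightarrow> 3/4 \<le> q / 8 + 16 * exp (- (1/4) * q)" for q :: real
proof (cases "q \<ge> 6")
  case False
  then have "exp (- 2) \<le> exp (- (1/4) * q)" by simp
  moreover have "exp (- 2 :: real) \<ge> 1 / 9" using exp_2_le by (simp add: exp_minus field_simps)
  moreover assume "q \<ge> 0"
  ultimately show ?thesis by linarith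
qed (use exp_ge_zero[of "- (1/4) * q"] in linarith)

text \<open>The rate 1/4 is half that of the heat kernel, which leaves the gain y^2/8 far out. The
  height 32 contributes 16 E through the nonlinearity, which carries the centre, where the decay 1/t
  is too fast for the linear equation alone.\<close>

lemma gaussian_supersolution:
  assumes "t + \<tau> > 0"
  shows "\<exists>a b. C12_at (\<lambda>t x. 32 * ((t + \<tau>) powr (- 1) * exp (- (1/4) * ((x + c) / sqrt (t + \<tau>))\<^sup>2))) t x a b \<and>
    b / 2 - (32 * ((t + \<tau>) powr (- 1) * exp (- (1/4) * ((x + c) / sqrt (t + \<tau>))\<^sup>2)))\<^sup>2 / 2 \<le> a"
proof -
  define y where "y = (x + c) / sqrt (t + \<tau>)"
  define E where "E = exp (- (1/4) * y\<^sup>2)"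
  define T where "T = t + \<tau>"
  have T: "T > 0" using assms by (simp add: T_def)
  have "C12_at (\<lambda>t x. t powr (- 1) * exp (- (1/4) * (x / sqrt t)\<^sup>2)) (1 * t + \<tau>) (1 * x + c)
     (T powr (- 1 - 1) * ((- 1 + (1/4) * y\<^sup>2) * E)) (T powr (- 1 - 1) * ((4 * (1/4)\<^sup>2 * y\<^sup>2 - 2 * (1/4)) * E))"
    using C12_at_gaussian[of "1 * t + \<tau>" "- 1" "1/4" "1 * x + c"] assms by (simp add: y_def E_def T_def)
  from C12_at_cmult[OF C12_at_affine[OF this], of 32]
  have "C12_at (\<lambda>t x. 32 * ((t + \<tau>) powr (- 1) * exp (- (1/4) * ((x + c) / sqrt (t + \<tau>))\<^sup>2))) t x
     (32 * (T powr (- 2) * ((- 1 + (1/4) * y\<^sup>2) * E))) (32 * (T powr (- 2) * ((1/4 * y\<^sup>2 - 1/2) * E)))"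
    by (simp add: power2_eq_square)
  moreover have "(32 * (T powr (- 2) * ((1/4 * y\<^sup>2 - 1/2) * E))) / 2 - (32 * (T powr (- 1) * E))\<^sup>2 / 2
      \<le> 32 * (T powr (- 2) * ((- 1 + (1/4) * y\<^sup>2) * E))"
  proof -
    have sq: "(32 * (T powr (- 1) * E))\<^sup>2 = 32 * (T powr (- 2) * (32 * E * E))"
      unfolding power_mult_distrib powr_minus1_sq[OF T] by (simp add: power2_eq_square)
    have "T powr (- 2) * E * (3/4 - y\<^sup>2 / 8 - 16 * E) \<le> 0"
      using supersolution_ineq[of "y\<^sup>2"] by (intro mult_nonneg_nonpos) (auto simp: E_def)
    moreover have id: "32 * (Q * ((1/4 * Y - 1/2) * E)) / 2 - 32 * (Q * (32 * E * E)) / 2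
      = 32 * (Q * ((- 1 + (1/4) * Y) * E)) + 32 * (Q * E * (3/4 - Y / 8 - 16 * E))" for Q Y
      by (simp add: field_simps)
    ultimately show ?thesis unfolding sq using id[of "T powr (- 2)" "y\<^sup>2"] by linarith
  qed
  ultimately show ?thesis unfolding E_def y_def T_def by blast
qed

text \<open>The time shift \<open>1 / n\<^sup>2\<close> gives the Gaussian height of order
  \<open>n\<^sup>2\<close> and width of order 1/n at time 0. It therefore lies above every bump of
  half-width 1/n and height at most \<open>n\<^sup>2\<close>.\<close>

lemma bsol_le_gaussian:
  assumes k: "k > 0" and n: "n > 0" "k \<le> n\<^sup>2" and t: "t \<ge> 0"
  shows "bsol k n t x \<le> 32 * ((t + 1 / n\<^sup>2) powr (- 1) * exp (- (1/4) * (x / sqrt (t + 1 / n\<^sup>2))\<^sup>2))"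
proof -
  define \<tau> where "\<tau> = 1 / n\<^sup>2"
  have \<tau>: "\<tau> > 0" using n by (simp add: \<tau>_def)
  have "bsol k n t x \<le> 32 * ((t + \<tau>) powr (- 1) * exp (- (1/4) * ((x + 0) / sqrt (t + \<tau>))\<^sup>2))"
  proof (rule sol_le_supersolution[OF sol_bsol[OF k] order.refl closed_UNIV, where T = t
      and s = "\<lambda>t x. 32 * ((t + \<tau>) powr (- 1) * exp (- (1/4) * ((x + 0) / sqrt (t + \<tau>))\<^sup>2))"])
    show "continuous_on ({0..t} \<times> UNIV) (\<lambda>(t, x). 32 * ((t + \<tau>) powr (- 1) * exp (- (1/4) * ((x + 0) / sqrt (t + \<tau>))\<^sup>2)))"
      by (rule continuous_on_gaussian) (use \<tau> in auto)
    show "bsol k n 0 x \<le> 32 * ((0 + \<tau>) powr (- 1) * exp (- (1/4) * ((x + 0) / sqrt (0 + \<tau>))\<^sup>2))" for x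
    proof (cases "\<bar>n * x\<bar> \<ge> 1")
      case True
      then show ?thesis using solD(2)[OF sol_bsol[OF k, of n]] bump_eq_0[of "n * x"] by simp
    next
      case False
      have e: "((x + 0) / sqrt (0 + \<tau>))\<^sup>2 = (n * x)\<^sup>2" using n \<tau>
        by (simp add: power_divide \<tau>_def real_sqrt_divide power_mult_distrib)
      have "(n * x)\<^sup>2 \<le> 1" using False by (simp add: abs_square_le_1)
      then have "1 - 1/4 \<le> exp (- (1/4) * (n * x)\<^sup>2)"
        using exp_ge_add_one_self[of "- (1/4) * (n * x)\<^sup>2"] by linarith
      then have E: "1 / 32 \<le> exp (- (1/4) * (n * x)\<^sup>2)" by simp
      have "bsol k n 0 x \<le> n\<^sup>2 * 1"
        using solD(2)[OF sol_bsol[OF k, of n]] mult_mono[OF n(2) bump_bounds(2)[of "n * x"]] bump_bounds n by simp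
      also have "\<dots> \<le> n\<^sup>2 * (32 * exp (- (1/4) * (n * x)\<^sup>2))" using E by (intro mult_left_mono) auto
      also have "\<dots> = 32 * ((0 + \<tau>) powr (- 1) * exp (- (1/4) * ((x + 0) / sqrt (0 + \<tau>))\<^sup>2))"
        unfolding e using \<tau> powr_minus1[OF \<tau>] by (simp add: \<tau>_def)
      finally show ?thesis .
    qed
    show "\<exists>a b. C12_at (\<lambda>t x. 32 * ((t + \<tau>) powr (- 1) * exp (- (1/4) * ((x + 0) / sqrt (t + \<tau>))\<^sup>2))) t x a b \<and>
      b / 2 - (32 * ((t + \<tau>) powr (- 1) * exp (- (1/4) * ((x + 0) / sqrt (t + \<tau>))\<^sup>2)))\<^sup>2 / 2 \<le> a" if "0 < t" for t x
      by (rule gaussian_supersolution) (use that \<tau> in simp)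
  qed (use t in auto)
  then show ?thesis by (simp add: \<tau>_def)
qed

lemma std_normal_density_bounds:
  "std_normal_density v \<le> 1/2" "(1/3) * exp (- v\<^sup>2 / 2) \<le> std_normal_density v"
proof -
  have "2 \<le> sqrt (2 * pi)" by (rule real_le_rsqrt) (use pi_gt3 in simp)
  then have "1 / sqrt (2 * pi) \<le> 1/2" by (simp add: field_simps)
  moreover have "exp (- v\<^sup>2 / 2) \<le> 1" by simp
  ultimately have "1 / sqrt (2 * pi) * exp (- v\<^sup>2 / 2) \<le> 1/2 * 1" by (intro mult_mono) auto
  then show "std_normal_density v \<le> 1/2" by (simp add: std_normal_density_def)
  have "sqrt (2 * pi) \<le> 3" by (rule real_le_lsqrt) (use pi_less_4 in auto)
  then have "1 / 3 \<le> 1 / sqrt (2 * pi)" by (intro frac_le) auto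
  then show "(1/3) * exp (- v\<^sup>2 / 2) \<le> std_normal_density v"
    unfolding std_normal_density_def by (rule mult_right_mono) simp
qed

lemma heat_bump_eq:
  assumes n: "n > 0" and t: "t > 0"
  shows "heat (\<lambda>x. n * bump (n * x)) t x = (\<integral>w. std_normal_density ((w / n - x) / sqrt t) * bump w \<partial>lborel) / sqrt t"
proof -
  have [measurable]: "bump \<in> borel_measurable borel" by (rule borel_measurable_continuous_onI[OF continuous_on_bump])
  have e: "- x / sqrt t + 1 / (n * sqrt t) * w = (w / n - x) / sqrt t" for w
    using n t by (simp add: field_simps)
  have e2: "n * (x + sqrt t * ((w / n - x) / sqrt t)) = w" for w using n t by simp
  have "heat (\<lambda>x. n * bump (n * x)) t x = (\<integral>z. std_normal_density z * (n * bump (n * (x + sqrt t * z))) \<partial>lborel)"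
    unfolding heat_def by (rule integral_std_gauss) measurable
  also have "\<dots> = \<bar>1 / (n * sqrt t)\<bar> *\<^sub>R (\<integral>w. std_normal_density (- x / sqrt t + 1 / (n * sqrt t) * w) *
      (n * bump (n * (x + sqrt t * (- x / sqrt t + 1 / (n * sqrt t) * w)))) \<partial>lborel)"
    by (rule lborel_integral_real_affine) (use n t in simp)
  also have "\<dots> = (1 / (n * sqrt t)) * (\<integral>w. n * (std_normal_density ((w / n - x) / sqrt t) * bump w) \<partial>lborel)"
    unfolding e e2 using n t by (simp add: mult.left_commute)
  also have "\<dots> = (\<integral>w. std_normal_density ((w / n - x) / sqrt t) * bump w \<partial>lborel) / sqrt t"
    using n by simp
  finally show ?thesis .
qed

text \<open>Both bounds are uniform in n because \<open>heat_bump_eq\<close> integrates over the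
  bump's own scale. Above, the density is at most 1/2 on a support of length 2; below, the bump is
  at least 1/4 on an interval of length 1, and the density contributes another 1/4.\<close>

lemma
  assumes n: "n > 0" and t: "t > 0"
  shows heat_bump_le: "heat (\<lambda>x. n * bump (n * x)) t x \<le> 1 / sqrt t"
    and heat_bump_ge: "n \<ge> 1 \<Longrightarrow> (1/16) * exp (- x\<^sup>2) \<le> heat (\<lambda>x. n * bump (n * x)) 1 x"
proof -
  have [measurable]: "bump \<in> borel_measurable borel" by (rule borel_measurable_continuous_onI[OF continuous_on_bump])
  have le: "std_normal_density v * bump w \<le> 1/2 * indicator {- 1..1} w" for v w
  proof (cases "w \<in> {- 1..1}")
    case True
    have "std_normal_density v * bump w \<le> 1/2 * 1"
      by (intro mult_mono std_normal_density_bounds bump_bounds) auto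
    then show ?thesis using True by simp
  next
    case False
    then show ?thesis using bump_eq_0[of w] by (auto simp: abs_le_iff)
  qed
  have ind: "integrable lborel (\<lambda>w::real. 1/2 * indicator {- 1..1} w :: real)"
    by (intro integrable_mult_right integrable_real_indicator) auto
  have i: "integrable lborel (\<lambda>w. std_normal_density ((w / n - x) / sqrt t) * bump w)" for t
    by (rule Bochner_Integration.integrable_bound[OF ind])
      (use le bump_bounds in \<open>auto simp: abs_mult\<close>)
  have "(\<integral>w. std_normal_density ((w / n - x) / sqrt t) * bump w \<partial>lborel) \<le> (\<integral>w. 1/2 * indicator {- 1..1::real} w \<partial>lborel)"
    by (rule integral_mono[OF i ind le])
  also have "\<dots> = 1" by simp
  finally show "heat (\<lambda>x. n * bump (n * x)) t x \<le> 1 / sqrt t"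
    unfolding heat_bump_eq[OF n t] using t by (simp add: divide_right_mono)
  assume n1: "n \<ge> 1"
  have ge: "(1/16) * exp (- x\<^sup>2) * indicator {- (1/2)..1/2} w \<le> std_normal_density ((w / n - x) / sqrt 1) * bump w" for w
  proof (cases "w \<in> {- (1/2)..1/2}")
    case True
    have "\<bar>w / n\<bar> \<le> 1/2"
    proof -
      have "\<bar>w\<bar> \<le> 1/2" using True by auto
      moreover have "\<bar>w\<bar> / n \<le> \<bar>w\<bar>" using n1 by (simp add: divide_le_eq mult_le_cancel_left1)
      moreover have "\<bar>w / n\<bar> = \<bar>w\<bar> / n" using n by simp
      ultimately show ?thesis by linarith
    qed
    then have w2: "(w / n)\<^sup>2 \<le> 1/4" using power_mono[of "\<bar>w / n\<bar>" "1/2" 2] by (simp add: power2_eq_square)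
    have "(p - x)\<^sup>2 \<le> 2 * p\<^sup>2 + 2 * x\<^sup>2" for p
      using zero_le_power2[of "p + x"] by (simp add: power2_eq_square algebra_simps)
    from this[of "w / n"] have v: "(w / n - x)\<^sup>2 / 2 \<le> x\<^sup>2 + 1/4" using w2 by linarith
    have "3/4 \<le> exp (- (1/4) :: real)" using exp_ge_add_one_self[of "- (1/4) :: real"] by simp
    then have "(3/4) * exp (- x\<^sup>2) \<le> exp (- (1/4)) * exp (- x\<^sup>2)" by (rule mult_right_mono) simp
    also have "\<dots> = exp (- (x\<^sup>2 + 1/4))" by (simp add: exp_add[symmetric])
    also have "\<dots> \<le> exp (- (w / n - x)\<^sup>2 / 2)" using v by simp
    finally have "(1/4) * exp (- x\<^sup>2) \<le> (1/3) * exp (- (w / n - x)\<^sup>2 / 2)" by simp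
    also have "\<dots> \<le> std_normal_density (w / n - x)" by (rule std_normal_density_bounds(2))
    finally have "(1/4 * exp (- x\<^sup>2)) * (1/4) \<le> std_normal_density (w / n - x) * bump w"
      using True by (intro mult_mono bump_ge) auto
    then show ?thesis using True by simp
  qed (simp add: bump_bounds)
  have "(1/16) * exp (- x\<^sup>2) = (\<integral>w. (1/16) * exp (- x\<^sup>2) * indicator {- (1/2)..1/2::real} w \<partial>lborel)"
    by simp
  also have "\<dots> \<le> (\<integral>w. std_normal_density ((w / n - x) / sqrt 1) * bump w \<partial>lborel)"
    by (rule integral_mono[OF _ i[of 1] ge]) simp
  finally show "(1/16) * exp (- x\<^sup>2) \<le> heat (\<lambda>x. n * bump (n * x)) 1 x"
    unfolding heat_bump_eq[OF n zero_less_one] by simp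
qed

text \<open>The heat flow of the datum is at most 1/sqrt t uniformly in n, so the loss u^2/2 is at
  most u/(2 sqrt t). That rate is integrable at 0, with integral sqrt t, and so exp(- sqrt t) times
  the heat flow is a subsolution.\<close>

lemma bsol_ge_at_1:
  assumes n: "n \<ge> 1"
  shows "(1/48) * exp (- x\<^sup>2) \<le> bsol n n 1 x"
proof -
  define f where "f = (\<lambda>x. n * bump (n * x))"
  have n0: "n > 0" using n by simp
  have u: "sol f (bsol n n)" unfolding f_def by (rule sol_bsol[OF n0])
  have f: "\<exists>f1 f2. C2b f f1 f2"
  proof -
    from C2b_affine[OF C2b_bump, of n n 0] have "\<exists>f1 f2. C2b (\<lambda>x. n * bump (n * x + 0)) f1 f2" by blast
    then show ?thesis unfolding f_def by simp
  qed
  have fc: "continuous_on UNIV f" unfolding f_def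
    by (intro continuous_intros continuous_on_compose2[OF continuous_on_bump[of UNIV]]) auto
  have fb: "0 \<le> f x" "f x \<le> n" for x using n0 bump_bounds[of "n * x"] by (auto simp: f_def mult_left_le)
  have hb: "0 \<le> heat f t x" "heat f t x \<le> n" for t x by (rule heat_bounds[OF fc fb])+
  have "exp (- sqrt 1) * heat f 1 x \<le> bsol n n 1 x"
  proof (rule subsolution_le_sol[OF u order.refl, where T = 1 and B = n and s = "\<lambda>t x. exp (- sqrt t) * heat f t x"])
    have "continuous_on UNIV (\<lambda>(t, x). heat f t x)"
      by (rule continuous_on_heat[OF fc, of n]) (use fb in simp)
    then show "continuous_on ({0..1} \<times> UNIV) (\<lambda>(t, x). exp (- sqrt t) * heat f t x)"
      unfolding case_prod_beta by (intro continuous_intros) (rule continuous_on_subset, auto)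
    show "exp (- sqrt t) * heat f t x \<le> n" if "t \<in> {0..1}" for t x
    proof -
      have "exp (- sqrt t) * heat f t x \<le> 1 * n" using hb that n0 by (intro mult_mono) auto
      then show ?thesis by simp
    qed
    show "exp (- sqrt 0) * heat f 0 x \<le> bsol n n 0 x" for x using solD(2)[OF u] by simp
    fix t x :: real assume t: "0 < t"
    from f obtain f1 f2 where C: "C2b f f1 f2" by blast
    define g where "g = exp (- sqrt t)"
    have "((\<lambda>s. exp (- sqrt s)) has_real_derivative g * (- (inverse (sqrt t) / 2))) (at t)"
      unfolding g_def by (intro DERIV_fun_exp DERIV_minus DERIV_real_sqrt t)
    from C12_at_time_mult[OF C12_at_heat[OF C t] this]
    have c: "C12_at (\<lambda>t x. exp (- sqrt t) * heat f t x) t x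
      (g * (- (inverse (sqrt t) / 2)) * heat f t x + g * (heat f2 t x / 2)) (g * heat f2 t x)"
      unfolding g_def .
    have g: "0 < g" "g \<le> 1" using t by (auto simp: g_def)
    have "g * heat f t x \<le> 1 * (1 / sqrt t)"
      using heat_bump_le[OF n0 t] hb g by (intro mult_mono) (auto simp: f_def)
    then have "(g * heat f t x) * (g * heat f t x) \<le> (g * heat f t x) * inverse (sqrt t)"
      using hb g by (intro mult_left_mono) (auto simp: divide_inverse)
    then have "g * (- (inverse (sqrt t) / 2)) * heat f t x + g * (heat f2 t x / 2) \<le> g * heat f2 t x / 2 - (g * heat f t x)\<^sup>2 / 2"
      by (simp add: power2_eq_square algebra_simps)
    with c show "\<exists>a b. C12_at (\<lambda>t x. exp (- sqrt t) * heat f t x) t x a b \<and> a \<le> b / 2 - (exp (- sqrt t) * heat f t x)\<^sup>2 / 2"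
      unfolding g_def by blast
  qed simp
  moreover have "(1/3) * ((1/16) * exp (- x\<^sup>2)) \<le> exp (- sqrt 1) * heat f 1 x"
  proof (rule mult_mono)
    show "(1/3::real) \<le> exp (- sqrt 1)" using exp_le by (simp add: exp_minus field_simps)
    show "(1/16) * exp (- x\<^sup>2) \<le> heat f 1 x" unfolding f_def by (rule heat_bump_ge[OF n0 zero_less_one n])
  qed auto
  ultimately show ?thesis by simp
qed

text \<open>The Gaussian profile of the heat kernel with the power - 1 in place of - 1/2 is a strict
  subsolution of the heat equation, and this slack pays for the small nonlinearity. The time shift -
  1/2 makes it coincide at t = 1 with (1/48) exp(- x^2), the bound already known there.\<close>

lemma bsol_ge:
  assumes n: "n \<ge> 1" and t: "t \<ge> 1"
  shows "(1/96) / t * exp (- x\<^sup>2 / t) \<le> bsol n n t x"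
proof -
  define \<tau> where "\<tau> = (- 1/2 :: real)"
  have n0: "n > 0" using n by simp
  have "(1/96) * ((t + \<tau>) powr (- 1) * exp (- (1/2) * ((x + 0) / sqrt (t + \<tau>))\<^sup>2)) \<le> bsol n n t x"
  proof (rule subsolution_le_sol[OF sol_bsol[OF n0], where T = t and ?t0.0 = 1 and B = "1"
      and s = "\<lambda>t x. (1/96) * ((t + \<tau>) powr (- 1) * exp (- (1/2) * ((x + 0) / sqrt (t + \<tau>))\<^sup>2))"])
    show "continuous_on ({1..t} \<times> UNIV) (\<lambda>(t, x). (1/96) * ((t + \<tau>) powr (- 1) * exp (- (1/2) * ((x + 0) / sqrt (t + \<tau>))\<^sup>2)))"
      by (rule continuous_on_gaussian) (auto simp: \<tau>_def)
    show "(1/96) * ((s + \<tau>) powr (- 1) * exp (- (1/2) * ((x + 0) / sqrt (s + \<tau>))\<^sup>2)) \<le> 1" if "s \<in> {1..t}" for s x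
    proof -
      have "s + \<tau> \<ge> 1/2" using that by (auto simp: \<tau>_def)
      then have "(s + \<tau>) powr (- 1) \<le> 2" by (simp add: powr_minus1 field_simps)
      then have "(s + \<tau>) powr (- 1) * exp (- (1/2) * ((x + 0) / sqrt (s + \<tau>))\<^sup>2) \<le> 2 * 1" by (intro mult_mono) auto
      then show ?thesis by simp
    qed
    show "(1/96) * ((1 + \<tau>) powr (- 1) * exp (- (1/2) * ((x + 0) / sqrt (1 + \<tau>))\<^sup>2)) \<le> bsol n n 1 x" for x
    proof -
      have "(1 + \<tau>) powr (- 1) = 2" "- (1/2) * ((x + 0) / sqrt (1 + \<tau>))\<^sup>2 = - x\<^sup>2"
        by (simp_all add: \<tau>_def powr_minus_divide power_divide)
      then show ?thesis using bsol_ge_at_1[OF n, of x] by simp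
    qed
    fix s x :: real assume s: "1 < s"
    define y where "y = (x + 0) / sqrt (s + \<tau>)"
    define E where "E = exp (- (1/2) * y\<^sup>2)"
    define T where "T = s + \<tau>"
    have T: "T > 0" using s by (simp add: T_def \<tau>_def)
    have "C12_at (\<lambda>t x. t powr (- 1) * exp (- (1/2) * (x / sqrt t)\<^sup>2)) (1 * s + \<tau>) (1 * x + 0)
       (T powr (- 1 - 1) * ((- 1 + (1/2) * y\<^sup>2) * E)) (T powr (- 1 - 1) * ((4 * (1/2)\<^sup>2 * y\<^sup>2 - 2 * (1/2)) * E))"
      using C12_at_gaussian[of "1 * s + \<tau>" "- 1" "1/2" "1 * x + 0"] T by (simp add: y_def E_def T_def)
    from C12_at_cmult[OF C12_at_affine[OF this], of "1/96"]
    have "C12_at (\<lambda>t x. (1/96) * ((t + \<tau>) powr (- 1) * exp (- (1/2) * ((x + 0) / sqrt (t + \<tau>))\<^sup>2))) s x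
       ((1/96) * (T powr (- 2) * ((- 1 + (1/2) * y\<^sup>2) * E))) ((1/96) * (T powr (- 2) * ((y\<^sup>2 - 1) * E)))"
      by (simp add: power2_eq_square)
    moreover have "(1/96) * (T powr (- 2) * ((- 1 + (1/2) * y\<^sup>2) * E))
        \<le> ((1/96) * (T powr (- 2) * ((y\<^sup>2 - 1) * E))) / 2 - ((1/96) * (T powr (- 1) * E))\<^sup>2 / 2"
    proof -
      have sq: "((1/96) * (T powr (- 1) * E))\<^sup>2 = (1/96) * (T powr (- 2) * ((1/96) * E * E))"
        unfolding power_mult_distrib powr_minus1_sq[OF T] by (simp add: power2_eq_square)
      have "E \<le> 1" by (simp add: E_def)
      then have "1/96 * E - 1 \<le> 0" by linarith
      then have "T powr (- 2) * E * (1/96 * E - 1) \<le> 0"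
        by (rule mult_nonneg_nonpos[rotated]) (simp add: E_def)
      moreover have id: "(1/96) * (Q * ((Y - 1) * E)) / 2 - (1/96) * (Q * ((1/96) * E * E)) / 2
        = (1/96) * (Q * ((- 1 + (1/2) * Y) * E)) - (1/192) * (Q * E * (1/96 * E - 1))" for Q Y
        by (simp add: field_simps)
      ultimately show ?thesis unfolding sq using id[of "T powr (- 2)" "y\<^sup>2"] by linarith
    qed
    ultimately show "\<exists>a b. C12_at (\<lambda>t x. (1/96) * ((t + \<tau>) powr (- 1) * exp (- (1/2) * ((x + 0) / sqrt (t + \<tau>))\<^sup>2))) s x a b \<and>
      a \<le> b / 2 - ((1/96) * ((s + \<tau>) powr (- 1) * exp (- (1/2) * ((x + 0) / sqrt (s + \<tau>))\<^sup>2)))\<^sup>2 / 2"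
      unfolding E_def y_def T_def by blast
  qed (use t in auto)
  moreover have "(1/96) / t * exp (- x\<^sup>2 / t) \<le> (1/96) * ((t + \<tau>) powr (- 1) * exp (- (1/2) * ((x + 0) / sqrt (t + \<tau>))\<^sup>2))"
  proof -
    have T: "t + \<tau> > 0" "t + \<tau> \<le> t" "t \<le> 2 * (t + \<tau>)" using t by (auto simp: \<tau>_def)
    have 1: "1 / t \<le> (t + \<tau>) powr (- 1)" unfolding powr_minus1[OF T(1)] using T by (intro frac_le) auto
    have "x\<^sup>2 / (2 * (t + \<tau>)) \<le> x\<^sup>2 / t" using T t by (intro frac_le) auto
    then have "exp (- x\<^sup>2 / t) \<le> exp (- (1/2) * ((x + 0) / sqrt (t + \<tau>))\<^sup>2)" using T by (simp add: power_divide)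
    with 1 have "1 / t * exp (- x\<^sup>2 / t) \<le> (t + \<tau>) powr (- 1) * exp (- (1/2) * ((x + 0) / sqrt (t + \<tau>))\<^sup>2)"
      by (rule mult_mono) auto
    then show ?thesis by simp
  qed
  ultimately show ?thesis by linarith
qed

text \<open>With \<open>E = exp (- q / 8)\<close>, \<open>q = y\<^sup>2\<close>, \<open>y = x / sqrt t\<close>, and \<open>U\<close>, \<open>V\<close> the values of \<open>t u\<close>, \<open>t v\<close>, this is
  the sign condition for \<open>t\<close> to the power \<open>- \<delta>\<close> times \<open>v + (\<eta> / t) E\<close> to be a supersolution
  of the equation for \<open>v - u\<close>: for \<open>q \<le> 16\<close> the lower bound on \<open>u\<close> helps, for \<open>q \<ge> 16\<close> the
  Gaussian factor.\<close>

lemma diff_bracket_nonpos: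
  fixes m \<delta> \<eta> U V E q :: real
  assumes m: "0 < m" "m \<le> 1" and \<eta>: "\<eta> = m\<^sup>2 / 4" and \<delta>: "\<delta> = m\<^sup>2 / 256"
    and E: "0 < E" "E \<le> 1" and U: "0 \<le> U" and V: "0 \<le> V" "V \<le> 32 * E"
    and inner: "q \<le> 16 \<Longrightarrow> m \<le> U \<and> m \<le> V" and q: "0 \<le> q"
  shows "V * (\<delta> - U / 2) - \<eta> * (E * (3 * q / 32 - 7 / 8 - \<delta>)) \<le> 0"
proof (cases "q \<le> 16")
  case True
  have m2: "m\<^sup>2 \<le> m" using m by (simp add: power2_eq_square mult_left_le)
  then have d: "\<delta> \<le> m / 4" "\<delta> \<le> 1 / 8" using m unfolding \<delta> by linarith+
  have "V * (\<delta> - U / 2) \<le> V * (- (m / 4))" using V inner[OF True] d by (intro mult_left_mono) auto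
  also have "\<dots> \<le> m * (- (m / 4))" using inner[OF True] m by (intro mult_right_mono_neg) auto
  finally have 1: "V * (\<delta> - U / 2) \<le> - \<eta>" by (simp add: \<eta> power2_eq_square)
  have "E * (7 / 8 + \<delta> - 3 * q / 32) \<le> E * 1" using E d q by (intro mult_left_mono) auto
  then have "E * (7 / 8 + \<delta> - 3 * q / 32) \<le> 1" using E by linarith
  then have "\<eta> * (E * (7 / 8 + \<delta> - 3 * q / 32)) \<le> \<eta> * 1" by (rule mult_left_mono) (simp add: \<eta>)
  moreover have "\<eta> * (E * (7 / 8 + \<delta> - 3 * q / 32)) = - (\<eta> * (E * (3 * q / 32 - 7 / 8 - \<delta>)))"
    by (simp add: algebra_simps)
  ultimately show ?thesis using 1 by linarith
next
  case False
  have "m\<^sup>2 \<le> 1" using m by (simp add: power_le_one)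
  then have d: "0 \<le> \<delta>" "\<delta> \<le> 1 / 8" unfolding \<delta> by auto
  \<comment> \<open>Here 32 \<delta> = \<eta>/2 fixes the ratio of the two constants, and 3q/32 >
    3/2 leaves at least 1/2 in the other bracket.\<close>
  have "V * (\<delta> - U / 2) \<le> V * \<delta>" using V U by (intro mult_left_mono) auto
  also have "\<dots> \<le> 32 * E * \<delta>" using V d by (intro mult_right_mono) auto
  finally have 1: "V * (\<delta> - U / 2) \<le> \<eta> * (E * (1/2))" by (simp add: \<eta> \<delta> mult.commute)
  have "\<eta> * (E * (1/2)) \<le> \<eta> * (E * (3 * q / 32 - 7 / 8 - \<delta>))"
    using False d E by (intro mult_left_mono) (auto simp: \<eta>)
  then show ?thesis using 1 by linarith
qed

text \<open>Solutions forget the mass of their datum: both are of order 1/t, yet the excess of one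
  over the other is smaller by a power of t. The constants come only from the two Gaussian bounds
  and so are common to all parameters. The condition l \<le> n ensures that the height l n is at
  most \<open>n\<^sup>2\<close>, as the upper Gaussian bound requires.\<close>

lemma bsol_diff_decay:
  "\<exists>\<delta>>0. \<exists>C>0. \<forall>l n M t x. 1 \<le> l \<and> l \<le> n \<and> 1 \<le> M \<and> 1 \<le> t \<longrightarrow>
     bsol (l * n) n t x - bsol M M t x \<le> C * t powr (- 1 - \<delta>)"
proof -
  \<comment> \<open>The lower bound \<open>bsol_ge\<close>, multiplied by t, on the region
    \<open>x\<^sup>2 / t \<le> 16\<close> where \<open>diff_bracket_nonpos\<close> needs it.\<close>
  define m where "m = (1/96) * exp (- 16 :: real)"
  define \<eta> where "\<eta> = m\<^sup>2 / 4"
  define \<delta> where "\<delta> = m\<^sup>2 / 256"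
  have m: "0 < m" "m \<le> 1"
  proof -
    have "exp (- 16 :: real) \<le> 1" by simp
    then show "0 < m" "m \<le> 1" unfolding m_def by (simp, linarith)
  qed
  have \<delta>0: "\<delta> > 0" and \<eta>0: "\<eta> > 0" using m by (auto simp: \<delta>_def \<eta>_def)
  have main: "bsol (l * n) n t x - bsol M M t x \<le> (2 + \<eta>) * t powr (- 1 - \<delta>)"
    if l: "1 \<le> l" and n: "l \<le> n" and M: "1 \<le> M" and t: "1 \<le> t" for l n M t x
  proof -
    define v where "v = bsol (l * n) n"
    define u where "u = bsol M M"
    have ln: "l * n > 0" "n \<ge> 1" "n > 0" "M > 0" using l n M by auto
    have ln2: "l * n \<le> n\<^sup>2" using l n by (simp add: power2_eq_square)
    have nln: "n \<le> l * n" using l ln by simp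
    note sv = sol_bsol[OF ln(1), of n, folded v_def]
    note su = sol_bsol[OF ln(4), of M, folded u_def]
    have v_lower: "m \<le> t * v t x" and u_lower: "m \<le> t * u t x" if t: "t \<ge> 1" and y: "(x / sqrt t)\<^sup>2 \<le> 16" for t x
    proof -
      have "x\<^sup>2 / t \<le> 16" using t y by (simp add: power_divide)
      then have "exp (- 16) \<le> exp (- x\<^sup>2 / t)" by simp
      then have e: "m / t \<le> (1/96) / t * exp (- x\<^sup>2 / t)" using t unfolding m_def by (simp add: divide_right_mono)
      have "bsol n n t x \<le> v t x" unfolding v_def by (rule bsol_mono) (use ln nln t in auto)
      then have "m / t \<le> v t x" using e bsol_ge[OF ln(2) t, of x] by linarith
      then show "m \<le> t * v t x" using t by (simp add: field_simps)
      have "m / t \<le> u t x" using e bsol_ge[OF M t, of x] unfolding u_def by linarith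
      then show "m \<le> t * u t x" using t by (simp add: field_simps)
    qed
    have v_upper: "t * v t x \<le> 32 * exp (- (1/8) * (x / sqrt t)\<^sup>2)" if t: "t \<ge> 1" for t x
    proof -
      define T where "T = t + 1 / n\<^sup>2"
      have "1 \<le> n\<^sup>2" using ln by simp
      then have "0 < 1 / n\<^sup>2" "1 / n\<^sup>2 \<le> 1" using ln(3) by (simp_all only: divide_le_eq_1 zero_less_divide_iff zero_less_power) simp_all
      then have T: "t \<le> T" "T \<le> 2 * t" "T > 0" using t unfolding T_def by linarith+
      have v1: "v t x \<le> 32 * (T powr (- 1) * exp (- (1/4) * (x / sqrt T)\<^sup>2))"
        unfolding v_def T_def by (rule bsol_le_gaussian) (use ln ln2 t in auto)
      have "(1/8) * (x / sqrt t)\<^sup>2 \<le> (1/4) * (x / sqrt T)\<^sup>2"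
      proof -
        have "x\<^sup>2 / (8 * t) \<le> x\<^sup>2 / (4 * T)" using T t by (intro frac_le) auto
        then show ?thesis using T t by (simp add: power_divide)
      qed
      moreover have "T powr (- 1) \<le> 1 / t" unfolding powr_minus1[OF T(3)] using T t by (intro frac_le) auto
      ultimately have "T powr (- 1) * exp (- (1/4) * (x / sqrt T)\<^sup>2) \<le> 1 / t * exp (- (1/8) * (x / sqrt t)\<^sup>2)"
        using t by (intro mult_mono) auto
      with v1 have "v t x \<le> 32 * (1 / t * exp (- (1/8) * (x / sqrt t)\<^sup>2))" by linarith
      then show ?thesis using t by (simp add: field_simps)
    qed
    have v0: "0 \<le> v t x" "0 \<le> u t x" if "t \<ge> 0" for t x using solD(3)[OF sv] solD(3)[OF su] that by auto
    have v2: "v t x \<le> 2 / t" if "t > 0" for t x by (rule sol_le_2_div_t[OF sv that])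
    define k where "k = (\<lambda>t x::real. t powr (- 1 - \<delta>) * exp (- (1/8) * (x / sqrt t)\<^sup>2))"
    \<comment> \<open>At t = 1 the first summand is \<open>v\<close> itself, so the initial
      comparison holds without any estimate.\<close>
    define S where "S = (\<lambda>t x. t powr (- \<delta>) * v t x + \<eta> * k t x)"
    have k0: "k t x \<ge> 0" for t x by (simp add: k_def)
    have "v t x - u t x - S t x \<le> 0"
    proof (rule max_principle[OF closed_UNIV, where w = "\<lambda>t x. v t x - u t x - S t x" and B = 2 and T = t and ?t0.0 = 1])
      have sub: "{1..t} \<times> UNIV \<subseteq> {0..} \<times> (UNIV :: real set)" by auto
      have cv: "continuous_on ({1..t} \<times> UNIV) (\<lambda>p. v (fst p) (snd p))" "continuous_on ({1..t} \<times> UNIV) (\<lambda>p. u (fst p) (snd p))"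
        using sol_cont_subset[OF sv sub] sol_cont_subset[OF su sub] by (simp_all add: case_prod_beta)
      have "continuous_on ({1..t} \<times> UNIV) (\<lambda>(t, x). \<eta> * ((t + 0) powr (- 1 - \<delta>) * exp (- (1/8) * ((x + 0) / sqrt (t + 0))\<^sup>2)))"
        by (rule continuous_on_gaussian) auto
      then have ck: "continuous_on ({1..t} \<times> UNIV) (\<lambda>p. \<eta> * k (fst p) (snd p))"
        by (simp add: k_def case_prod_beta)
      have "continuous_on ({1..t} \<times> UNIV) (\<lambda>p::real \<times> real. fst p powr (- \<delta>))"
        by (intro continuous_intros) auto
      then show "continuous_on ({1..t} \<times> UNIV) (\<lambda>(t, x). v t x - u t x - S t x)"
        unfolding S_def case_prod_beta by (intro continuous_on_diff continuous_on_add continuous_on_mult cv ck)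
    next
      fix s x assume s: "s \<in> {1..t}"
      have "2 / s \<le> 2 / 1" using s by (intro frac_le) auto
      moreover have "S s x \<ge> 0" unfolding S_def
        by (intro add_nonneg_nonneg mult_nonneg_nonneg) (use v0(1)[of s x] s k0[of s x] \<eta>0 in auto)
      ultimately show "v s x - u s x - S s x \<le> 2" using v2[of s x] v0(2)[of s x] s unfolding atLeastAtMost_iff by linarith
    next
      show "v 1 x - u 1 x - S 1 x \<le> 0" for x
        using v0(2)[of 1 x] mult_nonneg_nonneg[OF less_imp_le[OF \<eta>0] k0[of 1 x]] unfolding S_def by simp
    next
      fix s x assume s: "1 < s" "s \<le> t" and pos: "v s x - u s x - S s x > 0"
      have s0: "s > 0" using s by simp
      \<comment> \<open>All powers of \<open>s\<close> that occur are \<open>P\<close> times integer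
        powers of \<open>s\<close>; the inequality then becomes polynomial and has the shape of
        \<open>diff_bracket_nonpos\<close>.\<close>
      define P where "P = s powr (- 2 - \<delta>)"
      define E where "E = exp (- (1/8) * (x / sqrt s)\<^sup>2)"
      define q where "q = (x / sqrt s)\<^sup>2"
      have P: "P > 0" using s0 by (simp add: P_def)
      have p1: "s powr (- \<delta> - 1) = s * P" "s powr (- 1 - \<delta>) = s * P" "s powr (- \<delta>) = s * (s * P)" "s powr (- 1 - \<delta> - 1) = P"
      proof -
        have sp: "s * s powr b = s powr (1 + b)" for b using powr_add[of s 1 b] s0 by simp
        have e: "1 + (- 2 - \<delta>) = - 1 - \<delta>" "1 + (- 1 - \<delta>) = - \<delta>" "- \<delta> - 1 = - 1 - \<delta>" by simp_all
        show a: "s powr (- 1 - \<delta>) = s * P" unfolding P_def sp e ..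
        then show "s powr (- \<delta> - 1) = s * P" unfolding e .
        show "s powr (- \<delta>) = s * (s * P)" unfolding a[symmetric] sp e ..
        have "- 1 - \<delta> - 1 = - 2 - \<delta>" by simp
        then show "s powr (- 1 - \<delta> - 1) = P" unfolding P_def by (simp only:)
      qed
      from solD(5)[OF sv s0, of x] obtain va vb where va: "C12_at v s x va vb" "va = vb / 2 - (v s x)\<^sup>2 / 2" by blast
      from solD(5)[OF su s0, of x] obtain ua ub where ua: "C12_at u s x ua ub" "ua = ub / 2 - (u s x)\<^sup>2 / 2" by blast
      have "((\<lambda>r. r powr (- \<delta>)) has_real_derivative - \<delta> * (s * P)) (at s)"
        using has_real_derivative_powr[OF s0, of "- \<delta>"] p1(1) by simp
      from C12_at_time_mult[OF va(1) this]
      have c1: "C12_at (\<lambda>t x. t powr (- \<delta>) * v t x) s x (- \<delta> * (s * P) * v s x + s * (s * P) * va) (s * (s * P) * vb)"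
        unfolding p1(3) .
      have c2: "C12_at (\<lambda>t x. \<eta> * k t x) s x (\<eta> * (P * ((- 1 - \<delta> + 1/8 * q) * E))) (\<eta> * (P * ((4 * (1/8)\<^sup>2 * q - 2 * (1/8)) * E)))"
        using C12_at_cmult[OF C12_at_gaussian[OF s0, of "- 1 - \<delta>" "1/8" x], of \<eta>]
        unfolding k_def E_def q_def p1(4) .
      define wa where "wa = va - ua - (- \<delta> * (s * P) * v s x + s * (s * P) * va + \<eta> * (P * ((- 1 - \<delta> + 1/8 * q) * E)))"
      define wb where "wb = vb - ub - (s * (s * P) * vb + \<eta> * (P * ((4 * (1/8)\<^sup>2 * q - 2 * (1/8)) * E)))"
      have c: "C12_at (\<lambda>t x. v t x - u t x - S t x) s x wa wb"
        unfolding wa_def wb_def S_def by (rule C12_at_diff[OF C12_at_diff[OF va(1) ua(1)] C12_at_add[OF c1 c2]])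
      \<comment> \<open>Only points with v - u > S matter. There v^2 - u^2 is bounded below by s
        powr (- \<delta>) times v (v + u), which makes the nonlinear term comparable with those
        coming from \<open>S\<close>.\<close>
      have vu: "v s x - u s x \<ge> s * (s * P) * v s x"
        using pos k0[of s x] \<eta>0 mult_nonneg_nonneg[of \<eta> "k s x"] unfolding S_def p1(3) by linarith
      have "(s * (s * P) * v s x) * (v s x + u s x) \<le> (v s x - u s x) * (v s x + u s x)"
        using v0[of s x] s0 by (intro mult_right_mono vu) auto
      then have sq: "(s * (s * P) * v s x) * (v s x + u s x) \<le> (v s x)\<^sup>2 - (u s x)\<^sup>2"
        by (simp add: power2_eq_square algebra_simps)
      have br: "(s * v s x) * (\<delta> - (s * u s x) / 2) - \<eta> * (E * (3 * q / 32 - 7 / 8 - \<delta>)) \<le> 0"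
      proof (rule diff_bracket_nonpos[OF m \<eta>_def \<delta>_def])
        show "s * v s x \<le> 32 * E" unfolding E_def by (rule v_upper) (use s in simp)
        show "m \<le> s * u s x \<and> m \<le> s * v s x" if "q \<le> 16"
          using v_lower[of s x] u_lower[of s x] that s by (auto simp: q_def)
      qed (use v0[of s x] s0 in \<open>auto simp: E_def q_def\<close>)
      have "wa - wb / 2 = - ((v s x)\<^sup>2 - (u s x)\<^sup>2) / 2 + \<delta> * (s * P) * v s x + s * (s * P) * ((v s x)\<^sup>2 / 2)
           - \<eta> * (P * (E * (3 * q / 32 - 7 / 8 - \<delta>)))"
        unfolding wa_def wb_def va(2) ua(2) by (simp add: field_simps power2_eq_square)
      also have "\<dots> \<le> - ((s * (s * P) * v s x) * (v s x + u s x)) / 2 + \<delta> * (s * P) * v s x + s * (s * P) * ((v s x)\<^sup>2 / 2)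
           - \<eta> * (P * (E * (3 * q / 32 - 7 / 8 - \<delta>)))"
        by (intro diff_right_mono add_right_mono divide_right_mono) (use sq in simp_all)
      also have "\<dots> = P * ((s * v s x) * (\<delta> - (s * u s x) / 2) - \<eta> * (E * (3 * q / 32 - 7 / 8 - \<delta>)))"
        by (simp add: field_simps power2_eq_square)
      also have "\<dots> \<le> 0" using br P by (intro mult_nonneg_nonpos) auto
      finally have "wa \<le> wb / 2" by linarith
      with c show "x \<in> interior UNIV \<and> (\<exists>a b. C12_at (\<lambda>t x. v t x - u t x - S t x) s x a b \<and> a \<le> b / 2)" by auto
    qed (use t in auto)
    moreover have "S t x \<le> (2 + \<eta>) * t powr (- 1 - \<delta>)"
    proof -
      have "t powr (- \<delta>) * v t x \<le> t powr (- \<delta>) * (2 / t)" using v2[of t x] t by (intro mult_left_mono) auto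
      also have "\<dots> = 2 * t powr (- 1 - \<delta>)"
        using t by (simp add: powr_diff powr_minus_divide[of t 1] divide_simps) (simp add: powr_diff[symmetric] powr_minus_divide powr_add)
      finally have a: "t powr (- \<delta>) * v t x \<le> 2 * t powr (- 1 - \<delta>)" .
      have "k t x \<le> t powr (- 1 - \<delta>) * 1" unfolding k_def by (intro mult_left_mono) auto
      then have "\<eta> * k t x \<le> \<eta> * t powr (- 1 - \<delta>)" using \<eta>0 by simp
      with a show ?thesis unfolding S_def by (simp add: algebra_simps)
    qed
    ultimately show ?thesis unfolding u_def v_def by linarith
  qed
  show ?thesis
    by (intro exI[of _ \<delta>] exI[of _ "2 + \<eta>"] conjI \<delta>0 allI impI main add_pos_pos \<eta>0) auto
qed

text \<open>The height \<open>K\<close> may be far larger than \<open>M\<^sup>2\<close>, so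
  \<open>bsol_le_gaussian\<close> is out of reach. Instead the comparison runs on x \<ge> 1, where
  the datum vanishes: on the boundary the solution is at most 2/(t + 2/K), and a Gaussian
  supersolution centred at 1 with the same time shift 2/K equals 32/(t + 2/K) there. Evenness and
  the bound 2 cover the rest.\<close>

lemma bsol_tail:
  assumes K: "K \<ge> 2" and M: "M \<ge> 1"
  shows "bsol K M 1 x \<le> 64 * exp (- (1/16) * x\<^sup>2)"
proof -
  have K0: "K > 0" using K by simp
  define \<tau> where "\<tau> = 2 / K"
  have \<tau>: "0 < \<tau>" "\<tau> \<le> 1" using K by (auto simp: \<tau>_def)
  note su = sol_bsol[OF K0, of M]
  have ub: "bsol K M t y \<le> 2 / (t + \<tau>)" if "t \<ge> 0" for t y
    unfolding \<tau>_def by (rule sol_le_2_div[OF su _ K0 that]) (use K0 bump_bounds in \<open>auto simp: mult_left_le\<close>)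
  have "3/4 \<le> exp (- (1/16) :: real)" using exp_ge_add_one_self[of "- (1/16) :: real"] by simp
  have right: "bsol K M 1 y \<le> 64 * exp (- (1/16) * y\<^sup>2)" if y: "y \<ge> 1" for y
  proof -
    have "bsol K M 1 y \<le> 32 * ((1 + \<tau>) powr (- 1) * exp (- (1/4) * ((y + (- 1)) / sqrt (1 + \<tau>))\<^sup>2))"
    proof (rule sol_le_supersolution[OF su order.refl, where T = 1 and D = "{1..}"
        and s = "\<lambda>t x. 32 * ((t + \<tau>) powr (- 1) * exp (- (1/4) * ((x + (- 1)) / sqrt (t + \<tau>))\<^sup>2))"])
      show "continuous_on ({0..1} \<times> {1..}) (\<lambda>(t, x). 32 * ((t + \<tau>) powr (- 1) * exp (- (1/4) * ((x + (- 1)) / sqrt (t + \<tau>))\<^sup>2)))"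
        by (rule continuous_on_gaussian) (use \<tau> in auto)
      show "bsol K M 0 x \<le> 32 * ((0 + \<tau>) powr (- 1) * exp (- (1/4) * ((x + (- 1)) / sqrt (0 + \<tau>))\<^sup>2))" if "x \<in> {1..}" for x
      proof -
        have "1 * 1 \<le> M * x" using M that by (intro mult_mono) auto
        then show ?thesis using solD(2)[OF su] bump_eq_0[of "M * x"] by simp
      qed
      show "bsol K M t x \<le> 32 * ((t + \<tau>) powr (- 1) * exp (- (1/4) * ((x + (- 1)) / sqrt (t + \<tau>))\<^sup>2))"
        if "0 < t" "t \<le> 1" "x \<in> {1..}" "x \<notin> interior {1..}" for t x
      proof -
        have "x = 1" using that(3,4) by (simp add: interior_real_atLeast)
        have "bsol K M t x \<le> 2 / (t + \<tau>)" by (rule ub) (use that in simp)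
        also have "\<dots> \<le> 32 * (t + \<tau>) powr (- 1)" using that \<tau> by (simp add: powr_minus1 divide_right_mono)
        finally show ?thesis using \<open>x = 1\<close> by simp
      qed
      show "\<exists>a b. C12_at (\<lambda>t x. 32 * ((t + \<tau>) powr (- 1) * exp (- (1/4) * ((x + (- 1)) / sqrt (t + \<tau>))\<^sup>2))) t x a b \<and>
        b / 2 - (32 * ((t + \<tau>) powr (- 1) * exp (- (1/4) * ((x + (- 1)) / sqrt (t + \<tau>))\<^sup>2)))\<^sup>2 / 2 \<le> a" if "0 < t" for t x
        by (rule gaussian_supersolution) (use that \<tau> in simp)
    qed (use y in auto)
    also have "\<dots> \<le> 32 * (1 * (2 * exp (- (1/16) * y\<^sup>2)))"
    proof (intro mult_left_mono mult_mono)
      show "(1 + \<tau>) powr (- 1) \<le> 1" using \<tau> by (simp add: powr_minus1)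
      have "(y - 1)\<^sup>2 \<ge> y\<^sup>2 / 2 - 1"
        using zero_le_power2[of "y - 2"] by (simp add: power2_eq_square algebra_simps)
      moreover have "(y - 1)\<^sup>2 / 8 \<le> (1/4) * ((y + (- 1)) / sqrt (1 + \<tau>))\<^sup>2"
      proof -
        have "(y - 1)\<^sup>2 / 8 \<le> (y - 1)\<^sup>2 / (4 * (1 + \<tau>))" using \<tau> by (intro frac_le) auto
        then show ?thesis using \<tau> by (simp add: power_divide)
      qed
      ultimately have "- (1/4) * ((y + (- 1)) / sqrt (1 + \<tau>))\<^sup>2 \<le> 1/8 + - (1/16) * y\<^sup>2" by linarith
      then have "exp (- (1/4) * ((y + (- 1)) / sqrt (1 + \<tau>))\<^sup>2) \<le> exp (1/8 + - (1/16) * y\<^sup>2)" by (simp only: exp_le_cancel_iff)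
      also have "\<dots> = exp (1/8) * exp (- (1/16) * y\<^sup>2)" by (rule exp_add)
      also have "\<dots> \<le> 2 * exp (- (1/16) * y\<^sup>2)"
      proof (rule mult_right_mono)
        have "1 - 1/8 \<le> exp (- (1/8) :: real)" using exp_ge_add_one_self[of "- (1/8) :: real"] by simp
        then show "exp (1/8) \<le> (2::real)" by (simp add: exp_minus field_simps)
      qed simp
      finally show "exp (- (1/4) * ((y + (- 1)) / sqrt (1 + \<tau>))\<^sup>2) \<le> 2 * exp (- (1/16) * y\<^sup>2)" .
    qed auto
    finally show ?thesis by simp
  qed
  consider "x \<ge> 1" | "x \<le> - 1" | "\<bar>x\<bar> \<le> 1" by linarith
  then show ?thesis
  proof cases
    case 2
    then show ?thesis using right[of "- x"] bsol_even[OF K0, of 1 M x] by simp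
  next
    case 3
    then have "x\<^sup>2 \<le> 1" by (simp add: abs_square_le_1)
    then have "exp (- (1/16)) \<le> exp (- (1/16) * x\<^sup>2)" by simp
    then have "2 \<le> 64 * exp (- (1/16) * x\<^sup>2)" using \<open>3/4 \<le> exp (- (1/16) :: real)\<close> by linarith
    moreover have "bsol K M 1 x \<le> 2" using bsol_le_2_div_t[OF K0, of 1 M x] by simp
    ultimately show ?thesis by linarith
  qed (use right in auto)
qed

section \<open>The ground state by shooting\<close>

text \<open>The signed integral from 0 to x: one of the two intervals is always empty or a single
  point.\<close>

definition anti :: "(real \<Rightarrow> real) \<Rightarrow> real \<Rightarrow> real" where
  "anti g x = integral {0..x} g - integral {x..0} g"

lemma anti_eq:
  assumes g: "continuous_on UNIV g" and x: "\<bar>x\<bar> \<le> R"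
  shows "anti g x = integral {- R..x} g - integral {- R..0} g"
proof -
  have i: "g integrable_on {a..b}" for a b by (rule integrable_continuous_interval[OF continuous_on_subset[OF g subset_UNIV]])
  show ?thesis
  proof (cases "x \<ge> 0")
    case True
    then have "integral {- R..0} g + integral {0..x} g = integral {- R..x} g"
      by (intro Henstock_Kurzweil_Integration.integral_combine i) (use x in auto)
    moreover have "integral {x..0} g = 0" using True by (cases "x = 0") auto
    ultimately show ?thesis by (simp add: anti_def)
  next
    case False
    then have "integral {- R..x} g + integral {x..0} g = integral {- R..0} g"
      by (intro Henstock_Kurzweil_Integration.integral_combine i) (use x in auto)
    then show ?thesis using False by (simp add: anti_def)
  qed
qed

lemma DERIV_anti:
  assumes g: "continuous_on UNIV g"
  shows "(anti g has_real_derivative g x) (at x)"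
proof -
  define R where "R = \<bar>x\<bar> + 1"
  have "((\<lambda>x. integral {- R..x} g - integral {- R..0} g) has_real_derivative g x - 0) (at x within {- R..R})"
    by (intro DERIV_diff integral_has_real_derivative DERIV_const continuous_on_subset[OF g]) (auto simp: R_def)
  then have "((\<lambda>x. integral {- R..x} g - integral {- R..0} g) has_real_derivative g x) (at x)"
    by (simp add: at_within_Icc_at R_def)
  moreover have "eventually (\<lambda>y. integral {- R..y} g - integral {- R..0} g = anti g y) (nhds x)"
  proof (rule eventually_mono[OF eventually_nhds_in_open[of "{- R<..<R}" x]])
    show "integral {- R..y} g - integral {- R..0} g = anti g y" if "y \<in> {- R<..<R}" for y
      using anti_eq[OF g, of y R] that by auto
  qed (auto simp: R_def)
  ultimately show ?thesis by (subst DERIV_cong_ev[OF refl _ refl, symmetric])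
qed

lemma anti_0 [simp]: "anti g 0 = 0" by (simp add: anti_def)

lemma continuous_on_anti: "continuous_on UNIV g \<Longrightarrow> continuous_on S (anti g)"
  by (rule continuous_at_imp_continuous_on) (auto intro: DERIV_isCont[OF DERIV_anti])

lemma anti_diff:
  assumes "continuous_on UNIV g" "continuous_on UNIV h"
  shows "anti (\<lambda>x. g x - h x) x = anti g x - anti h x"
  unfolding anti_def
  by (subst (1 2) Henstock_Kurzweil_Integration.integral_diff)
    (auto intro!: integrable_continuous_interval continuous_on_subset[OF assms(1)] continuous_on_subset[OF assms(2)])

lemma anti_minus: "anti g (- x) = - anti (\<lambda>y. g (- y)) x"
proof -
  have "integral {- 0..- x} g = integral {x..0} (\<lambda>y. g (- y))" "integral {- x..- 0} g = integral {0..x} (\<lambda>y. g (- y))"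
    using Henstock_Kurzweil_Integration.integral_reflect_real[of x 0 "\<lambda>y. g (- y)"]
      Henstock_Kurzweil_Integration.integral_reflect_real[of 0 x "\<lambda>y. g (- y)"] by simp_all
  then show ?thesis by (simp add: anti_def)
qed

text \<open>Against the weight exp(\<gamma> \<bar>x\<bar>) one integration gains a factor
  1/\<gamma>; this is what makes the integral equation contractive on any bounded interval.\<close>

lemma abs_anti_le:
  assumes g: "continuous_on UNIV g" and b: "\<And>y. \<bar>y\<bar> \<le> \<bar>x\<bar> \<Longrightarrow> \<bar>g y\<bar> \<le> b * exp (\<gamma> * \<bar>y\<bar>)" and \<gamma>: "\<gamma> > 0"
  shows "\<bar>anti g x\<bar> \<le> b / \<gamma> * exp (\<gamma> * \<bar>x\<bar>)"
proof -
  have b0: "b \<ge> 0" using b[of 0] by simp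
  have pos: "\<bar>anti h y\<bar> \<le> b / \<gamma> * exp (\<gamma> * y)"
    if h: "continuous_on UNIV h" and hb: "\<And>s. \<bar>s\<bar> \<le> y \<Longrightarrow> \<bar>h s\<bar> \<le> b * exp (\<gamma> * \<bar>s\<bar>)" and y: "y \<ge> 0" for h y
  proof -
    have "integral {y..0} h = 0" using y by (cases "y = 0") auto
    then have "\<bar>anti h y\<bar> = norm (integral {0..y} h)" by (simp add: anti_def)
    also have "\<dots> \<le> integral {0..y} (\<lambda>s. b * exp (\<gamma> * s))"
    proof (rule integral_norm_bound_integral)
      show "norm (h s) \<le> b * exp (\<gamma> * s)" if "s \<in> {0..y}" for s using hb[of s] that by simp
    qed (auto intro!: integrable_continuous_interval continuous_on_subset[OF h] continuous_intros)
    also have "\<dots> = b / \<gamma> * (exp (\<gamma> * y) - 1)" by (rule integral_exp[OF y \<gamma>])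
    also have "\<dots> \<le> b / \<gamma> * exp (\<gamma> * y)" using b0 \<gamma> by (intro mult_left_mono) auto
    finally show ?thesis .
  qed
  show ?thesis
  proof (cases "x \<ge> 0")
    case True then show ?thesis using pos[OF g, of x] b by simp
  next
    case False
    then have nx: "0 \<le> - x" by simp
    have "continuous_on UNIV (\<lambda>y. g (- y))" by (auto intro!: continuous_on_compose2[OF g] continuous_intros)
    moreover have "\<bar>g (- s)\<bar> \<le> b * exp (\<gamma> * \<bar>s\<bar>)" if "\<bar>s\<bar> \<le> - x" for s
      using b[of "- s"] that by simp
    ultimately have "\<bar>anti (\<lambda>y. g (- y)) (- x)\<bar> \<le> b / \<gamma> * exp (\<gamma> * - x)"
      by (rule pos[OF _ _ nx])
    then show ?thesis using False anti_minus[of g "- x"] by simp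
  qed
qed

lemma first_zero:
  fixes h :: "real \<Rightarrow> real"
  assumes h: "continuous_on UNIV h" and h0: "h a > 0" and n: "b \<ge> a" "h b \<le> 0"
  obtains c where "c > a" "c \<le> b" "h c = 0" "\<And>x. a \<le> x \<Longrightarrow> x < c \<Longrightarrow> h x > 0"
proof -
  define S where "S = {x. a \<le> x \<and> x \<le> b \<and> h x \<le> 0}"
  have "S = {a..b} \<inter> {x. h x \<le> 0}" by (auto simp: S_def)
  moreover have "closed {x. h x \<le> 0}" by (intro closed_Collect_le h continuous_intros)
  ultimately have "compact S" by (simp add: compact_Int_closed)
  moreover have "S \<noteq> {}" using n by (auto simp: S_def)
  ultimately obtain c where c: "c \<in> S" "\<And>x. x \<in> S \<Longrightarrow> c \<le> x" using compact_attains_inf[of S] by metis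
  have ca: "c > a" using c(1) h0 by (cases "c = a") (auto simp: S_def)
  have pos: "h x > 0" if "a \<le> x" "x < c" for x
  proof (rule ccontr)
    assume "\<not> h x > 0"
    then have "x \<in> S" using that c(1) by (auto simp: S_def)
    then show False using c(2)[of x] that by simp
  qed
  have "h c \<ge> 0"
  proof (rule ccontr)
    assume "\<not> h c \<ge> 0"
    then have "h c < 0" by simp
    moreover have "continuous_on {a..c} h" by (rule continuous_on_subset[OF h]) auto
    ultimately obtain x where x: "a \<le> x" "x \<le> c" "h x = 0"
      using IVT2'[of h c 0 a] h0 ca by (metis less_imp_le)
    then have "x < c" using \<open>h c < 0\<close> by (cases "x = c") auto
    with pos[OF x(1)] x(3) show False by simp
  qed
  then have "h c = 0" using c(1) by (simp add: S_def)
  with that[of c] ca pos c(1) show thesis by (auto simp: S_def)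
qed

text \<open>For \<open>sbm_F\<close> the upper bound 2 is the universal bound 2/t at time 1, and
  evenness lets the problem be solved on x \<ge> 0.\<close>

locale potential =
  fixes F :: "real \<Rightarrow> real"
  assumes F_cont: "continuous_on UNIV F" and F_nonneg: "\<And>x. 0 \<le> F x" and F_le: "\<And>x. F x \<le> 2"
    and F_even: "\<And>x. F (- x) = F x"
begin

text \<open>\<open>\<psi>'' - x \<psi>' = 2 (F - l) \<psi>\<close> has the divergence form \<open>(exp (- x\<^sup>2 / 2) \<psi>')' = 2 (F - l) exp (- x\<^sup>2 / 2) \<psi>\<close>;
  with \<open>\<psi> 0 = 1\<close> and \<open>\<psi>' 0 = 0\<close> it reads \<open>\<psi> = 1 + volterra l \<psi>\<close>. On \<open>[- L, L]\<close> the right-hand side is a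
  contraction for the norm weighted by \<open>exp (- rate L \<Lambda> \<bar>x\<bar>)\<close> when \<open>\<bar>l\<bar> \<le> \<Lambda>\<close>.\<close>

definition src :: "real \<Rightarrow> (real \<Rightarrow> real) \<Rightarrow> real \<Rightarrow> real" where
  "src l h z = 2 * (F z - l) * exp (- z\<^sup>2 / 2) * h z"

definition slope :: "real \<Rightarrow> (real \<Rightarrow> real) \<Rightarrow> real \<Rightarrow> real" where
  "slope l h y = exp (y\<^sup>2 / 2) * anti (src l h) y"

definition volterra :: "real \<Rightarrow> (real \<Rightarrow> real) \<Rightarrow> real \<Rightarrow> real" where
  "volterra l h x = anti (slope l h) x"

lemma cont_F: "continuous_on S F"
  by (rule continuous_on_subset[OF F_cont]) simp

lemma cont_src: "continuous_on UNIV h \<Longrightarrow> continuous_on UNIV (src l h)"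
  unfolding src_def[abs_def] by (intro continuous_intros cont_F) simp_all

lemma cont_slope: "continuous_on UNIV h \<Longrightarrow> continuous_on UNIV (slope l h)"
  unfolding slope_def[abs_def] by (intro continuous_intros continuous_on_anti cont_src) simp_all

lemma cont_volterra: "continuous_on UNIV h \<Longrightarrow> continuous_on UNIV (volterra l h)"
  unfolding volterra_def[abs_def] by (intro continuous_on_anti cont_slope)

lemma exp_sq_le: "\<bar>x\<bar> \<le> L \<Longrightarrow> exp (x\<^sup>2 / 2) \<le> exp (L\<^sup>2 / 2)" for x L :: real
  using power_mono[of "\<bar>x\<bar>" L 2] by simp

lemma slope_volterra_diff_bound:
  assumes h: "continuous_on UNIV h" and g: "continuous_on UNIV g" and L: "\<bar>x\<bar> \<le> L" and \<gamma>: "\<gamma> > 0"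
    and B: "\<And>z. \<bar>z\<bar> \<le> L \<Longrightarrow> \<bar>src l h z - src m g z\<bar> \<le> B * exp (\<gamma> * \<bar>z\<bar>)"
  shows "\<bar>slope l h x - slope m g x\<bar> \<le> exp (L\<^sup>2 / 2) * B / \<gamma> * exp (\<gamma> * \<bar>x\<bar>)"
    and "\<bar>volterra l h x - volterra m g x\<bar> \<le> exp (L\<^sup>2 / 2) * B / \<gamma>\<^sup>2 * exp (\<gamma> * \<bar>x\<bar>)"
proof -
  have 1: "\<bar>slope l h y - slope m g y\<bar> \<le> exp (L\<^sup>2 / 2) * B / \<gamma> * exp (\<gamma> * \<bar>y\<bar>)" if y: "\<bar>y\<bar> \<le> L" for y
  proof -
    have "slope l h y - slope m g y = exp (y\<^sup>2 / 2) * anti (\<lambda>z. src l h z - src m g z) y"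
      unfolding slope_def anti_diff[OF cont_src[OF h] cont_src[OF g]] by (simp add: algebra_simps)
    moreover have "\<bar>anti (\<lambda>z. src l h z - src m g z) y\<bar> \<le> B / \<gamma> * exp (\<gamma> * \<bar>y\<bar>)"
      by (rule abs_anti_le[OF _ _ \<gamma>]) (use y in \<open>auto intro!: continuous_on_diff cont_src h g B\<close>)
    then have "exp (y\<^sup>2 / 2) * \<bar>anti (\<lambda>z. src l h z - src m g z) y\<bar> \<le> exp (L\<^sup>2 / 2) * (B / \<gamma> * exp (\<gamma> * \<bar>y\<bar>))"
      using exp_sq_le[OF y] by (intro mult_mono) auto
    ultimately have "\<bar>slope l h y - slope m g y\<bar> \<le> exp (L\<^sup>2 / 2) * (B / \<gamma> * exp (\<gamma> * \<bar>y\<bar>))"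
      by (simp only: abs_mult abs_exp_cancel)
    then show ?thesis by simp
  qed
  show "\<bar>slope l h x - slope m g x\<bar> \<le> exp (L\<^sup>2 / 2) * B / \<gamma> * exp (\<gamma> * \<bar>x\<bar>)" by (rule 1[OF L])
  have "volterra l h x - volterra m g x = anti (\<lambda>z. slope l h z - slope m g z) x"
    unfolding volterra_def anti_diff[OF cont_slope[OF h] cont_slope[OF g]] ..
  also have "\<bar>\<dots>\<bar> \<le> (exp (L\<^sup>2 / 2) * B / \<gamma>) / \<gamma> * exp (\<gamma> * \<bar>x\<bar>)"
  proof (rule abs_anti_le[OF _ _ \<gamma>])
    show "\<bar>slope l h y - slope m g y\<bar> \<le> exp (L\<^sup>2 / 2) * B / \<gamma> * exp (\<gamma> * \<bar>y\<bar>)" if "\<bar>y\<bar> \<le> \<bar>x\<bar>" for y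
      by (rule 1) (use that L in linarith)
  qed (intro continuous_on_diff cont_slope h g)
  finally show "\<bar>volterra l h x - volterra m g x\<bar> \<le> exp (L\<^sup>2 / 2) * B / \<gamma>\<^sup>2 * exp (\<gamma> * \<bar>x\<bar>)"
    by (simp add: power2_eq_square)
qed

definition rate :: "real \<Rightarrow> real \<Rightarrow> real" where
  "rate L \<Lambda> = 1 + 4 * (2 + \<Lambda>) * exp (L\<^sup>2 / 2)"

lemma rate_ge_1: "\<Lambda> \<ge> 0 \<Longrightarrow> 1 \<le> rate L \<Lambda>" by (simp add: rate_def)

lemma F_minus_le: "\<bar>l\<bar> \<le> \<Lambda> \<Longrightarrow> \<bar>F z - l\<bar> \<le> 2 + \<Lambda>"
  using F_nonneg[of z] F_le[of z] by linarith

lemma abs_src_diff_le: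
  assumes l: "\<bar>l\<bar> \<le> \<Lambda>" and B: "\<bar>h z - g z\<bar> \<le> B"
  shows "\<bar>src l h z - src l g z\<bar> \<le> 2 * (2 + \<Lambda>) * B"
proof -
  have "\<bar>src l h z - src l g z\<bar> = 2 * \<bar>F z - l\<bar> * exp (- z\<^sup>2 / 2) * \<bar>h z - g z\<bar>"
  proof -
    have "src l h z - src l g z = 2 * ((F z - l) * (exp (- z\<^sup>2 / 2) * (h z - g z)))"
      by (simp add: src_def algebra_simps)
    then show ?thesis by (simp only: abs_mult abs_numeral abs_exp_cancel mult.assoc)
  qed
  also have "\<dots> \<le> 2 * (2 + \<Lambda>) * 1 * B"
    using F_minus_le[OF l, of z] l by (intro mult_mono B) auto
  finally show ?thesis by simp
qed

lemma volterra_contraction: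
  assumes h: "continuous_on UNIV h" and g: "continuous_on UNIV g" and l: "\<bar>l\<bar> \<le> \<Lambda>" and x: "\<bar>x\<bar> \<le> L"
    and B: "\<And>z. \<bar>z\<bar> \<le> L \<Longrightarrow> \<bar>h z - g z\<bar> \<le> B * exp (rate L \<Lambda> * \<bar>z\<bar>)"
  shows "\<bar>volterra l h x - volterra l g x\<bar> \<le> B / 2 * exp (rate L \<Lambda> * \<bar>x\<bar>)"
proof -
  define \<gamma> where "\<gamma> = rate L \<Lambda>"
  have \<Lambda>: "\<Lambda> \<ge> 0" using l by simp
  have \<gamma>: "\<gamma> \<ge> 1" unfolding \<gamma>_def by (rule rate_ge_1[OF \<Lambda>])
  have "0 \<le> L" using x by linarith
  then have B0: "B \<ge> 0" using B[of 0] by simp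
  have "\<bar>volterra l h x - volterra l g x\<bar> \<le> exp (L\<^sup>2 / 2) * (2 * (2 + \<Lambda>) * B) / \<gamma>\<^sup>2 * exp (\<gamma> * \<bar>x\<bar>)"
  proof (rule slope_volterra_diff_bound(2)[OF h g x])
    show "\<bar>src l h z - src l g z\<bar> \<le> 2 * (2 + \<Lambda>) * B * exp (\<gamma> * \<bar>z\<bar>)" if "\<bar>z\<bar> \<le> L" for z
      using abs_src_diff_le[where h = h and g = g and z = z, OF l B[OF that]] by (simp add: \<gamma>_def mult_ac)
  qed (use \<gamma> in simp)
  also have "\<dots> \<le> B / 2 * exp (\<gamma> * \<bar>x\<bar>)"
  proof (rule mult_right_mono)
    \<comment> \<open>The two integrations yield 1/\<gamma>^2. The summand 1 in \<open>rate\<close>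
      ensures \<gamma> \<ge> 1, so that \<gamma> itself bounds \<gamma>^2 from below.\<close>
    have "4 * (2 + \<Lambda>) * exp (L\<^sup>2 / 2) \<le> \<gamma>" by (simp add: \<gamma>_def rate_def)
    also have "\<dots> \<le> \<gamma>\<^sup>2" using \<gamma> by (simp add: power2_eq_square)
    finally have "(4 * (2 + \<Lambda>) * exp (L\<^sup>2 / 2)) * B \<le> \<gamma>\<^sup>2 * B" using B0 by (rule mult_right_mono)
    then show "exp (L\<^sup>2 / 2) * (2 * (2 + \<Lambda>) * B) / \<gamma>\<^sup>2 \<le> B / 2" using \<gamma> by (simp add: field_simps)
  qed simp
  finally show ?thesis by (simp add: \<gamma>_def)
qed

section \<open>The even solution of the eigenvalue equation by iteration\<close>

primrec iter :: "real \<Rightarrow> nat \<Rightarrow> real \<Rightarrow> real" where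
  "iter l 0 = (\<lambda>_. 1)"
| "iter l (Suc k) = (\<lambda>x. 1 + volterra l (iter l k) x)"

lemma cont_iter: "continuous_on UNIV (iter l k)"
  by (induction k) (auto intro!: continuous_intros cont_volterra)

lemma iter_even: "iter l k (- x) = iter l k x"
proof (induction k arbitrary: x)
  case (Suc k)
  have s: "(\<lambda>z. src l (iter l k) (- z)) = src l (iter l k)" by (simp add: src_def F_even Suc fun_eq_iff)
  have "slope l (iter l k) (- y) = - slope l (iter l k) y" for y
    unfolding slope_def anti_minus s by simp
  then have "(\<lambda>y. slope l (iter l k) (- y)) = (\<lambda>y. 0 - slope l (iter l k) y)" by simp
  then have "volterra l (iter l k) (- x) = - anti (\<lambda>y. 0 - slope l (iter l k) y) x"
    unfolding volterra_def anti_minus by simp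
  also have "anti (\<lambda>y. 0 - slope l (iter l k) y) x = anti (\<lambda>_. 0) x - anti (slope l (iter l k)) x"
    by (rule anti_diff) (auto intro!: cont_slope cont_iter)
  finally have "volterra l (iter l k) (- x) = volterra l (iter l k) x" by (simp add: volterra_def anti_def)
  then show ?case by simp
qed simp

lemma iter_step:
  assumes l: "\<bar>l\<bar> \<le> \<Lambda>" and x: "\<bar>x\<bar> \<le> L"
  shows "\<bar>iter l (Suc k) x - iter l k x\<bar> \<le> (1/2) ^ Suc k * exp (rate L \<Lambda> * \<bar>x\<bar>)"
  using x
proof (induction k arbitrary: x)
  case 0
  \<comment> \<open>Since \<open>volterra l\<close> maps 0 to 0, the first increment is itself a
    difference of images, of 1 and 0, and the contraction applies to it as well.\<close>
  have "\<bar>volterra l (\<lambda>_. 1) x - volterra l (\<lambda>_. 0) x\<bar> \<le> 1 / 2 * exp (rate L \<Lambda> * \<bar>x\<bar>)"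
  proof (rule volterra_contraction[OF _ _ l 0])
    have "0 \<le> rate L \<Lambda>" using rate_ge_1[of \<Lambda> L] l by linarith
    then show "\<bar>1 - 0\<bar> \<le> 1 * exp (rate L \<Lambda> * \<bar>z\<bar>)" for z by simp
  qed simp_all
  moreover have "volterra l (\<lambda>_. 0) x = 0"
    by (simp add: volterra_def slope_def[abs_def] src_def[abs_def] anti_def)
  ultimately show ?case by simp
next
  case (Suc k)
  have "\<bar>volterra l (iter l (Suc k)) x - volterra l (iter l k) x\<bar> \<le> (1/2) ^ Suc k / 2 * exp (rate L \<Lambda> * \<bar>x\<bar>)"
    by (rule volterra_contraction[OF cont_iter cont_iter l Suc.prems Suc.IH])
  then show ?case by simp
qed

lemma iter_far:
  assumes l: "\<bar>l\<bar> \<le> \<Lambda>" and x: "\<bar>x\<bar> \<le> L"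
  shows "\<bar>iter l (n + j) x - iter l n x\<bar> \<le> ((1/2) ^ n - (1/2) ^ (n + j)) * exp (rate L \<Lambda> * \<bar>x\<bar>)"
proof (induction j)
  case (Suc j)
  have "\<bar>iter l (n + Suc j) x - iter l n x\<bar> \<le> \<bar>iter l (Suc (n + j)) x - iter l (n + j) x\<bar> + \<bar>iter l (n + j) x - iter l n x\<bar>"
    by simp
  also have "\<dots> \<le> (1/2) ^ Suc (n + j) * exp (rate L \<Lambda> * \<bar>x\<bar>) + ((1/2) ^ n - (1/2) ^ (n + j)) * exp (rate L \<Lambda> * \<bar>x\<bar>)"
    by (intro add_mono iter_step[OF l x] Suc.IH)
  also have "\<dots> = ((1/2) ^ n - (1/2) ^ (n + Suc j)) * exp (rate L \<Lambda> * \<bar>x\<bar>)" by (simp add: algebra_simps)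
  finally show ?case .
qed simp

definition shot :: "real \<Rightarrow> real \<Rightarrow> real" where
  "shot l x = lim (\<lambda>n. iter l n x)"

lemma iter_tendsto: "(\<lambda>n. iter l n x) \<longlonglongrightarrow> shot l x"
proof -
  have "summable (\<lambda>k. iter l (Suc k) x - iter l k x)"
  proof (rule summable_comparison_test'[where N = 0])
    show "norm (iter l (Suc k) x - iter l k x) \<le> (1/2) ^ k * (1/2 * exp (rate \<bar>x\<bar> \<bar>l\<bar> * \<bar>x\<bar>))" for k
      using iter_step[of l "\<bar>l\<bar>" x "\<bar>x\<bar>" k] by simp
    show "summable (\<lambda>k. (1/2) ^ k * (1/2 * exp (rate \<bar>x\<bar> \<bar>l\<bar> * \<bar>x\<bar>)))"
      by (intro summable_mult2 summable_geometric) simp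
  qed
  then have "convergent (\<lambda>n. \<Sum>k<n. iter l (Suc k) x - iter l k x)" by (simp add: summable_iff_convergent)
  then have "convergent (\<lambda>n. iter l n x - iter l 0 x)" by (simp only: sum_lessThan_telescope[of "\<lambda>k. iter l k x"])
  then have "convergent (\<lambda>n. (iter l n x - iter l 0 x) + iter l 0 x)"
    by (intro convergent_add convergent_const)
  then have "convergent (\<lambda>n. iter l n x)" by simp
  then show ?thesis unfolding shot_def by (simp add: convergent_LIMSEQ_iff)
qed

lemma shot_iter_bound:
  assumes l: "\<bar>l\<bar> \<le> \<Lambda>" and x: "\<bar>x\<bar> \<le> L"
  shows "\<bar>shot l x - iter l n x\<bar> \<le> (1/2) ^ n * exp (rate L \<Lambda> * \<bar>x\<bar>)"
proof (rule LIMSEQ_le_const2)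
  show "(\<lambda>j. \<bar>iter l (n + j) x - iter l n x\<bar>) \<longlonglongrightarrow> \<bar>shot l x - iter l n x\<bar>"
    using LIMSEQ_ignore_initial_segment[OF iter_tendsto[of l x], where k = n] by (intro tendsto_intros) (simp add: add.commute)
  have "((1/2) ^ n - (1/2) ^ (n + j)) * exp (rate L \<Lambda> * \<bar>x\<bar>) \<le> (1/2) ^ n * exp (rate L \<Lambda> * \<bar>x\<bar>)" for j
    by (intro mult_right_mono) auto
  then show "\<exists>N. \<forall>j\<ge>N. \<bar>iter l (n + j) x - iter l n x\<bar> \<le> (1/2) ^ n * exp (rate L \<Lambda> * \<bar>x\<bar>)"
    using iter_far[OF l x] by (meson order.trans)
qed

lemma shot_even: "shot l (- x) = shot l x"
  by (simp add: shot_def iter_even)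

lemma cont_shot: "continuous_on UNIV (shot l)"
proof (rule continuous_at_imp_continuous_on, intro ballI)
  fix x :: real
  define L where "L = \<bar>x\<bar> + 1"
  define \<gamma> where "\<gamma> = rate L \<bar>l\<bar>"
  have \<gamma>: "\<gamma> \<ge> 1" unfolding \<gamma>_def by (rule rate_ge_1) simp
  have "uniform_limit {- L<..<L} (iter l) (shot l) sequentially"
  proof (rule uniform_limitI)
    fix e :: real assume e: "e > 0"
    have "(\<lambda>n. (1/2) ^ n * exp (\<gamma> * L)) \<longlonglongrightarrow> 0 * exp (\<gamma> * L)"
      by (intro tendsto_intros LIMSEQ_realpow_zero) auto
    then have "(\<lambda>n. (1/2) ^ n * exp (\<gamma> * L)) \<longlonglongrightarrow> 0" by (simp only: mult_zero_left)
    from order_tendstoD(2)[OF this e]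
    have "eventually (\<lambda>n. (1/2) ^ n * exp (\<gamma> * L) < e) sequentially" .
    then show "\<forall>\<^sub>F n in sequentially. \<forall>y\<in>{- L<..<L}. dist (iter l n y) (shot l y) < e"
    proof (rule eventually_mono, intro ballI)
      fix n y assume n: "(1/2) ^ n * exp (\<gamma> * L) < e" and y: "y \<in> {- L<..<L}"
      have "dist (iter l n y) (shot l y) = \<bar>shot l y - iter l n y\<bar>" by (simp add: dist_real_def abs_minus_commute)
      also have "\<dots> \<le> (1/2) ^ n * exp (\<gamma> * \<bar>y\<bar>)" unfolding \<gamma>_def by (rule shot_iter_bound) (use y in auto)
      also have "\<dots> \<le> (1/2) ^ n * exp (\<gamma> * L)" using y \<gamma> by (intro mult_left_mono) auto
      finally show "dist (iter l n y) (shot l y) < e" using n by linarith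
    qed
  qed
  then have "continuous_on {- L<..<L} (shot l)"
    by (rule uniform_limit_theorem[rotated]) (auto intro: always_eventually continuous_on_subset[OF cont_iter])
  then show "isCont (shot l) x" by (rule continuous_on_interior) (auto simp: L_def)
qed

lemma shot_eq: "shot l x = 1 + volterra l (shot l) x"
proof -
  define \<gamma> where "\<gamma> = rate \<bar>x\<bar> \<bar>l\<bar>"
  have b: "norm (iter l (Suc n) x - (1 + volterra l (shot l) x)) \<le> (1/2) ^ n * (exp (\<gamma> * \<bar>x\<bar>) / 2)" for n
  proof -
    have "\<bar>volterra l (iter l n) x - volterra l (shot l) x\<bar> \<le> (1/2) ^ n / 2 * exp (\<gamma> * \<bar>x\<bar>)"
      unfolding \<gamma>_def
    proof (rule volterra_contraction[OF cont_iter cont_shot order.refl order.refl])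
      fix z assume "\<bar>z\<bar> \<le> \<bar>x\<bar>"
      from shot_iter_bound[OF order.refl this, of l n]
      show "\<bar>iter l n z - shot l z\<bar> \<le> (1/2) ^ n * exp (rate \<bar>x\<bar> \<bar>l\<bar> * \<bar>z\<bar>)" by (simp only: abs_minus_commute)
    qed
    then show ?thesis by simp
  qed
  have "(\<lambda>n. (1/2) ^ n * (exp (\<gamma> * \<bar>x\<bar>) / 2)) \<longlonglongrightarrow> 0 * (exp (\<gamma> * \<bar>x\<bar>) / 2)"
    by (intro tendsto_intros LIMSEQ_realpow_zero) auto
  then have "(\<lambda>n. (1/2) ^ n * (exp (\<gamma> * \<bar>x\<bar>) / 2)) \<longlonglongrightarrow> 0" by simp
  from Lim_null_comparison[OF always_eventually[OF allI[OF b]] this]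
  have "(\<lambda>n. iter l (Suc n) x - (1 + volterra l (shot l) x)) \<longlonglongrightarrow> 0" .
  then have "(\<lambda>n. iter l (Suc n) x) \<longlonglongrightarrow> 1 + volterra l (shot l) x" by (rule LIM_zero_cancel)
  then show ?thesis using LIMSEQ_Suc[OF iter_tendsto] LIMSEQ_unique by blast
qed

definition shot' :: "real \<Rightarrow> real \<Rightarrow> real" where
  "shot' l = slope l (shot l)"

lemma DERIV_shot: "(shot l has_real_derivative shot' l x) (at x)"
proof -
  have "shot l = (\<lambda>x. 1 + volterra l (shot l) x)" using shot_eq by (simp add: fun_eq_iff)
  moreover have "((\<lambda>x. 1 + volterra l (shot l) x) has_real_derivative 0 + shot' l x) (at x)"
    unfolding volterra_def[abs_def] shot'_def by (intro DERIV_add DERIV_const DERIV_anti cont_slope cont_shot)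
  ultimately show ?thesis by simp
qed

lemma DERIV_shot': "(shot' l has_real_derivative x * shot' l x + 2 * (F x - l) * shot l x) (at x)"
proof -
  have e: "((\<lambda>y. exp (y\<^sup>2 / 2)) has_real_derivative x * exp (x\<^sup>2 / 2)) (at x)"
    by (auto intro!: derivative_eq_intros)
  have "(shot' l has_real_derivative x * exp (x\<^sup>2 / 2) * anti (src l (shot l)) x + src l (shot l) x * exp (x\<^sup>2 / 2)) (at x)"
    unfolding shot'_def slope_def[abs_def] by (intro DERIV_mult e DERIV_anti cont_src cont_shot)
  moreover have "src l (shot l) x * exp (x\<^sup>2 / 2) = 2 * (F x - l) * shot l x"
    by (simp add: src_def exp_minus)
  ultimately show ?thesis by (simp add: shot'_def slope_def mult_ac)
qed

lemma shot_0 [simp]: "shot l 0 = 1" "shot' l 0 = 0"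
  using shot_eq[of l 0] by (simp_all add: volterra_def shot'_def slope_def)

text \<open>A fixed point of a contraction depends on a parameter as regularly as the map does:
  changing \<open>l\<close> in the map costs a multiple of \<bar>l - m\<bar>, and the contraction
  absorbs half of the resulting difference. The derivative follows because \<open>slope\<close> is
  one integration of the same source.\<close>

lemma shot_lipschitz:
  assumes \<Lambda>: "\<Lambda> \<ge> 0" and L: "L \<ge> 0"
  shows "\<exists>K. \<forall>l m x. \<bar>l\<bar> \<le> \<Lambda> \<longrightarrow> \<bar>m\<bar> \<le> \<Lambda> \<longrightarrow> \<bar>x\<bar> \<le> L \<longrightarrow>
     \<bar>shot l x - shot m x\<bar> \<le> K * \<bar>l - m\<bar> \<and> \<bar>shot' l x - shot' m x\<bar> \<le> K * \<bar>l - m\<bar>"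
proof -
  define \<gamma> where "\<gamma> = rate L \<Lambda>"
  have \<gamma>: "\<gamma> \<ge> 1" unfolding \<gamma>_def by (rule rate_ge_1[OF \<Lambda>])
  define E where "E = exp (L\<^sup>2 / 2)"
  define K where "K = E * (2 * (2 + \<Lambda>) * (8 * E) + 4) * exp (\<gamma> * L) + 8 * E * exp (\<gamma> * L)"
  have E: "E > 0" by (simp add: E_def)
  have main: "\<bar>shot l x - shot m x\<bar> \<le> 8 * E * \<bar>l - m\<bar> * exp (\<gamma> * \<bar>x\<bar>)"
    and main': "\<bar>shot' l x - shot' m x\<bar> \<le> E * ((2 * (2 + \<Lambda>) * (8 * E) + 4) * \<bar>l - m\<bar>) / \<gamma> * exp (\<gamma> * \<bar>x\<bar>)"
    if l: "\<bar>l\<bar> \<le> \<Lambda>" and m: "\<bar>m\<bar> \<le> \<Lambda>" and x: "\<bar>x\<bar> \<le> L" for l m x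
  proof -
    have hb: "\<bar>shot m z\<bar> \<le> 2 * exp (\<gamma> * \<bar>z\<bar>)" if "\<bar>z\<bar> \<le> L" for z
    proof -
      have "\<bar>shot m z - 1\<bar> \<le> exp (\<gamma> * \<bar>z\<bar>)" using shot_iter_bound[OF m that, of 0] by (simp add: \<gamma>_def)
      moreover have "1 \<le> exp (\<gamma> * \<bar>z\<bar>)" using \<gamma> by simp
      ultimately show ?thesis by linarith
    qed
    have s2: "\<bar>src l (shot m) z - src m (shot m) z\<bar> \<le> 4 * \<bar>l - m\<bar> * exp (\<gamma> * \<bar>z\<bar>)" if z: "\<bar>z\<bar> \<le> L" for z
    proof -
      have "src l (shot m) z - src m (shot m) z = 2 * ((m - l) * (exp (- z\<^sup>2 / 2) * shot m z))"
        by (simp add: src_def algebra_simps)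
      then have "\<bar>src l (shot m) z - src m (shot m) z\<bar> = 2 * \<bar>l - m\<bar> * exp (- z\<^sup>2 / 2) * \<bar>shot m z\<bar>"
        by (simp only: abs_mult abs_numeral abs_exp_cancel abs_minus_commute[of m l] mult.assoc)
      also have "\<dots> \<le> 2 * \<bar>l - m\<bar> * 1 * (2 * exp (\<gamma> * \<bar>z\<bar>))" by (intro mult_mono hb[OF z]) auto
      finally show ?thesis by simp
    qed
    have v2: "\<bar>volterra l (shot m) y - volterra m (shot m) y\<bar> \<le> 4 * E * \<bar>l - m\<bar> * exp (\<gamma> * \<bar>y\<bar>)" if y: "\<bar>y\<bar> \<le> L" for y
    proof -
      have "\<bar>volterra l (shot m) y - volterra m (shot m) y\<bar> \<le> E * (4 * \<bar>l - m\<bar>) / \<gamma>\<^sup>2 * exp (\<gamma> * \<bar>y\<bar>)"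
        unfolding E_def by (rule slope_volterra_diff_bound(2)[OF cont_shot cont_shot y _ s2]) (use \<gamma> in auto)
      also have "\<dots> \<le> E * (4 * \<bar>l - m\<bar>) / 1 * exp (\<gamma> * \<bar>y\<bar>)"
        using \<gamma> E by (intro mult_right_mono divide_left_mono) (auto simp: one_le_power)
      finally show ?thesis by (simp add: mult_ac)
    qed
    \<comment> \<open>The difference in the weighted norm; at a maximum point y it satisfies Q(y)
      \<le> Q(y)/2 + 4 E \<bar>l - m\<bar>.\<close>
    define Q where "Q = (\<lambda>y. \<bar>shot l y - shot m y\<bar> * exp (- \<gamma> * \<bar>y\<bar>))"
    have "continuous_on {- L..L} Q" unfolding Q_def
      by (intro continuous_intros continuous_on_subset[OF cont_shot]) auto
    then obtain y where y: "y \<in> {- L..L}" "\<And>z. z \<in> {- L..L} \<Longrightarrow> Q z \<le> Q y"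
      using continuous_attains_sup[of "{- L..L}" Q] L by auto
    have Qb: "\<bar>shot l z - shot m z\<bar> \<le> Q y * exp (\<gamma> * \<bar>z\<bar>)" if "\<bar>z\<bar> \<le> L" for z
    proof -
      have "z \<in> {- L..L}" using that by (auto simp: abs_le_iff)
      then have "Q z * exp (\<gamma> * \<bar>z\<bar>) \<le> Q y * exp (\<gamma> * \<bar>z\<bar>)" by (intro mult_right_mono y(2)) auto
      moreover have "Q z * exp (\<gamma> * \<bar>z\<bar>) = \<bar>shot l z - shot m z\<bar>" by (simp add: Q_def exp_minus)
      ultimately show ?thesis by simp
    qed
    have yL: "\<bar>y\<bar> \<le> L" using y(1) by auto
    have "\<bar>shot l y - shot m y\<bar> \<le> \<bar>volterra l (shot l) y - volterra l (shot m) y\<bar> + \<bar>volterra l (shot m) y - volterra m (shot m) y\<bar>"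
      using shot_eq[of l y] shot_eq[of m y] by linarith
    also have "\<dots> \<le> Q y / 2 * exp (\<gamma> * \<bar>y\<bar>) + 4 * E * \<bar>l - m\<bar> * exp (\<gamma> * \<bar>y\<bar>)"
      by (intro add_mono v2[OF yL] volterra_contraction[OF cont_shot cont_shot l yL, folded \<gamma>_def] Qb)
    also have "\<dots> = (Q y / 2 + 4 * E * \<bar>l - m\<bar>) * exp (\<gamma> * \<bar>y\<bar>)" by (simp add: distrib_right)
    finally have "Q y \<le> (Q y / 2 + 4 * E * \<bar>l - m\<bar>) * exp (\<gamma> * \<bar>y\<bar>) * exp (- \<gamma> * \<bar>y\<bar>)"
      unfolding Q_def by (intro mult_right_mono) auto
    moreover have "exp (\<gamma> * \<bar>y\<bar>) * exp (- \<gamma> * \<bar>y\<bar>) = 1" by (simp add: exp_minus)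
    ultimately have "Q y \<le> Q y / 2 + 4 * E * \<bar>l - m\<bar>" by (simp only: mult.assoc mult_1_right)
    then have Qy: "Q y \<le> 8 * E * \<bar>l - m\<bar>" by simp
    have diff: "\<bar>shot l z - shot m z\<bar> \<le> 8 * E * \<bar>l - m\<bar> * exp (\<gamma> * \<bar>z\<bar>)" if "\<bar>z\<bar> \<le> L" for z
      by (rule order.trans[OF Qb[OF that] mult_right_mono[OF Qy]]) simp
    then show "\<bar>shot l x - shot m x\<bar> \<le> 8 * E * \<bar>l - m\<bar> * exp (\<gamma> * \<bar>x\<bar>)" using x by blast
    show "\<bar>shot' l x - shot' m x\<bar> \<le> E * ((2 * (2 + \<Lambda>) * (8 * E) + 4) * \<bar>l - m\<bar>) / \<gamma> * exp (\<gamma> * \<bar>x\<bar>)"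
      unfolding shot'_def
    proof (rule slope_volterra_diff_bound(1)[OF cont_shot cont_shot x, folded E_def])
      fix z assume z: "\<bar>z\<bar> \<le> L"
      have "\<bar>src l (shot l) z - src l (shot m) z\<bar> \<le> 2 * (2 + \<Lambda>) * (8 * E * \<bar>l - m\<bar> * exp (\<gamma> * \<bar>z\<bar>))"
        by (rule abs_src_diff_le[where h = "shot l" and g = "shot m" and z = z, OF l diff[OF z]])
      moreover have "(2 * (2 + \<Lambda>) * (8 * E) + 4) * \<bar>l - m\<bar> * exp (\<gamma> * \<bar>z\<bar>)
          = 2 * (2 + \<Lambda>) * (8 * E * \<bar>l - m\<bar> * exp (\<gamma> * \<bar>z\<bar>)) + 4 * \<bar>l - m\<bar> * exp (\<gamma> * \<bar>z\<bar>)"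
        by (simp add: algebra_simps)
      ultimately show "\<bar>src l (shot l) z - src m (shot m) z\<bar> \<le> (2 * (2 + \<Lambda>) * (8 * E) + 4) * \<bar>l - m\<bar> * exp (\<gamma> * \<bar>z\<bar>)"
        using s2[OF z] by linarith
    qed (use \<gamma> in simp)
  qed
  show ?thesis
  proof (intro exI[of _ K] allI impI)
    fix l m x assume a: "\<bar>l\<bar> \<le> \<Lambda>" "\<bar>m\<bar> \<le> \<Lambda>" "\<bar>x\<bar> \<le> L"
    define c where "c = E * (2 * (2 + \<Lambda>) * (8 * E) + 4)"
    have c: "c \<ge> 0" using E \<Lambda> by (simp add: c_def)
    have ex: "exp (\<gamma> * \<bar>x\<bar>) \<le> exp (\<gamma> * L)" using a(3) \<gamma> by simp
    have K: "K = (c + 8 * E) * exp (\<gamma> * L)" by (simp add: K_def c_def algebra_simps)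
    have "8 * E * \<bar>l - m\<bar> * exp (\<gamma> * \<bar>x\<bar>) \<le> (c + 8 * E) * \<bar>l - m\<bar> * exp (\<gamma> * L)"
      using c E by (intro mult_mono ex) auto
    moreover have "E * ((2 * (2 + \<Lambda>) * (8 * E) + 4) * \<bar>l - m\<bar>) / \<gamma> * exp (\<gamma> * \<bar>x\<bar>) \<le> (c + 8 * E) * \<bar>l - m\<bar> * exp (\<gamma> * L)"
    proof (intro mult_mono ex)
      have "E * ((2 * (2 + \<Lambda>) * (8 * E) + 4) * \<bar>l - m\<bar>) / \<gamma> = c * \<bar>l - m\<bar> / \<gamma>" by (simp add: c_def mult.assoc)
      also have "\<dots> \<le> c * \<bar>l - m\<bar> / 1" using \<gamma> c by (intro divide_left_mono) auto
      also have "\<dots> \<le> (c + 8 * E) * \<bar>l - m\<bar>" using E by (simp add: mult_right_mono)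
      finally show "E * ((2 * (2 + \<Lambda>) * (8 * E) + 4) * \<bar>l - m\<bar>) / \<gamma> \<le> (c + 8 * E) * \<bar>l - m\<bar>" .
    qed (use c E in auto)
    ultimately show "\<bar>shot l x - shot m x\<bar> \<le> K * \<bar>l - m\<bar> \<and> \<bar>shot' l x - shot' m x\<bar> \<le> K * \<bar>l - m\<bar>"
      using main[OF a] main'[OF a] unfolding K by (simp add: mult_ac)
  qed
qed

section \<open>Sturm comparison through the flux
  \<open>exp (- x\<^sup>2 / 2) \<psi>'\<close>\<close>

definition flux :: "real \<Rightarrow> real \<Rightarrow> real" where
  "flux l = anti (src l (shot l))"

lemma DERIV_flux: "(flux l has_real_derivative 2 * (F x - l) * exp (- x\<^sup>2 / 2) * shot l x) (at x)"
  using DERIV_anti[OF cont_src[OF cont_shot]] unfolding flux_def src_def[symmetric] .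

lemma shot'_flux: "shot' l x = exp (x\<^sup>2 / 2) * flux l x"
  by (simp add: shot'_def slope_def flux_def)

lemma flux_0 [simp]: "flux l 0 = 0" by (simp add: flux_def)

lemma cont_flux: "continuous_on S (flux l)"
  unfolding flux_def by (intro continuous_on_anti cont_src cont_shot)

lemma cont_shot': "continuous_on S (shot' l)"
  unfolding shot'_def by (rule continuous_on_subset[OF cont_slope[OF cont_shot]]) simp

lemma cont_shot_on: "continuous_on S (shot l)"
  by (rule continuous_on_subset[OF cont_shot]) simp

text \<open>In divergence form the weighted Wronskian vanishes at 0 and has derivative 2 (m - l)
  exp(- x^2/2) times the product of the two solutions.\<close>

lemma wronskian_pos:
  assumes lm: "l < m" and c: "c > 0"
    and pos: "\<And>x. 0 \<le> x \<Longrightarrow> x < c \<Longrightarrow> shot l x > 0" "\<And>x. 0 \<le> x \<Longrightarrow> x < c \<Longrightarrow> shot m x > 0"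
  shows "flux l c * shot m c - flux m c * shot l c > 0"
proof -
  have "flux l 0 * shot m 0 - flux m 0 * shot l 0 < flux l c * shot m c - flux m c * shot l c"
  proof (rule DERIV_pos_imp_increasing_open[OF c])
    show "continuous_on {0..c} (\<lambda>x. flux l x * shot m x - flux m x * shot l x)"
      by (intro continuous_intros cont_flux cont_shot_on)
    fix x assume x: "0 < x" "x < c"
    have "((\<lambda>x. flux l x * shot m x - flux m x * shot l x) has_real_derivative
       (2 * (F x - l) * exp (- x\<^sup>2 / 2) * shot l x) * shot m x + shot' m x * flux l x
       - ((2 * (F x - m) * exp (- x\<^sup>2 / 2) * shot m x) * shot l x + shot' l x * flux m x)) (at x)"
      by (intro DERIV_diff DERIV_mult DERIV_flux DERIV_shot)
    moreover have "(2 * (F x - l) * exp (- x\<^sup>2 / 2) * shot l x) * shot m x + shot' m x * flux l x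
       - ((2 * (F x - m) * exp (- x\<^sup>2 / 2) * shot m x) * shot l x + shot' l x * flux m x)
       = 2 * (m - l) * exp (- x\<^sup>2 / 2) * shot l x * shot m x"
      unfolding shot'_flux by (simp add: algebra_simps)
    moreover have "2 * (m - l) * exp (- x\<^sup>2 / 2) * shot l x * shot m x > 0"
      using lm pos(1)[of x] pos(2)[of x] x by simp
    ultimately show "\<exists>y. ((\<lambda>x. flux l x * shot m x - flux m x * shot l x) has_real_derivative y) (at x) \<and> 0 < y" by metis
  qed
  then show ?thesis by simp
qed

lemma flux_le_0_at_first_zero:
  assumes c: "c > 0" and z: "shot l c = 0" and pos: "\<And>x. 0 \<le> x \<Longrightarrow> x < c \<Longrightarrow> shot l x > 0"
  shows "flux l c \<le> 0"
proof (rule ccontr)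
  assume "\<not> flux l c \<le> 0"
  then have "shot' l c > 0" by (simp add: shot'_flux)
  from DERIV_pos_inc_left[OF DERIV_shot this] obtain d where d: "d > 0" "\<And>h. 0 < h \<Longrightarrow> h < d \<Longrightarrow> shot l (c - h) < shot l c"
    by blast
  define h where "h = min c d / 2"
  have "0 < h" "h < d" "h < c" using d c by (auto simp: h_def)
  then show False using d(2)[of h] pos[of "c - h"] z by simp
qed

definition admissible :: "real set" where
  "admissible = {l. \<forall>x\<ge>0. 0 < shot l x}"

lemma not_admissible:
  assumes "l \<notin> admissible"
  obtains c where "c > 0" "shot l c = 0" "\<And>x. 0 \<le> x \<Longrightarrow> x < c \<Longrightarrow> shot l x > 0"
proof -
  from assms obtain b where "b \<ge> 0" "shot l b \<le> 0" by (auto simp: admissible_def not_less)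
  from first_zero[OF cont_shot _ this] that show thesis by (metis shot_0(1) zero_less_one)
qed

text \<open>At a first zero of the solution for \<open>l\<close> the Wronskian reduces to its flux
  there times a positive number. The flux is nonpositive, as the solution arrives from above, which
  contradicts \<open>wronskian_pos\<close>.\<close>

lemma admissible_downward:
  assumes m: "m \<in> admissible" and l: "l < m"
  shows "l \<in> admissible"
proof (rule ccontr)
  assume "l \<notin> admissible"
  then obtain c where c: "c > 0" "shot l c = 0" "\<And>x. 0 \<le> x \<Longrightarrow> x < c \<Longrightarrow> shot l x > 0"
    by (rule not_admissible) blast
  have "flux l c * shot m c - flux m c * shot l c > 0"
    by (rule wronskian_pos[OF l c(1,3)]) (use m in \<open>auto simp: admissible_def\<close>)
  moreover have "flux l c * shot m c \<le> 0"
    using flux_le_0_at_first_zero[OF c] m c(1) by (intro mult_nonpos_nonneg) (auto simp: admissible_def less_imp_le)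
  ultimately show False using c(2) by simp
qed

lemma zero_admissible: "0 \<in> admissible"
proof (rule ccontr)
  assume "0 \<notin> admissible"
  then obtain c where c: "c > 0" "shot 0 c = 0" "\<And>x. 0 \<le> x \<Longrightarrow> x < c \<Longrightarrow> shot 0 x > 0"
    by (rule not_admissible) blast
  have p: "shot 0 x \<ge> 0" if "0 \<le> x" "x \<le> c" for x using c that by (cases "x = c") (auto simp: less_imp_le)
  have f: "flux 0 x \<ge> 0" if "0 \<le> x" "x \<le> c" for x
  proof -
    have "flux 0 0 \<le> flux 0 x"
    proof (rule DERIV_nonneg_imp_nondecreasing[OF that(1)])
      fix y assume "0 \<le> y" "y \<le> x"
      then have "0 \<le> 2 * (F y - 0) * exp (- y\<^sup>2 / 2) * shot 0 y" using F_nonneg[of y] p[of y] that by simp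
      then show "\<exists>z. (flux 0 has_real_derivative z) (at y) \<and> 0 \<le> z" using DERIV_flux by blast
    qed
    then show ?thesis by simp
  qed
  have "shot 0 0 \<le> shot 0 c"
  proof (rule DERIV_nonneg_imp_nondecreasing[where f = "shot 0"])
    show "\<exists>z. (shot 0 has_real_derivative z) (at y) \<and> 0 \<le> z" if "0 \<le> y" "y \<le> c" for y
      using DERIV_shot[of 0 y] f[OF that] by (intro exI[of _ "shot' 0 y"]) (simp add: shot'_flux)
  qed (use c in simp)
  then show False using c by simp
qed

text \<open>For l > 2 \<ge> F the flux is strictly decreasing while the solution is positive, so
  beyond 1 the slope stays below a negative constant - c and the solution reaches 0 at the latest at
  distance \<open>shot l 1 / c\<close>.\<close>

lemma admissible_le_2:
  assumes l: "l \<in> admissible"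
  shows "l \<le> 2"
proof (rule ccontr)
  assume "\<not> l \<le> 2"
  then have l2: "l > 2" by simp
  have pos: "shot l x > 0" if "x \<ge> 0" for x using l that by (simp add: admissible_def)
  have dec: "flux l x < flux l y" if "0 \<le> y" "y < x" for x y
  proof (rule DERIV_neg_imp_decreasing[OF that(2)])
    fix z assume z: "y \<le> z" "z \<le> x"
    have "2 * (F z - l) * exp (- z\<^sup>2 / 2) * shot l z < 0"
      using F_le[of z] l2 pos[of z] z that by (simp add: mult_neg_pos)
    then show "\<exists>w. (flux l has_real_derivative w) (at z) \<and> w < 0" using DERIV_flux by blast
  qed
  define c where "c = - flux l 1"
  have c: "c > 0" using dec[of 0 1] by (simp add: c_def)
  define s where "s = shot l 1 / c"
  have s: "s > 0" using pos[of 1] c by (simp add: s_def)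
  obtain z where z: "1 < z" "z < 1 + s" "shot l (1 + s) - shot l 1 = s * shot' l z"
    using MVT2[of 1 "1 + s" "shot l" "shot' l"] DERIV_shot s by (auto simp: algebra_simps)
  have f: "flux l z \<le> - c" using dec[of 1 z] z by (simp add: c_def)
  then have "flux l z \<le> 0" using c by simp
  have "1 * flux l z \<ge> exp (z\<^sup>2 / 2) * flux l z"
    by (rule mult_right_mono_neg) (use \<open>flux l z \<le> 0\<close> in auto)
  then have "shot' l z \<le> - c" using f by (simp add: shot'_flux)
  then have "s * shot' l z \<le> s * (- c)" using s by (intro mult_left_mono) auto
  also have "\<dots> = - shot l 1" using c by (simp add: s_def)
  finally have "shot l (1 + s) \<le> 0" using z(3) by simp
  then show False using pos[of "1 + s"] s by simp
qed

section \<open>The largest admissible value and the growth of its solution\<close>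

definition bottom :: real where
  "bottom = Sup admissible"

lemma admissible_bdd: "bdd_above admissible"
  using admissible_le_2 by (auto simp: bdd_above_def)

lemma le_bottom: "l \<in> admissible \<Longrightarrow> l \<le> bottom"
  unfolding bottom_def by (rule cSup_upper[OF _ admissible_bdd])

lemma bottom_bounds: "0 \<le> bottom" "bottom \<le> 2"
  using le_bottom[OF zero_admissible] admissible_le_2 zero_admissible
  by (auto simp: bottom_def intro!: cSup_least)

lemma below_bottom:
  assumes "l < bottom"
  shows "l \<in> admissible"
proof -
  obtain m where "m \<in> admissible" "l < m"
    using less_cSupD[of admissible l] assms zero_admissible by (auto simp: bottom_def)
  then show ?thesis by (rule admissible_downward)
qed

text \<open>A zero of the solution for \<open>bottom\<close> would be a transversal crossing, so the
  solution would be negative somewhere. By continuity in the parameter this would persist for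
  slightly smaller values, which are admissible.\<close>

lemma bottom_admissible: "bottom \<in> admissible"
proof (rule ccontr)
  assume "bottom \<notin> admissible"
  then obtain c where c: "c > 0" "shot bottom c = 0" "\<And>x. 0 \<le> x \<Longrightarrow> x < c \<Longrightarrow> shot bottom x > 0"
    by (rule not_admissible) blast
  have adm: "bottom - e \<in> admissible" if "e > 0" for e by (rule below_bottom) (use that in simp)
  \<comment> \<open>The Wronskian with any smaller admissible value excludes a double zero, in place
    of a uniqueness theorem for the differential equation.\<close>
  have "flux (bottom - 1) c * shot bottom c - flux bottom c * shot (bottom - 1) c > 0"
    by (rule wronskian_pos[OF _ c(1)]) (use adm[of 1] c in \<open>auto simp: admissible_def\<close>)
  then have "flux bottom c \<noteq> 0" using c(2) by auto
  then have "flux bottom c < 0" using flux_le_0_at_first_zero[OF c] by simp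
  then have "shot' bottom c < 0" by (simp add: shot'_flux mult_pos_neg)
  from DERIV_neg_dec_right[OF DERIV_shot this] obtain d where d: "d > 0" "\<And>h. 0 < h \<Longrightarrow> h < d \<Longrightarrow> shot bottom (c + h) < shot bottom c"
    by blast
  define y where "y = c + d / 2"
  have y: "shot bottom y < 0" "y \<ge> 0" using d(2)[of "d / 2"] d(1) c by (auto simp: y_def)
  obtain K where K: "\<And>l m x. \<bar>l\<bar> \<le> 3 \<Longrightarrow> \<bar>m\<bar> \<le> 3 \<Longrightarrow> \<bar>x\<bar> \<le> y \<Longrightarrow> \<bar>shot l x - shot m x\<bar> \<le> K * \<bar>l - m\<bar>"
    using shot_lipschitz[of 3 y] y(2) by auto
  define e where "e = min 1 (- shot bottom y / (2 * (\<bar>K\<bar> + 1)))"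
  have "0 < - shot bottom y / (2 * (\<bar>K\<bar> + 1))" using y(1) by (intro divide_pos_pos) auto
  then have e: "0 < e" "e \<le> 1" unfolding e_def by linarith+
  have "\<bar>shot (bottom - e) y - shot bottom y\<bar> \<le> K * \<bar>(bottom - e) - bottom\<bar>"
    by (rule K) (use bottom_bounds e y(2) in auto)
  also have "\<dots> \<le> (\<bar>K\<bar> + 1) * e" using e by (simp add: mult_right_mono)
  also have "\<dots> \<le> (\<bar>K\<bar> + 1) * (- shot bottom y / (2 * (\<bar>K\<bar> + 1)))" by (intro mult_left_mono) (auto simp: e_def)
  also have "\<dots> = - shot bottom y / 2"
  proof -
    have "\<bar>K\<bar> + 1 \<noteq> 0" by linarith
    then show ?thesis by (simp add: field_simps)
  qed
  finally have "shot (bottom - e) y < 0" using y(1) by linarith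
  then show False using adm[OF e(1)] y(2) by (force simp: admissible_def)
qed

text \<open>Once the slope exceeds the value at a large \<open>x0\<close>, it does so forever. By continuity in \<open>l\<close>
  this would make some \<open>l > bottom\<close> admissible, so the ground state grows at most like
  \<open>exp x\<close>, which makes it square integrable.\<close>

lemma admissible_by_growth:
  assumes l: "l \<ge> 0" and x0: "x0 \<ge> 2 * l + 1" and pos: "\<And>x. 0 \<le> x \<Longrightarrow> x \<le> x0 \<Longrightarrow> shot l x > 0"
    and gr: "shot' l x0 > shot l x0"
  shows "l \<in> admissible"
proof -
  \<comment> \<open>The minimum tracks both inequalities at once, so that a single first zero covers
    the failure of either.\<close>
  define k where "k = (\<lambda>x. min (shot l x) (shot' l x - shot l x))"
  have kc: "continuous_on UNIV k" unfolding k_def by (intro continuous_intros cont_shot_on cont_shot')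
  have k0: "k x0 > 0" using pos[of x0] gr x0 l by (simp add: k_def)
  have kpos: "k b > 0" if b: "b \<ge> x0" for b
  proof (rule ccontr)
    assume "\<not> k b > 0"
    then have "k b \<le> 0" by simp
    then obtain c where c: "c > x0" "k c = 0" "\<And>x. x0 \<le> x \<Longrightarrow> x < c \<Longrightarrow> k x > 0"
      using first_zero[OF kc k0 b] by metis
    have p: "shot l x > 0" "shot' l x > shot l x" if "x0 \<le> x" "x < c" for x using c(3)[OF that] by (auto simp: k_def)
    have "shot l x0 < shot l c"
    proof (rule DERIV_pos_imp_increasing_open[OF c(1)])
      show "\<exists>y. (shot l has_real_derivative y) (at x) \<and> 0 < y" if "x0 < x" "x < c" for x
        using DERIV_shot[of l x] p[of x] that by (intro exI[of _ "shot' l x"]) auto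
    qed (rule cont_shot_on)
    then have s: "shot l c > 0" using p(1)[of x0] c(1) by simp
    \<comment> \<open>By the equation the derivative of this gap is (x - 1) \<psi>' + 2 (F - l)
      \<psi>. While \<psi>' > \<psi> > 0 it is at least (x - 1 - 2 l) \<psi>, which explains the
      condition on \<open>x0\<close>.\<close>
    have "(\<lambda>x. shot' l x - shot l x) x0 \<le> (\<lambda>x. shot' l x - shot l x) c"
    proof (rule DERIV_nonneg_imp_increasing_open[where f = "\<lambda>x. shot' l x - shot l x"])
      fix x assume x: "x0 < x" "x < c"
      have "0 \<le> (x - 1 - 2 * l) * shot l x" using x x0 p(1)[of x] by simp
      moreover have "(x - 1) * shot l x \<le> (x - 1) * shot' l x" using x x0 l p(2)[of x] by (intro mult_left_mono) auto
      moreover have "0 \<le> F x * shot l x" using F_nonneg[of x] p(1)[of x] x by simp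
      ultimately have "0 \<le> x * shot' l x + 2 * (F x - l) * shot l x - shot' l x" by (simp add: algebra_simps)
      moreover have "((\<lambda>x. shot' l x - shot l x) has_real_derivative x * shot' l x + 2 * (F x - l) * shot l x - shot' l x) (at x)"
        by (intro DERIV_diff DERIV_shot DERIV_shot')
      ultimately show "\<exists>y. ((\<lambda>x. shot' l x - shot l x) has_real_derivative y) (at x) \<and> 0 \<le> y" by blast
    qed (use c(1) in \<open>auto intro!: continuous_intros cont_shot_on cont_shot'\<close>)
    then have "shot' l c - shot l c > 0" using gr by simp
    then show False using s c(2) by (simp add: k_def min_def split: if_splits)
  qed
  have "shot l x > 0" if "x \<ge> 0" for x
    using pos[OF that] kpos[of x] by (cases "x \<le> x0") (auto simp: k_def)
  then show ?thesis by (simp add: admissible_def)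
qed

lemma bottom_pos: "shot bottom x > 0"
proof -
  have "shot bottom \<bar>x\<bar> > 0" using bottom_admissible by (simp add: admissible_def)
  then show ?thesis using shot_even[of bottom x] by (cases "x \<ge> 0") auto
qed

lemma bottom_slope:
  assumes x0: "x0 \<ge> 2 * bottom + 2"
  shows "shot' bottom x0 \<le> shot bottom x0"
proof (rule ccontr)
  assume "\<not> shot' bottom x0 \<le> shot bottom x0"
  then have gr: "shot' bottom x0 - shot bottom x0 > 0" by simp
  have x00: "x0 \<ge> 0" using x0 bottom_bounds by simp
  obtain y where y: "y \<in> {0..x0}" "\<And>x. x \<in> {0..x0} \<Longrightarrow> shot bottom y \<le> shot bottom x"
    using continuous_attains_inf[of "{0..x0}" "shot bottom"] x00 cont_shot_on by auto
  obtain K where K: "\<And>l m x. \<bar>l\<bar> \<le> 3 \<Longrightarrow> \<bar>m\<bar> \<le> 3 \<Longrightarrow> \<bar>x\<bar> \<le> x0 \<Longrightarrow> \<bar>shot l x - shot m x\<bar> \<le> K * \<bar>l - m\<bar>"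
    "\<And>l m x. \<bar>l\<bar> \<le> 3 \<Longrightarrow> \<bar>m\<bar> \<le> 3 \<Longrightarrow> \<bar>x\<bar> \<le> x0 \<Longrightarrow> \<bar>shot' l x - shot' m x\<bar> \<le> K * \<bar>l - m\<bar>"
    using shot_lipschitz[of 3 x0] x00 by auto
  define b where "b = min (shot bottom y) (shot' bottom x0 - shot bottom x0)"
  have b: "b > 0" using bottom_pos gr by (simp add: b_def)
  \<comment> \<open>The bound 1/2 keeps \<open>x0 \<ge> 2 (bottom + e) + 1\<close>; the other entry
    makes the changes of value and slope at most b/3 each, so both strict inequalities
    survive.\<close>
  define e where "e = min (1/2) (b / (3 * (\<bar>K\<bar> + 1)))"
  have K1: "\<bar>K\<bar> + 1 > 0" by linarith
  have "0 < b / (3 * (\<bar>K\<bar> + 1))" using b K1 by (intro divide_pos_pos) auto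
  then have e: "0 < e" "e \<le> 1/2" unfolding e_def by linarith+
  have "K * e \<le> (\<bar>K\<bar> + 1) * e" using e by (intro mult_right_mono) auto
  also have "\<dots> \<le> (\<bar>K\<bar> + 1) * (b / (3 * (\<bar>K\<bar> + 1)))" using K1 by (intro mult_left_mono) (auto simp: e_def)
  also have "\<dots> = b / 3" using K1 by (simp add: field_simps)
  finally have Ke: "K * e \<le> b / 3" .
  define l where "l = bottom + e"
  have l: "\<bar>l\<bar> \<le> 3" "\<bar>bottom\<bar> \<le> 3" "\<bar>l - bottom\<bar> = e" using bottom_bounds e by (auto simp: l_def)
  have d: "\<bar>shot l x - shot bottom x\<bar> \<le> b / 3" "\<bar>shot' l x - shot' bottom x\<bar> \<le> b / 3" if "\<bar>x\<bar> \<le> x0" for x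
    using K[OF l(1,2) that] Ke unfolding l(3) by linarith+
  have "l \<in> admissible"
  proof (rule admissible_by_growth)
    show "l \<ge> 0" "x0 \<ge> 2 * l + 1" using bottom_bounds e x0 by (auto simp: l_def)
    show "shot l x > 0" if "0 \<le> x" "x \<le> x0" for x
    proof -
      have "b \<le> shot bottom x" using y(2)[of x] that by (simp add: b_def)
      moreover have "\<bar>shot l x - shot bottom x\<bar> \<le> b / 3" by (rule d(1)) (use that in simp)
      ultimately show ?thesis using b by linarith
    qed
    have "b \<le> shot' bottom x0 - shot bottom x0" by (simp add: b_def)
    moreover have "\<bar>x0\<bar> \<le> x0" using x00 by simp
    ultimately show "shot' l x0 > shot l x0" using d(1)[of x0] d(2)[of x0] b by linarith
  qed
  from le_bottom[OF this] show False using e by (simp add: l_def)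
qed

text \<open>Past 2 \<open>bottom\<close> + 2 the slope never exceeds the value, so the solution
  times exp(- x) is nonincreasing there; compactness and evenness give the rest.\<close>

lemma bottom_growth: "\<exists>C>0. \<forall>x. shot bottom x \<le> C * exp \<bar>x\<bar>"
proof -
  define X where "X = 2 * bottom + 2"
  have X: "X \<ge> 0" using bottom_bounds by (simp add: X_def)
  obtain y where y: "\<And>x. x \<in> {0..X} \<Longrightarrow> shot bottom x \<le> shot bottom y"
  proof -
    have "{0..X} \<noteq> {}" using X by simp
    from continuous_attains_sup[OF compact_Icc this cont_shot_on] that show thesis by blast
  qed
  have tail: "shot bottom x * exp (- x) \<le> shot bottom X * exp (- X)" if x: "x \<ge> X" for x
  proof (rule DERIV_nonpos_imp_nonincreasing[OF x])
    fix z assume z: "X \<le> z"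
    have e: "((\<lambda>x. exp (- x)) has_real_derivative - exp (- z)) (at z)"
      by (auto intro!: derivative_eq_intros)
    have "((\<lambda>x. shot bottom x * exp (- x)) has_real_derivative shot' bottom z * exp (- z) + - exp (- z) * shot bottom z) (at z)"
      by (rule DERIV_mult[OF DERIV_shot e])
    moreover have "shot' bottom z * exp (- z) + - exp (- z) * shot bottom z \<le> 0"
      using bottom_slope[of z] z by (simp add: X_def mult.commute)
    ultimately show "\<exists>w. ((\<lambda>x. shot bottom x * exp (- x)) has_real_derivative w) (at z) \<and> w \<le> 0" by blast
  qed
  have nn: "shot bottom x \<le> shot bottom y * exp x" if "x \<ge> 0" for x
  proof (cases "x \<le> X")
    case True
    then have "shot bottom x \<le> shot bottom y * 1" using y[of x] that by simp
    also have "\<dots> \<le> shot bottom y * exp x" using that bottom_pos[of y] by (intro mult_left_mono) auto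
    finally show ?thesis .
  next
    case False
    have "shot bottom X * exp (- X) \<le> shot bottom y * 1"
      using y[of X] X bottom_pos[of y] by (intro mult_mono) auto
    then have "shot bottom x * exp (- x) \<le> shot bottom y" using tail[of x] False by simp
    then have "shot bottom x * exp (- x) * exp x \<le> shot bottom y * exp x" by (rule mult_right_mono) simp
    moreover have "shot bottom x * exp (- x) * exp x = shot bottom x" by (simp add: exp_minus)
    ultimately show ?thesis by simp
  qed
  have "shot bottom x \<le> shot bottom y * exp \<bar>x\<bar>" for x
    using nn[of "\<bar>x\<bar>"] shot_even[of bottom x] by (cases "x \<ge> 0") auto
  then show ?thesis using bottom_pos by blast
qed

lemma ground_state:
  obtains l \<psi> \<psi>1 C where "0 \<le> l" "l \<le> 2" "\<And>x. \<psi> x > 0"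
    "\<And>x. (\<psi> has_real_derivative \<psi>1 x) (at x)"
    "\<And>x. (\<psi>1 has_real_derivative x * \<psi>1 x + 2 * (F x - l) * \<psi> x) (at x)"
    "C > 0" "\<And>x. \<psi> x \<le> C * exp \<bar>x\<bar>"
  using bottom_bounds bottom_pos DERIV_shot DERIV_shot' bottom_growth by metis

end

section \<open>Decay of the difference of two solutions\<close>

text \<open>Determines \<open>sbm_F\<close> from the log-Laplace equation alone, so that the constants below do not depend
  on the realisation of super-Brownian motion: \<open>bump\<close> rescaled by \<open>n\<close> tends to a multiple of \<open>\<delta>\<^sub>0\<close>, and
  \<open>l \<rightarrow> \<infinity>\<close> picks out the event \<open>X(1, 0) = 0\<close>.\<close>

definition iterated_limit :: "(real \<Rightarrow> real) \<Rightarrow> bool" where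
  "iterated_limit F \<longleftrightarrow> (\<exists>G. \<forall>x. (\<forall>l\<ge>1. (\<lambda>n. bsol (real l * real n) (real n) 1 x) \<longlonglongrightarrow> G l x) \<and> (\<lambda>l::nat. G l x) \<longlonglongrightarrow> F x)"

lemma iterated_limitE:
  assumes "iterated_limit F"
  obtains G where "\<And>l x. l \<ge> 1 \<Longrightarrow> (\<lambda>n. bsol (real l * real n) (real n) 1 x) \<longlonglongrightarrow> G l x"
    "\<And>x. (\<lambda>l::nat. G l x) \<longlonglongrightarrow> F x"
  using assms unfolding iterated_limit_def by blast

lemma iterated_limit_unique:
  assumes "iterated_limit F" "iterated_limit F'"
  shows "F = F'"
proof
  fix x
  obtain G where G: "\<And>l x. l \<ge> 1 \<Longrightarrow> (\<lambda>n. bsol (real l * real n) (real n) 1 x) \<longlonglongrightarrow> G l x"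
    "\<And>x. (\<lambda>l::nat. G l x) \<longlonglongrightarrow> F x" using assms(1) by (rule iterated_limitE) blast
  obtain G' where G': "\<And>l x. l \<ge> 1 \<Longrightarrow> (\<lambda>n. bsol (real l * real n) (real n) 1 x) \<longlonglongrightarrow> G' l x"
    "\<And>x. (\<lambda>l::nat. G' l x) \<longlonglongrightarrow> F' x" using assms(2) by (rule iterated_limitE) blast
  have "G l x = G' l x" if "l \<ge> 1" for l by (rule LIMSEQ_unique[OF G(1)[OF that] G'(1)[OF that]])
  then have "eventually (\<lambda>l. G l x = G' l x) sequentially" by (auto simp: eventually_sequentially)
  from tendsto_cong[OF this] have "(\<lambda>l. G' l x) \<longlonglongrightarrow> F x" using G(2) by blast
  then show "F x = F' x" using G'(2) LIMSEQ_unique by blast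
qed

text \<open>Only large \<open>l\<close>, and for each of them only n \<ge> l, are visible to the two
  limits. The restriction is essential for \<open>iterated_limit_compat\<close>, where scaling
  divides both parameters by sqrt t and the quotients must still satisfy 1 \<le> l' \<le>
  n'.\<close>

lemma iterated_limit_le:
  assumes F: "iterated_limit F" and b: "\<And>l n. real l \<ge> L \<Longrightarrow> l \<ge> 1 \<Longrightarrow> n \<ge> l \<Longrightarrow> bsol (real l * real n) (real n) 1 x \<le> b"
  shows "F x \<le> b"
proof -
  obtain G where G: "\<And>l x. l \<ge> 1 \<Longrightarrow> (\<lambda>n. bsol (real l * real n) (real n) 1 x) \<longlonglongrightarrow> G l x"
    "\<And>x. (\<lambda>l::nat. G l x) \<longlonglongrightarrow> F x" using F by (rule iterated_limitE) blast
  have "G l x \<le> b" if "real l \<ge> L" "l \<ge> 1" for l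
    using LIMSEQ_le_const2[OF G(1)[OF that(2)]] b[OF that] by blast
  moreover obtain l0 :: nat where "real l0 \<ge> L" using real_arch_simple by blast
  ultimately have "\<exists>N. \<forall>l\<ge>N. G l x \<le> b"
    by (intro exI[of _ "max l0 1"] allI impI) (auto simp: max_def split: if_splits)
  then show ?thesis using LIMSEQ_le_const2[OF G(2)] by blast
qed

lemma iterated_limit_diff_le:
  assumes F: "iterated_limit F" and b: "\<And>l n. l \<ge> 1 \<Longrightarrow> n \<ge> 1 \<Longrightarrow> \<bar>bsol (real l * real n) (real n) 1 x - bsol (real l * real n) (real n) 1 y\<bar> \<le> b"
  shows "\<bar>F x - F y\<bar> \<le> b"
proof -
  obtain G where G: "\<And>l x. l \<ge> 1 \<Longrightarrow> (\<lambda>n. bsol (real l * real n) (real n) 1 x) \<longlonglongrightarrow> G l x"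
    "\<And>x. (\<lambda>l::nat. G l x) \<longlonglongrightarrow> F x" using F by (rule iterated_limitE) blast
  have "\<bar>G l x - G l y\<bar> \<le> b" if l: "l \<ge> 1" for l
  proof (rule LIMSEQ_le_const2)
    show "(\<lambda>n. \<bar>bsol (real l * real n) (real n) 1 x - bsol (real l * real n) (real n) 1 y\<bar>) \<longlonglongrightarrow> \<bar>G l x - G l y\<bar>"
      by (intro tendsto_intros G l)
  qed (use b l in blast)
  moreover have "(\<lambda>l. \<bar>G l x - G l y\<bar>) \<longlonglongrightarrow> \<bar>F x - F y\<bar>" by (intro tendsto_intros G)
  ultimately show ?thesis using LIMSEQ_le_const2 by blast
qed

text \<open>Continuity survives the two pointwise limits because all approximants share one
  Lipschitz constant at time 1.\<close>

lemma iterated_limit_potential: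
  assumes F: "iterated_limit F" and F0: "\<And>x. 0 \<le> F x"
  shows "potential F"
proof
  obtain L where L: "\<And>f u x y. sol f u \<Longrightarrow> \<bar>u 1 x - u 1 y\<bar> \<le> L * \<bar>x - y\<bar>" using sol_lipschitz_at_1 by blast
  have lip: "\<bar>F x - F y\<bar> \<le> L * \<bar>x - y\<bar>" for x y
    by (rule iterated_limit_diff_le[OF F], rule L[OF sol_bsol]) simp
  show "continuous_on UNIV F"
  proof (rule continuous_at_imp_continuous_on, intro ballI)
    fix x
    have l: "((\<lambda>y. L * \<bar>y - x\<bar>) \<longlongrightarrow> L * \<bar>x - x\<bar>) (at x)" by (intro tendsto_intros)
    have "((\<lambda>y. F y - F x) \<longlongrightarrow> 0) (at x)"
      by (rule Lim_null_comparison[where g = "\<lambda>y. L * \<bar>y - x\<bar>"]) (use lip l in auto)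
    then show "isCont F x" unfolding isCont_def by (rule LIM_zero_cancel)
  qed
  show "0 \<le> F x" for x by (rule F0)
  show "F x \<le> 2" for x
    by (rule iterated_limit_le[OF F, where L = 0]) (use bsol_le_2_div_t[of _ 1] in \<open>auto simp: mult_pos_pos\<close>)
  show "F (- x) = F x" for x
  proof -
    have "\<bar>F (- x) - F x\<bar> \<le> 0"
      by (rule iterated_limit_diff_le[OF F]) (simp add: bsol_even)
    then show ?thesis by simp
  qed
qed

text \<open>F(x / sqrt t)/t is the value at (t, x) of the self-similar limit. Scaling time 1 to time
  t turns the approximants of F into bump solutions at time t, to which
  \<open>bsol_diff_decay\<close> applies with constants common to all F.\<close>

lemma iterated_limit_compat:
  "\<exists>\<delta>>0. \<exists>C>0. \<forall>F M t x. iterated_limit F \<and> 1 \<le> M \<and> 1 \<le> t \<longrightarrow>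
     F (x / sqrt t) / t \<le> bsol M M t x + C * t powr (- 1 - \<delta>)"
proof -
  obtain \<delta> C where \<delta>: "\<delta> > 0" and C: "C > 0"
    and dec: "\<And>l n M t x. 1 \<le> l \<Longrightarrow> l \<le> n \<Longrightarrow> 1 \<le> M \<Longrightarrow> 1 \<le> t \<Longrightarrow> bsol (l * n) n t x - bsol M M t x \<le> C * t powr (- 1 - \<delta>)"
    using bsol_diff_decay by blast
  have "F (x / sqrt t) / t \<le> bsol M M t x + C * t powr (- 1 - \<delta>)"
    if F: "iterated_limit F" and M: "1 \<le> M" and t: "1 \<le> t" for F M t x
  proof -
    define r where "r = sqrt t"
    have r: "r \<ge> 1" "r\<^sup>2 = t" using t by (auto simp: r_def)
    have "F (x / sqrt t) \<le> t * (bsol M M t x + C * t powr (- 1 - \<delta>))"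
    proof (rule iterated_limit_le[OF F, where L = r])
      fix l n :: nat assume l: "r \<le> real l" "1 \<le> l" and n: "l \<le> n"
      \<comment> \<open>Scaling by \<open>r\<close> multiplies the mass of the datum by
        \<open>r\<close>, so the mass \<open>l\<close> at time 1 corresponds to l/r at time
        t.\<close>
      define l' where "l' = real l / r"
      define n' where "n' = real n / r"
      have ln: "1 \<le> l'" "l' \<le> n'" using l n r by (auto simp: l'_def n'_def divide_right_mono)
      have e: "real l * real n = r\<^sup>2 * (l' * n')" "real n = n' * r" using r by (auto simp: l'_def n'_def power2_eq_square)
      have "bsol (real l * real n) (real n) 1 (x / r) = bsol (r\<^sup>2 * (l' * n')) (n' * r) 1 (x / r)"
        by (simp only: e(1)[symmetric] e(2)[symmetric])
      also have "\<dots> = r\<^sup>2 * bsol (l' * n') n' (r\<^sup>2 * 1) (r * (x / r))"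
        by (rule bsol_scale) (use ln r in auto)
      also have "\<dots> = t * bsol (l' * n') n' t x" using r by simp
      also have "\<dots> \<le> t * (bsol M M t x + C * t powr (- 1 - \<delta>))"
        using dec[OF ln M t, of x] t by (intro mult_left_mono) auto
      finally show "bsol (real l * real n) (real n) 1 (x / sqrt t) \<le> t * (bsol M M t x + C * t powr (- 1 - \<delta>))"
        by (simp add: r_def)
    qed
    then show ?thesis using t by (simp add: divide_le_eq mult.commute)
  qed
  then show ?thesis using \<delta> C by blast
qed

context potential
begin

text \<open>For \<alpha> = - 1/2 - l the right-hand side is - (F/t) times the function, so the
  product is an exact solution of the linear equation with potential F(x / sqrt t)/t. Lowering
  \<alpha> by 1 leaves an additional - 1, the source of strictness in
  \<open>bsol_gap_decay\<close>.\<close>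

lemma C12_at_ground_state:
  assumes t: "t > 0"
    and \<psi>: "\<And>x. (\<psi> has_real_derivative \<psi>1 x) (at x)"
      "\<And>x. (\<psi>1 has_real_derivative x * \<psi>1 x + 2 * (F x - l) * \<psi> x) (at x)"
  shows "\<exists>a b. C12_at (\<lambda>t x. t powr \<alpha> * (\<psi> (x / sqrt t) * exp (- (x / sqrt t)\<^sup>2 / 2))) t x a b \<and>
    a - b / 2 = t powr (\<alpha> - 1) * ((\<alpha> + 1 / 2 + l - F (x / sqrt t)) * (\<psi> (x / sqrt t) * exp (- (x / sqrt t)\<^sup>2 / 2)))"
proof -
  have e: "((\<lambda>y. exp (- y\<^sup>2 / 2)) has_real_derivative - y * exp (- y\<^sup>2 / 2)) (at y)" for y :: real
    by (auto intro!: derivative_eq_intros)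
  define G where "G = (\<lambda>y. \<psi> y * exp (- y\<^sup>2 / 2))"
  define G1 where "G1 = (\<lambda>y. (\<psi>1 y - y * \<psi> y) * exp (- y\<^sup>2 / 2))"
  define G2 where "G2 = (\<lambda>y. (2 * (F y - l) * \<psi> y - \<psi> y - y * (\<psi>1 y - y * \<psi> y)) * exp (- y\<^sup>2 / 2))"
  have d1: "(G has_real_derivative G1 y) (at y)" for y
    unfolding G_def G1_def by (rule DERIV_cong[OF DERIV_mult[OF \<psi>(1) e]]) (simp add: algebra_simps)
  have d: "((\<lambda>y. \<psi>1 y - y * \<psi> y) has_real_derivative (y * \<psi>1 y + 2 * (F y - l) * \<psi> y) - (1 * \<psi> y + \<psi>1 y * y)) (at y)" for y
    by (intro DERIV_diff DERIV_mult DERIV_ident \<psi>)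
  have d2: "(G1 has_real_derivative G2 y) (at y)" for y
    unfolding G1_def G2_def by (rule DERIV_cong[OF DERIV_mult[OF d e]]) (simp add: algebra_simps)
  have "\<alpha> * G y - y / 2 * G1 y - G2 y / 2 = (\<alpha> + 1 / 2 + l - F y) * G y" for y
    unfolding G_def G1_def G2_def by (simp add: field_simps)
  then have "t powr (\<alpha> - 1) * (\<alpha> * G y - y / 2 * G1 y) - t powr (\<alpha> - 1) * G2 y / 2 = t powr (\<alpha> - 1) * ((\<alpha> + 1 / 2 + l - F y) * G y)" for y
    by (metis (no_types, lifting) right_diff_distrib times_divide_eq_right)
  with C12_at_self_similar[OF t d1 d2, of \<alpha> x] show ?thesis unfolding G_def by blast
qed

text \<open>The exact self-similar solution is not enough: no lower bound on the tail of \<psi> is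
  known, whereas at t = 1 the difference is controlled only by a Gaussian of rate 1/16. A Gaussian
  of that rate therefore has to be added. It violates the inequality for moderate y, and a lower
  order multiple of the self-similar profile compensates for this.\<close>

lemma bsol_gap_decay:
  assumes l: "0 \<le> l" "l \<le> 2" and \<psi>0: "\<And>x. \<psi> x > 0"
    and \<psi>: "\<And>x. (\<psi> has_real_derivative \<psi>1 x) (at x)"
      "\<And>x. (\<psi>1 has_real_derivative x * \<psi>1 x + 2 * (F x - l) * \<psi> x) (at x)"
    and D: "\<And>x. \<psi> x \<le> D * exp \<bar>x\<bar>"
    and \<delta>: "\<delta> > 0" and C: "C > 0"
    and compat: "\<And>M t x. 1 \<le> M \<Longrightarrow> 1 \<le> t \<Longrightarrow> F (x / sqrt t) / t \<le> bsol M M t x + C * t powr (- 1 - \<delta>)"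
  shows "\<exists>A>0. \<forall>K M t x. 1 \<le> M \<and> 2 \<le> K \<and> M \<le> K \<and> 1 \<le> t \<longrightarrow>
    bsol K M t x - bsol M M t x \<le> A * t powr (- 1 / 2 - l)"
proof -
  define g where "g = (\<lambda>y. \<psi> y * exp (- y\<^sup>2 / 2))"
  define k where "k = (\<lambda>y::real. exp (- (1/16) * y\<^sup>2))"
  have \<psi>c: "continuous_on S \<psi>" for S
    using \<psi>(1) by (meson DERIV_isCont continuous_at_imp_continuous_on)
  have gc: "continuous_on S g" for S unfolding g_def by (intro continuous_intros \<psi>c) simp
  have g0: "g y > 0" for y using \<psi>0 by (simp add: g_def)
  have D0: "D > 0" using \<psi>0[of 0] D[of 0] by simp
  have gD: "g y \<le> 2 * D" for y
  proof -
    have "g y \<le> D * exp \<bar>y\<bar> * exp (- y\<^sup>2 / 2)" unfolding g_def by (rule mult_right_mono[OF D]) simp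
    also have "\<dots> = D * exp (\<bar>y\<bar> + - y\<^sup>2 / 2)" by (simp only: exp_add mult.assoc)
    also have "\<dots> \<le> D * 2"
    proof (rule mult_left_mono)
      have "0 \<le> (\<bar>y\<bar> - 1)\<^sup>2" by simp
      then have "\<bar>y\<bar> + - y\<^sup>2 / 2 \<le> 1/2" by (simp add: power2_eq_square algebra_simps)
      then have "exp (\<bar>y\<bar> + - y\<^sup>2 / 2) \<le> exp (1/2)" by simp
      also have "exp (1/2) \<le> (2::real)"
      proof -
        have "1 - 1/2 \<le> exp (- (1/2) :: real)" using exp_ge_add_one_self[of "- (1/2) :: real"] by simp
        then show ?thesis by (simp add: exp_minus field_simps)
      qed
      finally show "exp (\<bar>y\<bar> + - y\<^sup>2 / 2) \<le> 2" .
    qed (use D0 in simp)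
    finally show ?thesis by simp
  qed
  obtain y0 where y0: "\<And>y. y \<in> {- 8..8} \<Longrightarrow> g y0 \<le> g y"
  proof -
    have "{- 8..8::real} \<noteq> {}" by simp
    from continuous_attains_inf[OF compact_Icc this gc] that show thesis by blast
  qed
  \<comment> \<open>On \<bar>y\<bar> \<le> 8 the Gaussian term in the bracket is at least - 4
    \<alpha>, since - 3/2 - l \<ge> - 7/2, and this \<alpha> makes g \<ge> 4 \<alpha> there. For
    \<bar>y\<bar> \<ge> 8 the term 7 y^2/128 \<ge> 7/2 makes the bracket nonnegative by
    itself.\<close>
  define \<alpha> where "\<alpha> = g y0 / 4"
  have \<alpha>: "\<alpha> > 0" using g0 by (simp add: \<alpha>_def)
  have k01: "0 < k y" "k y \<le> 1" for y by (auto simp: k_def)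
  have bracket: "0 \<le> g y + \<alpha> * (k y * (- 3 / 2 - l + 1 / 16 + 7 * y\<^sup>2 / 128 + F y))" for y
  proof (cases "\<bar>y\<bar> \<le> 8")
    case True
    then have "4 * \<alpha> \<le> g y" using y0[of y] by (auto simp: \<alpha>_def abs_le_iff)
    moreover have "k y * (- 4) \<le> k y * (- 3 / 2 - l + 1 / 16 + 7 * y\<^sup>2 / 128 + F y)"
      using l F_nonneg[of y] k01(1)[of y] zero_le_power2[of y] by (intro mult_left_mono) linarith+
    then have "- 4 \<le> k y * (- 3 / 2 - l + 1 / 16 + 7 * y\<^sup>2 / 128 + F y)" using k01(2)[of y] by linarith
    then have "\<alpha> * (- 4) \<le> \<alpha> * (k y * (- 3 / 2 - l + 1 / 16 + 7 * y\<^sup>2 / 128 + F y))"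
      using \<alpha> by (intro mult_left_mono) auto
    ultimately show ?thesis by linarith
  next
    case False
    then have "8\<^sup>2 \<le> \<bar>y\<bar>\<^sup>2" by (intro power_mono) auto
    then have "64 \<le> y\<^sup>2" by simp
    then have b: "0 \<le> - 3 / 2 - l + 1 / 16 + 7 * y\<^sup>2 / 128 + F y" using l F_nonneg[of y] by linarith
    have "0 \<le> \<alpha> * (k y * (- 3 / 2 - l + 1 / 16 + 7 * y\<^sup>2 / 128 + F y))"
      using \<alpha> k01(1)[of y] b by (intro mult_nonneg_nonneg) auto
    then show ?thesis using g0[of y] by linarith
  qed
  text \<open>The term with the weight \<open>- 1 / t\<close> makes \<open>W0\<close> a strict supersolution where \<open>g\<close> is not small,
    \<open>k\<close> dominates every \<open>bsol K M\<close> at \<open>t = 1\<close>, and \<open>exp (B t)\<close> absorbs the error of order \<open>t\<close> to the power \<open>- 1 - \<delta>\<close> in the potential.\<close>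
  define a1 where "a1 = - 1 / 2 - l"
  define W0 where "W0 = (\<lambda>t x. 2 * (t powr a1 * g (x / sqrt t)) - t powr (a1 - 1) * g (x / sqrt t) + \<alpha> * (t powr (a1 - 1) * k (x / sqrt t)))"
  define B where "B = (\<lambda>t. - (C / \<delta>) * t powr (- \<delta>))"
  define W where "W = (\<lambda>t x. exp (B t) * W0 t x)"
  have W0_form: "W0 t x = t powr a1 * ((2 - 1 / t) * g (x / sqrt t) + \<alpha> / t * k (x / sqrt t))" if "t > 0" for t x
    using that by (simp add: W0_def powr_diff field_simps)
  have W0_nonneg: "W0 t x \<ge> 0" if "t \<ge> 1" for t x
  proof -
    \<comment> \<open>The coefficient 2 of the leading term outweighs the subtracted 1/t for all t
      \<ge> 1.\<close>
    have "1 / t \<le> 1" using that by simp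
    then have "1 / t \<le> 2" by linarith
    then show ?thesis unfolding W0_form[of t x, OF less_le_trans[OF zero_less_one that]]
      using that g0[of "x / sqrt t"] k01(1)[of "x / sqrt t"] \<alpha>
      by (intro mult_nonneg_nonneg add_nonneg_nonneg) auto
  qed
  have W0_upper: "W0 t x \<le> (4 * D + \<alpha>) * t powr a1" if t: "t \<ge> 1" for t x
  proof -
    have "1 / t \<le> 1" "0 \<le> 1 / t" using t by auto
    then have "(2 - 1 / t) * g (x / sqrt t) \<le> 2 * (2 * D)"
      using gD g0[of "x / sqrt t"] by (intro mult_mono) auto
    moreover have "\<alpha> / t * k (x / sqrt t) \<le> \<alpha> * 1"
    proof (intro mult_mono k01)
      show "\<alpha> / t \<le> \<alpha>" using t \<alpha> by (simp add: divide_le_eq)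
    qed (use \<alpha> k01(1)[of "x / sqrt t"] in auto)
    ultimately have "(2 - 1 / t) * g (x / sqrt t) + \<alpha> / t * k (x / sqrt t) \<le> 4 * D + \<alpha>" by simp
    then have "t powr a1 * ((2 - 1 / t) * g (x / sqrt t) + \<alpha> / t * k (x / sqrt t)) \<le> t powr a1 * (4 * D + \<alpha>)"
      by (rule mult_left_mono) simp
    then show ?thesis using W0_form[of t x] t by (simp add: mult.commute)
  qed
  have B0: "B t \<le> 0" for t using C \<delta> by (simp add: B_def)
  have W_super: "\<exists>a b. C12_at W t x a b \<and> (C * t powr (- 1 - \<delta>) - F (x / sqrt t) / t) * W t x \<le> a - b / 2" if t: "t \<ge> 1" for t x
  proof -
    have t0: "t > 0" using t by simp
    define y where "y = x / sqrt t"
    define P where "P = t powr (a1 - 1)"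
    have P: "P > 0" "t powr (a1 - 1 - 1) = P / t" "t powr a1 = t * P" using t0 by (auto simp: P_def powr_diff power2_eq_square)
    obtain p1 q1 where 1: "C12_at (\<lambda>t x. t powr a1 * g (x / sqrt t)) t x p1 q1"
      "p1 - q1 / 2 = P * ((a1 + 1 / 2 + l - F y) * g y)"
      using C12_at_ground_state[OF t0 \<psi>, of a1 x] unfolding g_def y_def P_def by blast
    obtain p2 q2 where 2: "C12_at (\<lambda>t x. t powr (a1 - 1) * g (x / sqrt t)) t x p2 q2"
      "p2 - q2 / 2 = P / t * ((a1 - 1 + 1 / 2 + l - F y) * g y)"
      using C12_at_ground_state[OF t0 \<psi>, of "a1 - 1" x] unfolding P(2) g_def y_def by blast
    define p3 where "p3 = P / t * ((a1 - 1 + (1/16) * y\<^sup>2) * k y)"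
    define q3 where "q3 = P / t * ((4 * (1/16)\<^sup>2 * y\<^sup>2 - 2 * (1/16)) * k y)"
    have 3: "C12_at (\<lambda>t x. t powr (a1 - 1) * k (x / sqrt t)) t x p3 q3"
      using C12_at_gaussian[OF t0, of "a1 - 1" "1/16" x] unfolding k_def p3_def q3_def y_def P(2) .
    have 33: "p3 - q3 / 2 = P / t * ((- 3 / 2 - l + 1 / 16 + 7 * y\<^sup>2 / 128) * k y)"
    proof -
      have "Q * ((a + (1/16) * Y) * \<kappa>) - Q * ((4 * (1/16)\<^sup>2 * Y - 2 * (1/16)) * \<kappa>) / 2 = Q * ((a + 1 / 16 + 7 * Y / 128) * \<kappa>)"
        for Q a Y \<kappa> :: real by (simp add: field_simps power2_eq_square)
      moreover have "a1 - 1 = - 3 / 2 - l" by (simp add: a1_def)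
      ultimately show ?thesis unfolding p3_def q3_def by (simp only:)
    qed
    define p0 where "p0 = 2 * p1 - p2 + \<alpha> * p3"
    define q0 where "q0 = 2 * q1 - q2 + \<alpha> * q3"
    have 0: "C12_at W0 t x p0 q0" unfolding W0_def p0_def q0_def
      by (intro C12_at_add C12_at_diff C12_at_cmult 1 2 3)
    have "p0 - q0 / 2 = 2 * (p1 - q1 / 2) - (p2 - q2 / 2) + \<alpha> * (p3 - q3 / 2)"
      unfolding p0_def q0_def by (simp add: field_simps)
    also have "\<dots> = P / t * (g y + \<alpha> * (k y * (- 3 / 2 - l + 1 / 16 + 7 * y\<^sup>2 / 128 + F y))) - F y / t * W0 t x"
    proof -
      have w: "W0 t x = 2 * (t * P * g y) - P * g y + \<alpha> * (P * k y)"
        unfolding W0_def P(3) P_def[symmetric] y_def[symmetric] by simp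
      show ?thesis unfolding 1(2) 2(2) 33 w using t0 by (simp add: a1_def field_simps)
    qed
    finally have w0: "- (F y / t * W0 t x) \<le> p0 - q0 / 2"
      using bracket[of y] P(1) t0 by simp
    have dB: "((\<lambda>t. t powr (- \<delta>)) has_real_derivative - \<delta> * t powr (- \<delta> - 1)) (at t)"
      by (rule has_real_derivative_powr[OF t0])
    have "(B has_real_derivative C * t powr (- 1 - \<delta>)) (at t)"
    proof -
      have "- (C / \<delta>) * (- \<delta> * t powr (- \<delta> - 1)) = C * t powr (- 1 - \<delta>)"
        unfolding minus_diff_commute[of \<delta> 1] using \<delta> by simp
      with DERIV_cmult[OF dB, of "- (C / \<delta>)"]
      show ?thesis unfolding B_def by (simp only:)
    qed
    from DERIV_fun_exp[OF this]
    have "((\<lambda>t. exp (B t)) has_real_derivative exp (B t) * (C * t powr (- 1 - \<delta>))) (at t)" .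
    from C12_at_time_mult[OF 0 this]
    have c: "C12_at W t x (exp (B t) * (C * t powr (- 1 - \<delta>)) * W0 t x + exp (B t) * p0) (exp (B t) * q0)"
      unfolding W_def .
    have "exp (B t) * (- (F y / t * W0 t x)) \<le> exp (B t) * (p0 - q0 / 2)" using w0 by (rule mult_left_mono) simp
    then have "(C * t powr (- 1 - \<delta>) - F y / t) * W t x \<le> exp (B t) * (C * t powr (- 1 - \<delta>)) * W0 t x + exp (B t) * p0 - exp (B t) * q0 / 2"
      unfolding W_def by (simp add: algebra_simps)
    with c show ?thesis unfolding y_def by blast
  qed
  have W_nonneg: "W t x \<ge> 0" if "t \<ge> 1" for t x using W0_nonneg[OF that] by (simp add: W_def)
  have Wc: "continuous_on ({1..T} \<times> UNIV) (\<lambda>(t, x). W t x)" for T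
  proof -
    have p: "t > 0" if "(t, x) \<in> {1..T} \<times> (UNIV :: real set)" for t x :: real using that by auto
    have y: "continuous_on ({1..T} \<times> UNIV) (\<lambda>p::real \<times> real. snd p / sqrt (fst p))"
      by (intro continuous_intros) auto
    have "continuous_on ({1..T} \<times> UNIV) (\<lambda>p. g (snd p / sqrt (fst p)))"
      by (rule continuous_on_compose2[OF gc[of UNIV] y]) simp
    moreover have "continuous_on UNIV k" unfolding k_def by (intro continuous_intros)
    from continuous_on_compose2[OF this y] have "continuous_on ({1..T} \<times> UNIV) (\<lambda>p. k (snd p / sqrt (fst p)))" by simp
    moreover have "continuous_on ({1..T} \<times> UNIV) (\<lambda>p::real \<times> real. fst p powr b)" for b
      by (intro continuous_intros) auto
    ultimately show ?thesis unfolding W_def W0_def B_def case_prod_beta by (intro continuous_intros) auto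
  qed
  \<comment> \<open>At t = 1 one has exp(B t) = exp(- C/\<delta>) and W0 \<ge> \<alpha> k, so this
    factor lifts \<open>W\<close> above the tail bound 64 k.\<close>
  define A where "A = 64 * exp (C / \<delta>) / \<alpha>"
  have A: "A > 0" using \<alpha> by (simp add: A_def)
  have main: "bsol K M t x - bsol M M t x \<le> A * (4 * D + \<alpha>) * t powr (- 1 / 2 - l)"
    if M: "1 \<le> M" and K: "2 \<le> K" and MK: "M \<le> K" and t: "1 \<le> t" for K M t x
  proof -
    have K0: "K > 0" and M0: "M > 0" using K M by auto
    define v where "v = bsol K M"
    define u where "u = bsol M M"
    note sv = sol_bsol[OF K0, of M, folded v_def]
    note su = sol_bsol[OF M0, of M, folded u_def]
    have uv: "u t x \<le> v t x" if "t \<ge> 0" for t x unfolding u_def v_def by (rule bsol_mono[OF M0 MK that])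
    have u0: "0 \<le> u t x" if "t \<ge> 0" for t x by (rule solD(3)[OF su that])
    have "v t x - u t x - A * W t x \<le> 0"
    proof (rule max_principle[OF closed_UNIV, where w = "\<lambda>t x. v t x - u t x - A * W t x" and B = 2 and T = t and ?t0.0 = 1])
      have sub: "{1..t} \<times> UNIV \<subseteq> {0..} \<times> (UNIV :: real set)" by auto
      show "continuous_on ({1..t} \<times> UNIV) (\<lambda>(t, x). v t x - u t x - A * W t x)"
        unfolding case_prod_beta
        by (intro continuous_intros sol_cont_subset[OF sv sub, unfolded case_prod_beta]
            sol_cont_subset[OF su sub, unfolded case_prod_beta] Wc[unfolded case_prod_beta])
    next
      fix s x assume s: "s \<in> {1..t}"
      have "v s x \<le> 2 / s" using sol_le_2_div_t[OF sv, of s x] s by simp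
      moreover have "2 / s \<le> 2 / 1" using s by (intro frac_le) auto
      moreover have "0 \<le> A * W s x" using A W_nonneg[of s x] s by simp
      moreover have "0 \<le> u s x" using u0 s by simp
      ultimately show "v s x - u s x - A * W s x \<le> 2" by linarith
    next
      fix x
      have "v 1 x \<le> 64 * k x" unfolding v_def k_def by (rule bsol_tail[OF K M])
      also have "\<dots> = A * (exp (- (C / \<delta>)) * (\<alpha> * k x))" using \<alpha> by (simp add: A_def exp_minus)
      also have "\<dots> \<le> A * W 1 x"
      proof (rule mult_left_mono)
        have "\<alpha> * k x \<le> W0 1 x" using g0[of x] by (simp add: W0_def)
        then show "exp (- (C / \<delta>)) * (\<alpha> * k x) \<le> W 1 x" unfolding W_def B_def by simp
      qed (use A in simp)
      finally show "v 1 x - u 1 x - A * W 1 x \<le> 0" using u0[of 1 x] by simp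
    next
      fix s x assume s: "1 < s" "s \<le> t" and pos: "v s x - u s x - A * W s x > 0"
      have s0: "s > 0" "s \<ge> 1" using s by auto
      from solD(5)[OF sv s0(1), of x] obtain va vb where va: "C12_at v s x va vb" "va = vb / 2 - (v s x)\<^sup>2 / 2" by blast
      from solD(5)[OF su s0(1), of x] obtain ua ub where ua: "C12_at u s x ua ub" "ua = ub / 2 - (u s x)\<^sup>2 / 2" by blast
      from W_super[OF s0(2), of x] obtain wa wb where w: "C12_at W s x wa wb"
        "(C * s powr (- 1 - \<delta>) - F (x / sqrt s) / s) * W s x \<le> wa - wb / 2" by blast
      have c: "C12_at (\<lambda>t x. v t x - u t x - A * W t x) s x (va - ua - A * wa) (vb - ub - A * wb)"
        by (intro C12_at_diff C12_at_cmult va ua w)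
      have uF: "F (x / sqrt s) / s - C * s powr (- 1 - \<delta>) \<le> u s x"
        using compat[OF M s0(2), of x] unfolding u_def by simp
      have AW: "0 \<le> A * W s x" using A W_nonneg[OF s0(2)] by simp
      \<comment> \<open>The chain replaces the potential F/s by u, then A W by v - u, which is
        larger at the points considered, and finally u (v - u) by (v^2 - u^2)/2.\<close>
      have "A * ((C * s powr (- 1 - \<delta>) - F (x / sqrt s) / s) * W s x) \<le> A * (wa - wb / 2)"
        using w(2) A by (intro mult_left_mono) auto
      moreover have "(F (x / sqrt s) / s - C * s powr (- 1 - \<delta>)) * (A * W s x) \<le> u s x * (A * W s x)"
        by (rule mult_right_mono[OF uF AW])
      moreover have "u s x * (A * W s x) \<le> u s x * (v s x - u s x)"
        using pos u0[of s x] s0 by (intro mult_left_mono) auto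
      moreover have "u s x * (v s x - u s x) \<le> ((v s x)\<^sup>2 - (u s x)\<^sup>2) / 2"
        using zero_le_power2[of "v s x - u s x"] by (simp add: power2_eq_square algebra_simps)
      moreover have "A * ((C * s powr (- 1 - \<delta>) - F (x / sqrt s) / s) * W s x) = - ((F (x / sqrt s) / s - C * s powr (- 1 - \<delta>)) * (A * W s x))"
        by (simp add: algebra_simps)
      ultimately have "- (((v s x)\<^sup>2 - (u s x)\<^sup>2) / 2) \<le> A * (wa - wb / 2)" by linarith
      then have "va - ua - A * wa \<le> (vb - ub - A * wb) / 2"
        unfolding va(2) ua(2) by (simp add: field_simps)
      with c show "x \<in> interior UNIV \<and> (\<exists>a b. C12_at (\<lambda>t x. v t x - u t x - A * W t x) s x a b \<and> a \<le> b / 2)"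
        by (intro conjI exI[of _ "va - ua - A * wa"] exI[of _ "vb - ub - A * wb"]) (simp, assumption+)
    qed (use t in auto)
    moreover have "W t x \<le> (4 * D + \<alpha>) * t powr a1"
    proof -
      have "W t x \<le> 1 * W0 t x" unfolding W_def using B0 W0_nonneg[OF t] by (intro mult_right_mono) auto
      then show ?thesis using W0_upper[OF t, of x] by simp
    qed
    then have "A * W t x \<le> A * ((4 * D + \<alpha>) * t powr a1)" using A by (intro mult_left_mono) auto
    ultimately show ?thesis unfolding u_def v_def a1_def by (simp add: mult.assoc)
  qed
  have "A * (4 * D + \<alpha>) > 0" using A D0 \<alpha> by simp
  then show ?thesis using main by blast
qed

end

section \<open>Eigenvalues of the killed Ornstein--Uhlenbeck generator\<close>

text \<open>For lam < 0 \<le> F the quantity h h' exp(- x^2/2) is nondecreasing. Once positive it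
  stays above some q0 > 0, so (h^2)' \<ge> 2 q0 exp(x^2/2). Then h^2 grows at least like
  exp(x^2/2)/x, and its product with the Gaussian density like 1/x, which is not integrable.\<close>

lemma eigen_growth_not_integrable:
  fixes F h h1 :: "real \<Rightarrow> real"
  assumes F: "\<And>x. 0 \<le> F x" and lam: "lam < 0"
    and h: "\<And>x. (h has_real_derivative h1 x) (at x)"
    and h1: "\<And>x. (h1 has_real_derivative x * h1 x + 2 * (F x - lam) * h x) (at x)"
    and q: "h x0 * h1 x0 > 0"
  shows "\<not> integrable std_gauss (\<lambda>x. (h x)\<^sup>2)"
proof
  assume int: "integrable std_gauss (\<lambda>x. (h x)\<^sup>2)"
  have e: "((\<lambda>y. exp (- y\<^sup>2 / 2)) has_real_derivative - y * exp (- y\<^sup>2 / 2)) (at y)" for y :: real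
    by (auto intro!: derivative_eq_intros)
  have e2: "((\<lambda>y. exp (y\<^sup>2 / 2)) has_real_derivative y * exp (y\<^sup>2 / 2)) (at y)" for y :: real
    by (auto intro!: derivative_eq_intros)
  define Q where "Q = (\<lambda>x. h x * h1 x * exp (- x\<^sup>2 / 2))"
  have dQ: "(Q has_real_derivative ((h1 x)\<^sup>2 + 2 * (F x - lam) * (h x)\<^sup>2) * exp (- x\<^sup>2 / 2)) (at x)" for x
    unfolding Q_def
    by (rule DERIV_cong[OF DERIV_mult[OF DERIV_mult[OF h h1] e]]) (simp add: power2_eq_square algebra_simps)
  have Qmono: "Q x0 \<le> Q x" if "x0 \<le> x" for x
  proof (rule DERIV_nonneg_imp_nondecreasing[OF that])
    fix z
    have "0 \<le> ((h1 z)\<^sup>2 + 2 * (F z - lam) * (h z)\<^sup>2) * exp (- z\<^sup>2 / 2)"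
      using F[of z] lam by (intro mult_nonneg_nonneg add_nonneg_nonneg) auto
    then show "\<exists>y. (Q has_real_derivative y) (at z) \<and> 0 \<le> y" using dQ by blast
  qed
  define q0 where "q0 = Q x0"
  have q0: "q0 > 0" using q by (simp add: q0_def Q_def)
  define X where "X = max x0 1"
  \<comment> \<open>An explicit function whose derivative is at most exp(x^2/2), used in place of
    the antiderivative.\<close>
  define k where "k = (\<lambda>x::real. exp (x\<^sup>2 / 2) / x)"
  have lower: "2 * q0 * (k x - k X) \<le> (h x)\<^sup>2" if x: "X \<le> x" for x
  proof -
    have "(h X)\<^sup>2 - 2 * q0 * k X \<le> (h x)\<^sup>2 - 2 * q0 * k x"
    proof (rule DERIV_nonneg_imp_nondecreasing[OF x, where f = "\<lambda>x. (h x)\<^sup>2 - 2 * q0 * k x"])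
      fix z assume z: "X \<le> z"
      then have z1: "z \<ge> 1" "x0 \<le> z" by (auto simp: X_def)
      have "(k has_real_derivative (z * exp (z\<^sup>2 / 2) * z - exp (z\<^sup>2 / 2) * 1) / (z * z)) (at z)"
        unfolding k_def by (rule DERIV_divide[OF e2 DERIV_ident]) (use z1 in simp)
      moreover have "(z * exp (z\<^sup>2 / 2) * z - exp (z\<^sup>2 / 2) * 1) / (z * z) = exp (z\<^sup>2 / 2) - exp (z\<^sup>2 / 2) / (z * z)"
        using z1 by (simp add: field_simps)
      ultimately have dk: "(k has_real_derivative exp (z\<^sup>2 / 2) - exp (z\<^sup>2 / 2) / (z * z)) (at z)" by simp
      have h2: "((\<lambda>x. (h x)\<^sup>2) has_real_derivative 2 * (h z * h1 z)) (at z)"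
        by (rule DERIV_cong[OF DERIV_power[OF h]]) simp
      have "((\<lambda>x. (h x)\<^sup>2 - 2 * q0 * k x) has_real_derivative 2 * (h z * h1 z) - 2 * q0 * (exp (z\<^sup>2 / 2) - exp (z\<^sup>2 / 2) / (z * z))) (at z)"
        by (intro DERIV_diff h2 DERIV_cmult dk)
      moreover have "0 \<le> 2 * (h z * h1 z) - 2 * q0 * (exp (z\<^sup>2 / 2) - exp (z\<^sup>2 / 2) / (z * z))"
      proof -
        have "h z * h1 z = Q z * exp (z\<^sup>2 / 2)" by (simp add: Q_def exp_minus)
        then have "q0 * exp (z\<^sup>2 / 2) \<le> h z * h1 z" using Qmono[OF z1(2)] by (simp add: q0_def mult_right_mono)
        moreover have "0 \<le> q0 * (exp (z\<^sup>2 / 2) / (z * z))" using q0 z1 by simp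
        moreover have id: "2 * (h z * h1 z) - 2 * q0 * (E - E / (z * z)) = 2 * (h z * h1 z - q0 * E) + 2 * (q0 * (E / (z * z)))" for E
          by (simp add: algebra_simps)
        ultimately show ?thesis unfolding id by (intro add_nonneg_nonneg) simp_all
      qed
      ultimately show "\<exists>y. ((\<lambda>x. (h x)\<^sup>2 - 2 * q0 * k x) has_real_derivative y) (at z) \<and> 0 \<le> y" by blast
    qed
    then show ?thesis using zero_le_power2[of "h X"] unfolding right_diff_distrib by linarith
  qed
  have hc: "continuous_on UNIV h" using h by (meson DERIV_isCont continuous_at_imp_continuous_on)
  have hm: "(\<lambda>x. (h x)\<^sup>2) \<in> borel_measurable borel"
    by (intro borel_measurable_continuous_onI continuous_intros hc)
  define f where "f = (\<lambda>x. std_normal_density x * (h x)\<^sup>2)"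
  have fi: "integrable lborel f" using int unfolding f_def integrable_std_gauss_iff[OF hm] .
  have f0: "f x \<ge> 0" for x by (simp add: f_def)
  have "((\<lambda>x::real. x * exp (- x\<^sup>2 / 2)) \<longlongrightarrow> 0) at_top" by real_asymp
  then have "eventually (\<lambda>x. x * exp (- x\<^sup>2 / 2) < 1 / (2 * k X)) at_top"
    by (rule order_tendstoD(2)) (auto simp: k_def X_def)
  then obtain R where R: "\<And>x. x \<ge> R \<Longrightarrow> x * exp (- x\<^sup>2 / 2) < 1 / (2 * k X)"
    by (auto simp: eventually_at_top_linorder)
  have kX: "k X > 0" by (auto simp: k_def X_def)
  have f_lower: "q0 / (3 * x) \<le> f x" if x: "x \<ge> max R X" for x
  proof -
    have x1: "x \<ge> 1" "x \<ge> X" "x \<ge> R" using x by (auto simp: X_def)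
    have "k X * exp (- x\<^sup>2 / 2) \<le> 1 / (2 * x)"
      using R[OF x1(3)] kX x1 by (simp add: field_simps)
    moreover have "k x * exp (- x\<^sup>2 / 2) = 1 / x" by (simp add: k_def exp_minus)
    ultimately have "1 / x - 1 / (2 * x) \<le> (k x - k X) * exp (- x\<^sup>2 / 2)" by (simp add: left_diff_distrib)
    then have "2 * q0 * (1 / x - 1 / (2 * x)) \<le> 2 * q0 * ((k x - k X) * exp (- x\<^sup>2 / 2))" using q0 by (intro mult_left_mono) auto
    also have "\<dots> \<le> (h x)\<^sup>2 * exp (- x\<^sup>2 / 2)" using mult_right_mono[OF lower[OF x1(2)], of "exp (- x\<^sup>2 / 2)"] by (simp add: mult.assoc)
    finally have a: "q0 / x \<le> (h x)\<^sup>2 * exp (- x\<^sup>2 / 2)" using x1 by (simp add: field_simps)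
    have "(h x)\<^sup>2 * ((1/3) * exp (- x\<^sup>2 / 2)) \<le> (h x)\<^sup>2 * std_normal_density x"
      by (intro mult_left_mono std_normal_density_bounds(2)) simp
    moreover have "q0 / (3 * x) = (1/3) * (q0 / x)" by simp
    moreover have "(h x)\<^sup>2 * ((1/3) * exp (- x\<^sup>2 / 2)) = (1/3) * ((h x)\<^sup>2 * exp (- x\<^sup>2 / 2))" by simp
    ultimately show ?thesis using a unfolding f_def by (simp only: mult.commute[of "std_normal_density x"])
  qed
  \<comment> \<open>The windows [n, 2n] escape to infinity, so integrability would send their
    contributions to 0; a lower bound of order 1/x makes each at least q0/6.\<close>
  have lim: "(\<lambda>n. \<integral>x. indicator {real n..2 * real n} x * f x \<partial>lborel) \<longlonglongrightarrow> (\<integral>x. 0 \<partial>(lborel :: real measure))"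
  proof (rule integral_dominated_convergence[where w = f])
    show "AE x in lborel. (\<lambda>n. indicator {real n..2 * real n} x * f x) \<longlonglongrightarrow> 0"
    proof (rule AE_I2)
      fix x
      obtain N :: nat where "x < real N" using reals_Archimedean2 by blast
      then have "eventually (\<lambda>n. indicator {real n..2 * real n} x * f x = 0) sequentially"
        by (intro eventually_sequentiallyI[of N]) auto
      then show "(\<lambda>n. indicator {real n..2 * real n} x * f x) \<longlonglongrightarrow> 0" by (rule tendsto_eventually)
    qed
    show "AE x in lborel. norm (indicator {real n..2 * real n} x * f x) \<le> f x" for n
      using f0 by (intro AE_I2) (auto simp: indicator_def)
  qed (use fi in auto)
  have "q0 / 6 \<le> (\<integral>x. indicator {real n..2 * real n} x * f x \<partial>lborel)" if n: "real n \<ge> max R X" for n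
  proof -
    have n1: "real n \<ge> 1" using n by (auto simp: X_def)
    have "q0 / 6 = (\<integral>x. q0 / (6 * real n) * indicator {real n..2 * real n} x \<partial>lborel)" using n1 by simp
    also have "\<dots> \<le> (\<integral>x. indicator {real n..2 * real n} x * f x \<partial>lborel)"
    proof (rule integral_mono)
      show "integrable lborel (\<lambda>x. q0 / (6 * real n) * indicator {real n..2 * real n} x)"
        by (intro integrable_mult_right integrable_real_indicator) auto
      show "integrable lborel (\<lambda>x. indicator {real n..2 * real n} x * f x)"
        using integrable_mult_indicator[OF _ fi, of "{real n..2 * real n}"] by simp
      show "q0 / (6 * real n) * indicator {real n..2 * real n} x \<le> indicator {real n..2 * real n} x * f x" for x
      proof (cases "x \<in> {real n..2 * real n}")
        case True
        have "q0 / (6 * real n) \<le> q0 / (3 * x)" using True n1 q0 by (intro divide_left_mono) auto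
        also have "\<dots> \<le> f x" by (rule f_lower) (use True n in auto)
        finally show ?thesis using True by simp
      qed simp
    qed
    finally show ?thesis .
  qed
  moreover obtain N :: nat where "real N \<ge> max R X" using real_arch_simple by blast
  ultimately have "\<exists>N. \<forall>n\<ge>N. q0 / 6 \<le> (\<integral>x. indicator {real n..2 * real n} x * f x \<partial>lborel)"
    by (intro exI[of _ N]) (meson order.trans of_nat_mono)
  from LIMSEQ_le_const[OF lim this] q0 show False by simp
qed

text \<open>A negative eigenvalue would force h h' \<le> 0 everywhere, and by reflection h h' \<ge>
  0. So h h' vanishes identically; differentiating it and using the equation gives h'^2 + 2 (F -
  lam) h^2 = 0, hence h = 0. This bounds the set below whose infimum is
  \<open>sbm_lambda0\<close>.\<close>

lemma LF_eigen_nonneg: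
  assumes F: "\<And>x. 0 \<le> sbm_F P X x" and E: "LF_eigen P X h lam"
  shows "0 \<le> lam"
proof (rule ccontr)
  define F where "F = sbm_F P X"
  assume "\<not> 0 \<le> lam"
  then have lam: "lam < 0" by simp
  from E obtain h1 h2 where d: "\<And>x. (h has_real_derivative h1 x) (at x)" "\<And>x. (h1 has_real_derivative h2 x) (at x)"
    and eq: "\<And>x. h2 x / 2 - x / 2 * h1 x - F x * h x = - lam * h x"
    and int: "integrable std_gauss (\<lambda>x. (h x)\<^sup>2)" and nz: "\<exists>x. h x \<noteq> 0"
    unfolding LF_eigen_def F_def by blast
  have h2: "h2 x = x * h1 x + 2 * (F x - lam) * h x" for x using eq[of x] by (simp add: field_simps)
  have d1: "(h1 has_real_derivative x * h1 x + 2 * (F x - lam) * h x) (at x)" for x using d(2)[of x] unfolding h2 .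
  have F0: "0 \<le> F x" for x using assms(1) by (simp add: F_def)
  have le: "h x * h1 x \<le> 0" for x
    using eigen_growth_not_integrable[OF F0 lam d(1) d1, of x] int by (meson not_less)
  have ge: "h x * h1 x \<ge> 0" for x
  proof (rule ccontr)
    assume neg: "\<not> h x * h1 x \<ge> 0"
    have m: "((\<lambda>x. - x) has_real_derivative - 1) (at y)" for y :: real
      by (auto intro!: derivative_eq_intros)
    have "\<not> integrable std_gauss (\<lambda>x. (h (- x))\<^sup>2)"
    proof (rule eigen_growth_not_integrable[where F = "\<lambda>x. F (- x)" and ?h1.0 = "\<lambda>x. - h1 (- x)" and ?x0.0 = "- x", OF F0 lam])
      show "((\<lambda>x. h (- x)) has_real_derivative - h1 (- y)) (at y)" for y
        using DERIV_chain2[OF d(1) m] by simp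
      show "((\<lambda>x. - h1 (- x)) has_real_derivative y * - h1 (- y) + 2 * (F (- y) - lam) * h (- y)) (at y)" for y
        using DERIV_minus[OF DERIV_chain2[OF d1 m, of y]] by simp
    qed (use neg in simp)
    moreover have "integrable std_gauss (\<lambda>x. (h (- x))\<^sup>2)"
    proof -
      have hc: "continuous_on UNIV h" using d(1) by (meson DERIV_isCont continuous_at_imp_continuous_on)
      have hm: "(\<lambda>x. (h x)\<^sup>2) \<in> borel_measurable borel" "(\<lambda>x. (h (- x))\<^sup>2) \<in> borel_measurable borel"
        by (auto intro!: borel_measurable_continuous_onI continuous_intros hc continuous_on_compose2[OF hc])
      have "integrable lborel (\<lambda>x. std_normal_density x * (h x)\<^sup>2)" using int unfolding integrable_std_gauss_iff[OF hm(1)] .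
      from lborel_integrable_real_affine[OF this, of "- 1" 0]
      have "integrable lborel (\<lambda>x. std_normal_density (- x) * (h (- x))\<^sup>2)" by simp
      moreover have "std_normal_density (- x) = std_normal_density x" for x by (simp add: std_normal_density_def)
      ultimately show ?thesis unfolding integrable_std_gauss_iff[OF hm(2)] by simp
    qed
    ultimately show False by simp
  qed
  have z: "h x * h1 x = 0" for x using le[of x] ge[of x] by simp
  have z': "(\<lambda>x. h x * h1 x) = (\<lambda>x. 0)" by (rule ext) (rule z)
  have "((\<lambda>x. h x * h1 x) has_real_derivative h1 x * h1 x + (x * h1 x + 2 * (F x - lam) * h x) * h x) (at x)" for x
    by (rule DERIV_mult[OF d(1) d1])
  from DERIV_unique[OF this[unfolded z'] DERIV_const]
  have "h1 x * h1 x + (x * h1 x + 2 * (F x - lam) * h x) * h x = 0" for x .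
  moreover have "(x * h1 x + 2 * (F x - lam) * h x) * h x = x * (h x * h1 x) + 2 * (F x - lam) * (h x)\<^sup>2" for x
    by (simp add: power2_eq_square algebra_simps)
  ultimately have s: "h1 x * h1 x + 2 * (F x - lam) * (h x)\<^sup>2 = 0" for x using z by simp
  have "h x = 0" for x
  proof -
    have "0 \<le> h1 x * h1 x" by simp
    moreover have "0 \<le> 2 * (F x - lam) * (h x)\<^sup>2" using F0[of x] lam by simp
    ultimately have "2 * (F x - lam) * (h x)\<^sup>2 = 0" using s[of x] by linarith
    then show ?thesis using F0[of x] lam by simp
  qed
  then show False using nz by simp
qed

text \<open>Growth exp \<bar>x\<bar> is square integrable for the Gaussian law: 2 \<bar>x\<bar> -
  x^2/2 \<le> 4 - x^2/4, which leaves a Gaussian of variance 2. Being an eigenvalue gives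
  \<open>sbm_lambda0 \<le> l\<close>.\<close>

lemma LF_eigen_ground_state:
  assumes \<psi>0: "\<And>x. \<psi> x > 0" and Fc: "continuous_on UNIV (sbm_F P X)"
    and \<psi>: "\<And>x. (\<psi> has_real_derivative \<psi>1 x) (at x)"
      "\<And>x. (\<psi>1 has_real_derivative x * \<psi>1 x + 2 * (sbm_F P X x - l) * \<psi> x) (at x)"
    and D: "\<And>x. \<psi> x \<le> D * exp \<bar>x\<bar>"
  shows "LF_eigen P X \<psi> l"
  unfolding LF_eigen_def
proof (intro conjI exI allI)
  have c: "continuous_on UNIV \<psi>" "continuous_on UNIV \<psi>1"
    using \<psi> by (meson DERIV_isCont continuous_at_imp_continuous_on)+
  show "continuous_on UNIV (\<lambda>x. x * \<psi>1 x + 2 * (sbm_F P X x - l) * \<psi> x)"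
    by (intro continuous_intros c Fc)
  show "\<psi> 0 \<noteq> 0" using \<psi>0[of 0] by simp
  have m: "(\<lambda>x. (\<psi> x)\<^sup>2) \<in> borel_measurable borel"
    by (intro borel_measurable_continuous_onI continuous_intros c)
  have [measurable]: "\<psi> \<in> borel_measurable borel" by (rule borel_measurable_continuous_onI[OF c(1)])
  show "integrable std_gauss (\<lambda>x. (\<psi> x)\<^sup>2)"
    unfolding integrable_std_gauss_iff[OF m]
  proof (rule Bochner_Integration.integrable_bound[where f = "\<lambda>x. D\<^sup>2 * (exp 4 * (sqrt 2 * normal_density 0 (sqrt 2) x))"])
    show "integrable lborel (\<lambda>x. D\<^sup>2 * (exp 4 * (sqrt 2 * normal_density 0 (sqrt 2) x)))"
      by (intro integrable_mult_right) auto
    show "AE x in lborel. norm (std_normal_density x * (\<psi> x)\<^sup>2) \<le> norm (D\<^sup>2 * (exp 4 * (sqrt 2 * normal_density 0 (sqrt 2) x)))"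
    proof (rule AE_I2)
      fix x
      have nd: "sqrt 2 * normal_density 0 (sqrt 2) x = exp (- x\<^sup>2 / 4) / sqrt (2 * pi)"
        by (simp add: normal_density_def real_sqrt_mult field_simps)
      have "(\<psi> x)\<^sup>2 \<le> (D * exp \<bar>x\<bar>)\<^sup>2" using D[of x] \<psi>0[of x] by (intro power_mono) auto
      also have "\<dots> = D\<^sup>2 * exp (2 * \<bar>x\<bar>)" by (simp add: power_mult_distrib exp_double)
      finally have "std_normal_density x * (\<psi> x)\<^sup>2 \<le> std_normal_density x * (D\<^sup>2 * exp (2 * \<bar>x\<bar>))" by (rule mult_left_mono) simp
      also have "\<dots> = D\<^sup>2 * (exp (2 * \<bar>x\<bar> + - x\<^sup>2 / 2) / sqrt (2 * pi))"
        by (simp add: std_normal_density_def exp_add[symmetric])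
      also have "\<dots> \<le> D\<^sup>2 * (exp (4 + - x\<^sup>2 / 4) / sqrt (2 * pi))"
      proof (intro mult_left_mono divide_right_mono)
        have "0 \<le> (\<bar>x\<bar> - 4)\<^sup>2" by simp
        then have "2 * \<bar>x\<bar> + - x\<^sup>2 / 2 \<le> 4 + - x\<^sup>2 / 4" by (simp add: power2_eq_square algebra_simps)
        then show "exp (2 * \<bar>x\<bar> + - x\<^sup>2 / 2) \<le> exp (4 + - x\<^sup>2 / 4)" by simp
      qed auto
      also have "\<dots> = D\<^sup>2 * (exp 4 * (sqrt 2 * normal_density 0 (sqrt 2) x))" unfolding nd exp_add by simp
      finally show "norm (std_normal_density x * (\<psi> x)\<^sup>2) \<le> norm (D\<^sup>2 * (exp 4 * (sqrt 2 * normal_density 0 (sqrt 2) x)))"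
        by simp
    qed
  qed simp
  show "(x * \<psi>1 x + 2 * (sbm_F P X x - l) * \<psi> x) / 2 - x / 2 * \<psi>1 x - sbm_F P X x * \<psi> x = - l * \<psi> x" for x
    by (simp add: field_simps)
qed (use \<psi> in blast)+

section \<open>Super-Brownian motion\<close>

lemma is_SBM_density:
  assumes "is_SBM P X" "t > 0"
  shows "continuous_on UNIV (X \<omega> t)" "0 \<le> X \<omega> t x" "integrable lborel (X \<omega> t)"
proof -
  from assms have c: "continuous_on ({0<..} \<times> UNIV) (\<lambda>(t, x). X \<omega> t x)" unfolding is_SBM_def by blast
  have "continuous_on UNIV (\<lambda>x. (\<lambda>(t, x). X \<omega> t x) (t, x))"
    by (rule continuous_on_compose2[OF c]) (use assms(2) in \<open>auto intro!: continuous_intros\<close>)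
  then show "continuous_on UNIV (X \<omega> t)" by simp
  from assms show "0 \<le> X \<omega> t x" "integrable lborel (X \<omega> t)" unfolding is_SBM_def by blast+
qed

lemma is_SBM_prob: "is_SBM P X \<Longrightarrow> finite_borel_measure \<mu> \<Longrightarrow> prob_space (P \<mu>)"
  unfolding is_SBM_def by blast

lemma is_SBM_measurable: "is_SBM P X \<Longrightarrow> finite_borel_measure \<mu> \<Longrightarrow> t > 0 \<Longrightarrow> (\<lambda>\<omega>. X \<omega> t x) \<in> borel_measurable (P \<mu>)"
  unfolding is_SBM_def by blast

lemma is_SBM_laplace:
  assumes S: "is_SBM P X" and \<mu>: "finite_borel_measure \<mu>" and u: "sol \<phi> u" and t: "t > 0"
  shows "(\<integral>\<omega>. exp (- mass_fun X \<omega> t \<phi>) \<partial>(P \<mu>)) = exp (- (\<integral>y. u t y \<partial>\<mu>))"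
proof -
  have u0: "u 0 = \<phi>" using solD(2)[OF u] by auto
  obtain f1 f2 where "C2b \<phi> f1 f2" using solD(7)[OF u, of 0] u0 by auto
  then have "continuous_on UNIV \<phi>" by (rule C2bD)
  moreover have "0 \<le> \<phi> x" for x using solD(3)[OF u, of 0 x] u0 by simp
  moreover have "\<exists>B. \<forall>x. \<phi> x \<le> B" using solD(4)[OF u] u0 by (metis order.refl)
  ultimately have "test_fun \<phi>" by (simp add: test_fun_def)
  then show ?thesis using S \<mu> solD(6)[OF u] t unfolding is_SBM_def by blast
qed

lemma mass_fun_measurable:
  assumes S: "is_SBM P X" and \<mu>: "finite_borel_measure \<mu>" and u: "sol \<phi> u" and t: "t > 0"
  shows "(\<lambda>\<omega>. mass_fun X \<omega> t \<phi>) \<in> borel_measurable (P \<mu>)"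
proof -
  text \<open>The integral of a non-integrable function is \<open>0\<close>, so the Laplace functional
    can only be positive if its integrand is measurable.\<close>
  have "integrable (P \<mu>) (\<lambda>\<omega>. exp (- mass_fun X \<omega> t \<phi>))"
    using is_SBM_laplace[OF S \<mu> u t] not_integrable_integral_eq by fastforce
  then have "(\<lambda>\<omega>. - ln (exp (- mass_fun X \<omega> t \<phi>))) \<in> borel_measurable (P \<mu>)" by measurable
  then show ?thesis by simp
qed

lemma mass_fun_nonneg:
  assumes "is_SBM P X" "t > 0" "\<And>x. 0 \<le> \<phi> x"
  shows "0 \<le> mass_fun X \<omega> t \<phi>"
  unfolding mass_fun_def using is_SBM_density(2)[OF assms(1,2)] assms(3) by (intro integral_nonneg_AE AE_I2) simp

lemma finite_borel_measure_return: "finite_borel_measure (return borel x)"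
  by (simp add: finite_borel_measure_def prob_space.finite_measure prob_space_return)

section \<open>The density at 0 and the function \<open>sbm_F\<close> as limits\<close>

definition bump_mass :: real where
  "bump_mass = (\<integral>z. bump z \<partial>lborel)"

lemma bump_measurable [measurable]: "bump \<in> borel_measurable borel"
  by (rule borel_measurable_continuous_onI[OF continuous_on_bump])

lemma bump_le_indicator: "bump z \<le> indicator {- 1..1} z"
  using bump_bounds[of z] bump_eq_0[of z] by (auto simp: indicator_def abs_le_iff)

lemma integrable_bump: "integrable lborel bump"
  by (rule Bochner_Integration.integrable_bound[where f = "indicator {- 1..1} :: real \<Rightarrow> real"])
    (use bump_le_indicator bump_bounds in auto)

lemma bump_mass_pos: "bump_mass > 0"
proof -
  have "(\<integral>z. 1/4 * indicator {- (1/2)..1/2::real} z \<partial>lborel) \<le> bump_mass"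
    unfolding bump_mass_def
  proof (rule integral_mono[OF _ integrable_bump])
    show "1/4 * indicator {- (1/2)..1/2} z \<le> bump z" for z
      using bump_bounds[of z] bump_ge[of z] by (auto simp: indicator_def abs_le_iff)
  qed (intro integrable_mult_right integrable_real_indicator, auto)
  then show ?thesis by simp
qed

text \<open>On the scale of the bump the integrand converges by continuity of the density and is
  bounded on the common support [- 1, 1].\<close>

lemma mass_fun_bump_tendsto:
  assumes S: "is_SBM P X" and t: "t > 0"
  shows "(\<lambda>n. mass_fun X \<omega> t (\<lambda>y. l * real n * bump (real n * y))) \<longlonglongrightarrow> l * bump_mass * X \<omega> t 0"
proof -
  note Xc = is_SBM_density(1)[OF S t, of \<omega>]
  have [measurable]: "X \<omega> t \<in> borel_measurable borel" by (rule borel_measurable_continuous_onI[OF Xc])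
  have "compact (X \<omega> t ` {- 1..1})" by (intro compact_continuous_image continuous_on_subset[OF Xc]) auto
  then obtain B where "\<forall>y\<in>X \<omega> t ` {- 1..1}. norm y \<le> B" using compact_imp_bounded bounded_iff by metis
  then have B: "\<bar>X \<omega> t z\<bar> \<le> B" if "z \<in> {- 1..1}" for z using that by simp
  have eq: "mass_fun X \<omega> t (\<lambda>y. l * real n * bump (real n * y)) = (\<integral>z. l * (bump z * X \<omega> t (z / real n)) \<partial>lborel)" if n: "n \<ge> 1" for n
  proof -
    have n0: "real n > 0" using n by simp
    have e: "0 + 1 / real n * z = z / real n" "real n * (z / real n) = z" for z using n0 by simp_all
    have "mass_fun X \<omega> t (\<lambda>y. l * real n * bump (real n * y)) =
      \<bar>1 / real n\<bar> *\<^sub>R (\<integral>z. l * real n * bump (real n * (0 + 1 / real n * z)) * X \<omega> t (0 + 1 / real n * z) \<partial>lborel)"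
      unfolding mass_fun_def by (rule lborel_integral_real_affine) (use n0 in simp)
    also have "\<dots> = (1 / real n) * (\<integral>z. real n * (l * (bump z * X \<omega> t (z / real n))) \<partial>lborel)"
      unfolding e using n0 by (simp add: mult_ac)
    also have "\<dots> = (\<integral>z. l * (bump z * X \<omega> t (z / real n)) \<partial>lborel)" using n0 by simp
    finally show ?thesis .
  qed
  have "(\<lambda>n. \<integral>z. l * (bump z * X \<omega> t (z / real (Suc n))) \<partial>lborel) \<longlonglongrightarrow> (\<integral>z. l * (bump z * X \<omega> t 0) \<partial>lborel)"
  proof (rule integral_dominated_convergence[where w = "\<lambda>z. \<bar>l\<bar> * (\<bar>B\<bar> * indicator {- 1..1} z)"])
    show "integrable lborel (\<lambda>z::real. \<bar>l\<bar> * (\<bar>B\<bar> * indicator {- 1..1} z))"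
      by (intro integrable_mult_right integrable_real_indicator) auto
    show "AE z in lborel. (\<lambda>n. l * (bump z * X \<omega> t (z / real (Suc n)))) \<longlonglongrightarrow> l * (bump z * X \<omega> t 0)"
    proof (rule AE_I2, intro tendsto_intros)
      fix z :: real
      have "(\<lambda>n. z * inverse (real (Suc n))) \<longlonglongrightarrow> z * 0"
        by (intro tendsto_intros LIMSEQ_inverse_real_of_nat)
      then have "(\<lambda>n. z / real (Suc n)) \<longlonglongrightarrow> 0" by (simp add: divide_inverse)
      then show "(\<lambda>n. X \<omega> t (z / real (Suc n))) \<longlonglongrightarrow> X \<omega> t 0"
        by (intro continuous_on_tendsto_compose[OF Xc]) auto
    qed
    show "AE z in lborel. norm (l * (bump z * X \<omega> t (z / real (Suc n)))) \<le> \<bar>l\<bar> * (\<bar>B\<bar> * indicator {- 1..1} z)" for n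
    proof (rule AE_I2)
      fix z :: real
      show "norm (l * (bump z * X \<omega> t (z / real (Suc n)))) \<le> \<bar>l\<bar> * (\<bar>B\<bar> * indicator {- 1..1} z)"
      proof (cases "z \<in> {- 1..1}")
        case True
        have "\<bar>z\<bar> \<le> 1" using True by auto
        then have "\<bar>z / real (Suc n)\<bar> \<le> 1" by (simp add: abs_divide divide_le_eq)
        then have "z / real (Suc n) \<in> {- 1..1}" unfolding atLeastAtMost_iff abs_le_iff by linarith
        then have "\<bar>X \<omega> t (z / real (Suc n))\<bar> \<le> \<bar>B\<bar>" using B by force
        then have "bump z * \<bar>X \<omega> t (z / real (Suc n))\<bar> \<le> 1 * \<bar>B\<bar>" using bump_bounds[of z] by (intro mult_mono) auto
        then show ?thesis using True bump_bounds[of z] by (simp add: abs_mult mult_left_mono)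
      next
        case False
        then have "bump z = 0" by (intro bump_eq_0) (auto simp: abs_if)
        then show ?thesis by simp
      qed
    qed
  qed measurable
  moreover have "(\<integral>z. l * (bump z * X \<omega> t 0) \<partial>lborel) = l * bump_mass * X \<omega> t 0"
    unfolding bump_mass_def by simp
  moreover have "(\<lambda>n. mass_fun X \<omega> t (\<lambda>y. l * real (Suc n) * bump (real (Suc n) * y))) = (\<lambda>n. \<integral>z. l * (bump z * X \<omega> t (z / real (Suc n))) \<partial>lborel)"
    by (rule ext, rule eq) simp
  ultimately have "(\<lambda>n. mass_fun X \<omega> t (\<lambda>y. l * real (Suc n) * bump (real (Suc n) * y))) \<longlonglongrightarrow> l * bump_mass * X \<omega> t 0"
    by (simp only:)
  then show ?thesis by (rule LIMSEQ_imp_Suc)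
qed

text \<open>The limit in n yields the Laplace transform of X(1, 0) at the point
  \<open>l * bump_mass\<close>, and the limit in l its atom at 0. Logarithms pass to the limit
  because everything stays above exp(- 2).\<close>

lemma sbm_F_iterated_limit:
  assumes S: "is_SBM P X"
  shows "iterated_limit (sbm_F P X)" "0 \<le> sbm_F P X x"
proof -
  define Q where "Q = (\<lambda>x. P (return borel x))"
  define Y where "Y = (\<lambda>\<omega>. X \<omega> 1 0)"
  define L where "L = (\<lambda>(l::nat) x. \<integral>\<omega>. exp (- (real l * bump_mass * Y \<omega>)) \<partial>(Q x))"
  define p where "p = (\<lambda>x. measure (Q x) {\<omega> \<in> space (Q x). Y \<omega> = 0})"
  have Q: "prob_space (Q x)" for x unfolding Q_def by (rule is_SBM_prob[OF S finite_borel_measure_return])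
  have Ym [measurable]: "Y \<in> borel_measurable (Q x)" for x
    unfolding Q_def Y_def by (rule is_SBM_measurable[OF S finite_borel_measure_return]) simp
  have Y0: "0 \<le> Y \<omega>" for \<omega> unfolding Y_def by (rule is_SBM_density(2)[OF S]) simp
  have lap: "(\<integral>\<omega>. exp (- mass_fun X \<omega> 1 (\<lambda>y. real l * real n * bump (real n * y))) \<partial>(Q x)) = exp (- bsol (real l * real n) (real n) 1 x)"
    and mm: "(\<lambda>\<omega>. mass_fun X \<omega> 1 (\<lambda>y. real l * real n * bump (real n * y))) \<in> borel_measurable (Q x)"
    if l: "l \<ge> 1" and n: "n \<ge> 1" for l n x
  proof -
    have k: "real l * real n > 0" using l n by simp
    have "continuous_on UNIV (bsol (real l * real n) (real n) 1)"
      using solD(7)[OF sol_bsol[OF k], of 1 "real n"] by (metis C2bD zero_le_one)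
    then have "bsol (real l * real n) (real n) 1 \<in> borel_measurable borel" by (rule borel_measurable_continuous_onI)
    then have "(\<integral>y. bsol (real l * real n) (real n) 1 y \<partial>(return borel x)) = bsol (real l * real n) (real n) 1 x"
      by (intro integral_return) auto
    then show "(\<integral>\<omega>. exp (- mass_fun X \<omega> 1 (\<lambda>y. real l * real n * bump (real n * y))) \<partial>(Q x)) = exp (- bsol (real l * real n) (real n) 1 x)"
      using is_SBM_laplace[OF S finite_borel_measure_return sol_bsol[OF k], of 1 x "real n"] unfolding Q_def by simp
    show "(\<lambda>\<omega>. mass_fun X \<omega> 1 (\<lambda>y. real l * real n * bump (real n * y))) \<in> borel_measurable (Q x)"
      unfolding Q_def by (rule mass_fun_measurable[OF S finite_borel_measure_return sol_bsol[OF k]]) simp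
  qed
  have L_lim: "(\<lambda>n. exp (- bsol (real l * real n) (real n) 1 x)) \<longlonglongrightarrow> L l x" if l: "l \<ge> 1" for l x
  proof -
    interpret prob_space "Q x" by (rule Q)
    have "(\<lambda>n. \<integral>\<omega>. exp (- mass_fun X \<omega> 1 (\<lambda>y. real l * real (Suc n) * bump (real (Suc n) * y))) \<partial>(Q x)) \<longlonglongrightarrow> L l x"
      unfolding L_def
    proof (rule integral_dominated_convergence[where w = "\<lambda>_. 1"])
      show "AE \<omega> in Q x. (\<lambda>n. exp (- mass_fun X \<omega> 1 (\<lambda>y. real l * real (Suc n) * bump (real (Suc n) * y)))) \<longlonglongrightarrow> exp (- (real l * bump_mass * Y \<omega>))"
        unfolding Y_def
        by (intro AE_I2 tendsto_intros LIMSEQ_Suc[OF mass_fun_bump_tendsto[OF S zero_less_one]])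
      show "AE \<omega> in Q x. norm (exp (- mass_fun X \<omega> 1 (\<lambda>y. real l * real (Suc n) * bump (real (Suc n) * y)))) \<le> 1" for n
        by (intro AE_I2) (use mass_fun_nonneg[OF S zero_less_one] bump_bounds in simp)
      show "(\<lambda>\<omega>. exp (- mass_fun X \<omega> 1 (\<lambda>y. real l * real (Suc n) * bump (real (Suc n) * y)))) \<in> borel_measurable (Q x)" for n
        using mm[OF l, of "Suc n" x] by measurable
    qed auto
    then have "(\<lambda>n. exp (- bsol (real l * real (Suc n)) (real (Suc n)) 1 x)) \<longlonglongrightarrow> L l x"
      using lap[OF l, of "Suc _" x] by simp
    then show ?thesis by (rule LIMSEQ_imp_Suc)
  qed
  \<comment> \<open>The universal bound 2/t at t = 1; it also shows that X(1, 0) = 0 has probability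
    at least exp(- 2), so the logarithm in \<open>sbm_F\<close> is taken of a positive
    number.\<close>
  have L_ge: "exp (- 2) \<le> L l x" if l: "l \<ge> 1" for l x
  proof (rule LIMSEQ_le_const[OF L_lim[OF l]], intro exI[of _ 1] allI impI)
    fix n :: nat assume "1 \<le> n"
    then show "exp (- 2) \<le> exp (- bsol (real l * real n) (real n) 1 x)"
      using bsol_le_2_div_t[of "real l * real n" 1 "real n" x] l by simp
  qed
  have p_lim: "(\<lambda>l. L l x) \<longlonglongrightarrow> p x" for x
  proof -
    interpret prob_space "Q x" by (rule Q)
    have "(\<lambda>l. L l x) \<longlonglongrightarrow> (\<integral>\<omega>. indicator {\<omega> \<in> space (Q x). Y \<omega> = 0} \<omega> \<partial>(Q x))"
      unfolding L_def
    proof (rule integral_dominated_convergence[where w = "\<lambda>_. 1"])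
      show "AE \<omega> in Q x. (\<lambda>l. exp (- (real l * bump_mass * Y \<omega>))) \<longlonglongrightarrow> indicator {\<omega> \<in> space (Q x). Y \<omega> = 0} \<omega>"
      proof (rule AE_I2)
        fix \<omega> assume w: "\<omega> \<in> space (Q x)"
        show "(\<lambda>l. exp (- (real l * bump_mass * Y \<omega>))) \<longlonglongrightarrow> indicator {\<omega> \<in> space (Q x). Y \<omega> = 0} \<omega>"
        proof (cases "Y \<omega> = 0")
          case False
          then have c: "bump_mass * Y \<omega> > 0" using Y0[of \<omega>] bump_mass_pos by simp
          have "(\<lambda>l. exp (- (bump_mass * Y \<omega>)) ^ l) \<longlonglongrightarrow> 0"
            by (rule LIMSEQ_realpow_zero) (use c in auto)
          moreover have "exp (- (real l * bump_mass * Y \<omega>)) = exp (- (bump_mass * Y \<omega>)) ^ l" for l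
            by (simp add: exp_of_nat_mult[symmetric] mult.assoc)
          ultimately show ?thesis using False by simp
        qed (use w in simp)
      qed
      show "AE \<omega> in Q x. norm (exp (- (real l * bump_mass * Y \<omega>))) \<le> 1" for l
        using Y0 bump_mass_pos by (intro AE_I2) simp
    qed auto
    then show ?thesis by (simp add: p_def)
  qed
  have p: "exp (- 2) \<le> p x" "p x \<le> 1" for x
  proof -
    interpret prob_space "Q x" by (rule Q)
    show "exp (- 2) \<le> p x" by (rule LIMSEQ_le_const[OF p_lim]) (use L_ge in blast)
    show "p x \<le> 1" by (simp add: p_def)
  qed
  have p0: "p x > 0" for x using less_le_trans[OF exp_gt_zero p(1)] .
  have F: "sbm_F P X x = - ln (p x)" for x by (simp add: sbm_F_def p_def Q_def Y_def)
  have "(\<lambda>n. bsol (real l * real n) (real n) 1 x) \<longlonglongrightarrow> - ln (L l x)" if l: "l \<ge> 1" for l x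
  proof -
    have "L l x > 0" using less_le_trans[OF exp_gt_zero L_ge[OF l]] .
    then have "(\<lambda>n. - ln (exp (- bsol (real l * real n) (real n) 1 x))) \<longlonglongrightarrow> - ln (L l x)"
      by (intro tendsto_intros L_lim l) simp
    then show ?thesis by simp
  qed
  moreover have "(\<lambda>l. - ln (L l x)) \<longlonglongrightarrow> sbm_F P X x" for x
    unfolding F by (intro tendsto_intros p_lim) (use p0[of x] in simp)
  ultimately show "iterated_limit (sbm_F P X)" unfolding iterated_limit_def by (intro exI[of _ "\<lambda>l x. - ln (L l x)"]) auto
  show "0 \<le> sbm_F P X x" unfolding F using p(2)[of x] p0[of x] by simp
qed

text \<open>The Laplace functionals are exponentials of integrals p and q of solutions, and exp(- p)
  - exp(- q) \<le> max 0 (q - p) for p \<ge> 0. This linearisation makes the bound proportional to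
  the total mass of the initial measure.\<close>

lemma small_mass_prob:
  assumes S: "is_SBM P X" and \<mu>: "finite_borel_measure \<mu>" and t: "t > 0" and a: "a > 0"
    and u: "\<And>N::nat. N \<ge> 1 \<Longrightarrow> sol (\<lambda>y. real N / a * \<phi> y) (u N)"
    and B: "\<And>N y. N \<ge> 1 \<Longrightarrow> u N t y - u 1 t y \<le> B" and \<phi>: "\<And>y. 0 \<le> \<phi> y"
  shows "{\<omega> \<in> space (P \<mu>). 0 < mass_fun X \<omega> t \<phi> \<and> mass_fun X \<omega> t \<phi> \<le> a} \<in> sets (P \<mu>)"
    and "measure (P \<mu>) {\<omega> \<in> space (P \<mu>). 0 < mass_fun X \<omega> t \<phi> \<and> mass_fun X \<omega> t \<phi> \<le> a} \<le> exp 1 * (B * measure \<mu> UNIV)"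
proof -
  interpret prob_space "P \<mu>" by (rule is_SBM_prob[OF S \<mu>])
  from \<mu> have \<mu>s: "sets \<mu> = sets borel" and fm: "finite_measure \<mu>" by (auto simp: finite_borel_measure_def)
  interpret \<mu>: finite_measure \<mu> by (rule fm)
  have sp: "space \<mu> = UNIV" using sets_eq_imp_space_eq[OF \<mu>s] by simp
  define Z where "Z = (\<lambda>\<omega>. mass_fun X \<omega> t \<phi>)"
  have mass: "mass_fun X \<omega> t (\<lambda>y. real N / a * \<phi> y) = real N / a * Z \<omega>" for N \<omega>
    unfolding mass_fun_def Z_def by (subst Bochner_Integration.integral_mult_right_zero[symmetric]) (simp add: mult_ac)
  have Z0: "0 \<le> Z \<omega>" for \<omega> unfolding Z_def by (rule mass_fun_nonneg[OF S t \<phi>])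
  \<comment> \<open>Solutions are given only for the multiples N/a of the test function, so
    measurability is obtained for N = 1 and then rescaled.\<close>
  have "(\<lambda>\<omega>. real 1 / a * Z \<omega>) \<in> borel_measurable (P \<mu>)"
    using mass_fun_measurable[OF S \<mu> u[of 1] t] unfolding mass by simp
  then have "(\<lambda>\<omega>. a * (real 1 / a * Z \<omega>)) \<in> borel_measurable (P \<mu>)" by measurable
  then have Zm [measurable]: "Z \<in> borel_measurable (P \<mu>)" using a by simp
  show E: "{\<omega> \<in> space (P \<mu>). 0 < mass_fun X \<omega> t \<phi> \<and> mass_fun X \<omega> t \<phi> \<le> a} \<in> sets (P \<mu>)"
    using Zm unfolding Z_def by measurable
  have ui: "integrable \<mu> (u N t)" if N: "N \<ge> 1" for N
  proof -
    obtain K where K: "\<And>t x. t \<ge> 0 \<Longrightarrow> u N t x \<le> K" using solD(4)[OF u[OF N]] by blast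
    obtain f1 f2 where "C2b (u N t) f1 f2" using solD(7)[OF u[OF N], of t] t by auto
    then have "continuous_on UNIV (u N t)" by (rule C2bD)
    then have "u N t \<in> borel_measurable borel" by (rule borel_measurable_continuous_onI)
    then have m: "u N t \<in> borel_measurable \<mu>" using measurable_cong_sets[OF \<mu>s refl] by blast
    show ?thesis
      by (rule \<mu>.integrable_const_bound[of _ K]) (use K[of t] solD(3)[OF u[OF N], of t] t m in auto)
  qed
  have lap: "(\<integral>\<omega>. exp (- (real N / a * Z \<omega>)) \<partial>(P \<mu>)) = exp (- (\<integral>y. u N t y \<partial>\<mu>))" if N: "N \<ge> 1" for N
    using is_SBM_laplace[OF S \<mu> u[OF N] t] unfolding mass .
  have ei: "integrable (P \<mu>) (\<lambda>\<omega>. exp (- (real N / a * Z \<omega>)))" for N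
    by (rule integrable_const_bound[of _ 1]) (use Z0 a in auto)
  have diff: "(\<integral>\<omega>. exp (- (1 / a * Z \<omega>)) - exp (- (real N / a * Z \<omega>)) \<partial>(P \<mu>)) \<le> B * measure \<mu> UNIV" if N: "N \<ge> 1" for N
  proof -
    define p where "p = (\<integral>y. u 1 t y \<partial>\<mu>)"
    define q where "q = (\<integral>y. u N t y \<partial>\<mu>)"
    have p0: "0 \<le> p" unfolding p_def using solD(3)[OF u[of 1], of t] t by (intro integral_nonneg_AE AE_I2) simp
    have "(\<integral>\<omega>. exp (- (1 / a * Z \<omega>)) - exp (- (real N / a * Z \<omega>)) \<partial>(P \<mu>)) = exp (- p) - exp (- q)"
      using lap[OF N] lap[of 1] ei[of N] ei[of 1] by (simp add: p_def q_def)
    also have "\<dots> \<le> max 0 (q - p)"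
    proof (cases "p \<le> q")
      case True
      have "exp (- p) - exp (- q) = exp (- p) * (1 - exp (- (q - p)))" by (simp add: algebra_simps exp_add[symmetric])
      also have "\<dots> \<le> 1 * (q - p)"
      proof (rule mult_mono)
        show "1 - exp (- (q - p)) \<le> q - p" using exp_ge_add_one_self[of "- (q - p)"] by linarith
      qed (use True p0 in auto)
      finally show ?thesis by simp
    qed simp
    also have "\<dots> \<le> B * measure \<mu> UNIV"
    proof -
      have "q - p = (\<integral>y. u N t y - u 1 t y \<partial>\<mu>)" unfolding p_def q_def using ui[OF N] ui[of 1] by simp
      also have "\<dots> \<le> (\<integral>y. B \<partial>\<mu>)" using ui[OF N] ui[of 1] B[OF N] by (intro integral_mono) auto
      also have "\<dots> = B * measure \<mu> UNIV" by (simp add: sp)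
      finally have "q - p \<le> B * measure \<mu> UNIV" .
      moreover have "0 \<le> B * measure \<mu> UNIV" using B[of 1 0] by simp
      ultimately show ?thesis by simp
    qed
    finally show ?thesis .
  qed
  define A where "A = {\<omega> \<in> space (P \<mu>). 0 < Z \<omega> \<and> Z \<omega> \<le> a}"
  have Am [measurable]: "A \<in> sets (P \<mu>)" unfolding A_def by measurable
  \<comment> \<open>The limit of the integrand: where Z = 0 both exponentials equal 1 and cancel,
    which excludes the event of no mass.\<close>
  define g where "g = (\<lambda>\<omega>. exp (- (1 / a * Z \<omega>)) - (if Z \<omega> = 0 then 1 else 0))"
  have gm [measurable]: "g \<in> borel_measurable (P \<mu>)" unfolding g_def by measurable
  have lim: "(\<lambda>N. \<integral>\<omega>. exp (- (1 / a * Z \<omega>)) - exp (- (real N / a * Z \<omega>)) \<partial>(P \<mu>)) \<longlonglongrightarrow> (\<integral>\<omega>. g \<omega> \<partial>(P \<mu>))"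
  proof (rule integral_dominated_convergence[where w = "\<lambda>_. 2"])
    show "AE \<omega> in P \<mu>. (\<lambda>N. exp (- (1 / a * Z \<omega>)) - exp (- (real N / a * Z \<omega>))) \<longlonglongrightarrow> g \<omega>"
    proof (rule AE_I2)
      fix \<omega>
      have "(\<lambda>N. exp (- (real N / a * Z \<omega>))) \<longlonglongrightarrow> (if Z \<omega> = 0 then 1 else 0)"
      proof (cases "Z \<omega> = 0")
        case False
        then have c: "Z \<omega> / a > 0" using Z0[of \<omega>] a by simp
        have "(\<lambda>l. exp (- (Z \<omega> / a)) ^ l) \<longlonglongrightarrow> 0" by (rule LIMSEQ_realpow_zero) (use c in auto)
        moreover have "exp (- (real l / a * Z \<omega>)) = exp (- (Z \<omega> / a)) ^ l" for l
          by (simp add: exp_of_nat_mult[symmetric])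
        ultimately show ?thesis using False by simp
      qed simp
      then show "(\<lambda>N. exp (- (1 / a * Z \<omega>)) - exp (- (real N / a * Z \<omega>))) \<longlonglongrightarrow> g \<omega>"
        unfolding g_def by (intro tendsto_intros)
    qed
    show "AE \<omega> in P \<mu>. norm (exp (- (1 / a * Z \<omega>)) - exp (- (real N / a * Z \<omega>))) \<le> 2" for N
    proof (rule AE_I2)
      fix \<omega>
      have "exp (- (1 / a * Z \<omega>)) \<le> 1" "exp (- (real N / a * Z \<omega>)) \<le> 1" using Z0[of \<omega>] a by auto
      then show "norm (exp (- (1 / a * Z \<omega>)) - exp (- (real N / a * Z \<omega>))) \<le> 2"
        using exp_ge_zero[of "- (1 / a * Z \<omega>)"] exp_ge_zero[of "- (real N / a * Z \<omega>)"] unfolding real_norm_def abs_le_iff by linarith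
    qed
  qed auto
  have g_le: "(\<integral>\<omega>. g \<omega> \<partial>(P \<mu>)) \<le> B * measure \<mu> UNIV"
    by (rule LIMSEQ_le_const2[OF lim]) (use diff in blast)
  have gb: "0 \<le> g \<omega>" "g \<omega> \<le> 1" for \<omega>
    using Z0[of \<omega>] a by (auto simp: g_def)
  have gi: "integrable (P \<mu>) g" by (rule integrable_const_bound[of _ 1]) (use gb in auto)
  have "exp (- 1) * measure (P \<mu>) A = (\<integral>\<omega>. exp (- 1) * indicator A \<omega> \<partial>(P \<mu>))" by simp
  also have "\<dots> \<le> (\<integral>\<omega>. g \<omega> \<partial>(P \<mu>))"
  proof (rule integral_mono[OF _ gi])
    show "exp (- 1) * indicator A \<omega> \<le> g \<omega>" for \<omega>
    proof (cases "\<omega> \<in> A")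
      case True
      then have "1 / a * Z \<omega> \<le> 1" "Z \<omega> \<noteq> 0" using a by (auto simp: A_def divide_le_eq)
      then show ?thesis using True by (simp add: g_def)
    qed (use gb in simp)
  qed (auto intro!: integrable_real_indicator simp: emeasure_eq_measure)
  finally have "exp (- 1) * measure (P \<mu>) A \<le> B * measure \<mu> UNIV" using g_le by linarith
  then have "exp 1 * (exp (- 1) * measure (P \<mu>) A) \<le> exp 1 * (B * measure \<mu> UNIV)" by (intro mult_left_mono) auto
  moreover have "exp 1 * (exp (- 1) * m) = m" for m :: real by (simp add: exp_minus)
  ultimately have "measure (P \<mu>) A \<le> exp 1 * (B * measure \<mu> UNIV)" by metis
  then show "measure (P \<mu>) {\<omega> \<in> space (P \<mu>). 0 < mass_fun X \<omega> t \<phi> \<and> mass_fun X \<omega> t \<phi> \<le> a} \<le> exp 1 * (B * measure \<mu> UNIV)"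
    unfolding A_def Z_def .
qed

text \<open>The two parts together include the event for the indicator in the event for the bump.
  Positivity passes over because the bump is positive on the open interval and the two endpoints are
  null sets.\<close>

lemma mass_fun_indicator_bump:
  fixes x \<epsilon> :: real
  assumes S: "is_SBM P X" and t: "t > 0" and \<epsilon>: "\<epsilon> > 0"
  defines "\<phi> \<equiv> \<lambda>y. bump ((y - (x + \<epsilon> / 2)) / (\<epsilon> / 2))"
  shows "mass_fun X \<omega> t \<phi> \<le> mass_fun X \<omega> t (indicator {x..x + \<epsilon>})"
    and "0 < mass_fun X \<omega> t (indicator {x..x + \<epsilon>}) \<Longrightarrow> 0 < mass_fun X \<omega> t \<phi>"
proof -
  have [measurable]: "\<phi> \<in> borel_measurable borel" unfolding \<phi>_def by measurable
  note X0 = is_SBM_density(2)[OF S t, of \<omega>] and Xi = is_SBM_density(3)[OF S t, of \<omega>]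
  have [measurable]: "X \<omega> t \<in> borel_measurable borel"
    by (rule borel_measurable_continuous_onI[OF is_SBM_density(1)[OF S t]])
  have \<phi>: "0 \<le> \<phi> y" "\<phi> y \<le> 1" "y \<notin> {x..x + \<epsilon>} \<Longrightarrow> \<phi> y = 0" "y \<in> {x<..<x + \<epsilon>} \<Longrightarrow> \<phi> y > 0" for y
  proof -
    show "0 \<le> \<phi> y" "\<phi> y \<le> 1" by (simp_all add: \<phi>_def bump_bounds)
    show "\<phi> y = 0" if "y \<notin> {x..x + \<epsilon>}"
      unfolding \<phi>_def
    proof (rule bump_eq_0)
      have "\<epsilon> / 2 \<le> \<bar>y - (x + \<epsilon> / 2)\<bar>" using that by (auto simp: abs_if)
      moreover have aux: "c \<le> \<bar>b\<bar> \<Longrightarrow> c > 0 \<Longrightarrow> 1 \<le> \<bar>b / c\<bar>" for b c :: real by (simp add: abs_divide le_divide_eq)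
      ultimately show "1 \<le> \<bar>(y - (x + \<epsilon> / 2)) / (\<epsilon> / 2)\<bar>" by (intro aux) (use \<epsilon> in simp_all)
    qed
    show "\<phi> y > 0" if "y \<in> {x<..<x + \<epsilon>}"
      unfolding \<phi>_def
    proof (rule bump_pos)
      have "\<bar>y - (x + \<epsilon> / 2)\<bar> < \<epsilon> / 2" using that by (auto simp: abs_if)
      moreover have aux: "\<bar>b\<bar> < c \<Longrightarrow> c > 0 \<Longrightarrow> \<bar>b / c\<bar> < 1" for b c :: real by (simp add: abs_divide divide_less_eq)
      ultimately show "\<bar>(y - (x + \<epsilon> / 2)) / (\<epsilon> / 2)\<bar> < 1" by (intro aux) (use \<epsilon> in simp_all)
    qed
  qed
  have i1: "integrable lborel (\<lambda>y. \<phi> y * X \<omega> t y)"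
    by (rule Bochner_Integration.integrable_bound[OF Xi]) (use \<phi> X0 in \<open>auto simp: abs_mult mult_left_le_one_le\<close>)
  have i2: "integrable lborel (\<lambda>y. indicator {x..x + \<epsilon>} y * X \<omega> t y)"
    using integrable_mult_indicator[OF _ Xi, of "{x..x + \<epsilon>}"] by simp
  show "mass_fun X \<omega> t \<phi> \<le> mass_fun X \<omega> t (indicator {x..x + \<epsilon>})"
    unfolding mass_fun_def
  proof (rule integral_mono[OF i1 i2])
    show "\<phi> y * X \<omega> t y \<le> indicator {x..x + \<epsilon>} y * X \<omega> t y" for y
      using \<phi>[of y] X0[of y] by (intro mult_right_mono) (auto simp: indicator_def)
  qed
  assume pos: "0 < mass_fun X \<omega> t (indicator {x..x + \<epsilon>})"
  show "0 < mass_fun X \<omega> t \<phi>"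
  proof (rule ccontr)
    assume "\<not> 0 < mass_fun X \<omega> t \<phi>"
    moreover have "0 \<le> mass_fun X \<omega> t \<phi>" by (rule mass_fun_nonneg[OF S t \<phi>(1)])
    ultimately have "(\<integral>y. \<phi> y * X \<omega> t y \<partial>lborel) = 0" by (simp add: mass_fun_def)
    then have "AE y in lborel. \<phi> y * X \<omega> t y = 0"
      by (subst (asm) integral_nonneg_eq_0_iff_AE[OF i1]) (use \<phi>(1) X0 in auto)
    moreover have "AE y in lborel. y \<noteq> x" "AE y in lborel. y \<noteq> x + \<epsilon>" by (rule AE_lborel_singleton)+
    ultimately have "AE y in lborel. indicator {x..x + \<epsilon>} y * X \<omega> t y = 0"
    proof eventually_elim
      case (elim y)
      then show ?case using \<phi>(4)[of y] by (cases "y \<in> {x..x + \<epsilon>}") auto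
    qed
    then have "mass_fun X \<omega> t (indicator {x..x + \<epsilon>}) = 0"
      unfolding mass_fun_def by (rule integral_eq_zero_AE)
    then show False using pos by simp
  qed
qed

text \<open>With \<tau> = t/r^2 there are two regimes. If \<tau> \<ge> 1, the decay estimate applies
  and the power of r splits into powers of \<epsilon> and 2M. If \<tau> < 1, the time is too short
  for decay, but then \<epsilon>^2 \<le> t < (2M)^2 \<epsilon>^2, so the crude bound 2/t differs
  from the claim only by a power of M. In both cases l0 \<le> 2 keeps that power below (2M)^3 \<le>
  8 M^19.\<close>

lemma scaled_gap_bound:
  fixes A M \<epsilon> t l l0 :: real
  assumes A: "A > 0" and gap: "\<And>K M t x. 1 \<le> M \<and> 2 \<le> K \<and> M \<le> K \<and> 1 \<le> t \<Longrightarrow> bsol K M t x - bsol M M t x \<le> A * t powr (- 1 / 2 - l)"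
    and l0: "0 \<le> l0" "l0 \<le> l" "l \<le> 2" and M: "M \<ge> 1" and t: "t > 0" and \<epsilon>: "0 < \<epsilon>" "\<epsilon> \<le> sqrt t" and N: "N \<ge> 1"
    and r: "r = 2 * \<epsilon> * M"
  shows "(1 / r)\<^sup>2 * (bsol (N * (4 * M)) (4 * M) ((1 / r)\<^sup>2 * t) y - bsol (4 * M) (4 * M) ((1 / r)\<^sup>2 * t) y)
    \<le> (8 * A + 16) * t powr (- (1 / 2) - l0) * M ^ 19 * \<epsilon> powr (2 * l0 - 1)"
proof -
  have r0: "r > 0" using r \<epsilon> M by simp
  define \<tau> where "\<tau> = (1 / r)\<^sup>2 * t"
  have \<tau>0: "\<tau> > 0" using r0 t by (simp add: \<tau>_def)
  have \<tau>e: "\<tau> = t / r\<^sup>2" by (simp add: \<tau>_def power_divide)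
  define R where "R = t powr (- (1 / 2) - l0) * M ^ 19 * \<epsilon> powr (2 * l0 - 1)"
  have R0: "R \<ge> 0" using M by (simp add: R_def)
  have M3: "(2 * M) powr 3 \<le> 8 * M ^ 19"
  proof -
    have "(2 * M) powr 3 = (2 * M) ^ 3" using powr_realpow[of "2 * M" 3] M by simp
    also have "\<dots> = 8 * M ^ 3" by (simp add: power_mult_distrib)
    also have "\<dots> \<le> 8 * M ^ 19" using M power_increasing[of 3 19 M] by simp
    finally show ?thesis .
  qed
  define D where "D = bsol (N * (4 * M)) (4 * M) \<tau> y - bsol (4 * M) (4 * M) \<tau> y"
  have "4 * M * 1 \<le> 4 * M * N" using M N by (intro mult_left_mono) auto
  then have "4 * M \<le> N * (4 * M)" by (simp add: mult.commute)
  with M have NM: "4 * M \<le> N * (4 * M)" "2 \<le> N * (4 * M)" by linarith+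
  have pos: "0 < 4 * M" "0 < N * (4 * M)" using M N by auto
  have "(1 / r)\<^sup>2 * D \<le> (8 * A + 16) * R"
  proof (cases "\<tau> \<ge> 1")
    case True
    have "D \<le> A * \<tau> powr (- 1 / 2 - l)" unfolding D_def by (rule gap) (use M NM True in auto)
    also have "\<dots> \<le> A * \<tau> powr (- (1 / 2) - l0)" using A True l0 by (intro mult_left_mono powr_mono) auto
    finally have "(1 / r)\<^sup>2 * D \<le> (1 / r)\<^sup>2 * (A * \<tau> powr (- (1 / 2) - l0))" by (rule mult_left_mono) simp
    also have "\<dots> = A * (t powr (- (1 / 2) - l0) * (r powr (2 * l0 - 1)))"
    proof -
      have "(1 / r)\<^sup>2 = r powr (- 2)" using r0 by (simp add: powr_minus_divide power_divide)
      moreover have "\<tau> powr c = t powr c * r powr (- 2 * c)" for c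
      proof -
        have "r\<^sup>2 = r powr 2" using r0 by simp
        then have "(r\<^sup>2) powr c = r powr (2 * c)" by (simp only: powr_powr)
        then show ?thesis unfolding \<tau>e using t r0 by (simp add: powr_divide powr_minus_divide)
      qed
      moreover have "r powr (- 2) * r powr (- 2 * (- (1 / 2) - l0)) = r powr (2 * l0 - 1)"
        by (simp add: powr_add[symmetric])
      ultimately show ?thesis by (simp add: mult_ac)
    qed
    also have "r powr (2 * l0 - 1) = (2 * M) powr (2 * l0 - 1) * \<epsilon> powr (2 * l0 - 1)"
      unfolding r using \<epsilon> M by (simp add: powr_mult)
    also have "A * (t powr (- (1 / 2) - l0) * ((2 * M) powr (2 * l0 - 1) * \<epsilon> powr (2 * l0 - 1)))
      \<le> A * (t powr (- (1 / 2) - l0) * (8 * M ^ 19 * \<epsilon> powr (2 * l0 - 1)))"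
    proof (intro mult_left_mono mult_right_mono)
      have "(2 * M) powr (2 * l0 - 1) \<le> (2 * M) powr 3" using M l0 by (intro powr_mono) auto
      then show "(2 * M) powr (2 * l0 - 1) \<le> 8 * M ^ 19" using M3 by linarith
    qed (use A in auto)
    also have "\<dots> = 8 * A * R" by (simp add: R_def)
    also have "\<dots> \<le> (8 * A + 16) * R" using R0 by (intro mult_right_mono) auto
    finally show ?thesis .
  next
    case False
    have "D \<le> 2 / \<tau>"
      using bsol_le_2_div_t[OF pos(2) \<tau>0, of "4 * M" y] bsol_nonneg[OF pos(1), of \<tau> "4 * M" y] \<tau>0 by (simp add: D_def)
    then have "(1 / r)\<^sup>2 * D \<le> (1 / r)\<^sup>2 * (2 / \<tau>)" by (rule mult_left_mono) simp
    also have "\<dots> = 2 / t" unfolding \<tau>e using r0 t by (simp add: power_divide)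
    \<comment> \<open>Rewrites 1/t as the claimed power law times a power of t/\<epsilon>^2, which
      lies between 1 and (2M)^2 in this case.\<close>
    also have "\<dots> = 2 * (t powr (- (1 / 2) - l0) * \<epsilon> powr (2 * l0 - 1) * (t / \<epsilon>\<^sup>2) powr (l0 - 1 / 2))"
    proof -
      have "\<epsilon>\<^sup>2 = \<epsilon> powr 2" using \<epsilon> by simp
      then have "(\<epsilon>\<^sup>2) powr (l0 - 1 / 2) = \<epsilon> powr (2 * (l0 - 1 / 2))" by (simp only: powr_powr)
      also have "2 * (l0 - 1 / 2) = 2 * l0 - 1" by simp
      finally have "(t / \<epsilon>\<^sup>2) powr (l0 - 1 / 2) = t powr (l0 - 1 / 2) / \<epsilon> powr (2 * l0 - 1)"
        using t \<epsilon> by (simp add: powr_divide)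
      moreover have "t powr (- (1 / 2) - l0) * t powr (l0 - 1 / 2) = 1 / t"
        using t by (simp add: powr_add[symmetric] powr_minus_divide)
      moreover have "\<epsilon> powr (2 * l0 - 1) > 0" using \<epsilon> by simp
      ultimately show ?thesis by simp
    qed
    also have "\<dots> \<le> 2 * (t powr (- (1 / 2) - l0) * \<epsilon> powr (2 * l0 - 1) * (8 * M ^ 19))"
    proof (intro mult_left_mono)
      have e2: "\<epsilon>\<^sup>2 \<le> t" using power_mono[OF \<epsilon>(2), of 2] \<epsilon> t by simp
      then have s1: "1 \<le> t / \<epsilon>\<^sup>2" using \<epsilon> by simp
      have "t < r\<^sup>2" using False r0 unfolding \<tau>e by simp
      also have "r\<^sup>2 = (2 * M)\<^sup>2 * \<epsilon>\<^sup>2" by (simp add: r power_mult_distrib)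
      finally have s2: "t / \<epsilon>\<^sup>2 \<le> (2 * M)\<^sup>2" using \<epsilon> by (simp add: divide_le_eq)
      have "(t / \<epsilon>\<^sup>2) powr (l0 - 1 / 2) \<le> (t / \<epsilon>\<^sup>2) powr (3 / 2)" using s1 l0 by (intro powr_mono) auto
      also have "\<dots> \<le> ((2 * M)\<^sup>2) powr (3 / 2)" using s1 s2 by (intro powr_mono2) auto
      also have "\<dots> = (2 * M) powr 3"
      proof -
        have "(2 * M)\<^sup>2 = (2 * M) powr 2" using M by simp
        then show ?thesis by (simp only: powr_powr) simp
      qed
      finally show "(t / \<epsilon>\<^sup>2) powr (l0 - 1 / 2) \<le> 8 * M ^ 19" using M3 by linarith
    qed auto
    also have "\<dots> = 16 * R" by (simp add: R_def)
    also have "\<dots> \<le> (8 * A + 16) * R" using R0 A by (intro mult_right_mono) auto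
    finally show ?thesis .
  qed
  then show ?thesis unfolding D_def \<tau>_def R_def by (simp add: mult.assoc)
qed

theorem theorem5p8:
  shows "\<exists>C>0. \<forall>(P :: real measure \<Rightarrow> 'w measure) X. is_SBM P X \<longrightarrow>
    (\<forall>t M \<epsilon> x X0. t > 0 \<and> M \<ge> 1 \<and> 0 < \<epsilon> \<and> \<epsilon> \<le> sqrt t \<and> finite_borel_measure X0 \<longrightarrow>
      measure (P X0) {\<omega> \<in> space (P X0).
          0 < mass_fun X \<omega> t (indicator {x..x+\<epsilon>}) \<and>
          mass_fun X \<omega> t (indicator {x..x+\<epsilon>}) \<le> \<epsilon>\<^sup>2 * M}
      \<le> C * measure X0 UNIV * t powr (- (1/2) - sbm_lambda0 P X) * M ^ 19
          * \<epsilon> powr (2 * sbm_lambda0 P X - 1))"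
proof (cases "\<exists>(P :: real measure \<Rightarrow> 'w measure) X. is_SBM P X")
  case False
  then show ?thesis by (intro exI[of _ 1]) auto
next
  case True
  \<comment> \<open>One realisation fixes F and hence the constant; any other on the same sample
    type has the same F by uniqueness of the iterated limit.\<close>
  then obtain P0 :: "real measure \<Rightarrow> 'w measure" and X0 where S0: "is_SBM P0 X0" by blast
  define F where "F = sbm_F P0 X0"
  have FL: "iterated_limit F" and F0: "\<And>x. 0 \<le> F x" unfolding F_def by (rule sbm_F_iterated_limit[OF S0])+
  interpret potential F by (rule iterated_limit_potential[OF FL F0])
  obtain l \<psi> \<psi>1 D where l: "0 \<le> l" "l \<le> 2" and \<psi>0: "\<And>x. \<psi> x > 0"
    and \<psi>: "\<And>x. (\<psi> has_real_derivative \<psi>1 x) (at x)"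
      "\<And>x. (\<psi>1 has_real_derivative x * \<psi>1 x + 2 * (F x - l) * \<psi> x) (at x)"
    and D: "\<And>x. \<psi> x \<le> D * exp \<bar>x\<bar>"
    by (rule ground_state) blast
  obtain \<delta> c where \<delta>: "\<delta> > 0" and c: "c > 0"
    and compat: "\<And>M t x. 1 \<le> M \<Longrightarrow> 1 \<le> t \<Longrightarrow> F (x / sqrt t) / t \<le> bsol M M t x + c * t powr (- 1 - \<delta>)"
    using iterated_limit_compat FL by blast
  obtain A where A: "A > 0"
    and gap: "\<And>K M t x. 1 \<le> M \<and> 2 \<le> K \<and> M \<le> K \<and> 1 \<le> t \<Longrightarrow> bsol K M t x - bsol M M t x \<le> A * t powr (- 1 / 2 - l)"
    using bsol_gap_decay[OF l \<psi>0 \<psi> D \<delta> c compat] by blast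
  show ?thesis
  proof (intro exI[of _ "exp 1 * (8 * A + 16)"] conjI allI impI)
    show "0 < exp 1 * (8 * A + 16)" using A by simp
    fix P :: "real measure \<Rightarrow> 'w measure" and X and t M \<epsilon> x :: real and \<mu> :: "real measure"
    assume S: "is_SBM P X" and "t > 0 \<and> M \<ge> 1 \<and> 0 < \<epsilon> \<and> \<epsilon> \<le> sqrt t \<and> finite_borel_measure \<mu>"
    then have t: "t > 0" and M: "M \<ge> 1" and \<epsilon>: "0 < \<epsilon>" "\<epsilon> \<le> sqrt t" and \<mu>: "finite_borel_measure \<mu>" by auto
    interpret prob_space "P \<mu>" by (rule is_SBM_prob[OF S \<mu>])
    have FP: "sbm_F P X = F" by (rule iterated_limit_unique[OF sbm_F_iterated_limit(1)[OF S] FL])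
    define l0 where "l0 = sbm_lambda0 P X"
    have eig: "LF_eigen P X \<psi> l" by (rule LF_eigen_ground_state[OF \<psi>0 _ \<psi>(1) _ D]) (use FP F_cont \<psi>(2) in auto)
    have nn: "0 \<le> lam" if "LF_eigen P X h lam" for h lam
      by (rule LF_eigen_nonneg[OF _ that]) (simp add: FP F0)
    have l0: "0 \<le> l0" "l0 \<le> l"
    proof -
      show "0 \<le> l0" unfolding l0_def sbm_lambda0_def by (rule cInf_greatest) (use eig nn in auto)
      have "bdd_below {lam. \<exists>h. LF_eigen P X h lam}" using nn by (auto simp: bdd_below_def)
      then show "l0 \<le> l" unfolding l0_def sbm_lambda0_def by (intro cInf_lower) (use eig in auto)
    qed
    \<comment> \<open>The scale at which, for N = 1, the bump of height
      \<open>1 / (\<epsilon>\<^sup>2 M)\<close> and half-width \<epsilon>/2 has height equal to its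
      inverse half-width, both being 4M.\<close>
    define r where "r = 2 * \<epsilon> * M"
    have r0: "r > 0" using \<epsilon> M by (simp add: r_def)
    define \<phi> where "\<phi> = (\<lambda>y. bump ((y - (x + \<epsilon> / 2)) / (\<epsilon> / 2)))"
    define u where "u = (\<lambda>N::nat. \<lambda>s y. (1 / r)\<^sup>2 * bsol (real N * (4 * M)) (4 * M) ((1 / r)\<^sup>2 * s) (1 / r * y + - (x + \<epsilon> / 2) / r))"
    have u: "sol (\<lambda>y. real N / (\<epsilon>\<^sup>2 * M) * \<phi> y) (u N)" if N: "N \<ge> 1" for N
    proof -
      have "real N * (4 * M) > 0" using N M by simp
      from sol_scale[OF sol_bsol[OF this, of "4 * M"], of "1 / r" "- (x + \<epsilon> / 2) / r"] r0
      have "sol (\<lambda>y. (1 / r)\<^sup>2 * (real N * (4 * M) * bump (4 * M * (1 / r * y + - (x + \<epsilon> / 2) / r)))) (u N)"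
        unfolding u_def by simp
      moreover have "(1 / r)\<^sup>2 * (real N * (4 * M) * bump (4 * M * (1 / r * y + - (x + \<epsilon> / 2) / r))) = real N / (\<epsilon>\<^sup>2 * M) * \<phi> y" for y
      proof -
        have "4 * M * (1 / r * y + - (x + \<epsilon> / 2) / r) = (4 * M / r) * (y - (x + \<epsilon> / 2))"
          using r0 by (simp add: field_simps)
        also have "4 * M / r = 1 / (\<epsilon> / 2)" using \<epsilon> M by (simp add: r_def)
        finally have "4 * M * (1 / r * y + - (x + \<epsilon> / 2) / r) = (y - (x + \<epsilon> / 2)) / (\<epsilon> / 2)" by (simp only: times_divide_eq_left mult_1)
        moreover have "(1 / r)\<^sup>2 * (real N * (4 * M)) = real N / (\<epsilon>\<^sup>2 * M)"
          using \<epsilon> M by (simp add: r_def power2_eq_square field_simps)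
        ultimately show ?thesis unfolding \<phi>_def by (simp only: mult.assoc[symmetric])
      qed
      ultimately show ?thesis by (simp only:)
    qed
    define B where "B = (8 * A + 16) * t powr (- (1 / 2) - l0) * M ^ 19 * \<epsilon> powr (2 * l0 - 1)"
    have uB: "u N t y - u 1 t y \<le> B" if N: "N \<ge> 1" for N y
      using scaled_gap_bound[OF A gap l0 l(2) M t \<epsilon> _ r_def, of "real N" "1 / r * y + - (x + \<epsilon> / 2) / r"] N
      unfolding u_def B_def right_diff_distrib by simp
    have a: "\<epsilon>\<^sup>2 * M > 0" using \<epsilon> M by simp
    have \<phi>0: "0 \<le> \<phi> y" for y by (simp add: \<phi>_def bump_bounds)
    note small = small_mass_prob[OF S \<mu> t a u uB \<phi>0]
    have "{\<omega> \<in> space (P \<mu>). 0 < mass_fun X \<omega> t (indicator {x..x+\<epsilon>}) \<and> mass_fun X \<omega> t (indicator {x..x+\<epsilon>}) \<le> \<epsilon>\<^sup>2 * M}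
      \<subseteq> {\<omega> \<in> space (P \<mu>). 0 < mass_fun X \<omega> t \<phi> \<and> mass_fun X \<omega> t \<phi> \<le> \<epsilon>\<^sup>2 * M}"
      using mass_fun_indicator_bump[OF S t \<epsilon>(1), of _ x] unfolding \<phi>_def by (auto intro: order.trans)
    from finite_measure_mono[OF this small(1)] small(2)
    have "measure (P \<mu>) {\<omega> \<in> space (P \<mu>). 0 < mass_fun X \<omega> t (indicator {x..x+\<epsilon>}) \<and> mass_fun X \<omega> t (indicator {x..x+\<epsilon>}) \<le> \<epsilon>\<^sup>2 * M}
      \<le> exp 1 * (B * measure \<mu> UNIV)" by linarith
    also have "exp 1 * (B * measure \<mu> UNIV) = exp 1 * (8 * A + 16) * measure \<mu> UNIV * t powr (- (1/2) - sbm_lambda0 P X) * M ^ 19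
          * \<epsilon> powr (2 * sbm_lambda0 P X - 1)"
      unfolding B_def l0_def by (simp add: mult_ac)
    finally show "measure (P \<mu>) {\<omega> \<in> space (P \<mu>). 0 < mass_fun X \<omega> t (indicator {x..x+\<epsilon>}) \<and> mass_fun X \<omega> t (indicator {x..x+\<epsilon>}) \<le> \<epsilon>\<^sup>2 * M}
      \<le> exp 1 * (8 * A + 16) * measure \<mu> UNIV * t powr (- (1/2) - sbm_lambda0 P X) * M ^ 19
          * \<epsilon> powr (2 * sbm_lambda0 P X - 1)" .
  qed
qed

end
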